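(* Let $(\Omega_1,\nu)$ and $(\Omega_2,\mu)$ be non-atomic measure spaces, $p(\cdot)\in\mathcal{P}_b(\Omega_1,\nu)$, $q(\cdot)\in\mathcal{P}_b(\Omega_2,\mu)$, $1<r<\infty$, and define $$\frac1{\alpha(\cdot)}=\Big|1-\frac r{p(\cdot)}\Big|,\qquad \frac1{\beta(\cdot)}=\Big|1-\frac r{q(\cdot)}\Big|.$$ Let $T:L^{q(\cdot)}(\Omega_2,\mu)\to L^{p(\cdot)}(\Omega_1,\nu)$ be any linear operator. (i) If $2\le r<\min\{p_-,q_-\}$, then $T:L^{q(\cdot)}(\Omega_2,\mu)\to L^{p(\cdot)}(\Omega_1,\nu)$ is bounded if and only if for every $u\in L_+^{\alpha(\cdot)}(\Omega_1,\nu)$ there exists $U\in L_+^{\beta(\cdot)}(\Omega_2,\mu)$ such that $\|U\|_{L^{\beta(\cdot)}(\Omega_2,\mu)}\le\|u\|_{L^{\alpha(\cdot)}(\Omega_1,\nu)}$ and $T:L^r(\Omega_2,U\,d\mu)\to L^r(\Omega_1,u\,d\nu)$ is bounded. (ii) If $\max\{p_+,q_+\}<r\le2$, then $T:L^{q(\cdot)}(\Omega_2,\mu)\to L^{p(\cdot)}(\Omega_1,\nu)$ is bounded if and only if for every $u\in L_+^{\beta(\cdot)}(\Omega_2,\mu)$ there exists $U\in L_+^{\alpha(\cdot)}(\Omega_1,\nu)$ such that $\|U\|_{L^{\alpha(\cdot)}(\Omega_1,\nu)}\le\|u\|_{L^{\beta(\cdot)}(\Omega_2,\mu)}$ and $T:L^r(\Omega_2,u^{-1}\,d\mu)\to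 L^r(\Omega_1,U^{-1}\,d\nu)$ is bounded. (iii) Suppose that $(\Omega_2,\mu)=(\Omega_1,\nu)$ and $q(\cdot)=p(\cdot)$. If $2\le r<p_-$ (respectively, $p_+<r\le2$), then $T:L^{p(\cdot)}(\Omega_1,\nu)\to L^{p(\cdot)}(\Omega_1,\nu)$ is bounded if and only if for every $u\in L_+^{\alpha(\cdot)}(\Omega_1,\nu)$ there exists $w\in L_+^{\alpha(\cdot)}(\Omega_1,\nu)$ such that $u(x)\le w(x)$ for $\nu$-a.e. $x\in\Omega_1$, $\|w\|_{L^{\alpha(\cdot)}(\Omega_1,\nu)}\le\max\{2,2^{r/r'}\}\,\|u\|_{L^{\alpha(\cdot)}(\Omega_1,\nu)}$, where $\frac1r+\frac1{r'}=1$, and $T:L^r(w\,d\nu)\to L^r(w\,d\nu)$ is bounded (respectively, $T:L^r(w^{-1}d\nu)\to L^r(w^{-1}d\nu)$ is bounded).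
   Context: All measure spaces are $\sigma$-finite and complete, and function spaces are real. For a measure space $(\Omega,\nu)$ and a measurable $p:\Omega\to[1,\infty]$, let $p_-=\operatorname{ess\,inf}_{\Omega}p$, $p_+=\operatorname{ess\,sup}_{\Omega}p$; $\mathcal{P}_b(\Omega,\nu)$ is the set of those $p$ with $1<p_-\le p_+<\infty$. With $\Omega_\infty=\{x: p(x)=\infty\}$, put $\rho_{p(\cdot)}(f)=\int_{\Omega\setminus\Omega_\infty}|f(x)|^{p(x)}\,d\nu(x)+\|f\|_{L^\infty(\Omega_\infty)}$. The variable Lebesgue space $L^{p(\cdot)}(\Omega,\nu)$ consists of the measurable $f$ with $\rho_{p(\cdot)}(f/\lambda)<\infty$ for some $\lambda>0$, with norm $\|f\|_{L^{p(\cdot)}(\Omega,\nu)}=\inf\{\lambda>0:\rho_{p(\cdot)}(f/\lambda)\le1\}$. Also $L_+^{p(\cdot)}(\Omega,\nu)=\{f\in L^{p(\cdot)}(\Omega,\nu): f>0\}$. For a linear operator $T$ defined on $L^{q(\cdot)}(\Omega_2,\mu)$ and weights $V$ on $\Omega_2$, $v$ on $\Omega_1$, the statement "$T:L^r(\Omega_2,V\,d\mu)\to L^r(\Omega_1,v\,d\nu)$ is bounded" means that there is a constant $K>0$ such that $\int_{\Omega_1}|T(f)(x)|^r v(x)\,d\nu(x)\le K\int_{\Omega_2}|f(x)|^r V(x)\,d\mu(x)$ for every $f\in L^{q(\cdot)}(\Omega_2,\mu)$. *)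

theory Defs
  imports "HOL-Analysis.Analysis" "HOL-Probability.Essential_Supremum"
begin

definition nonatomic :: "'a measure \<Rightarrow> bool" where
  "nonatomic M \<longleftrightarrow> (\<forall>A\<in>sets M. 0 < emeasure M A \<longrightarrow>
     (\<exists>B\<in>sets M. B \<subseteq> A \<and> 0 < emeasure M B \<and> emeasure M B < emeasure M A))"

definition essinf :: "'a measure \<Rightarrow> ('a \<Rightarrow> ereal) \<Rightarrow> ereal" where
  "essinf M p = Sup {c. AE x in M. c \<le> p x}"

text \<open>
  The chain of inequalities for the essential bounds is kept in full: on a null measure space
  the essential infimum is \<open>\<infinity>\<close> and the essential supremum is \<open>-\<infinity>\<close>, so
  such spaces carry no admissible exponent.
\<close>

definition bounded_exponents :: "'a measure \<Rightarrow> ('a \<Rightarrow> ereal) set" where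
  "bounded_exponents M =
     {p. p \<in> borel_measurable M \<and> (\<forall>x\<in>space M. 1 \<le> p x) \<and>
         1 < essinf M p \<and> essinf M p \<le> esssup M p \<and> esssup M p < \<infinity>}"

text \<open>
  The second summand is the essential supremum taken in \<^typ>\<open>ennreal\<close>, whose least
  element is 0; hence it vanishes when the set where \<open>p = \<infinity>\<close> is null.
\<close>

definition modular :: "'a measure \<Rightarrow> ('a \<Rightarrow> ereal) \<Rightarrow> ('a \<Rightarrow> real) \<Rightarrow> ennreal" where
  "modular M p f =
     (\<integral>\<^sup>+x\<in>{x \<in> space M. p x \<noteq> \<infinity>}. ennreal (\<bar>f x\<bar> powr real_of_ereal (p x)) \<partial>M)
     + esssup (restrict_space M {x \<in> space M. p x = \<infinity>}) (\<lambda>x. ennreal \<bar>f x\<bar>)"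

text \<open>
  Elements of the space are functions rather than classes modulo equality almost everywhere;
  accordingly positivity, and all identities between elements, are required almost everywhere.
\<close>

definition var_Lp :: "'a measure \<Rightarrow> ('a \<Rightarrow> ereal) \<Rightarrow> ('a \<Rightarrow> real) set" where
  "var_Lp M p =
     {f. f \<in> borel_measurable M \<and> (\<exists>l>0. modular M p (\<lambda>x. f x / l) < \<infinity>)}"

definition var_norm :: "'a measure \<Rightarrow> ('a \<Rightarrow> ereal) \<Rightarrow> ('a \<Rightarrow> real) \<Rightarrow> real" where
  "var_norm M p f = Inf {l. 0 < l \<and> modular M p (\<lambda>x. f x / l) \<le> 1}"

definition var_Lp_pos :: "'a measure \<Rightarrow> ('a \<Rightarrow> ereal) \<Rightarrow> ('a \<Rightarrow> real) set" where
  "var_Lp_pos M p = {f \<in> var_Lp M p. AE x in M. 0 < f x}"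

text \<open>
  A linear map from \<open>var_Lp M q\<close> to \<open>var_Lp N p\<close>; the second clause says that
  it is well defined on classes.
\<close>

definition linear_operator ::
  "'b measure \<Rightarrow> ('b \<Rightarrow> ereal) \<Rightarrow> 'a measure \<Rightarrow> ('a \<Rightarrow> ereal) \<Rightarrow>
     (('b \<Rightarrow> real) \<Rightarrow> 'a \<Rightarrow> real) \<Rightarrow> bool" where
  "linear_operator M q N p T \<longleftrightarrow>
     (\<forall>f\<in>var_Lp M q. T f \<in> var_Lp N p) \<and>
     (\<forall>f\<in>var_Lp M q. \<forall>g\<in>var_Lp M q.
        (AE y in M. f y = g y) \<longrightarrow> (AE x in N. T f x = T g x)) \<and>
     (\<forall>f\<in>var_Lp M q. \<forall>g\<in>var_Lp M q. AE x in N. T (\<lambda>y. f y + g y) x = T f x + T g x) \<and>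
     (\<forall>c. \<forall>f\<in>var_Lp M q. AE x in N. T (\<lambda>y. c * f y) x = c * T f x)"

definition bounded_operator ::
  "'b measure \<Rightarrow> ('b \<Rightarrow> ereal) \<Rightarrow> 'a measure \<Rightarrow> ('a \<Rightarrow> ereal) \<Rightarrow>
     (('b \<Rightarrow> real) \<Rightarrow> 'a \<Rightarrow> real) \<Rightarrow> bool" where
  "bounded_operator M q N p T \<longleftrightarrow>
     (\<exists>K. \<forall>f\<in>var_Lp M q. var_norm N p (T f) \<le> K * var_norm M q f)"

text \<open>
  Boundedness from \<open>L\<^sup>r(V dM)\<close> to \<open>L\<^sup>r(v dN)\<close>, tested on \<open>var_Lp M q\<close>; both
  integrals may be infinite.
\<close>

definition weighted_bounded ::
  "real \<Rightarrow> 'b measure \<Rightarrow> ('b \<Rightarrow> ereal) \<Rightarrow> ('b \<Rightarrow> real) \<Rightarrow>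
     'a measure \<Rightarrow> ('a \<Rightarrow> real) \<Rightarrow> (('b \<Rightarrow> real) \<Rightarrow> 'a \<Rightarrow> real) \<Rightarrow> bool" where
  "weighted_bounded r M q V N v T \<longleftrightarrow>
     (\<exists>K>0. \<forall>f\<in>var_Lp M q.
        (\<integral>\<^sup>+x. ennreal (\<bar>T f x\<bar> powr r * v x) \<partial>N)
        \<le> ennreal K * (\<integral>\<^sup>+y. ennreal (\<bar>f y\<bar> powr r * V y) \<partial>M))"

end

theory Submission
  imports Defs
begin

text \<open>
  If \<open>T\<close> is bounded, it is bounded between the corresponding spaces of \<open>\<ell>\<^sup>r\<close>-valued functions:
  for \<open>r = 2\<close> by Khintchine's inequality, for \<open>r < 2\<close> by replacing the signs by independent
  variables with tail \<open>\<lambda> powr (- r)\<close>, which span \<open>\<ell>\<^sup>r\<close> in \<open>L\<^sup>s\<close> for \<open>s < r\<close> just as stable variables do,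
  and for \<open>r > 2\<close> by the dual of that embedding. The modulars of \<open>\<Sum> \<bar>f\<^sub>i\<bar> powr r\<close> and of
  \<open>\<Sum> \<bar>T f\<^sub>i\<bar> powr r\<close> are then comparable on a convex cone of pairs, and the first variation of the
  modular at an extremal element of the cone is the weight \<open>U\<close>. Conversely, if \<open>T\<close> were unbounded,
  functions of modular at most 1 with rapidly growing images could be coded into a single weight
  \<open>u\<close>, the dyadic sum of their extremal weights, for which no \<open>U\<close> exists. Equality of the two weights in the
  last part comes from iterating \<open>u \<mapsto> U\<close> as in the Rubio de Francia algorithm.
\<close>

section \<open>Inequalities for real powers\<close>

text \<open>The exponents \<open>\<alpha>\<close> and \<open>\<beta>\<close> are conjugates of
  \<open>p / r\<close> and \<open>q / r\<close>: in the usual sense s / (s - 1) when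
  \<open>r\<close> lies below both exponents, and in the concave sense s / (1 - s) when it lies
  above. This is why the two ranges of \<open>r\<close> lead to a minimum problem and to a maximum
  problem. The obstacle throughout is that a modular with variable exponent is not homogeneous: a
  factor can only be estimated by powers with the bounds of the exponent. Hence every pointwise
  inequality carries a constant uniform in the exponent, all bounds are proved for modulars and
  return to norms only at the end, and for \<open>r \<le> 2\<close> a randomisation is closed by
  discarding the outcomes of large modular instead of taking expectations. Moreover,
  \<open>T\<close> is linear only almost everywhere, with a null set that depends on the functions;
  therefore signs and heavy-tailed variables live on finite probability spaces, and infinite sums
  are reached by limits of finite ones.\<close>

lemma young_powr:
  fixes a b \<theta> :: real
  assumes "0 \<le> \<theta>" "\<theta> \<le> 1" "0 \<le> a" "0 \<le> b"
  shows "a powr \<theta> * b powr (1 - \<theta>) \<le> \<theta> * a + (1 - \<theta>) * b"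
proof (cases "a = 0 \<or> b = 0")
  case True
  then show ?thesis using assms by (auto intro!: add_nonneg_nonneg mult_nonneg_nonneg)
next
  case False
  then show ?thesis using Youngs_inequality_0[of \<theta> "1 - \<theta>" a b] assms by simp
qed

text \<open>Convexity in tangent form: the graph of the power lies above its tangent at
  \<open>z\<close>, with the negative term moved over so that both sides are nonnegative. It is
  Young's inequality with weight 1 / s, and \<open>z = 0\<close> is allowed.\<close>

lemma powr_tangent_below:
  fixes s x z :: real
  assumes "1 \<le> s" "0 \<le> x" "0 \<le> z"
  shows "s * x * z powr (s - 1) \<le> x powr s + (s - 1) * z powr s"
proof -
  have "(x powr s) powr (1/s) * (z powr s) powr (1 - 1/s) \<le> (1/s) * x powr s + (1 - 1/s) * z powr s"
    by (rule young_powr) (use assms in auto)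
  moreover have "(z powr s) powr (1 - 1/s) = z powr (s - 1)"
    using assms by (simp add: powr_powr right_diff_distrib)
  moreover have "(x powr s) powr (1/s) = x"
    using assms by (simp add: powr_powr)
  ultimately have "s * (x * z powr (s - 1)) \<le> s * ((1/s) * x powr s + (1 - 1/s) * z powr s)"
    using assms by (intro mult_left_mono) auto
  also have "\<dots> = x powr s + (s - 1) * z powr s"
    using assms by (simp add: distrib_left right_diff_distrib flip: mult.assoc)
  finally show ?thesis by (simp add: mult.assoc)
qed

text \<open>The concave counterpart. Here \<open>z\<close> has to be positive: for
  \<open>s < 1\<close> the exponent \<open>s - 1\<close> is negative, and
  \<open>0 powr (s - 1)\<close> is 0 by convention.\<close>

lemma powr_tangent_above:
  fixes s x z :: real
  assumes "0 \<le> s" "s \<le> 1" "0 \<le> x" "0 < z"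
  shows "x powr s \<le> s * x * z powr (s - 1) + (1 - s) * z powr s"
proof -
  have "x powr s * z powr (1 - s) \<le> s * x + (1 - s) * z"
    using young_powr[of s x z] assms by simp
  then have "(x powr s * z powr (1 - s)) * z powr (s - 1) \<le> (s * x + (1 - s) * z) * z powr (s - 1)"
    by (rule mult_right_mono) auto
  moreover have "z powr (1 - s) * z powr (s - 1) = 1" "z * z powr (s - 1) = z powr s"
    using assms by (simp_all flip: powr_add add: powr_mult_base)
  ultimately show ?thesis
    by (simp add: algebra_simps)
qed

text \<open>Normalising both pairs to total 1 turns Hoelder's inequality into two instances of
  Young's inequality whose right sides add up to 1.\<close>

lemma holder_two_terms:
  fixes A B C D \<theta> :: real
  assumes "0 \<le> \<theta>" "\<theta> \<le> 1" "0 \<le> A" "0 \<le> B" "0 \<le> C" "0 \<le> D"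
  shows "A powr \<theta> * B powr (1 - \<theta>) + C powr \<theta> * D powr (1 - \<theta>)
          \<le> (A + C) powr \<theta> * (B + D) powr (1 - \<theta>)"
proof (cases "A + C = 0 \<or> B + D = 0")
  case True
  then show ?thesis using assms by (auto simp: add_nonneg_eq_0_iff)
next
  case False
  define X Y where "X = A + C" and "Y = B + D"
  have XY: "0 < X" "0 < Y" using False assms by (auto simp: X_def Y_def)
  have eq: "a powr \<theta> * b powr (1-\<theta>) = X powr \<theta> * Y powr (1-\<theta>) * ((a/X) powr \<theta> * (b/Y) powr (1-\<theta>))"
    if "0 \<le> a" "0 \<le> b" for a b
    using XY that by (simp add: powr_divide)
  have "(A/X) powr \<theta> * (B/Y) powr (1-\<theta>) + (C/X) powr \<theta> * (D/Y) powr (1-\<theta>)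
     \<le> (\<theta> * (A/X) + (1-\<theta>) * (B/Y)) + (\<theta> * (C/X) + (1-\<theta>) * (D/Y))"
    using assms XY by (intro add_mono young_powr) auto
  also have "\<dots> = \<theta> * ((A+C)/X) + (1-\<theta>) * ((B+D)/Y)"
    by (simp add: add_divide_distrib algebra_simps)
  also have "\<dots> = 1" using XY by (simp add: X_def Y_def)
  finally have "X powr \<theta> * Y powr (1-\<theta>) * ((A/X) powr \<theta> * (B/Y) powr (1-\<theta>) + (C/X) powr \<theta> * (D/Y) powr (1-\<theta>))
     \<le> X powr \<theta> * Y powr (1-\<theta>) * 1"
    by (intro mult_left_mono) auto
  then show ?thesis
    using assms by (simp add: eq distrib_left flip: X_def Y_def)
qed

lemma powr_midpoint_convex:
  fixes a b s :: real
  assumes "1 \<le> s" "0 \<le> a" "0 \<le> b"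
  shows "((a + b) / 2) powr s \<le> (a powr s + b powr s) / 2"
proof -
  define z where "z = (a + b) / 2"
  have z: "0 \<le> z" using assms by (simp add: z_def)
  have "s * a * z powr (s - 1) + s * b * z powr (s - 1)
     \<le> (a powr s + (s - 1) * z powr s) + (b powr s + (s - 1) * z powr s)"
    by (intro add_mono powr_tangent_below) (use assms z in auto)
  moreover have "s * a * z powr (s - 1) + s * b * z powr (s - 1) = 2 * s * (z * z powr (s - 1))"
    by (simp add: z_def algebra_simps)
  moreover have "z * z powr (s - 1) = z powr s"
    using z by (cases "z = 0") (auto simp: powr_mult_base)
  ultimately show ?thesis
    by (simp add: algebra_simps flip: z_def)
qed

text \<open>The convexity gap is measured by half powers, so that integrating it gives an ordinary
  square norm although the exponent varies. With \<open>x\<close>, \<open>y\<close> the half powers,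
  \<open>m\<close> their mean and \<open>v\<close> the mean of their squares,
  \<open>v - m\<^sup>2\<close> is a quarter of the squared difference. For \<open>2 \<le> s\<close>
  convexity of the power s / 2 bounds the s-th power of the midpoint by \<open>m\<^sup>2\<close>;
  for \<open>s < 2\<close> Hoelder's inequality puts it below a weighted geometric mean of
  \<open>m\<^sup>2\<close> and \<open>v\<close>. The constant depends only on the lower bound
  \<open>s1\<close>.\<close>

lemma powr_uniform_convexity:
  fixes a b s s1 :: real
  assumes "1 < s1" "s1 \<le> s" "0 \<le> a" "0 \<le> b"
  shows "min (s1 - 1) 1 / 4 * (a powr (s/2) - b powr (s/2))\<^sup>2
           \<le> (a powr s + b powr s) / 2 - ((a + b) / 2) powr s"
proof -
  define x y where "x = a powr (s/2)" and "y = b powr (s/2)"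
  define m v where "m = (x + y) / 2" and "v = (x\<^sup>2 + y\<^sup>2) / 2"
  have xy: "0 \<le> x" "0 \<le> y" by (auto simp: x_def y_def)
  have sq: "a powr s = x\<^sup>2" "b powr s = y\<^sup>2"
    using assms by (simp_all add: x_def y_def power2_eq_square flip: powr_add)
  have vm: "v - m\<^sup>2 = (x - y)\<^sup>2 / 4"
    by (simp add: v_def m_def power2_eq_square field_simps)
  have v0: "0 \<le> v" and m0: "0 \<le> m" using xy by (auto simp: v_def m_def)
  have *: "min (s1 - 1) 1 * (v - m\<^sup>2) \<le> v - ((a + b) / 2) powr s"
  proof (cases "2 \<le> s")
    case True
    have "((a + b) / 2) powr (s/2) \<le> m"
      unfolding m_def x_def y_def by (rule powr_midpoint_convex) (use True assms in auto)
    then have "(((a + b) / 2) powr (s/2))\<^sup>2 \<le> m\<^sup>2"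
      by (intro power_mono) auto
    then have "((a + b) / 2) powr s \<le> m\<^sup>2"
      by (simp add: power2_eq_square flip: powr_add)
    moreover have "min (s1 - 1) 1 * (v - m\<^sup>2) \<le> 1 * (v - m\<^sup>2)"
      unfolding vm by (intro mult_right_mono) auto
    ultimately show ?thesis by simp
  next
    case False
    \<comment> \<open>Since \<open>a = x powr k\<close> with 1 < k < 2, the number \<open>a\<close>
      interpolates between \<open>x\<close> and \<open>x\<^sup>2\<close> with weights 2 - k and k -
      1.\<close>
    define k where "k = 2 / s"
    have k: "1 < k" "k < 2" using False assms by (auto simp: k_def field_simps)
    have rep: "t = (t powr (s/2)) powr (2 - k) * ((t powr (s/2))\<^sup>2) powr (1 - (2 - k))" if "0 \<le> t" for t
    proof (cases "t = 0")
      case False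
      with that have t: "0 < t" by simp
      have "s/2 * (2 - k) + s * (1 - (2 - k)) = 1" using assms by (simp add: k_def field_simps)
      moreover have "(t powr (s/2))\<^sup>2 = t powr s" by (simp add: power2_eq_square flip: powr_add)
      ultimately show ?thesis using t by (simp add: powr_powr flip: powr_add)
    qed simp
    have "a + b \<le> (x + y) powr (2 - k) * (x\<^sup>2 + y\<^sup>2) powr (1 - (2 - k))"
      using holder_two_terms[of "2 - k" x "x\<^sup>2" y "y\<^sup>2"] xy k rep[of a] rep[of b] assms
      by (simp add: x_def y_def)
    also have "\<dots> = (2 * m) powr (2 - k) * (2 * v) powr (1 - (2 - k))"
    proof -
      have "2 * m = x + y" "2 * v = x\<^sup>2 + y\<^sup>2" by (simp_all add: m_def v_def)
      then show ?thesis by (simp only:)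
    qed
    also have "\<dots> = (2 powr (2 - k) * 2 powr (1 - (2 - k))) * (m powr (2 - k) * v powr (1 - (2 - k)))"
      using v0 m0 by (simp add: powr_mult)
    also have "2 powr (2 - k) * 2 powr (1 - (2 - k)) = (2::real)"
      by (simp flip: powr_add)
    finally have "(a + b) / 2 \<le> m powr (2 - k) * v powr (1 - (2 - k))" by simp
    then have "((a + b) / 2) powr s \<le> (m powr (2 - k) * v powr (1 - (2 - k))) powr s"
      using assms by (intro powr_mono2) auto
    also have "\<dots> = (m\<^sup>2) powr (s - 1) * v powr (1 - (s - 1))"
    proof -
      have "m powr ((2 - k) * s) = (m\<^sup>2) powr (s - 1)"
      proof (cases "m = 0")
        case False
        then have "m\<^sup>2 = m powr 2" using m0 by (simp)
        moreover have "2 * (s - 1) = (2 - k) * s" using assms by (simp add: k_def left_diff_distrib)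
        ultimately show ?thesis by (simp only: powr_powr)
      qed simp
      moreover have "(1 - (2 - k)) * s = 1 - (s - 1)" using assms by (simp add: k_def field_simps)
      ultimately show ?thesis by (simp add: powr_mult powr_powr)
    qed
    also have "\<dots> \<le> (s - 1) * m\<^sup>2 + (1 - (s - 1)) * v"
      by (rule young_powr) (use assms False v0 in auto)
    finally have "(s - 1) * (v - m\<^sup>2) \<le> v - ((a + b) / 2) powr s"
      by (simp add: algebra_simps)
    moreover have "min (s1 - 1) 1 * (v - m\<^sup>2) \<le> (s - 1) * (v - m\<^sup>2)"
      unfolding vm using assms by (intro mult_right_mono) auto
    ultimately show ?thesis by simp
  qed
  show ?thesis using * unfolding vm sq by (simp add: v_def x_def y_def)
qed

text \<open>Below 1 the roles change: now \<open>a powr s\<close> interpolates between the half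
  power and \<open>a\<close> itself, so Hoelder's inequality bounds \<open>v\<close> by a geometric
  mean of \<open>m\<^sup>2\<close> and the s-th power of the midpoint. The 8 in the constant is the
  4 from \<open>v - m\<^sup>2\<close> times the 2 from \<open>(1 - s2) / 2 \<le> l\<close>.\<close>

lemma powr_uniform_concavity:
  fixes a b s s2 :: real
  assumes "0 < s" "s \<le> s2" "s2 < 1" "0 \<le> a" "0 \<le> b"
  shows "(1 - s2) / 8 * (a powr (s/2) - b powr (s/2))\<^sup>2
           \<le> ((a + b) / 2) powr s - (a powr s + b powr s) / 2"
proof -
  define x y where "x = a powr (s/2)" and "y = b powr (s/2)"
  define m v where "m = (x + y) / 2" and "v = (x\<^sup>2 + y\<^sup>2) / 2"
  define w where "w = (a + b) / 2"
  have xy: "0 \<le> x" "0 \<le> y" by (auto simp: x_def y_def)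
  have sq: "a powr s = x\<^sup>2" "b powr s = y\<^sup>2"
    using assms by (simp_all add: x_def y_def power2_eq_square flip: powr_add)
  have vm: "v - m\<^sup>2 = (x - y)\<^sup>2 / 4"
    by (simp add: v_def m_def power2_eq_square field_simps)
  have m0: "0 \<le> m" and w0: "0 \<le> w" using xy assms by (auto simp: v_def m_def w_def)
  \<comment> \<open>\<open>\<theta>\<close> solves s / 2 * \<theta> + (1 - \<theta>) = s, and
    \<open>l = \<theta> / 2\<close> is the weight that results when \<open>m\<close> is expressed
    through its square.\<close>
  define \<theta> where "\<theta> = (2 - 2 * s) / (2 - s)"
  define l where "l = (1 - s) / (2 - s)"
  have \<theta>: "0 \<le> \<theta>" "\<theta> \<le> 1" using assms by (auto simp: \<theta>_def field_simps)
  have l: "(1 - s2) / 2 \<le> l" "0 \<le> l" "l < 1"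
  proof -
    have "(1 - s2) / 2 \<le> (1 - s) / 2" using assms by simp
    also have "\<dots> \<le> l" unfolding l_def using assms by (intro divide_left_mono) auto
    finally show "(1 - s2) / 2 \<le> l" .
  qed (use assms in \<open>auto simp: l_def field_simps\<close>)
  have rep: "(t powr (s/2))\<^sup>2 = (t powr (s/2)) powr \<theta> * t powr (1 - \<theta>)" for t
  proof -
    have "\<theta> * (2 - s) = 2 - 2 * s" using assms by (simp add: \<theta>_def)
    then have "s/2 * \<theta> + (1 - \<theta>) = s" by (simp add: algebra_simps)
    then show ?thesis by (simp add: powr_powr power2_eq_square flip: powr_add)
  qed
  have "x\<^sup>2 + y\<^sup>2 \<le> (x + y) powr \<theta> * (a + b) powr (1 - \<theta>)"
    using holder_two_terms[of \<theta> x a y b] xy \<theta> rep[of a] rep[of b] assms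
    by (simp add: x_def y_def)
  also have "\<dots> = (2 * m) powr \<theta> * (2 * w) powr (1 - \<theta>)"
  proof -
    have "2 * m = x + y" "2 * w = a + b" by (simp_all add: m_def w_def)
    then show ?thesis by (simp only:)
  qed
  also have "\<dots> = (2 powr \<theta> * 2 powr (1 - \<theta>)) * (m powr \<theta> * w powr (1 - \<theta>))"
    using w0 m0 by (simp add: powr_mult)
  also have "2 powr \<theta> * 2 powr (1 - \<theta>) = (2::real)"
    by (simp flip: powr_add)
  finally have "v \<le> m powr \<theta> * w powr (1 - \<theta>)" by (simp add: v_def)
  also have "\<dots> = (m\<^sup>2) powr l * (w powr s) powr (1 - l)"
  proof -
    have "s * (1 - l) = 1 - \<theta>" using assms by (simp add: l_def \<theta>_def field_simps)
    moreover have "m powr \<theta> = (m\<^sup>2) powr l"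
    proof (cases "m = 0")
      case False
      then have "m\<^sup>2 = m powr 2" using m0 by simp
      moreover have "2 * l = \<theta>" using assms by (simp add: l_def \<theta>_def field_simps)
      ultimately show ?thesis by (simp add: powr_powr)
    qed simp
    ultimately show ?thesis by (simp add: powr_powr)
  qed
  also have "\<dots> \<le> l * m\<^sup>2 + (1 - l) * w powr s"
    by (rule young_powr) (use l in auto)
  finally have v: "v \<le> l * m\<^sup>2 + (1 - l) * w powr s" .
  have mv: "m\<^sup>2 \<le> v" using vm zero_le_power2[of "x - y"] by linarith
  have "(1 - l) * v \<le> (1 - l) * w powr s"
    using v mult_left_mono[OF mv l(2)] by (simp add: algebra_simps)
  then have vw: "v \<le> w powr s" using l by simp
  have "(1 - s2) / 2 * (v - m\<^sup>2) \<le> l * (v - m\<^sup>2)"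
    using l mv by (intro mult_right_mono) auto
  also have "\<dots> \<le> l * (w powr s - m\<^sup>2)"
    using l vw by (intro mult_left_mono) auto
  also have "\<dots> \<le> w powr s - v" using v by (simp add: algebra_simps)
  finally show ?thesis unfolding vm sq by (simp add: v_def x_def y_def w_def)
qed

text \<open>By homogeneity it suffices to look at fractions of \<open>a + b\<close>, and t \<le> t
  powr s for t in [0, 1].\<close>

lemma powr_add_le_concave:
  fixes a b s :: real
  assumes "0 \<le> s" "s \<le> 1" "0 \<le> a" "0 \<le> b"
  shows "(a + b) powr s \<le> a powr s + b powr s"
proof (cases "a + b = 0")
  case False
  then have p: "0 < a + b" using assms by auto
  have *: "t / (a + b) \<le> (t / (a + b)) powr s" if "0 \<le> t" "t \<le> a + b" for t
  proof (cases "t = 0")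
    case False
    have "(t / (a + b)) powr 1 \<le> (t / (a + b)) powr s"
      using p that assms False by (intro powr_mono') (auto simp: field_simps)
    then show ?thesis using that p by simp
  qed simp
  have "1 \<le> (a/(a+b)) powr s + (b/(a+b)) powr s"
    using add_mono[OF *[of a] *[of b]] assms p by (simp flip: add_divide_distrib)
  then have "(a+b) powr s * 1 \<le> (a+b) powr s * ((a/(a+b)) powr s + (b/(a+b)) powr s)"
    by (intro mult_left_mono) auto
  then show ?thesis using assms p by (simp add: powr_divide distrib_left)
qed (use assms in auto)

lemma powr_sum_le_concave:
  fixes f :: "'i \<Rightarrow> real"
  assumes "0 \<le> s" "s \<le> 1" "\<And>i. i \<in> I \<Longrightarrow> 0 \<le> f i"
  shows "(\<Sum>i\<in>I. f i) powr s \<le> (\<Sum>i\<in>I. f i powr s)"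
  using assms(3)
proof (induction I rule: infinite_finite_induct)
  case (insert i I)
  have "(f i + (\<Sum>i\<in>I. f i)) powr s \<le> f i powr s + (\<Sum>i\<in>I. f i) powr s"
    using insert by (intro powr_add_le_concave assms(1,2) sum_nonneg) auto
  then show ?case using insert by (simp add: order_trans[OF _ add_left_mono])
qed auto

text \<open>A crude estimate through the maximum; its point is that the constant depends only on the
  upper bound \<open>S\<close> of the exponent.\<close>

lemma powr_add_le:
  fixes a b s S :: real
  assumes "0 \<le> s" "s \<le> S" "0 \<le> a" "0 \<le> b"
  shows "(a + b) powr s \<le> 2 powr S * (a powr s + b powr s)"
proof -
  have "(a + b) powr s \<le> (2 * max a b) powr s"
    using assms by (intro powr_mono2) auto
  also have "\<dots> = 2 powr s * max a b powr s" using assms by (simp add: powr_mult)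
  also have "\<dots> \<le> 2 powr S * (a powr s + b powr s)"
    using assms by (intro mult_mono powr_mono) (auto simp: max_def)
  finally show ?thesis .
qed

section \<open>Khintchine's inequality\<close>

text \<open>A Rademacher sum. A choice of signs is encoded by the set \<open>\<omega>\<close> of the
  indices with a plus sign, so that expectations become averages over \<open>Pow I\<close>.\<close>

definition signed_sum :: "'i set \<Rightarrow> ('i \<Rightarrow> real) \<Rightarrow> 'i set \<Rightarrow> real" where
  "signed_sum I a \<omega> = (\<Sum>i\<in>I. if i \<in> \<omega> then a i else - a i)"

lemma sum_Pow_insert:
  fixes g :: "'i set \<Rightarrow> real"
  assumes "finite I" "i \<notin> I"
  shows "(\<Sum>\<omega>\<in>Pow (insert i I). g \<omega>) = (\<Sum>\<omega>\<in>Pow I. g \<omega> + g (insert i \<omega>))"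
proof -
  have "inj_on (insert i) (Pow I)" using assms by (auto simp: inj_on_def)
  moreover have "Pow I \<inter> insert i ` Pow I = {}" using assms by auto
  ultimately show ?thesis
    using assms by (simp add: Pow_insert sum.union_disjoint sum.reindex sum.distrib)
qed

text \<open>Conditioning on the sign of the new index. The moment estimates below are inductions
  with this identity.\<close>

lemma sum_signed_sum_insert:
  fixes \<phi> :: "real \<Rightarrow> real"
  assumes "finite I" "i \<notin> I"
  shows "(\<Sum>\<omega>\<in>Pow (insert i I). \<phi> (signed_sum (insert i I) a \<omega>))
       = (\<Sum>\<omega>\<in>Pow I. \<phi> (signed_sum I a \<omega> - a i) + \<phi> (signed_sum I a \<omega> + a i))"
  unfolding sum_Pow_insert[OF assms]
proof (intro sum.cong refl arg_cong2[where f="(+)"] arg_cong[where f=\<phi>])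
  fix \<omega> assume \<omega>: "\<omega> \<in> Pow I"
  then have "i \<notin> \<omega>" using assms by auto
  then show "signed_sum (insert i I) a \<omega> = signed_sum I a \<omega> - a i"
    using assms by (simp add: signed_sum_def)
  have "signed_sum I a (insert i \<omega>) = signed_sum I a \<omega>"
    unfolding signed_sum_def using assms by (intro sum.cong) auto
  then show "signed_sum (insert i I) a (insert i \<omega>) = signed_sum I a \<omega> + a i"
    using assms by (simp add: signed_sum_def)
qed

lemma signed_sum_moment2:
  assumes "finite I"
  shows "(\<Sum>\<omega>\<in>Pow I. (signed_sum I a \<omega>)\<^sup>2) = 2 ^ card I * (\<Sum>i\<in>I. (a i)\<^sup>2)"
  using assms
proof (induction I)
  case (insert i I)
  have "(\<Sum>\<omega>\<in>Pow (insert i I). (signed_sum (insert i I) a \<omega>)\<^sup>2)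
     = (\<Sum>\<omega>\<in>Pow I. 2 * (signed_sum I a \<omega>)\<^sup>2 + 2 * (a i)\<^sup>2)"
    using insert by (subst sum_signed_sum_insert) (auto simp: power2_eq_square algebra_simps intro!: sum.cong)
  also have "\<dots> = 2 ^ card (insert i I) * (\<Sum>i\<in>insert i I. (a i)\<^sup>2)"
    using insert by (simp add: sum.distrib card_Pow algebra_simps flip: sum_distrib_left)
  finally show ?case .
qed (simp add: signed_sum_def)

lemma signed_sum_moment4:
  assumes "finite I"
  shows "(\<Sum>\<omega>\<in>Pow I. signed_sum I a \<omega> ^ 4) \<le> 3 * 2 ^ card I * (\<Sum>i\<in>I. (a i)\<^sup>2)\<^sup>2"
  using assms
proof (induction I)
  case (insert i I)
  define S where "S = (\<Sum>i\<in>I. (a i)\<^sup>2)"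
  have "(\<Sum>\<omega>\<in>Pow (insert i I). signed_sum (insert i I) a \<omega> ^ 4)
     = (\<Sum>\<omega>\<in>Pow I. 2 * signed_sum I a \<omega> ^ 4 + 12 * (a i)\<^sup>2 * (signed_sum I a \<omega>)\<^sup>2 + 2 * (a i) ^ 4)"
    using insert by (subst sum_signed_sum_insert)
      (auto simp: power2_eq_square power4_eq_xxxx algebra_simps intro!: sum.cong)
  also have "\<dots> = 2 * (\<Sum>\<omega>\<in>Pow I. signed_sum I a \<omega> ^ 4) + 12 * (a i)\<^sup>2 * (2 ^ card I * S)
                 + 2 * 2 ^ card I * (a i) ^ 4"
    using insert by (simp add: sum.distrib card_Pow S_def signed_sum_moment2 flip: sum_distrib_left)
  \<comment> \<open>Raising the coefficient of the fourth power from 2 to 6 completes a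
    square.\<close>
  also have "\<dots> \<le> 2 * (3 * 2 ^ card I * S\<^sup>2) + 12 * (a i)\<^sup>2 * (2 ^ card I * S) + 6 * 2 ^ card I * (a i) ^ 4"
    using insert by (intro add_mono mult_left_mono mult_right_mono) (auto simp: S_def)
  also have "\<dots> = 3 * 2 ^ card (insert i I) * ((a i)\<^sup>2 + S)\<^sup>2"
    using insert by (simp add: power2_eq_square power4_eq_xxxx algebra_simps)
  finally show ?case using insert by (simp add: S_def)
qed (simp add: signed_sum_def)

text \<open>A sub-Gaussian bound for one random sign, from exp y \<le> 1 + y + y^2 and 1 / (1 + y)
  \<le> 1 - y + y^2 on [0, 1]. The restriction on \<open>x\<close> is met later because the
  coefficients are normalised to square sum 1.\<close>

lemma exp_symmetric_le:
  fixes x :: real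
  assumes "\<bar>x\<bar> \<le> 1"
  shows "exp x + exp (- x) \<le> 2 * exp (x\<^sup>2)"
proof -
  have *: "exp y + exp (- y) \<le> 2 * exp (y\<^sup>2)" if "0 \<le> y" "y \<le> 1" for y :: real
  proof -
    have "exp (- y) \<le> 1 / (1 + y)"
      using that exp_ge_add_one_self[of y] by (simp add: exp_minus inverse_eq_divide frac_le)
    also have "\<dots> \<le> 1 - y + y\<^sup>2"
    proof -
      have "1 \<le> (1 - y + y\<^sup>2) * (1 + y)"
        using that by (simp add: algebra_simps power2_eq_square)
      then show ?thesis using that by (simp add: divide_le_eq)
    qed
    finally have "exp y + exp (- y) \<le> 2 * (1 + y\<^sup>2)"
      using exp_bound[OF that] by simp
    also have "\<dots> \<le> 2 * exp (y\<^sup>2)" by (intro mult_left_mono exp_ge_add_one_self) auto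
    finally show ?thesis .
  qed
  show ?thesis using *[of x] *[of "- x"] assms by (cases "0 \<le> x") (auto simp: add.commute)
qed

lemma signed_sum_exp_moment:
  assumes "finite I" "\<And>i. i \<in> I \<Longrightarrow> \<bar>a i\<bar> \<le> 1"
  shows "(\<Sum>\<omega>\<in>Pow I. exp (signed_sum I a \<omega>)) \<le> 2 ^ card I * exp (\<Sum>i\<in>I. (a i)\<^sup>2)"
  using assms
proof (induction I)
  case (insert i I)
  have "(\<Sum>\<omega>\<in>Pow (insert i I). exp (signed_sum (insert i I) a \<omega>))
     = (\<Sum>\<omega>\<in>Pow I. exp (signed_sum I a \<omega>)) * (exp (a i) + exp (- a i))"
    unfolding sum_distrib_right using insert by (subst sum_signed_sum_insert)
      (auto simp: exp_diff exp_add exp_minus divide_inverse algebra_simps intro!: sum.cong)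
  also have "\<dots> \<le> (2 ^ card I * exp (\<Sum>i\<in>I. (a i)\<^sup>2)) * (2 * exp ((a i)\<^sup>2))"
    using insert by (intro mult_mono exp_symmetric_le) auto
  also have "\<dots> = 2 ^ card (insert i I) * exp (\<Sum>i\<in>insert i I. (a i)\<^sup>2)"
    using insert by (simp add: exp_add algebra_simps)
  finally show ?case .
qed (simp add: signed_sum_def)

lemma powr_le_exp:
  fixes x q Q :: real
  assumes "0 \<le> x" "1 \<le> q" "q \<le> Q"
  shows "x powr q \<le> Q powr Q * exp x"
proof -
  have "x / q \<le> exp (x / q)" using exp_ge_add_one_self[of "x/q"] by linarith
  then have "x \<le> q * exp (x / q)" using assms by (simp add: field_simps)
  then have "x powr q \<le> (q * exp (x / q)) powr q" using assms by (intro powr_mono2) auto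
  also have "\<dots> = q powr q * exp x" using assms by (simp add: powr_mult exp_powr_real)
  also have "\<dots> \<le> Q powr Q * exp x"
  proof -
    have "q powr q \<le> Q powr q" using assms by (intro powr_mono2) auto
    also have "\<dots> \<le> Q powr Q" using assms by (intro powr_mono) auto
    finally show ?thesis by simp
  qed
  finally show ?thesis .
qed

text \<open>After normalisation an exponential moment dominates all powers up to \<open>Q\<close> at
  once. One constant for the whole range is needed because \<open>q\<close> will be the value of a
  variable exponent at a point.\<close>

lemma khintchine_upper:
  fixes a :: "'i \<Rightarrow> real"
  assumes "finite I" "1 \<le> q" "q \<le> Q"
  shows "(\<Sum>\<omega>\<in>Pow I. \<bar>signed_sum I a \<omega>\<bar> powr q)
          \<le> 2 ^ card I * (2 * exp 1 * Q powr Q) * (\<Sum>i\<in>I. (a i)\<^sup>2) powr (q / 2)"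
proof (cases "(\<Sum>i\<in>I. (a i)\<^sup>2) = 0")
  case True
  then have "a i = 0" if "i \<in> I" for i using that assms by (simp add: sum_nonneg_eq_0_iff)
  then have "signed_sum I a \<omega> = 0" for \<omega>
    unfolding signed_sum_def by (intro sum.neutral) auto
  then show ?thesis by simp
next
  case False
  define A where "A = (\<Sum>i\<in>I. (a i)\<^sup>2)"
  have A: "0 < A" using False by (simp add: A_def less_le sum_nonneg)
  define b where "b i = a i / sqrt A" for i
  have b2: "(\<Sum>i\<in>I. (b i)\<^sup>2) = 1"
    using A by (simp add: b_def power_divide A_def flip: sum_divide_distrib)
  have b1: "\<bar>b i\<bar> \<le> 1" if "i \<in> I" for i
  proof -
    have "(b i)\<^sup>2 \<le> (\<Sum>i\<in>I. (b i)\<^sup>2)" using assms that by (intro member_le_sum) auto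
    then show ?thesis unfolding b2 by (simp add: abs_square_le_1)
  qed
  have S: "signed_sum I a \<omega> = sqrt A * signed_sum I b \<omega>" for \<omega>
    unfolding signed_sum_def sum_distrib_left using A by (intro sum.cong) (auto simp: b_def)
  have Sm: "signed_sum I (\<lambda>i. - b i) \<omega> = - signed_sum I b \<omega>" for \<omega>
    unfolding signed_sum_def sum_negf[symmetric] by (intro sum.cong) auto
  have "(\<Sum>\<omega>\<in>Pow I. \<bar>signed_sum I b \<omega>\<bar> powr q)
      \<le> (\<Sum>\<omega>\<in>Pow I. Q powr Q * (exp (signed_sum I b \<omega>) + exp (signed_sum I (\<lambda>i. - b i) \<omega>)))"
  proof (intro sum_mono)
    fix \<omega>
    have "\<bar>signed_sum I b \<omega>\<bar> powr q \<le> Q powr Q * exp \<bar>signed_sum I b \<omega>\<bar>"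
      by (rule powr_le_exp) (use assms in auto)
    also have "\<dots> \<le> Q powr Q * (exp (signed_sum I b \<omega>) + exp (signed_sum I (\<lambda>i. - b i) \<omega>))"
      unfolding Sm by (intro mult_left_mono) (auto simp: abs_if)
    finally show "\<bar>signed_sum I b \<omega>\<bar> powr q \<le> \<dots>" .
  qed
  also have "\<dots> \<le> Q powr Q * (2 ^ card I * exp 1 + 2 ^ card I * exp 1)"
    unfolding sum_distrib_left[symmetric] sum.distrib
    using signed_sum_exp_moment[of I b] signed_sum_exp_moment[of I "\<lambda>i. - b i"] b1 b2 assms
    by (intro mult_left_mono add_mono) auto
  finally have *: "(\<Sum>\<omega>\<in>Pow I. \<bar>signed_sum I b \<omega>\<bar> powr q) \<le> 2 ^ card I * (2 * exp 1 * Q powr Q)"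
    by (simp add: algebra_simps)
  have "(\<Sum>\<omega>\<in>Pow I. \<bar>signed_sum I a \<omega>\<bar> powr q) = A powr (q/2) * (\<Sum>\<omega>\<in>Pow I. \<bar>signed_sum I b \<omega>\<bar> powr q)"
  proof -
    have "sqrt A powr q = A powr (q/2)"
      using A powr_half_sqrt[of A] powr_powr[of A "1/2" q] by simp
    then show ?thesis
      using A by (simp add: S abs_mult powr_mult sum_distrib_left)
  qed
  also have "\<dots> \<le> A powr (q/2) * (2 ^ card I * (2 * exp 1 * Q powr Q))"
    by (intro mult_left_mono *) auto
  finally show ?thesis by (simp add: A_def mult.commute)
qed

text \<open>A Paley-Zygmund estimate. The lower bound is a probability and not a moment, because it
  has to survive the removal of those sign choices for which the input is too large.\<close>

lemma khintchine_lower: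
  fixes a :: "'i \<Rightarrow> real"
  assumes "finite I"
  shows "2 ^ card I / 6 \<le> real (card {\<omega> \<in> Pow I. (\<Sum>i\<in>I. (a i)\<^sup>2) / 4 \<le> (signed_sum I a \<omega>)\<^sup>2})"
proof (cases "(\<Sum>i\<in>I. (a i)\<^sup>2) = 0")
  case True
  then have "{\<omega> \<in> Pow I. (\<Sum>i\<in>I. (a i)\<^sup>2) / 4 \<le> (signed_sum I a \<omega>)\<^sup>2} = Pow I" by auto
  then show ?thesis using assms by (simp add: card_Pow)
next
  case False
  define A where "A = (\<Sum>i\<in>I. (a i)\<^sup>2)"
  have A: "0 < A" using False by (simp add: A_def less_le sum_nonneg)
  define G where "G = {\<omega> \<in> Pow I. A / 4 \<le> (signed_sum I a \<omega>)\<^sup>2}"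
  have G: "finite G" "G \<subseteq> Pow I" using assms by (auto simp: G_def)
  have "2 ^ card I * A = (\<Sum>\<omega>\<in>Pow I. (signed_sum I a \<omega>)\<^sup>2)"
    using signed_sum_moment2[OF assms] by (simp add: A_def)
  \<comment> \<open>Outside \<open>G\<close> the square X of the sum is below A / 4; inside, it is
    split by 0 \<le> (X - 3 A)^2. As X has mean A and X^2 has mean at most 3 A^2, an amount A - A /
    4 - A / 2 = A / 4 is left for \<open>G\<close>, and (A / 4) / (3 A / 2) = 1 / 6.\<close>
  also have "\<dots> \<le> (\<Sum>\<omega>\<in>Pow I. A / 4 + signed_sum I a \<omega> ^ 4 / (6 * A) + (if \<omega> \<in> G then 3 * A / 2 else 0))"
  proof (intro sum_mono)
    fix \<omega> assume \<omega>: "\<omega> \<in> Pow I"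
    define X where "X = (signed_sum I a \<omega>)\<^sup>2"
    have X4: "signed_sum I a \<omega> ^ 4 = X\<^sup>2" by (simp add: X_def flip: power_mult)
    have "X \<le> X\<^sup>2 / (6 * A) + 3 * A / 2"
    proof -
      have "0 \<le> (X - 3 * A)\<^sup>2" by simp
      then have "6 * A * X \<le> X\<^sup>2 + 9 * A\<^sup>2" by (simp add: power2_eq_square algebra_simps)
      then show ?thesis using A by (simp add: field_simps power2_eq_square)
    qed
    then show "(signed_sum I a \<omega>)\<^sup>2 \<le> A / 4 + signed_sum I a \<omega> ^ 4 / (6 * A) + (if \<omega> \<in> G then 3 * A / 2 else 0)"
      using \<omega> A unfolding X4 X_def[symmetric] by (auto simp: G_def X_def[symmetric] intro: add_increasing2)
  qed
  also have "\<dots> = 2 ^ card I * (A / 4) + (\<Sum>\<omega>\<in>Pow I. signed_sum I a \<omega> ^ 4) / (6 * A) + card G * (3 * A / 2)"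
    using assms G by (simp add: sum.distrib card_Pow sum_divide_distrib Int_absorb1 flip: sum.inter_restrict)
  also have "\<dots> \<le> 2 ^ card I * (A / 4) + (3 * 2 ^ card I * A\<^sup>2) / (6 * A) + card G * (3 * A / 2)"
    using signed_sum_moment4[OF assms, of a] A
    by (intro add_mono divide_right_mono) (auto simp: A_def)
  finally have "2 ^ card I / 4 \<le> real (card G) * (3 / 2)"
    using A by (simp add: power2_eq_square field_simps)
  then show ?thesis unfolding G_def A_def by simp
qed

section \<open>Sums of independent Pareto variables\<close>

text \<open>
  A finite model of the Pareto distribution: the value \<open>2 ^ k\<close> is exceeded (weakly) with
  probability \<open>2 powr (- k t)\<close>, for \<open>k \<le> L\<close>.
\<close>

definition pareto_weight :: "real \<Rightarrow> nat \<Rightarrow> nat \<Rightarrow> real" where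
  "pareto_weight t L k =
     (if k < L then 2 powr (- real k * t) - 2 powr (- real (Suc k) * t) else 2 powr (- real L * t))"

definition pareto_prob :: "real \<Rightarrow> nat \<Rightarrow> (nat \<Rightarrow> bool) \<Rightarrow> real" where
  "pareto_prob t L A = (\<Sum>k\<le>L. if A k then pareto_weight t L k else 0)"

lemma pareto_weight_nonneg:
  assumes "0 \<le> t" shows "0 \<le> pareto_weight t L k"
proof -
  have "- real (Suc k) * t \<le> - real k * t" using assms by (simp add: algebra_simps)
  then have "2 powr (- real (Suc k) * t) \<le> 2 powr (- real k * t)" by (rule powr_mono) simp
  then show ?thesis by (simp add: pareto_weight_def)
qed

lemma pareto_weight_le: "k \<le> L \<Longrightarrow> pareto_weight t L k \<le> 2 powr (- real k * t)"
  by (auto simp: pareto_weight_def)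

text \<open>The weights telescope downwards from \<open>L\<close>. Since the top level carries the
  whole remaining tail, truncation leaves the tail probabilities up to level \<open>L\<close>
  exact.\<close>

lemma pareto_weight_tail:
  assumes "j \<le> L"
  shows "(\<Sum>k\<in>{j..L}. pareto_weight t L k) = 2 powr (- real j * t)"
  using assms
proof (induction rule: inc_induct)
  case (step j)
  have "{j..L} = insert j {Suc j..L}" using step by auto
  then show ?case using step by (simp add: pareto_weight_def)
qed (simp add: pareto_weight_def)

lemma pareto_weight_sum: "(\<Sum>k\<le>L. pareto_weight t L k) = 1"
  using pareto_weight_tail[of 0 L t] by (simp add: atMost_atLeast0)

lemma pareto_prob_ge:
  fixes \<tau> :: real
  assumes "0 < t" "K \<le> L" "\<tau> \<le> 2 ^ K" "K = 0 \<or> 2 ^ (K - 1) < \<tau>"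
  shows "pareto_prob t L (\<lambda>k. \<tau> \<le> 2 ^ k) = 2 powr (- real K * t)"
proof -
  have eq: "\<tau> \<le> 2 ^ k \<longleftrightarrow> K \<le> k" for k
  proof
    assume "K \<le> k"
    then have "(2::real) ^ K \<le> 2 ^ k" by (intro power_increasing) auto
    with assms(3) show "\<tau> \<le> 2 ^ k" by (rule order_trans)
  next
    assume k: "\<tau> \<le> 2 ^ k"
    show "K \<le> k"
    proof (rule ccontr)
      assume "\<not> K \<le> k"
      then have "K \<noteq> 0" "k \<le> K - 1" by auto
      then have "2 ^ (K - 1) < \<tau>" "(2::real) ^ k \<le> 2 ^ (K - 1)"
        using assms(4) by (auto intro: power_increasing)
      then show False using k by linarith
    qed
  qed
  have "{..L} \<inter> {k. K \<le> k} = {K..L}" by auto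
  then show ?thesis
    unfolding pareto_prob_def eq using pareto_weight_tail[OF assms(2)]
    by (simp add: sum.If_cases)
qed

lemma exists_dyadic_ge:
  fixes \<tau> :: real
  assumes "\<tau> \<le> 2 ^ L"
  obtains K where "K \<le> L" "\<tau> \<le> 2 ^ K" "K = 0 \<or> 2 ^ (K - 1) < \<tau>"
proof -
  define K where "K = (LEAST k. \<tau> \<le> 2 ^ k)"
  have "\<tau> \<le> 2 ^ K" unfolding K_def by (rule LeastI) (rule assms)
  moreover have "K \<le> L" unfolding K_def by (rule Least_le) (rule assms)
  moreover have "K = 0 \<or> 2 ^ (K - 1) < \<tau>"
  proof (cases "K = 0")
    case False
    then have "K - 1 < K" by simp
    then have "\<not> \<tau> \<le> 2 ^ (K - 1)" unfolding K_def by (rule not_less_Least)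
    then show ?thesis by simp
  qed simp
  ultimately show ?thesis using that by blast
qed

lemma pareto_prob_upper:
  assumes "0 < t" "0 < \<tau>"
  shows "pareto_prob t L (\<lambda>k. \<tau> \<le> 2 ^ k) \<le> \<tau> powr (- t)"
proof (cases "\<tau> \<le> 2 ^ L")
  case True
  then obtain K where K: "K \<le> L" "\<tau> \<le> 2 ^ K" "K = 0 \<or> 2 ^ (K - 1) < \<tau>"
    by (rule exists_dyadic_ge)
  have "pareto_prob t L (\<lambda>k. \<tau> \<le> 2 ^ k) = (2 powr real K) powr (- t)"
    using pareto_prob_ge[OF assms(1) K] by (simp only: powr_powr) simp
  also have "\<dots> \<le> \<tau> powr (- t)"
    using K assms by (intro powr_mono2') (auto simp: powr_realpow)
  finally show ?thesis .
next
  case False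
  have "\<not> \<tau> \<le> 2 ^ k" if "k \<le> L" for k
  proof -
    have "(2::real) ^ k \<le> 2 ^ L" using that by (intro power_increasing) auto
    then show ?thesis using False by linarith
  qed
  then have "pareto_prob t L (\<lambda>k. \<tau> \<le> 2 ^ k) = 0"
    unfolding pareto_prob_def by (intro sum.neutral) auto
  then show ?thesis by simp
qed

text \<open>Rounding \<open>\<tau>\<close> up to a power of 2 at most doubles it, which costs the
  factor \<open>2 powr (- t)\<close>. Above \<open>2 ^ L\<close> the probability is 0, hence the
  later conditions on \<open>L\<close>.\<close>

lemma pareto_prob_lower:
  assumes "0 < t" "1 \<le> \<tau>" "\<tau> \<le> 2 ^ L"
  shows "2 powr (- t) * \<tau> powr (- t) \<le> pareto_prob t L (\<lambda>k. \<tau> \<le> 2 ^ k)"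
proof -
  obtain K where K: "K \<le> L" "\<tau> \<le> 2 ^ K" "K = 0 \<or> 2 ^ (K - 1) < \<tau>"
    using assms(3) by (rule exists_dyadic_ge)
  have "2 powr real K \<le> 2 * \<tau>"
  proof (cases "K = 0")
    case False
    then have "(2::real) ^ K = 2 * 2 ^ (K - 1)" by (cases K) auto
    then show ?thesis using K False by (simp add: powr_realpow)
  qed (use assms in auto)
  then have "(2 * \<tau>) powr (- t) \<le> (2 powr real K) powr (- t)"
    using assms by (intro powr_mono2') auto
  also have "\<dots> = pareto_prob t L (\<lambda>k. \<tau> \<le> 2 ^ k)"
    using pareto_prob_ge[OF assms(1) K] by (simp only: powr_powr) simp
  finally show ?thesis using assms by (simp add: powr_mult)
qed

text \<open>The summands are bounded by a geometric progression with ratio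
  \<open>2 powr (1 - t)\<close> above 1, whose sum is comparable to its last term.\<close>

lemma pareto_truncated_mean:
  assumes "0 < t" "t < 1" "0 < \<tau>"
  shows "(\<Sum>k\<le>L. if 2 ^ k \<le> \<tau> then pareto_weight t L k * 2 ^ k else 0)
          \<le> 2 powr (1 - t) / (2 powr (1 - t) - 1) * \<tau> powr (1 - t)"
proof -
  define z :: real where "z = 2 powr (1 - t)"
  have z: "1 < z" unfolding z_def using assms by (intro gr_one_powr) auto
  define S where "S = {k. k \<le> L \<and> (2::real) ^ k \<le> \<tau>}"
  have fS: "finite S" unfolding S_def by auto
  have "(\<Sum>k\<le>L. if 2 ^ k \<le> \<tau> then pareto_weight t L k * 2 ^ k else 0)
      = (\<Sum>k\<in>S. pareto_weight t L k * 2 ^ k)"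
    unfolding S_def by (simp add: sum.If_cases) (intro sum.cong, auto)
  also have "\<dots> \<le> (\<Sum>k\<in>S. z ^ k)"
  proof (intro sum_mono)
    fix k assume "k \<in> S"
    then have "pareto_weight t L k * 2 ^ k \<le> 2 powr (- real k * t) * 2 ^ k"
      by (intro mult_right_mono pareto_weight_le) (auto simp: S_def)
    also have "\<dots> = z ^ k"
      by (simp add: z_def powr_powr algebra_simps flip: powr_realpow powr_add)
    finally show "pareto_weight t L k * 2 ^ k \<le> z ^ k" .
  qed
  also have "\<dots> \<le> z / (z - 1) * \<tau> powr (1 - t)"
  proof (cases "S = {}")
    case False
    define K where "K = Max S"
    have K: "K \<in> S" "S \<subseteq> {..K}" using False fS by (auto simp: K_def)
    have "(\<Sum>k\<in>S. z ^ k) \<le> (\<Sum>k\<le>K. z ^ k)"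
      using K z by (intro sum_mono2) auto
    also have "\<dots> = (z ^ Suc K - 1) / (z - 1)"
      using z sum_gp_basic[of z K] by (simp add: field_simps)
    also have "\<dots> \<le> z / (z - 1) * z ^ K"
      using z by (simp add: field_simps)
    also have "z ^ K = (2 ^ K) powr (1 - t)"
      by (simp add: z_def powr_powr mult.commute flip: powr_realpow)
    also have "z / (z - 1) * (2 ^ K) powr (1 - t) \<le> z / (z - 1) * \<tau> powr (1 - t)"
      using K z assms by (intro mult_left_mono powr_mono2) (auto simp: S_def)
    finally show ?thesis .
  qed (use z in auto)
  finally show ?thesis unfolding z_def .
qed

text \<open>The summands are bounded by a decaying geometric progression, whose sum is comparable to
  its first term. The gap between \<open>\<sigma>2\<close> and \<open>t\<close> makes the constant
  independent of \<open>\<sigma>\<close>.\<close>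

lemma pareto_tail_moment:
  assumes "\<sigma> \<le> \<sigma>2" "\<sigma>2 < t" "0 < \<tau>"
  shows "(\<Sum>k\<le>L. if \<tau> < 2 ^ k then pareto_weight t L k * (2 ^ k) powr \<sigma> else 0)
          \<le> 1 / (1 - 2 powr (\<sigma>2 - t)) * \<tau> powr (\<sigma> - t)"
proof -
  define z :: real where "z = 2 powr (\<sigma> - t)"
  define z2 :: real where "z2 = 2 powr (\<sigma>2 - t)"
  have z: "0 < z" "z \<le> z2" unfolding z_def z2_def using assms by (auto intro!: powr_mono)
  have z2: "z2 < 1" unfolding z2_def using assms powr_less_mono[of "\<sigma>2 - t" 0 2] by simp
  define S where "S = {k. k \<le> L \<and> \<tau> < (2::real) ^ k}"
  have fS: "finite S" unfolding S_def by auto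
  have "(\<Sum>k\<le>L. if \<tau> < 2 ^ k then pareto_weight t L k * (2 ^ k) powr \<sigma> else 0)
      = (\<Sum>k\<in>S. pareto_weight t L k * (2 ^ k) powr \<sigma>)"
    unfolding S_def by (simp add: sum.If_cases) (intro sum.cong, auto)
  also have "\<dots> \<le> (\<Sum>k\<in>S. z ^ k)"
  proof (intro sum_mono)
    fix k assume "k \<in> S"
    then have "pareto_weight t L k * (2 ^ k) powr \<sigma> \<le> 2 powr (- real k * t) * (2 ^ k) powr \<sigma>"
      by (intro mult_right_mono pareto_weight_le) (auto simp: S_def)
    also have "\<dots> = z ^ k"
      by (simp add: z_def powr_powr algebra_simps flip: powr_realpow powr_add)
    finally show "pareto_weight t L k * (2 ^ k) powr \<sigma> \<le> z ^ k" .
  qed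
  also have "\<dots> \<le> 1 / (1 - z2) * \<tau> powr (\<sigma> - t)"
  proof (cases "S = {}")
    case False
    define K where "K = Min S"
    have K: "K \<in> S" "S \<subseteq> {K..L}" using False fS by (auto simp: K_def) (auto simp: S_def)
    have "(\<Sum>k\<in>S. z ^ k) \<le> (\<Sum>k=K..L. z ^ k)"
      using K z by (intro sum_mono2) auto
    also have "\<dots> = (z ^ K - z ^ Suc L) / (1 - z)"
      using K z z2 sum_gp_multiplied[of K L z] by (simp add: field_simps S_def)
    also have "\<dots> \<le> z ^ K / (1 - z2)"
      using z z2 by (intro frac_le) auto
    also have "z ^ K = (2 ^ K) powr (\<sigma> - t)"
      by (simp add: z_def powr_powr mult.commute flip: powr_realpow)
    also have "(2 ^ K) powr (\<sigma> - t) / (1 - z2) \<le> \<tau> powr (\<sigma> - t) / (1 - z2)"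
      using K z2 assms by (intro divide_right_mono powr_mono2') (auto simp: S_def)
    finally show ?thesis by simp
  qed (use z2 in auto)
  finally show ?thesis unfolding z2_def .
qed

section \<open>Independent families of Pareto variables\<close>

definition pareto_space :: "nat \<Rightarrow> 'i set \<Rightarrow> ('i \<Rightarrow> nat) set" where
  "pareto_space L I = PiE I (\<lambda>_. {..L})"

text \<open>The probability of an outcome under independence. An outcome records levels: the
  variable with index \<open>i\<close> has the value \<open>2 ^ \<omega> i\<close>.\<close>

definition pareto_prod :: "real \<Rightarrow> nat \<Rightarrow> 'i set \<Rightarrow> ('i \<Rightarrow> nat) \<Rightarrow> real" where
  "pareto_prod t L I \<omega> = (\<Prod>i\<in>I. pareto_weight t L (\<omega> i))"

lemma finite_pareto_space: "finite I \<Longrightarrow> finite (pareto_space L I)"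
  by (auto simp: pareto_space_def intro!: finite_PiE)

lemma pareto_prod_nonneg: "0 \<le> t \<Longrightarrow> 0 \<le> pareto_prod t L I \<omega>"
  by (auto simp: pareto_prod_def intro!: prod_nonneg pareto_weight_nonneg)

lemma pareto_prod_expectation:
  assumes "finite I"
  shows "(\<Sum>\<omega>\<in>pareto_space L I. pareto_prod t L I \<omega> * (\<Prod>i\<in>I. g i (\<omega> i)))
       = (\<Prod>i\<in>I. \<Sum>k\<le>L. pareto_weight t L k * g i k)"
  unfolding pareto_space_def pareto_prod_def prod.distrib[symmetric]
  by (subst prod_sum_PiE) (use assms in auto)

lemma pareto_prod_sum:
  assumes "finite I"
  shows "(\<Sum>\<omega>\<in>pareto_space L I. pareto_prod t L I \<omega>) = 1"
  using pareto_prod_expectation[OF assms, where L = L and t = t and g = "\<lambda>_ _. 1"] by (simp add: pareto_weight_sum)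

lemma pareto_prod_marginal:
  assumes "finite I" "i \<in> I"
  shows "(\<Sum>\<omega>\<in>pareto_space L I. pareto_prod t L I \<omega> * g (\<omega> i)) = (\<Sum>k\<le>L. pareto_weight t L k * g k)"
proof -
  have "(\<Sum>\<omega>\<in>pareto_space L I. pareto_prod t L I \<omega> * g (\<omega> i))
      = (\<Sum>\<omega>\<in>pareto_space L I. pareto_prod t L I \<omega> * (\<Prod>j\<in>I. if j = i then g (\<omega> j) else 1))"
    using assms by simp
  also have "\<dots> = (\<Prod>j\<in>I. \<Sum>k\<le>L. pareto_weight t L k * (if j = i then g k else 1))"
    by (rule pareto_prod_expectation[OF assms(1)])
  also have "\<dots> = (\<Prod>j\<in>I. if j = i then \<Sum>k\<le>L. pareto_weight t L k * g k else 1)"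
    by (intro prod.cong refl) (auto simp: pareto_weight_sum)
  also have "\<dots> = (\<Sum>k\<le>L. pareto_weight t L k * g k)" using assms by simp
  finally show ?thesis .
qed

text \<open>Weierstrass' product inequality. Applied to exceedance probabilities of total at most 1
  / 2, it keeps the probability of no exceedance at least 1 / 2.\<close>

lemma prod_one_minus_ge:
  fixes f :: "'i \<Rightarrow> real"
  assumes "finite J" "\<And>j. j \<in> J \<Longrightarrow> 0 \<le> f j \<and> f j \<le> 1"
  shows "1 - (\<Sum>j\<in>J. f j) \<le> (\<Prod>j\<in>J. 1 - f j) \<and> (\<Prod>j\<in>J. 1 - f j) \<le> 1 \<and> 0 \<le> (\<Prod>j\<in>J. 1 - f j)"
  using assms
proof (induction J)
  case (insert j J)
  let ?P = "\<Prod>j\<in>J. 1 - f j"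
  have IH: "1 - (\<Sum>j\<in>J. f j) \<le> ?P" "?P \<le> 1" "0 \<le> ?P" using insert by auto
  have f: "0 \<le> f j" "f j \<le> 1" using insert by auto
  have "f j * ?P \<le> f j * 1" using IH f by (intro mult_left_mono) auto
  moreover have "(1 - f j) * ?P \<le> 1" using IH f by (intro mult_le_one) auto
  moreover have "0 \<le> (1 - f j) * ?P" using IH f by (intro mult_nonneg_nonneg) auto
  ultimately show ?case using insert IH f by (auto simp: algebra_simps)
qed auto

text \<open>Each normalised term is split at the level 1: the small parts contribute through their
  truncated means, the large parts through their moments of order \<open>\<sigma>\<close>, and by
  the two preceding tail estimates both contributions are at most a constant times
  \<open>a i powr t\<close>. The three summands of the constant are the 1 of x powr \<sigma> \<le> 1
  + x and these two constants.\<close>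

lemma pareto_moment:
  fixes b :: "'i \<Rightarrow> real"
  assumes t: "0 < t" "t < 1" and \<sigma>: "0 < \<sigma>" "\<sigma> \<le> \<sigma>2" "\<sigma>2 < t"
    and I: "finite I" and b: "\<And>i. i \<in> I \<Longrightarrow> 0 \<le> b i"
  shows "(\<Sum>\<omega>\<in>pareto_space L I. pareto_prod t L I \<omega> * (\<Sum>i\<in>I. b i * 2 ^ \<omega> i) powr \<sigma>)
     \<le> (1 + 2 powr (1 - t) / (2 powr (1 - t) - 1) + 1 / (1 - 2 powr (\<sigma>2 - t)))
        * (\<Sum>i\<in>I. b i powr t) powr (\<sigma> / t)"
proof -
  define C1 C2 where "C1 = 2 powr (1 - t) / (2 powr (1 - t) - 1)" and "C2 = 1 / (1 - 2 powr (\<sigma>2 - t))"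
  define E where "E g = (\<Sum>\<omega>\<in>pareto_space L I. pareto_prod t L I \<omega> * g \<omega>)" for g
  have E_mono: "E g \<le> E h" if "\<And>\<omega>. g \<omega> \<le> h \<omega>" for g h
    unfolding E_def using that t by (intro sum_mono mult_left_mono pareto_prod_nonneg) auto
  have E_sum: "E (\<lambda>\<omega>. \<Sum>i\<in>I. g i \<omega>) = (\<Sum>i\<in>I. E (g i))" for g :: "'i \<Rightarrow> ('i \<Rightarrow> nat) \<Rightarrow> real"
    unfolding E_def sum_distrib_left by (rule sum.swap)
  have E_add: "E (\<lambda>\<omega>. 1 + g \<omega> + h \<omega>) = 1 + E g + E h" for g h
    unfolding E_def using pareto_prod_sum[OF I, of t L] by (simp add: distrib_left sum.distrib)
  have normalised: "E (\<lambda>\<omega>. (\<Sum>i\<in>I. a i * 2 ^ \<omega> i) powr \<sigma>) \<le> 1 + C1 + C2"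
    if a: "\<And>i. i \<in> I \<Longrightarrow> 0 \<le> a i" and a1: "(\<Sum>i\<in>I. a i powr t) = 1" for a :: "'i \<Rightarrow> real"
  proof -
    define lo where "lo i k = (if a i * 2 ^ k \<le> 1 then a i * 2 ^ k else 0)" for i and k :: nat
    define hi where "hi i k = (if a i * 2 ^ k \<le> 1 then 0 else (a i * 2 ^ k) powr \<sigma>)" for i and k :: nat
    have "E (\<lambda>\<omega>. (\<Sum>i\<in>I. a i * 2 ^ \<omega> i) powr \<sigma>)
        \<le> E (\<lambda>\<omega>. 1 + (\<Sum>i\<in>I. lo i (\<omega> i)) + (\<Sum>i\<in>I. hi i (\<omega> i)))"
    proof (rule E_mono)
      fix \<omega> :: "'i \<Rightarrow> nat"
      define hi0 where "hi0 i = (if a i * 2 ^ \<omega> i \<le> 1 then 0 else a i * 2 ^ \<omega> i)" for i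
      have s: "0 \<le> \<sigma>" "\<sigma> \<le> 1" using \<sigma> t by auto
      have nn: "0 \<le> lo i k" "0 \<le> hi0 i" if "i \<in> I" for i k using a[OF that] by (auto simp: lo_def hi0_def)
      have "(\<Sum>i\<in>I. a i * 2 ^ \<omega> i) powr \<sigma> = ((\<Sum>i\<in>I. lo i (\<omega> i)) + (\<Sum>i\<in>I. hi0 i)) powr \<sigma>"
        unfolding sum.distrib[symmetric] by (intro arg_cong[where f="\<lambda>x. x powr \<sigma>"] sum.cong) (auto simp: lo_def hi0_def)
      also have "\<dots> \<le> (\<Sum>i\<in>I. lo i (\<omega> i)) powr \<sigma> + (\<Sum>i\<in>I. hi0 i) powr \<sigma>"
        using nn by (intro powr_add_le_concave s sum_nonneg) auto
      also have "(\<Sum>i\<in>I. lo i (\<omega> i)) powr \<sigma> \<le> 1 + (\<Sum>i\<in>I. lo i (\<omega> i))"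
        using powr_tangent_above[of \<sigma> "\<Sum>i\<in>I. lo i (\<omega> i)" 1] s nn
          mult_right_mono[of \<sigma> 1 "\<Sum>i\<in>I. lo i (\<omega> i)"] by (auto simp: sum_nonneg)
      also have "(\<Sum>i\<in>I. hi0 i) powr \<sigma> \<le> (\<Sum>i\<in>I. hi0 i powr \<sigma>)"
        using nn by (intro powr_sum_le_concave s) auto
      also have "(\<Sum>i\<in>I. hi0 i powr \<sigma>) = (\<Sum>i\<in>I. hi i (\<omega> i))"
        by (intro sum.cong) (auto simp: hi0_def hi_def)
      finally show "(\<Sum>i\<in>I. a i * 2 ^ \<omega> i) powr \<sigma> \<le> 1 + (\<Sum>i\<in>I. lo i (\<omega> i)) + (\<Sum>i\<in>I. hi i (\<omega> i))"
        by simp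
    qed
    also have "\<dots> = 1 + (\<Sum>i\<in>I. E (\<lambda>\<omega>. lo i (\<omega> i))) + (\<Sum>i\<in>I. E (\<lambda>\<omega>. hi i (\<omega> i)))"
      by (simp only: E_add E_sum)
    also have "\<dots> = 1 + (\<Sum>i\<in>I. \<Sum>k\<le>L. pareto_weight t L k * lo i k)
                      + (\<Sum>i\<in>I. \<Sum>k\<le>L. pareto_weight t L k * hi i k)"
      unfolding E_def using I by (simp add: pareto_prod_marginal)
    also have "(\<Sum>i\<in>I. \<Sum>k\<le>L. pareto_weight t L k * lo i k) \<le> (\<Sum>i\<in>I. C1 * a i powr t)"
    proof (intro sum_mono)
      fix i assume i: "i \<in> I"
      show "(\<Sum>k\<le>L. pareto_weight t L k * lo i k) \<le> C1 * a i powr t"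
      proof (cases "a i = 0")
        case False
        then have ai: "0 < a i" using a[OF i] by simp
        have "(\<Sum>k\<le>L. pareto_weight t L k * lo i k)
            = a i * (\<Sum>k\<le>L. if 2 ^ k \<le> 1 / a i then pareto_weight t L k * 2 ^ k else 0)"
          unfolding sum_distrib_left using ai by (intro sum.cong) (auto simp: lo_def field_simps)
        also have "\<dots> \<le> a i * (C1 * (1 / a i) powr (1 - t))"
          unfolding C1_def using ai t by (intro mult_left_mono pareto_truncated_mean) auto
        also have "\<dots> = C1 * a i powr t"
        proof -
          have "(1 / a i) powr (1 - t) = a i powr (t - 1)"
            using ai by (simp add: powr_divide powr_minus_divide[symmetric])
          moreover have "a i * a i powr (t - 1) = a i powr t" using ai by (simp add: powr_mult_base)
          ultimately show ?thesis by (simp add: mult.left_commute)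
        qed
        finally show ?thesis .
      qed (simp add: lo_def)
    qed
    also have "(\<Sum>i\<in>I. \<Sum>k\<le>L. pareto_weight t L k * hi i k) \<le> (\<Sum>i\<in>I. C2 * a i powr t)"
    proof (intro sum_mono)
      fix i assume i: "i \<in> I"
      show "(\<Sum>k\<le>L. pareto_weight t L k * hi i k) \<le> C2 * a i powr t"
      proof (cases "a i = 0")
        case False
        then have ai: "0 < a i" using a[OF i] by simp
        have "(\<Sum>k\<le>L. pareto_weight t L k * hi i k)
            = a i powr \<sigma> * (\<Sum>k\<le>L. if 1 / a i < 2 ^ k then pareto_weight t L k * (2 ^ k) powr \<sigma> else 0)"
          unfolding sum_distrib_left using ai
          by (intro sum.cong) (auto simp: hi_def field_simps powr_mult)
        also have "\<dots> \<le> a i powr \<sigma> * (C2 * (1 / a i) powr (\<sigma> - t))"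
          unfolding C2_def using ai t \<sigma> by (intro mult_left_mono pareto_tail_moment) auto
        also have "\<dots> = C2 * a i powr t"
        proof -
          have "(1 / a i) powr (\<sigma> - t) = a i powr (t - \<sigma>)"
            using ai by (simp add: powr_divide powr_minus_divide[symmetric])
          moreover have "a i powr \<sigma> * a i powr (t - \<sigma>) = a i powr t" by (simp flip: powr_add)
          ultimately show ?thesis by (simp add: mult.left_commute)
        qed
        finally show ?thesis .
      qed (simp add: hi_def)
    qed
    finally show ?thesis by (simp add: a1 flip: sum_distrib_left)
  qed
  show ?thesis
  proof (cases "(\<Sum>i\<in>I. b i powr t) = 0")
    case True
    then have "b i powr t = 0" if "i \<in> I" for i using I that by (simp add: sum_nonneg_eq_0_iff)
    then have "b i = 0" if "i \<in> I" for i using that by simp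
    then have "(\<Sum>i\<in>I. b i * 2 ^ \<omega> i) = 0" for \<omega> :: "'i \<Rightarrow> nat" by (intro sum.neutral) auto
    then show ?thesis using True by simp
  next
    case False
    define A where "A = (\<Sum>i\<in>I. b i powr t)"
    have A: "0 < A" using False by (simp add: A_def less_le sum_nonneg)
    define a where "a i = b i / A powr (1/t)" for i
    have at: "a i powr t = b i powr t / A" if "i \<in> I" for i
      using b[OF that] A t by (simp add: a_def powr_divide powr_powr)
    have "E (\<lambda>\<omega>. (\<Sum>i\<in>I. a i * 2 ^ \<omega> i) powr \<sigma>) \<le> 1 + C1 + C2"
    proof (rule normalised)
      show "(\<Sum>i\<in>I. a i powr t) = 1" using A by (simp add: at flip: sum_divide_distrib A_def)
    qed (use b A in \<open>auto simp: a_def\<close>)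
    moreover have "E (\<lambda>\<omega>. (\<Sum>i\<in>I. b i * 2 ^ \<omega> i) powr \<sigma>) = A powr (\<sigma>/t) * E (\<lambda>\<omega>. (\<Sum>i\<in>I. a i * 2 ^ \<omega> i) powr \<sigma>)"
    proof -
      have "(\<Sum>i\<in>I. b i * 2 ^ \<omega> i) = A powr (1/t) * (\<Sum>i\<in>I. a i * 2 ^ \<omega> i)" for \<omega> :: "'i \<Rightarrow> nat"
        unfolding sum_distrib_left using A by (intro sum.cong) (auto simp: a_def)
      moreover have "0 \<le> (\<Sum>i\<in>I. a i * 2 ^ \<omega> i)" for \<omega> :: "'i \<Rightarrow> nat"
        using b A by (intro sum_nonneg) (auto simp: a_def)
      ultimately have "(\<Sum>i\<in>I. b i * 2 ^ \<omega> i) powr \<sigma> = A powr (\<sigma>/t) * (\<Sum>i\<in>I. a i * 2 ^ \<omega> i) powr \<sigma>"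
        for \<omega> :: "'i \<Rightarrow> nat" by (simp add: powr_mult powr_powr)
      then show ?thesis
        unfolding E_def by (simp add: sum_distrib_left mult.left_commute)
    qed
    ultimately have "E (\<lambda>\<omega>. (\<Sum>i\<in>I. b i * 2 ^ \<omega> i) powr \<sigma>) \<le> A powr (\<sigma>/t) * (1 + C1 + C2)"
      by (simp add: mult_left_mono)
    then show ?thesis by (simp add: E_def A_def C1_def C2_def mult.commute)
  qed
qed

text \<open>For different indices in \<open>I\<close> these events are disjoint. The lower estimate
  for sums and the lift further below both rest on this.\<close>

definition sole_exceedance :: "'i set \<Rightarrow> real \<Rightarrow> ('i \<Rightarrow> real) \<Rightarrow> 'i \<Rightarrow> ('i \<Rightarrow> nat) \<Rightarrow> bool" where
  "sole_exceedance I \<kappa> b i \<omega> \<longleftrightarrow> \<kappa> \<le> b i * 2 ^ \<omega> i \<and> (\<forall>j\<in>I - {i}. b j * 2 ^ \<omega> j < \<kappa>)"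

text \<open>By independence the probability is that of an exceedance by \<open>i\<close> times that
  of none by the others. The threshold \<open>2 powr (1/t)\<close> halves the tail bounds, so all
  exceedance probabilities add up to at most 1 / 2 and the second factor is at least 1 / 2.\<close>

lemma sole_exceedance_prob:
  fixes b :: "'i \<Rightarrow> real"
  assumes t: "0 < t" and I: "finite I" and i: "i \<in> I"
    and b: "\<And>i. i \<in> I \<Longrightarrow> 0 \<le> b i" "(\<Sum>i\<in>I. b i powr t) \<le> 1"
    and bi: "2 powr (1/t) \<le> b i * 2 ^ L"
  shows "2 powr (- t) / 4 * b i powr t
     \<le> (\<Sum>\<omega>\<in>pareto_space L I. pareto_prod t L I \<omega> * (if sole_exceedance I (2 powr (1/t)) b i \<omega> then 1 else 0))"
proof -
  define \<kappa> :: real where "\<kappa> = 2 powr (1/t)"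
  have inv: "(\<kappa> / x) powr (- t) = x powr t / 2" if "0 < x" for x
  proof -
    have "\<kappa> powr (- t) = 1 / 2" using t by (simp add: \<kappa>_def powr_powr powr_minus_divide)
    moreover have "x powr (- t) = 1 / x powr t" by (rule powr_minus_divide)
    ultimately show ?thesis using that by (simp add: powr_divide \<kappa>_def)
  qed
  have \<kappa>: "1 \<le> \<kappa>" "0 < \<kappa>" "\<kappa> powr t = 2" using t by (auto simp: \<kappa>_def powr_powr ge_one_powr_ge_zero)
  define Pr where "Pr j = pareto_prob t L (\<lambda>k. \<kappa> \<le> b j * 2 ^ k)" for j
  have Pr: "0 \<le> Pr j" "Pr j \<le> b j powr t / 2" if "j \<in> I" for j
  proof -
    show "0 \<le> Pr j" unfolding Pr_def pareto_prob_def using t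
      by (intro sum_nonneg) (auto intro: pareto_weight_nonneg)
    show "Pr j \<le> b j powr t / 2"
    proof (cases "b j = 0")
      case False
      then have bj: "0 < b j" using b(1)[OF that] by simp
      have "Pr j = pareto_prob t L (\<lambda>k. \<kappa> / b j \<le> 2 ^ k)"
        using bj by (simp add: Pr_def field_simps)
      also have "\<dots> \<le> (\<kappa> / b j) powr (- t)" using bj \<kappa> t by (intro pareto_prob_upper) auto
      also have "\<dots> = b j powr t / 2"
        by (rule inv[OF bj])
      finally show ?thesis .
    qed (use \<kappa> in \<open>simp add: Pr_def pareto_prob_def\<close>)
  qed
  have bi1: "b i powr t \<le> 1"
    using member_le_sum[of i I "\<lambda>i. b i powr t"] I i b by auto
  have bi0: "0 < b i"
    using bi b(1)[OF i] \<kappa>(2) by (cases "b i = 0") (auto simp flip: \<kappa>_def)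
  have bile: "b i \<le> 1"
  proof (rule ccontr)
    assume "\<not> b i \<le> 1"
    then have "1 < b i powr t" using t by (intro gr_one_powr) auto
    then show False using bi1 by simp
  qed
  have low: "2 powr (- t) / 2 * b i powr t \<le> Pr i"
  proof -
    have "2 powr (- t) * (\<kappa> / b i) powr (- t) \<le> pareto_prob t L (\<lambda>k. \<kappa> / b i \<le> 2 ^ k)"
    proof (rule pareto_prob_lower[OF t])
      show "1 \<le> \<kappa> / b i" using bi0 bile \<kappa> by (simp add: field_simps)
      show "\<kappa> / b i \<le> 2 ^ L" using bi bi0 by (simp add: field_simps \<kappa>_def)
    qed
    moreover have "(\<kappa> / b i) powr (- t) = b i powr t / 2"
      by (rule inv[OF bi0])
    moreover have "pareto_prob t L (\<lambda>k. \<kappa> / b i \<le> 2 ^ k) = Pr i"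
      using bi0 by (simp add: Pr_def field_simps)
    ultimately show ?thesis by simp
  qed
  have "(\<Sum>\<omega>\<in>pareto_space L I. pareto_prod t L I \<omega> * (if sole_exceedance I \<kappa> b i \<omega> then 1 else 0))
     = (\<Sum>\<omega>\<in>pareto_space L I. pareto_prod t L I \<omega> *
         (\<Prod>j\<in>I. if j = i then (if \<kappa> \<le> b j * 2 ^ \<omega> j then 1 else 0) else (if \<kappa> \<le> b j * 2 ^ \<omega> j then 0 else 1)))"
  proof (intro sum.cong refl arg_cong2[where f="(*)"])
    fix \<omega> :: "'i \<Rightarrow> nat"
    let ?f = "\<lambda>j. if j = i then (if \<kappa> \<le> b j * 2 ^ \<omega> j then 1 else 0) else (if \<kappa> \<le> b j * 2 ^ \<omega> j then 0 else 1::real)"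
    show "(if sole_exceedance I \<kappa> b i \<omega> then 1 else 0) = prod ?f I"
    proof (cases "sole_exceedance I \<kappa> b i \<omega>")
      case True
      then have "prod ?f I = 1" by (intro prod.neutral) (force simp: sole_exceedance_def not_le)
      then show ?thesis using True by simp
    next
      case False
      then have "\<exists>j\<in>I. ?f j = 0" using i by (auto simp: sole_exceedance_def not_less)
      then have "prod ?f I = 0" using I by (simp add: prod_zero)
      then show ?thesis using False by simp
    qed
  qed
  also have "\<dots> = (\<Prod>j\<in>I. \<Sum>k\<le>L. pareto_weight t L k *
        (if j = i then (if \<kappa> \<le> b j * 2 ^ k then 1 else 0) else (if \<kappa> \<le> b j * 2 ^ k then 0 else 1)))"
    by (rule pareto_prod_expectation[OF I])
  also have "\<dots> = (\<Prod>j\<in>I. if j = i then Pr i else 1 - Pr j)"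
  proof (intro prod.cong refl)
    fix j
    have "(\<Sum>k\<le>L. pareto_weight t L k * (if \<kappa> \<le> b j * 2 ^ k then 1 else 0)) = Pr j"
      unfolding Pr_def pareto_prob_def by (intro sum.cong) auto
    moreover have "(\<Sum>k\<le>L. pareto_weight t L k * (if \<kappa> \<le> b j * 2 ^ k then 0 else 1)) = 1 - Pr j"
    proof -
      have "1 - Pr j = (\<Sum>k\<le>L. pareto_weight t L k) - Pr j" by (simp only: pareto_weight_sum)
      also have "\<dots> = (\<Sum>k\<le>L. pareto_weight t L k * (if \<kappa> \<le> b j * 2 ^ k then 0 else 1))"
        unfolding Pr_def pareto_prob_def sum_subtractf[symmetric] by (intro sum.cong) auto
      finally show ?thesis by simp
    qed
    ultimately show "(\<Sum>k\<le>L. pareto_weight t L k *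
        (if j = i then (if \<kappa> \<le> b j * 2 ^ k then 1 else 0) else (if \<kappa> \<le> b j * 2 ^ k then 0 else 1)))
        = (if j = i then Pr i else 1 - Pr j)" by auto
  qed
  also have "\<dots> = Pr i * (\<Prod>j\<in>I - {i}. 1 - Pr j)"
    using I i by (simp add: prod.remove[of I i])
  finally have eq: "(\<Sum>\<omega>\<in>pareto_space L I. pareto_prod t L I \<omega> * (if sole_exceedance I \<kappa> b i \<omega> then 1 else 0))
     = Pr i * (\<Prod>j\<in>I - {i}. 1 - Pr j)" .
  have Pr1: "Pr j \<le> 1" if "j \<in> I" for j
    using Pr[OF that] b member_le_sum[of j I "\<lambda>i. b i powr t"] I that by auto
  have "(\<Sum>j\<in>I - {i}. Pr j) \<le> (\<Sum>j\<in>I. Pr j)" using I Pr by (intro sum_mono2) auto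
  also have "\<dots> \<le> (\<Sum>j\<in>I. b j powr t / 2)" using Pr by (intro sum_mono) auto
  also have "\<dots> \<le> 1 / 2" using b by (simp flip: sum_divide_distrib)
  finally have "1 / 2 \<le> (\<Prod>j\<in>I - {i}. 1 - Pr j)"
    using prod_one_minus_ge[of "I - {i}" Pr] I Pr Pr1 by auto
  then have "(2 powr (- t) / 2 * b i powr t) * (1/2) \<le> Pr i * (\<Prod>j\<in>I - {i}. 1 - Pr j)"
    using low Pr(1)[OF i] by (intro mult_mono) auto
  then show ?thesis unfolding eq[symmetric] \<kappa>_def by simp
qed

text \<open>After normalisation one exceedance of the threshold already makes the sum at least 1,
  and sole exceedances are disjoint, so that their probabilities add up.\<close>

lemma pareto_lower:
  fixes b :: "'i \<Rightarrow> real"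
  assumes t: "0 < t" and I: "finite I" and L: "(4 * real (card I)) powr (1/t) \<le> 2 ^ L"
    and b: "\<And>i. i \<in> I \<Longrightarrow> 0 \<le> b i"
  shows "2 powr (- t) / 8 \<le> (\<Sum>\<omega>\<in>pareto_space L I.
     if (\<Sum>i\<in>I. b i powr t) powr (1/t) \<le> (\<Sum>i\<in>I. b i * 2 ^ \<omega> i) then pareto_prod t L I \<omega> else 0)"
proof (cases "(\<Sum>i\<in>I. b i powr t) = 0")
  case True
  have "2 powr (- t) \<le> (1::real)" using t powr_mono[of "- t" 0 2] by simp
  moreover have "0 \<le> (\<Sum>i\<in>I. b i * 2 ^ \<omega> i)" for \<omega> :: "'i \<Rightarrow> nat"
    using b by (intro sum_nonneg) auto
  ultimately show ?thesis unfolding True using pareto_prod_sum[OF I, of t L] by simp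
next
  case False
  define A where "A = (\<Sum>i\<in>I. b i powr t)"
  have A: "0 < A" using False by (simp add: A_def less_le sum_nonneg)
  define a where "a i = b i / A powr (1/t)" for i
  have at: "a i powr t = b i powr t / A" if "i \<in> I" for i
    using b[OF that] A t by (simp add: a_def powr_divide powr_powr)
  have a0: "0 \<le> a i" if "i \<in> I" for i using b[OF that] A by (simp add: a_def)
  have a1: "(\<Sum>i\<in>I. a i powr t) = 1" using A by (simp add: at flip: sum_divide_distrib A_def)
  \<comment> \<open>\<open>J\<close> omits the indices whose terms may be too small for the
    truncation at \<open>L\<close>. The omitted terms carry at most half of the total, and the
    assumption on \<open>L\<close> is what the others need to reach the threshold.\<close>
  define J where "J = {i\<in>I. 1 / (2 * card I) \<le> a i powr t}"
  have J: "J \<subseteq> I" "finite J" using I by (auto simp: J_def)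
  have cI: "0 < card I" using a1 I by (cases "I = {}") (auto simp: card_gt_0_iff)
  have "(\<Sum>i\<in>I - J. a i powr t) \<le> (\<Sum>i\<in>I - J. 1 / (2 * card I))"
    by (intro sum_mono) (auto simp: J_def)
  also have "\<dots> \<le> card I * (1 / (2 * card I))"
    using card_mono[OF I, of "I - J"] cI by (simp add: divide_right_mono)
  also have "\<dots> = 1 / 2" using cI by simp
  finally have J2: "1 / 2 \<le> (\<Sum>i\<in>J. a i powr t)"
    using a1 sum.subset_diff[OF J(1) I, of "\<lambda>i. a i powr t"] by simp
  define \<kappa> :: real where "\<kappa> = 2 powr (1/t)"
  have \<kappa>: "1 \<le> \<kappa>" using t by (simp add: \<kappa>_def ge_one_powr_ge_zero)
  have "2 powr (- t) / 8 \<le> 2 powr (- t) / 4 * (\<Sum>i\<in>J. a i powr t)"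
    using J2 mult_left_mono[OF J2, of "2 powr (- t) / 4"] by simp
  also have "\<dots> = (\<Sum>i\<in>J. 2 powr (- t) / 4 * a i powr t)" by (rule sum_distrib_left)
  also have "\<dots> \<le> (\<Sum>i\<in>J. \<Sum>\<omega>\<in>pareto_space L I. pareto_prod t L I \<omega> * (if sole_exceedance I \<kappa> a i \<omega> then 1 else 0))"
  proof (intro sum_mono)
    fix i assume i: "i \<in> J"
    then have iI: "i \<in> I" using J by auto
    have "\<kappa> \<le> a i * 2 ^ L"
    proof -
      have "a i = (a i powr t) powr (1/t)" using a0[OF iI] t by (simp add: powr_powr)
      also have "\<dots> \<ge> (1 / (2 * card I)) powr (1/t)"
        using i t by (intro powr_mono2) (auto simp: J_def)
      finally have "(1 / (2 * card I)) powr (1/t) * (4 * real (card I)) powr (1/t) \<le> a i * 2 ^ L"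
        using L a0[OF iI] by (intro mult_mono) auto
      moreover have "(1 / (2 * card I)) powr (1/t) * (4 * real (card I)) powr (1/t) = \<kappa>"
        using cI by (simp add: \<kappa>_def flip: powr_mult)
      ultimately show ?thesis by simp
    qed
    then show "2 powr (- t) / 4 * a i powr t \<le> (\<Sum>\<omega>\<in>pareto_space L I. pareto_prod t L I \<omega> *
        (if sole_exceedance I \<kappa> a i \<omega> then 1 else 0))"
      unfolding \<kappa>_def using t I iI a0 a1 by (intro sole_exceedance_prob) auto
  qed
  also have "\<dots> = (\<Sum>\<omega>\<in>pareto_space L I. pareto_prod t L I \<omega> * (\<Sum>i\<in>J. if sole_exceedance I \<kappa> a i \<omega> then 1 else 0))"
    by (subst sum.swap) (simp add: sum_distrib_left)
  also have "\<dots> \<le> (\<Sum>\<omega>\<in>pareto_space L I. if A powr (1/t) \<le> (\<Sum>i\<in>I. b i * 2 ^ \<omega> i) then pareto_prod t L I \<omega> else 0)"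
  proof (intro sum_mono)
    fix \<omega> :: "'i \<Rightarrow> nat"
    have w: "0 \<le> pareto_prod t L I \<omega>" using t by (intro pareto_prod_nonneg) auto
    show "pareto_prod t L I \<omega> * (\<Sum>i\<in>J. if sole_exceedance I \<kappa> a i \<omega> then 1 else 0)
       \<le> (if A powr (1/t) \<le> (\<Sum>i\<in>I. b i * 2 ^ \<omega> i) then pareto_prod t L I \<omega> else 0)"
    proof (cases "\<exists>i\<in>J. sole_exceedance I \<kappa> a i \<omega>")
      case True
      then obtain i where i: "i \<in> J" "sole_exceedance I \<kappa> a i \<omega>" by auto
      have uniq: "sole_exceedance I \<kappa> a j \<omega> \<longleftrightarrow> j = i" if "j \<in> J" for j
        using i that J unfolding sole_exceedance_def by (metis DiffI insertE not_le empty_iff subsetD)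
      have "(\<Sum>j\<in>J. if sole_exceedance I \<kappa> a j \<omega> then 1 else 0::real) = (\<Sum>j\<in>J. if j = i then 1 else 0)"
        by (intro sum.cong) (auto simp: uniq)
      then have one: "(\<Sum>j\<in>J. if sole_exceedance I \<kappa> a j \<omega> then 1 else 0::real) = 1"
        using i J by simp
      have "1 \<le> a i * 2 ^ \<omega> i" using i(2) \<kappa> by (auto simp: sole_exceedance_def)
      also have "\<dots> \<le> (\<Sum>i\<in>I. a i * 2 ^ \<omega> i)"
        using i J I a0 by (intro member_le_sum) auto
      also have "\<dots> = (\<Sum>i\<in>I. b i * 2 ^ \<omega> i) / A powr (1/t)"
        by (simp add: a_def sum_divide_distrib)
      finally have "A powr (1/t) \<le> (\<Sum>i\<in>I. b i * 2 ^ \<omega> i)" using A by (simp add: field_simps)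
      then show ?thesis using one by simp
    next
      case False
      then have "(\<Sum>i\<in>J. if sole_exceedance I \<kappa> a i \<omega> then 1 else 0::real) = 0"
        by (intro sum.neutral) auto
      then show ?thesis using w by simp
    qed
  qed
  finally show ?thesis by (simp add: A_def)
qed

text \<open>The output bound \<open>D\<close> holds only for outcomes with bounded input modular
  \<open>R\<close>, and in the applications it grows like a power of that bound, so expectations
  cannot simply be taken. By Markov's inequality the outcomes with R above 2 B / c have total weight
  at most c / 2. At each point the event that \<open>Z\<close> reaches \<open>k\<close> therefore
  keeps weight c / 2 among the remaining outcomes, and averaging over these recovers
  \<open>k\<close>.\<close>

lemma markov_transfer:
  fixes w :: "'w \<Rightarrow> real" and Z :: "'w \<Rightarrow> 'a \<Rightarrow> real" and k :: "'a \<Rightarrow> real" and R :: "'w \<Rightarrow> ennreal"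
  assumes fin: "finite \<Omega>" and w: "\<And>\<omega>. \<omega> \<in> \<Omega> \<Longrightarrow> 0 \<le> w \<omega>"
    and meas: "\<And>\<omega>. \<omega> \<in> \<Omega> \<Longrightarrow> Z \<omega> \<in> borel_measurable N"
    and Z: "\<And>\<omega> x. \<omega> \<in> \<Omega> \<Longrightarrow> 0 \<le> Z \<omega> x" and k: "\<And>x. 0 \<le> k x"
    and low: "\<And>x. c \<le> (\<Sum>\<omega>\<in>\<Omega>. if k x \<le> Z \<omega> x then w \<omega> else 0)"
    and up: "(\<Sum>\<omega>\<in>\<Omega>. ennreal (w \<omega>) * R \<omega>) \<le> ennreal B"
    and cB: "0 < c" "0 < B"
    and bound: "\<And>\<omega>. \<omega> \<in> \<Omega> \<Longrightarrow> R \<omega> \<le> ennreal (2 * B / c) \<Longrightarrow> (\<integral>\<^sup>+x. ennreal (Z \<omega> x) \<partial>N) \<le> ennreal D"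
    and total: "(\<Sum>\<omega>\<in>\<Omega>. w \<omega>) = 1" and D: "0 \<le> D"
  shows "(\<integral>\<^sup>+x. ennreal (k x) \<partial>N) \<le> ennreal (2 / c * D)"
proof -
  define \<Lambda> where "\<Lambda> = 2 * B / c"
  have \<Lambda>: "0 < \<Lambda>" using cB by (simp add: \<Lambda>_def)
  define G where "G = {\<omega>\<in>\<Omega>. R \<omega> \<le> ennreal \<Lambda>}"
  have G: "G \<subseteq> \<Omega>" "finite G" using fin by (auto simp: G_def)
  have "ennreal ((\<Sum>\<omega>\<in>\<Omega> - G. w \<omega>) * \<Lambda>) = (\<Sum>\<omega>\<in>\<Omega> - G. ennreal (w \<omega>) * ennreal \<Lambda>)"
    unfolding sum_distrib_right using w \<Lambda>
    by (subst sum_ennreal[symmetric]) (auto intro!: sum.cong ennreal_mult)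
  also have "\<dots> \<le> (\<Sum>\<omega>\<in>\<Omega> - G. ennreal (w \<omega>) * R \<omega>)"
    by (intro sum_mono mult_left_mono) (auto simp: G_def not_le less_imp_le)
  also have "\<dots> \<le> (\<Sum>\<omega>\<in>\<Omega>. ennreal (w \<omega>) * R \<omega>)"
    using fin by (intro sum_mono2) auto
  also have "\<dots> \<le> ennreal B" by (rule up)
  finally have "(\<Sum>\<omega>\<in>\<Omega> - G. w \<omega>) * \<Lambda> \<le> B" using cB by simp
  then have bad: "(\<Sum>\<omega>\<in>\<Omega> - G. w \<omega>) \<le> c / 2"
    using cB by (simp add: \<Lambda>_def field_simps)
  have pointwise: "k x \<le> (\<Sum>\<omega>\<in>G. 2 / c * w \<omega> * Z \<omega> x)" for x
  proof -
    let ?i = "\<lambda>\<omega>. if k x \<le> Z \<omega> x then w \<omega> else 0"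
    have "(\<Sum>\<omega>\<in>\<Omega> - G. ?i \<omega>) \<le> (\<Sum>\<omega>\<in>\<Omega> - G. w \<omega>)" using w by (intro sum_mono) auto
    then have "c / 2 \<le> (\<Sum>\<omega>\<in>G. ?i \<omega>)"
      using low[of x] bad sum.subset_diff[OF G(1) fin, of ?i] by simp
    then have "c / 2 * k x \<le> (\<Sum>\<omega>\<in>G. ?i \<omega>) * k x" using k by (intro mult_right_mono) auto
    also have "\<dots> \<le> (\<Sum>\<omega>\<in>G. w \<omega> * Z \<omega> x)"
      unfolding sum_distrib_right using w G Z
      by (intro sum_mono) (auto intro!: mult_left_mono mult_nonneg_nonneg)
    finally have "2 / c * (c / 2 * k x) \<le> 2 / c * (\<Sum>\<omega>\<in>G. w \<omega> * Z \<omega> x)"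
      using cB by (intro mult_left_mono) auto
    then show ?thesis using cB by (simp add: sum_distrib_left mult.assoc)
  qed
  have "(\<integral>\<^sup>+x. ennreal (k x) \<partial>N) \<le> (\<integral>\<^sup>+x. (\<Sum>\<omega>\<in>G. ennreal (2 / c * w \<omega>) * ennreal (Z \<omega> x)) \<partial>N)"
  proof (intro nn_integral_mono)
    fix x
    have "ennreal (k x) \<le> ennreal (\<Sum>\<omega>\<in>G. 2 / c * w \<omega> * Z \<omega> x)" by (intro ennreal_leI pointwise)
    also have "\<dots> = (\<Sum>\<omega>\<in>G. ennreal (2 / c * w \<omega> * Z \<omega> x))"
      using G w Z cB by (intro sum_ennreal[symmetric]) (auto intro!: mult_nonneg_nonneg)
    also have "\<dots> = (\<Sum>\<omega>\<in>G. ennreal (2 / c * w \<omega>) * ennreal (Z \<omega> x))"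
      using G w Z cB by (intro sum.cong refl ennreal_mult) auto
    finally show "ennreal (k x) \<le> (\<Sum>\<omega>\<in>G. ennreal (2 / c * w \<omega>) * ennreal (Z \<omega> x))" .
  qed
  also have "\<dots> = (\<Sum>\<omega>\<in>G. ennreal (2 / c * w \<omega>) * (\<integral>\<^sup>+x. ennreal (Z \<omega> x) \<partial>N))"
    using G meas by (subst nn_integral_sum) (auto intro!: sum.cong nn_integral_cmult)
  also have "\<dots> \<le> (\<Sum>\<omega>\<in>G. ennreal (2 / c * w \<omega>) * ennreal D)"
    by (intro sum_mono mult_left_mono bound) (auto simp: G_def \<Lambda>_def)
  also have "\<dots> = ennreal (\<Sum>\<omega>\<in>G. 2 / c * w \<omega> * D)"
  proof -
    have "ennreal (2 / c * w \<omega>) * ennreal D = ennreal (2 / c * w \<omega> * D)" if "\<omega> \<in> G" for \<omega>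
      using that G w cB D by (intro ennreal_mult[symmetric]) auto
    then have "(\<Sum>\<omega>\<in>G. ennreal (2 / c * w \<omega>) * ennreal D) = (\<Sum>\<omega>\<in>G. ennreal (2 / c * w \<omega> * D))"
      by (intro sum.cong) auto
    also have "\<dots> = ennreal (\<Sum>\<omega>\<in>G. 2 / c * w \<omega> * D)"
      using G w cB D by (intro sum_ennreal) (auto intro!: mult_nonneg_nonneg)
    finally show ?thesis .
  qed
  also have "\<dots> \<le> ennreal (2 / c * D)"
  proof (rule ennreal_leI)
    have "(\<Sum>\<omega>\<in>G. w \<omega>) \<le> 1" using total sum_mono2[OF fin G(1), of w] w by auto
    then have "(2 / c * D) * (\<Sum>\<omega>\<in>G. w \<omega>) \<le> (2 / c * D) * 1" using cB D by (intro mult_left_mono) auto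
    moreover have "(\<Sum>\<omega>\<in>G. 2 / c * w \<omega> * D) = (2 / c * D) * (\<Sum>\<omega>\<in>G. w \<omega>)"
      unfolding sum_distrib_left by (intro sum.cong) auto
    ultimately show "(\<Sum>\<omega>\<in>G. 2 / c * w \<omega> * D) \<le> 2 / c * D" by simp
  qed
  finally show ?thesis .
qed

text \<open>
  The functions \<open>2 powr (\<omega> i / 2)\<close> span, up to constants, a copy of \<open>\<ell>\<^sup>r\<^sup>'\<close> in the mixed
  space; the following two lemmas are the dual quotient map onto \<open>\<ell>\<^sup>r\<close> and a bounded lift of it.
\<close>

lemma pareto_quotient_bound:
  fixes r p1 p2 :: real
  assumes r: "2 < r" "r < p1" "p1 \<le> p2"
  obtains K where "0 < K"
    "\<And>(I :: 'i set) L g h p. finite I \<Longrightarrow> p1 \<le> p \<Longrightarrow> p \<le> p2 \<Longrightarrow>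
      (\<And>i. i \<in> I \<Longrightarrow> g i = (\<Sum>\<omega>\<in>pareto_space L I. pareto_prod (r / (r - 1) / 2) L I \<omega> * (sqrt (2 ^ \<omega> i) * h i \<omega>))) \<Longrightarrow>
      (\<Sum>i\<in>I. \<bar>g i\<bar> powr r) powr (p / r)
        \<le> K * (\<Sum>\<omega>\<in>pareto_space L I. pareto_prod (r / (r - 1) / 2) L I \<omega> * (\<Sum>i\<in>I. (h i \<omega>)\<^sup>2) powr (p / 2))"
proof -
  \<comment> \<open>The conjugate exponent of \<open>r\<close>, halved because the coefficients
    enter through their squares. \<open>\<sigma>2\<close> is the same number for \<open>p1\<close>,
    and r < p1 becomes \<sigma>2 < t.\<close>
  define t where "t = r / (r - 1) / 2"
  have t: "0 < t" "t < 1" using r by (auto simp: t_def field_simps)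
  define \<sigma>2 where "\<sigma>2 = p1 / (p1 - 1) / 2"
  have \<sigma>2: "\<sigma>2 < t"
  proof -
    have "p1 / (p1 - 1) = 1 + 1 / (p1 - 1)" "r / (r - 1) = 1 + 1 / (r - 1)"
      using r by (auto simp: field_simps)
    moreover have "1 / (p1 - 1) < 1 / (r - 1)" using r by (intro divide_strict_left_mono) auto
    ultimately show ?thesis by (simp add: \<sigma>2_def t_def)
  qed
  define C where "C = 1 + 2 powr (1 - t) / (2 powr (1 - t) - 1) + 1 / (1 - 2 powr (\<sigma>2 - t))"
  have C: "1 \<le> C"
  proof -
    have "1 < 2 powr (1 - t)" using t by (intro gr_one_powr) auto
    moreover have "2 powr (\<sigma>2 - t) < 1" using \<sigma>2 powr_less_mono[of "\<sigma>2 - t" 0 2] by simp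
    ultimately show ?thesis by (simp add: C_def)
  qed
  define m where "m = 2 * C"
  have m: "1 \<le> m" using C by (simp add: m_def)
  show ?thesis
  proof (rule that[of "2 * m powr p2"])
    show "0 < 2 * m powr p2" using m by simp
    fix I :: "'i set" and L g h p
    assume I: "finite I" and p: "p1 \<le> p" "p \<le> p2"
      and g: "\<And>i. i \<in> I \<Longrightarrow> g i = (\<Sum>\<omega>\<in>pareto_space L I. pareto_prod (r / (r - 1) / 2) L I \<omega> * (sqrt (2 ^ \<omega> i) * h i \<omega>))"
    define w where "w = pareto_prod t L I"
    define \<Omega> where "\<Omega> = pareto_space L I"
    have w: "0 \<le> w \<omega>" for \<omega> using t by (simp add: w_def pareto_prod_nonneg)
    have g: "g i = (\<Sum>\<omega>\<in>\<Omega>. w \<omega> * (sqrt (2 ^ \<omega> i) * h i \<omega>))" if "i \<in> I" for i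
      using g[OF that] by (simp add: w_def \<Omega>_def t_def)
    define S where "S = (\<Sum>i\<in>I. \<bar>g i\<bar> powr r)"
    define G where "G \<omega> = (\<Sum>i\<in>I. (h i \<omega>)\<^sup>2)" for \<omega>
    have G0: "0 \<le> G \<omega>" for \<omega> by (simp add: G_def sum_nonneg)
    have "S powr (p / r) \<le> 2 * m powr p2 * (\<Sum>\<omega>\<in>\<Omega>. w \<omega> * G \<omega> powr (p / 2))"
    proof (cases "S = 0")
      case True
      then show ?thesis using w m by (auto intro!: mult_nonneg_nonneg sum_nonneg)
    next
      case False
      then have S: "0 < S" by (simp add: S_def less_le sum_nonneg)
      define A where "A = S powr (1/r)"
      have A: "0 < A" using S by (simp add: A_def)
      have Ar: "A powr r = S" using S r by (simp add: A_def powr_powr)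
      \<comment> \<open>The norming functional of \<open>g\<close>: its norm with the exponent
        conjugate to \<open>r\<close> is 1, and its pairing with \<open>g\<close> is the r-norm
        \<open>A\<close>.\<close>
      define a where "a i = sgn (g i) * \<bar>g i\<bar> powr (r - 1) / A powr (r - 1)" for i
      have aabs: "\<bar>a i\<bar> = (\<bar>g i\<bar> / A) powr (r - 1)" for i
        using A by (cases "g i = 0") (auto simp: a_def abs_mult powr_divide)
      have r': "(r - 1) * (r / (r - 1)) = r" using r by simp
      have at: "(\<Sum>i\<in>I. ((a i)\<^sup>2) powr t) = 1"
      proof -
        have "((a i)\<^sup>2) powr t = \<bar>g i\<bar> powr r / S" for i
        proof -
          have "(a i)\<^sup>2 = \<bar>a i\<bar> powr 2" by simp
          also have "\<dots> powr t = (\<bar>g i\<bar> / A) powr ((r - 1) * (r / (r - 1)))"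
            unfolding aabs powr_powr by (simp add: t_def)
          finally show ?thesis unfolding r' using A by (simp add: powr_divide Ar)
        qed
        then show ?thesis using S by (simp add: S_def flip: sum_divide_distrib)
      qed
      have ag: "(\<Sum>i\<in>I. a i * g i) = A"
      proof -
        have "a i * g i = \<bar>g i\<bar> powr r / A powr (r - 1)" for i
        proof -
          have "sgn (g i) * g i = \<bar>g i\<bar>" by (simp add: abs_sgn mult.commute)
          then have "a i * g i = \<bar>g i\<bar> * \<bar>g i\<bar> powr (r - 1) / A powr (r - 1)"
            by (simp add: a_def algebra_simps)
          also have "\<bar>g i\<bar> * \<bar>g i\<bar> powr (r - 1) = \<bar>g i\<bar> powr r"
            by (cases "g i = 0") (auto simp: powr_mult_base)
          finally show ?thesis .
        qed
        then have "(\<Sum>i\<in>I. a i * g i) = A powr r / A powr (r - 1)"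
          by (simp add: Ar S_def sum_divide_distrib)
        also have "\<dots> = A" using A by (simp flip: powr_diff)
        finally show ?thesis .
      qed
      define X where "X \<omega> = sqrt (\<Sum>i\<in>I. (a i)\<^sup>2 * 2 ^ \<omega> i)" for \<omega>
      have X0: "0 \<le> X \<omega>" for \<omega> by (simp add: X_def sum_nonneg)
      define \<sigma> where "\<sigma> = p / (p - 1)"
      have p1: "1 < p" using p r by simp
      have \<sigma>: "1 < \<sigma>" "1 / p + 1 / \<sigma> = 1" using p1 by (auto simp: \<sigma>_def field_simps)
      have \<sigma>le: "\<sigma> / 2 \<le> \<sigma>2"
      proof -
        have "p1 / (p1 - 1) = 1 + 1 / (p1 - 1)" "p / (p - 1) = 1 + 1 / (p - 1)"
          using r p by (auto simp: field_simps)
        moreover have "1 / (p - 1) \<le> 1 / (p1 - 1)" using r p by (intro divide_left_mono) auto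
        ultimately show ?thesis by (simp add: \<sigma>2_def \<sigma>_def)
      qed
      have XC: "(\<Sum>\<omega>\<in>\<Omega>. w \<omega> * X \<omega> powr \<sigma>) \<le> C"
      proof -
        have "X \<omega> powr \<sigma> = (\<Sum>i\<in>I. (a i)\<^sup>2 * 2 ^ \<omega> i) powr (\<sigma> / 2)" for \<omega>
          using powr_half_sqrt[of "\<Sum>i\<in>I. (a i)\<^sup>2 * 2 ^ \<omega> i"] powr_powr[of "\<Sum>i\<in>I. (a i)\<^sup>2 * 2 ^ \<omega> i" "1/2" \<sigma>]
          by (simp add: X_def sum_nonneg)
        then have "(\<Sum>\<omega>\<in>\<Omega>. w \<omega> * X \<omega> powr \<sigma>) = (\<Sum>\<omega>\<in>\<Omega>. w \<omega> * (\<Sum>i\<in>I. (a i)\<^sup>2 * 2 ^ \<omega> i) powr (\<sigma> / 2))" by simp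
        also have "\<dots> \<le> C * (\<Sum>i\<in>I. ((a i)\<^sup>2) powr t) powr (\<sigma> / 2 / t)"
          unfolding \<Omega>_def w_def C_def
          by (rule pareto_moment) (use t \<sigma> \<sigma>le \<sigma>2 I in auto)
        finally show ?thesis by (simp add: at)
      qed
      have "A = (\<Sum>\<omega>\<in>\<Omega>. w \<omega> * (\<Sum>i\<in>I. (a i * sqrt (2 ^ \<omega> i)) * h i \<omega>))"
      proof -
        have "A = (\<Sum>i\<in>I. \<Sum>\<omega>\<in>\<Omega>. a i * (w \<omega> * (sqrt (2 ^ \<omega> i) * h i \<omega>)))"
          unfolding ag[symmetric] by (intro sum.cong refl) (simp add: g sum_distrib_left)
        also have "\<dots> = (\<Sum>\<omega>\<in>\<Omega>. \<Sum>i\<in>I. a i * (w \<omega> * (sqrt (2 ^ \<omega> i) * h i \<omega>)))" by (rule sum.swap)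
        finally show ?thesis by (simp add: sum_distrib_left algebra_simps)
      qed
      also have "\<dots> \<le> (\<Sum>\<omega>\<in>\<Omega>. w \<omega> * (X \<omega> * sqrt (G \<omega>)))"
      proof (intro sum_mono mult_left_mono w)
        fix \<omega> :: "'i \<Rightarrow> nat"
        have "(\<Sum>i\<in>I. (a i * sqrt (2 ^ \<omega> i)) * h i \<omega>)\<^sup>2 \<le> (\<Sum>i\<in>I. (a i * sqrt (2 ^ \<omega> i))\<^sup>2) * (\<Sum>i\<in>I. (h i \<omega>)\<^sup>2)"
          by (rule Cauchy_Schwarz_ineq_sum)
        then have "\<bar>\<Sum>i\<in>I. (a i * sqrt (2 ^ \<omega> i)) * h i \<omega>\<bar> \<le> sqrt ((\<Sum>i\<in>I. (a i * sqrt (2 ^ \<omega> i))\<^sup>2) * (\<Sum>i\<in>I. (h i \<omega>)\<^sup>2))"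
          by (intro real_le_rsqrt) auto
        also have "\<dots> = X \<omega> * sqrt (G \<omega>)"
          by (simp add: X_def G_def real_sqrt_mult power_mult_distrib)
        finally show "(\<Sum>i\<in>I. (a i * sqrt (2 ^ \<omega> i)) * h i \<omega>) \<le> X \<omega> * sqrt (G \<omega>)" by linarith
      qed
      \<comment> \<open>Young's inequality after rescaling the two factors by \<open>m / A\<close>
        and \<open>1 / m\<close>. After division by \<open>A\<close> the left side is 1, and
        \<open>m = 2 * C\<close> makes the second contribution at most 1 / 2, so that it can be
        absorbed.\<close>
      also have "\<dots> \<le> (\<Sum>\<omega>\<in>\<Omega>. w \<omega> * (A * ((m / A) powr p * G \<omega> powr (p/2) + m powr (- \<sigma>) * X \<omega> powr \<sigma>)))"
      proof (intro sum_mono mult_left_mono w)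
        fix \<omega> :: "'i \<Rightarrow> nat"
        define U V where "U = m * sqrt (G \<omega>) / A" and "V = X \<omega> / m"
        have UV: "0 \<le> U" "0 \<le> V" using m A X0[of \<omega>] G0[of \<omega>] by (auto simp: U_def V_def)
        have "U * V \<le> U powr p / p + V powr \<sigma> / \<sigma>"
          using p1 \<sigma> UV by (intro Youngs_inequality) auto
        also have "\<dots> \<le> U powr p / 1 + V powr \<sigma> / 1"
          using p1 \<sigma> by (intro add_mono divide_left_mono) auto
        finally have "A * (U * V) \<le> A * (U powr p + V powr \<sigma>)" using A by simp
        moreover have "A * (U * V) = X \<omega> * sqrt (G \<omega>)" using A m by (simp add: U_def V_def)
        moreover have "U powr p = (m / A) powr p * G \<omega> powr (p / 2)"
        proof -
          have "sqrt (G \<omega>) powr p = G \<omega> powr (p/2)"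
            using powr_half_sqrt[of "G \<omega>"] powr_powr[of "G \<omega>" "1/2" p] G0[of \<omega>] by simp
          moreover have "U powr p = ((m / A) * sqrt (G \<omega>)) powr p" by (simp add: U_def)
          moreover have "\<dots> = (m / A) powr p * sqrt (G \<omega>) powr p"
            using m A G0[of \<omega>] by (subst powr_mult) auto
          ultimately show ?thesis by simp
        qed
        moreover have "V powr \<sigma> = m powr (- \<sigma>) * X \<omega> powr \<sigma>"
          using m X0[of \<omega>] by (simp add: V_def powr_divide powr_minus_divide)
        ultimately show "X \<omega> * sqrt (G \<omega>) \<le> A * ((m / A) powr p * G \<omega> powr (p/2) + m powr (- \<sigma>) * X \<omega> powr \<sigma>)"
          by simp
      qed
      also have "\<dots> = A * ((m / A) powr p * (\<Sum>\<omega>\<in>\<Omega>. w \<omega> * G \<omega> powr (p/2)) + m powr (- \<sigma>) * (\<Sum>\<omega>\<in>\<Omega>. w \<omega> * X \<omega> powr \<sigma>))"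
        by (simp add: sum_distrib_left sum.distrib[symmetric] algebra_simps)
      also have "\<dots> \<le> A * ((m / A) powr p * (\<Sum>\<omega>\<in>\<Omega>. w \<omega> * G \<omega> powr (p/2)) + m powr (- \<sigma>) * C)"
        using A XC by (intro mult_left_mono add_left_mono) auto
      finally have "1 \<le> (m / A) powr p * (\<Sum>\<omega>\<in>\<Omega>. w \<omega> * G \<omega> powr (p/2)) + m powr (- \<sigma>) * C"
        using A by simp
      moreover have "m powr (- \<sigma>) * C \<le> 1 / 2"
      proof -
        have "m powr (- \<sigma>) \<le> m powr (- 1)" using m \<sigma> by (intro powr_mono) auto
        then have "m powr (- \<sigma>) * C \<le> m powr (- 1) * C" using C by (intro mult_right_mono) auto
        also have "\<dots> = 1 / 2" using C by (simp add: m_def powr_minus_divide)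
        finally show ?thesis .
      qed
      ultimately have "1 / 2 \<le> (m / A) powr p * (\<Sum>\<omega>\<in>\<Omega>. w \<omega> * G \<omega> powr (p/2))" by linarith
      then have "A powr p \<le> 2 * m powr p * (\<Sum>\<omega>\<in>\<Omega>. w \<omega> * G \<omega> powr (p/2))"
        using A m by (simp add: powr_divide field_simps)
      also have "\<dots> \<le> 2 * m powr p2 * (\<Sum>\<omega>\<in>\<Omega>. w \<omega> * G \<omega> powr (p/2))"
        using m p w by (intro mult_right_mono mult_left_mono powr_mono sum_nonneg) auto
      finally show ?thesis by (simp add: A_def powr_powr)
    qed
    then show "(\<Sum>i\<in>I. \<bar>g i\<bar> powr r) powr (p / r)
        \<le> 2 * m powr p2 * (\<Sum>\<omega>\<in>pareto_space L I. pareto_prod (r / (r - 1) / 2) L I \<omega> * (\<Sum>i\<in>I. (h i \<omega>)\<^sup>2) powr (p / 2))"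
      by (simp add: S_def G_def \<Omega>_def w_def t_def)
  qed
qed

section \<open>A bounded lift into square-summable random families\<close>

definition lift_level :: "real \<Rightarrow> 'i set \<Rightarrow> ('i \<Rightarrow> real) \<Rightarrow> 'i \<Rightarrow> real" where
  "lift_level r I f i =
     ((\<bar>f i\<bar> powr r / (\<Sum>j\<in>I. \<bar>f j\<bar> powr r) + 1 / card I) / 2) powr (1 / (r / (r - 1) / 2))"

definition lift_coeff :: "real \<Rightarrow> nat \<Rightarrow> 'i set \<Rightarrow> ('i \<Rightarrow> real) \<Rightarrow> 'i \<Rightarrow> real" where
  "lift_coeff r L I f i = (\<Sum>\<omega>\<in>pareto_space L I. pareto_prod (r / (r - 1) / 2) L I \<omega> *
     (sqrt (2 ^ \<omega> i) * (if sole_exceedance I (2 powr (1 / (r / (r - 1) / 2))) (lift_level r I f) i \<omega> then 1 else 0)))"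

text \<open>Supported on the disjoint sole exceedances, so for each outcome at most one index has a
  nonzero value; \<open>lift_coeff\<close> is the divisor for which pairing with
  \<open>sqrt (2 ^ \<omega> i)\<close> returns \<open>f i\<close>. In \<open>lift_level\<close> the
  distribution of the mass of \<bar>f\<bar> powr r is averaged with the uniform one: this keeps
  every level positive and within reach of the truncation, also where \<open>f\<close> vanishes, a
  quotient with divisor 0 being 0.\<close>

definition pareto_lift :: "real \<Rightarrow> nat \<Rightarrow> 'i set \<Rightarrow> ('i \<Rightarrow> real) \<Rightarrow> 'i \<Rightarrow> ('i \<Rightarrow> nat) \<Rightarrow> real" where
  "pareto_lift r L I f i \<omega> = f i / lift_coeff r L I f i *
     (if sole_exceedance I (2 powr (1 / (r / (r - 1) / 2))) (lift_level r I f) i \<omega> then 1 else 0)"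

text \<open>With b the level of \<open>i\<close>, the value \<open>sqrt (2 ^ \<omega> i)\<close> is
  at least b powr (- 1/2) on the event, and the event has probability at least of order b powr t. So
  the coefficient is at least of order b powr (t - 1/2). For this \<open>t\<close> one has t / r = t
  - 1/2, and the latter is at least of order \<bar>f i\<bar> divided by the r-norm of
  \<open>f\<close>.\<close>

lemma lift_coeff_lower:
  assumes r: "2 < r" and I: "finite I" "i \<in> I"
    and L: "(4 * real (card I)) powr (1 / (r / (r - 1) / 2)) \<le> 2 ^ L"
  shows "0 < lift_coeff r L I f i"
    and "\<bar>f i\<bar> \<le> 16 * lift_coeff r L I f i * (\<Sum>j\<in>I. \<bar>f j\<bar> powr r) powr (1/r)"
proof -
  define t where "t = r / (r - 1) / 2"
  have t: "0 < t" "t < 1" "1/2 < t" using r by (auto simp: t_def field_simps)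
  define S where "S = (\<Sum>j\<in>I. \<bar>f j\<bar> powr r)"
  have S0: "0 \<le> S" by (simp add: S_def sum_nonneg)
  define b where "b = lift_level r I f"
  define \<kappa> :: real where "\<kappa> = 2 powr (1/t)"
  have \<kappa>: "1 \<le> \<kappa>" using t by (simp add: \<kappa>_def ge_one_powr_ge_zero)
  have m: "0 < card I" using I by (auto simp: card_gt_0_iff)
  have b_eq: "b j = ((\<bar>f j\<bar> powr r / S + 1 / card I) / 2) powr (1/t)" for j
    by (simp only: b_def lift_level_def t_def S_def)
  have inner: "0 < \<bar>f j\<bar> powr r / S + 1 / card I" for j
    using S0 m by (intro add_nonneg_pos) auto
  have bt: "b j powr t = (\<bar>f j\<bar> powr r / S + 1 / card I) / 2" for j
    using t inner[of j] by (simp add: b_eq powr_powr)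
  have b0: "0 < b j" for j
    using inner[of j] by (simp add: b_eq)
  have "(\<Sum>j\<in>I. b j powr t) = (S / S + 1) / 2"
    using m by (simp add: bt sum.distrib S_def flip: sum_divide_distrib)
  then have bsum: "(\<Sum>j\<in>I. b j powr t) \<le> 1" by (cases "S = 0") auto
  have bL: "\<kappa> \<le> b i * 2 ^ L"
  proof -
    have "(1 / (2 * card I)) powr (1/t) \<le> (b i powr t) powr (1/t)"
      using t S0 by (intro powr_mono2) (auto simp: bt field_simps)
    also have "\<dots> = b i" using b0[of i] t by (simp add: powr_powr)
    finally have "(1 / (2 * card I)) powr (1/t) * (4 * real (card I)) powr (1/t) \<le> b i * 2 ^ L"
      using L b0[of i] by (intro mult_mono) (auto simp: t_def)
    moreover have "(1 / (2 * card I)) powr (1/t) * (4 * real (card I)) powr (1/t) = \<kappa>"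
      using m by (simp add: \<kappa>_def flip: powr_mult)
    ultimately show ?thesis by simp
  qed
  define \<Omega> where "\<Omega> = pareto_space L I"
  define w where "w = pareto_prod t L I"
  have w: "0 \<le> w \<omega>" for \<omega> using t by (simp add: w_def pareto_prod_nonneg)
  have prob: "2 powr (- t) / 4 * b i powr t \<le> (\<Sum>\<omega>\<in>\<Omega>. w \<omega> * (if sole_exceedance I \<kappa> b i \<omega> then 1 else 0))"
    unfolding \<Omega>_def w_def \<kappa>_def
    by (rule sole_exceedance_prob) (use t I b0 bsum bL less_imp_le in \<open>auto simp: \<kappa>_def\<close>)
  have coeff: "lift_coeff r L I f i = (\<Sum>\<omega>\<in>\<Omega>. w \<omega> * (sqrt (2 ^ \<omega> i) * (if sole_exceedance I \<kappa> b i \<omega> then 1 else 0)))"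
    by (simp add: lift_coeff_def \<Omega>_def w_def \<kappa>_def b_def t_def)
  \<comment> \<open>The 8 comes from \<open>2 powr (- t) / 4\<close> with t < 1. It becomes 16 in
    the end because the factor 1 / 2 in the level costs \<open>2 powr (1/r) \<le> 2\<close>.\<close>
  have "1/8 * b i powr (t - 1/2) \<le> b i powr (- (1/2)) * (2 powr (- t) / 4 * b i powr t)"
  proof -
    have "2 powr (- 1) \<le> 2 powr (- t)" using t by (intro powr_mono) auto
    then have "1 / 8 \<le> 2 powr (- t) / 4" by (simp add: powr_minus_divide)
    then have "1/8 * b i powr (t - 1/2) \<le> 2 powr (- t) / 4 * b i powr (t - 1/2)"
      by (intro mult_right_mono) auto
    moreover have "b i powr (t - 1/2) = b i powr (- (1/2)) * b i powr t"
      by (simp flip: powr_add)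
    ultimately show ?thesis by (simp only: mult_ac)
  qed
  also have "\<dots> \<le> b i powr (- (1/2)) * (\<Sum>\<omega>\<in>\<Omega>. w \<omega> * (if sole_exceedance I \<kappa> b i \<omega> then 1 else 0))"
    by (intro mult_left_mono prob) auto
  also have "\<dots> \<le> lift_coeff r L I f i"
    unfolding coeff sum_distrib_left
  proof (intro sum_mono)
    fix \<omega> :: "'a \<Rightarrow> nat"
    show "b i powr (- (1/2)) * (w \<omega> * (if sole_exceedance I \<kappa> b i \<omega> then 1 else 0))
       \<le> w \<omega> * (sqrt (2 ^ \<omega> i) * (if sole_exceedance I \<kappa> b i \<omega> then 1 else 0))"
    proof (cases "sole_exceedance I \<kappa> b i \<omega>")
      case True
      then have "1 \<le> b i * 2 ^ \<omega> i" using \<kappa> by (auto simp: sole_exceedance_def)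
      then have "1 / b i \<le> 2 ^ \<omega> i" using b0[of i] by (simp add: field_simps)
      then have "sqrt (1 / b i) \<le> sqrt (2 ^ \<omega> i)" by (rule real_sqrt_le_mono)
      moreover have "sqrt (1 / b i) = b i powr (- (1/2))"
        using b0[of i] by (simp add: real_sqrt_divide powr_minus_divide powr_half_sqrt)
      ultimately show ?thesis using True w[of \<omega>] by (simp add: mult.commute mult_left_mono)
    qed simp
  qed
  finally have low: "1/8 * b i powr (t - 1/2) \<le> lift_coeff r L I f i" .
  then show pos: "0 < lift_coeff r L I f i"
    using b0[of i] by (intro less_le_trans[OF _ low]) simp
  show "\<bar>f i\<bar> \<le> 16 * lift_coeff r L I f i * (\<Sum>j\<in>I. \<bar>f j\<bar> powr r) powr (1/r)"
  proof (cases "f i = 0")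
    case True
    then show ?thesis using pos by simp
  next
    case False
    have "0 < \<bar>f i\<bar> powr r" using False by simp
    also have "\<dots> \<le> S" unfolding S_def using I by (intro member_le_sum) auto
    finally have S: "0 < S" .
    have e: "t * (1/r) = t - 1/2"
      using r by (simp add: t_def field_simps)
    have "(\<bar>f i\<bar> powr r / (2 * S)) powr (1/r) \<le> (b i powr t) powr (1/r)"
      using r S by (intro powr_mono2) (auto simp: bt field_simps)
    also have "\<dots> = b i powr (t - 1/2)" by (simp add: powr_powr flip: e)
    also have "\<dots> \<le> 8 * lift_coeff r L I f i" using low by simp
    also have "(\<bar>f i\<bar> powr r / (2 * S)) powr (1/r) = \<bar>f i\<bar> / ((2 powr (1/r)) * S powr (1/r))"
      using r S False by (simp add: powr_divide powr_powr powr_mult)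
    finally have "\<bar>f i\<bar> \<le> 8 * lift_coeff r L I f i * ((2 powr (1/r)) * S powr (1/r))"
      using S by (simp add: field_simps)
    also have "\<dots> \<le> 8 * lift_coeff r L I f i * (2 * S powr (1/r))"
    proof -
      have "2 powr (1/r) \<le> 2 powr (1::real)" using r by (intro powr_mono) auto
      then show ?thesis using pos by (intro mult_left_mono mult_right_mono) auto
    qed
    finally show ?thesis by (simp add: S_def)
  qed
qed

lemma pareto_lift_expectation:
  assumes "2 < r" "finite I" "i \<in> I"
    and "(4 * real (card I)) powr (1 / (r / (r - 1) / 2)) \<le> 2 ^ L"
  shows "f i = (\<Sum>\<omega>\<in>pareto_space L I. pareto_prod (r / (r - 1) / 2) L I \<omega> * (sqrt (2 ^ \<omega> i) * pareto_lift r L I f i \<omega>))"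
proof -
  have "(\<Sum>\<omega>\<in>pareto_space L I. pareto_prod (r / (r - 1) / 2) L I \<omega> * (sqrt (2 ^ \<omega> i) * pareto_lift r L I f i \<omega>))
      = f i / lift_coeff r L I f i * lift_coeff r L I f i"
    unfolding pareto_lift_def
    by (subst (3) lift_coeff_def) (simp add: sum_distrib_left algebra_simps)
  then show ?thesis using lift_coeff_lower(1)[OF assms, of f] by simp
qed

text \<open>At most one term of the sum is nonzero. The bound holds for every outcome and not only
  on average, so no outcomes have to be discarded after the lift.\<close>

lemma pareto_lift_bound:
  assumes r: "2 < r" and I: "finite I"
    and L: "(4 * real (card I)) powr (1 / (r / (r - 1) / 2)) \<le> 2 ^ L"
  shows "(\<Sum>i\<in>I. (pareto_lift r L I f i \<omega>)\<^sup>2) \<le> (16 * (\<Sum>j\<in>I. \<bar>f j\<bar> powr r) powr (1/r))\<^sup>2"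
proof -
  define n where "n = (\<Sum>j\<in>I. \<bar>f j\<bar> powr r) powr (1/r)"
  define D where "D = sole_exceedance I (2 powr (1 / (r / (r - 1) / 2))) (lift_level r I f)"
  have each: "(pareto_lift r L I f i \<omega>)\<^sup>2 \<le> (16 * n)\<^sup>2" if "i \<in> I" for i
  proof -
    have c: "0 < lift_coeff r L I f i" by (rule lift_coeff_lower(1)[OF r I that L])
    have "\<bar>pareto_lift r L I f i \<omega>\<bar> \<le> \<bar>f i\<bar> / lift_coeff r L I f i"
      using c by (simp add: pareto_lift_def abs_mult)
    also have "\<dots> \<le> 16 * n"
      using c lift_coeff_lower(2)[OF r I that L, of f] by (simp add: n_def field_simps)
    finally have "\<bar>pareto_lift r L I f i \<omega>\<bar>\<^sup>2 \<le> (16 * n)\<^sup>2" by (intro power_mono) auto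
    then show ?thesis by (simp only: power2_abs)
  qed
  have off: "pareto_lift r L I f i \<omega> = 0" if "\<not> D i \<omega>" for i
    using that by (simp add: pareto_lift_def D_def)
  show ?thesis
  proof (cases "\<exists>i\<in>I. D i \<omega>")
    case True
    then obtain i where i: "i \<in> I" "D i \<omega>" by auto
    have "\<not> D j \<omega>" if "j \<in> I" "j \<noteq> i" for j
    proof -
      have "2 powr (1 / (r / (r - 1) / 2)) \<le> lift_level r I f i * 2 ^ \<omega> i"
        using i by (simp add: D_def sole_exceedance_def)
      then show ?thesis using i(1) that unfolding D_def sole_exceedance_def by (auto simp: not_less)
    qed
    then have "(\<Sum>j\<in>I. (pareto_lift r L I f j \<omega>)\<^sup>2) = (\<Sum>j\<in>I. if j = i then (pareto_lift r L I f i \<omega>)\<^sup>2 else 0)"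
      using off by (intro sum.cong) auto
    then show ?thesis using i I each by (simp add: n_def)
  next
    case False
    then have "(\<Sum>j\<in>I. (pareto_lift r L I f j \<omega>)\<^sup>2) = 0" using off by (intro sum.neutral) auto
    then show ?thesis by simp
  qed
qed

lemma measurable_pareto_lift:
  fixes f :: "'i \<Rightarrow> 'b \<Rightarrow> real"
  assumes I: "finite I" and i: "i \<in> I" and f: "\<And>i. i \<in> I \<Longrightarrow> f i \<in> borel_measurable M"
  shows "(\<lambda>y. pareto_lift r L I (\<lambda>i. f i y) i \<omega>) \<in> borel_measurable M"
proof -
  have lev: "(\<lambda>y. lift_level r I (\<lambda>i. f i y) j) \<in> borel_measurable M" if "j \<in> I" for j
    unfolding lift_level_def using f that by measurable
  have ind: "(\<lambda>y. if sole_exceedance I c (lift_level r I (\<lambda>i. f i y)) i \<omega> then 1 else 0::real) \<in> borel_measurable M" for c \<omega>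
  proof -
    have "Measurable.pred M (\<lambda>y. \<forall>j\<in>I - {i}. lift_level r I (\<lambda>i. f i y) j * 2 ^ \<omega> j < c)"
      using I lev by (intro pred_intros_finite) auto
    moreover have "Measurable.pred M (\<lambda>y. c \<le> lift_level r I (\<lambda>i. f i y) i * 2 ^ \<omega> i)"
      using lev[OF i] by measurable
    ultimately have "Measurable.pred M (\<lambda>y. sole_exceedance I c (lift_level r I (\<lambda>i. f i y)) i \<omega>)"
      unfolding sole_exceedance_def by (intro pred_intros_logic)
    then show ?thesis by (intro measurable_If) auto
  qed
  have "(\<lambda>y. lift_coeff r L I (\<lambda>i. f i y) i) \<in> borel_measurable M"
    unfolding lift_coeff_def by (intro borel_measurable_sum borel_measurable_times ind) auto
  then show ?thesis
    unfolding pareto_lift_def using f[OF i] by (intro borel_measurable_times borel_measurable_divide ind) auto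
qed

section \<open>Vector-valued extension of operators\<close>

text \<open>The bounds are required at every point, which keeps pointwise estimates free of
  exceptional sets. A representative of the exponent with this property is chosen in the last
  section.\<close>

definition exponent_between :: "'a measure \<Rightarrow> ('a \<Rightarrow> real) \<Rightarrow> real \<Rightarrow> real \<Rightarrow> bool" where
  "exponent_between M s a b \<longleftrightarrow> s \<in> borel_measurable M \<and> (\<forall>x. a \<le> s x \<and> s x \<le> b)"

definition rmod :: "'a measure \<Rightarrow> ('a \<Rightarrow> real) \<Rightarrow> ('a \<Rightarrow> real) \<Rightarrow> ennreal" where
  "rmod M s f = (\<integral>\<^sup>+x. ennreal (\<bar>f x\<bar> powr s x) \<partial>M)"

definition rLp :: "'a measure \<Rightarrow> ('a \<Rightarrow> real) \<Rightarrow> ('a \<Rightarrow> real) set" where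
  "rLp M s = {f \<in> borel_measurable M. rmod M s f < \<infinity>}"

lemma exponent_betweenD:
  assumes "exponent_between M s a b"
  shows "s \<in> borel_measurable M" "a \<le> s x" "s x \<le> b"
  using assms by (auto simp: exponent_between_def)

lemma rmod_cong_AE: "AE x in M. f x = g x \<Longrightarrow> rmod M s f = rmod M s g"
  unfolding rmod_def by (rule nn_integral_cong_AE) auto

lemma rmod_mono_AE:
  assumes "exponent_between M s a b" "0 \<le> a" "AE x in M. \<bar>f x\<bar> \<le> \<bar>g x\<bar>"
  shows "rmod M s f \<le> rmod M s g"
  unfolding rmod_def
proof (rule nn_integral_mono_AE, use assms(3) in eventually_elim)
  fix x assume "\<bar>f x\<bar> \<le> \<bar>g x\<bar>"
  then show "ennreal (\<bar>f x\<bar> powr s x) \<le> ennreal (\<bar>g x\<bar> powr s x)"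
    using exponent_betweenD(2)[OF assms(1), of x] assms(2) by (intro ennreal_leI powr_mono2) auto
qed

text \<open>This estimate and the next replace homogeneity: a factor above 1 is paid for with the
  upper bound of the exponent, a factor below 1 gains with the lower bound.\<close>

lemma rmod_cmult_ge1:
  assumes s: "exponent_between M s a b" and f: "f \<in> borel_measurable M" and c: "1 \<le> c"
  shows "rmod M s (\<lambda>x. c * f x) \<le> ennreal (c powr b) * rmod M s f"
proof -
  have [measurable]: "s \<in> borel_measurable M" by (rule exponent_betweenD[OF s])
  note f[measurable]
  have "rmod M s (\<lambda>x. c * f x) \<le> (\<integral>\<^sup>+x. ennreal (c powr b) * ennreal (\<bar>f x\<bar> powr s x) \<partial>M)"
    unfolding rmod_def
  proof (rule nn_integral_mono)
    fix x
    have "\<bar>c * f x\<bar> powr s x = c powr s x * \<bar>f x\<bar> powr s x" using c by (simp add: abs_mult powr_mult)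
    also have "\<dots> \<le> c powr b * \<bar>f x\<bar> powr s x"
      using c exponent_betweenD(3)[OF s, of x] by (intro mult_right_mono powr_mono) auto
    finally show "ennreal (\<bar>c * f x\<bar> powr s x) \<le> ennreal (c powr b) * ennreal (\<bar>f x\<bar> powr s x)"
      by (simp add: ennreal_leI flip: ennreal_mult)
  qed
  also have "\<dots> = ennreal (c powr b) * rmod M s f"
    unfolding rmod_def by (rule nn_integral_cmult) measurable
  finally show ?thesis .
qed

lemma rmod_cmult_le1:
  assumes s: "exponent_between M s a b" and f: "f \<in> borel_measurable M" and c: "0 \<le> c" "c \<le> 1"
  shows "rmod M s (\<lambda>x. c * f x) \<le> ennreal (c powr a) * rmod M s f"
proof -
  have [measurable]: "s \<in> borel_measurable M" by (rule exponent_betweenD[OF s])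
  note f[measurable]
  have "rmod M s (\<lambda>x. c * f x) \<le> (\<integral>\<^sup>+x. ennreal (c powr a) * ennreal (\<bar>f x\<bar> powr s x) \<partial>M)"
    unfolding rmod_def
  proof (rule nn_integral_mono)
    fix x
    have "\<bar>c * f x\<bar> powr s x = c powr s x * \<bar>f x\<bar> powr s x" using c by (simp add: abs_mult powr_mult)
    also have "\<dots> \<le> c powr a * \<bar>f x\<bar> powr s x"
      using c exponent_betweenD(2)[OF s, of x]
      by (cases "c = 0") (auto intro!: mult_right_mono powr_mono')
    finally show "ennreal (\<bar>c * f x\<bar> powr s x) \<le> ennreal (c powr a) * ennreal (\<bar>f x\<bar> powr s x)"
      by (simp add: ennreal_leI flip: ennreal_mult)
  qed
  also have "\<dots> = ennreal (c powr a) * rmod M s f"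
    unfolding rmod_def by (rule nn_integral_cmult) measurable
  finally show ?thesis .
qed

lemma rLp_measurable: "f \<in> rLp M s \<Longrightarrow> f \<in> borel_measurable M"
  by (simp add: rLp_def)

lemma rLp_mono:
  assumes "exponent_between M s a b" "0 \<le> a" "g \<in> rLp M s" "f \<in> borel_measurable M"
    and "AE x in M. \<bar>f x\<bar> \<le> \<bar>g x\<bar>"
  shows "f \<in> rLp M s"
  using rmod_mono_AE[OF assms(1,2,5)] assms(3,4) by (auto simp: rLp_def intro: order.strict_trans1)

lemma rLp_cmult:
  assumes s: "exponent_between M s a b" "0 \<le> a" and f: "f \<in> rLp M s"
  shows "(\<lambda>x. c * f x) \<in> rLp M s"
proof -
  define d where "d = max 1 \<bar>c\<bar>"
  have fm[measurable]: "f \<in> borel_measurable M" by (rule rLp_measurable[OF f])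
  have "rmod M s (\<lambda>x. d * f x) \<le> ennreal (d powr b) * rmod M s f"
    using s fm by (intro rmod_cmult_ge1) (auto simp: d_def)
  also have "\<dots> < \<infinity>" using f by (simp add: rLp_def ennreal_mult_less_top)
  finally have "(\<lambda>x. d * f x) \<in> rLp M s" by (simp add: rLp_def)
  then show ?thesis
    by (rule rLp_mono[OF s]) (auto simp: abs_mult d_def intro!: mult_right_mono)
qed

lemma rLp_add:
  assumes s: "exponent_between M s a b" "0 \<le> a" and f: "f \<in> rLp M s" and g: "g \<in> rLp M s"
  shows "(\<lambda>x. f x + g x) \<in> rLp M s"
proof -
  have [measurable]: "f \<in> borel_measurable M" "g \<in> borel_measurable M" "s \<in> borel_measurable M"
    using f g exponent_betweenD[OF s(1)] by (auto simp: rLp_def)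
  have "rmod M s (\<lambda>x. f x + g x)
     \<le> (\<integral>\<^sup>+x. ennreal (2 powr b) * (ennreal (\<bar>f x\<bar> powr s x) + ennreal (\<bar>g x\<bar> powr s x)) \<partial>M)"
    unfolding rmod_def
  proof (rule nn_integral_mono)
    fix x
    have sx: "0 \<le> s x" "s x \<le> b" using exponent_betweenD(2,3)[OF s(1), of x] s(2) by auto
    have "\<bar>f x + g x\<bar> powr s x \<le> (\<bar>f x\<bar> + \<bar>g x\<bar>) powr s x" using sx by (intro powr_mono2) auto
    also have "\<dots> \<le> 2 powr b * (\<bar>f x\<bar> powr s x + \<bar>g x\<bar> powr s x)"
      using sx by (intro powr_add_le) auto
    finally show "ennreal (\<bar>f x + g x\<bar> powr s x) \<le> ennreal (2 powr b) * (ennreal (\<bar>f x\<bar> powr s x) + ennreal (\<bar>g x\<bar> powr s x))"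
      by (simp add: ennreal_leI flip: ennreal_mult ennreal_plus)
  qed
  also have "\<dots> = ennreal (2 powr b) * (rmod M s f + rmod M s g)"
    unfolding rmod_def by (subst nn_integral_cmult) (auto simp: nn_integral_add)
  also have "\<dots> < \<infinity>" using f g by (simp add: rLp_def ennreal_mult_less_top)
  finally show ?thesis by (simp add: rLp_def)
qed

lemma rLp_zero: "(\<lambda>x. 0) \<in> rLp M s"
  by (simp add: rLp_def rmod_def)

lemma rLp_sum:
  assumes s: "exponent_between M s a b" "0 \<le> a" and f: "\<And>i. i \<in> I \<Longrightarrow> f i \<in> rLp M s"
  shows "(\<lambda>x. \<Sum>i\<in>I. c i * f i x) \<in> rLp M s"
  using f by (induction I rule: infinite_finite_induct) (auto intro!: rLp_zero rLp_add[OF s] rLp_cmult[OF s])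

lemma nn_integral_weighted_sum_le:
  fixes w :: "'w \<Rightarrow> real" and h :: "'w \<Rightarrow> 'a \<Rightarrow> real" and k :: "'a \<Rightarrow> real"
  assumes meas: "\<And>\<omega>. \<omega> \<in> \<Omega> \<Longrightarrow> h \<omega> \<in> borel_measurable M" "k \<in> borel_measurable M"
    and w: "\<And>\<omega>. \<omega> \<in> \<Omega> \<Longrightarrow> 0 \<le> w \<omega>" and h: "\<And>\<omega> x. \<omega> \<in> \<Omega> \<Longrightarrow> 0 \<le> h \<omega> x" and C: "0 \<le> C"
    and le: "\<And>x. (\<Sum>\<omega>\<in>\<Omega>. w \<omega> * h \<omega> x) \<le> C * k x"
  shows "(\<Sum>\<omega>\<in>\<Omega>. ennreal (w \<omega>) * (\<integral>\<^sup>+x. ennreal (h \<omega> x) \<partial>M)) \<le> ennreal C * (\<integral>\<^sup>+x. ennreal (k x) \<partial>M)"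
proof -
  have "(\<Sum>\<omega>\<in>\<Omega>. ennreal (w \<omega>) * (\<integral>\<^sup>+x. ennreal (h \<omega> x) \<partial>M))
      = (\<integral>\<^sup>+x. (\<Sum>\<omega>\<in>\<Omega>. ennreal (w \<omega>) * ennreal (h \<omega> x)) \<partial>M)"
    using meas by (subst nn_integral_sum) (auto intro!: sum.cong nn_integral_cmult[symmetric])
  also have "\<dots> \<le> (\<integral>\<^sup>+x. ennreal C * ennreal (k x) \<partial>M)"
  proof (rule nn_integral_mono)
    fix x
    have "(\<Sum>\<omega>\<in>\<Omega>. ennreal (w \<omega>) * ennreal (h \<omega> x)) = (\<Sum>\<omega>\<in>\<Omega>. ennreal (w \<omega> * h \<omega> x))"
      using w h by (intro sum.cong refl ennreal_mult[symmetric]) auto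
    also have "\<dots> = ennreal (\<Sum>\<omega>\<in>\<Omega>. w \<omega> * h \<omega> x)"
      using w h by (intro sum_ennreal) auto
    also have "\<dots> \<le> ennreal (C * k x)" by (intro ennreal_leI le)
    also have "\<dots> = ennreal C * ennreal (k x)" using C by (rule ennreal_mult')
    finally show "(\<Sum>\<omega>\<in>\<Omega>. ennreal (w \<omega>) * ennreal (h \<omega> x)) \<le> ennreal C * ennreal (k x)" .
  qed
  also have "\<dots> = ennreal C * (\<integral>\<^sup>+x. ennreal (k x) \<partial>M)"
    using meas by (intro nn_integral_cmult) auto
  finally show ?thesis .
qed

section \<open>Linear maps between spaces with variable exponent\<close>

locale lp_map =
  fixes M :: "'b measure" and Q :: "'b \<Rightarrow> real" and N :: "'a measure" and P :: "'a \<Rightarrow> real"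
    and T :: "('b \<Rightarrow> real) \<Rightarrow> 'a \<Rightarrow> real" and q1 q2 p1 p2 :: real
  assumes Q: "exponent_between M Q q1 q2" "1 < q1" and P: "exponent_between N P p1 p2" "1 < p1"
    and T_in: "f \<in> rLp M Q \<Longrightarrow> T f \<in> rLp N P"
    and T_cong: "f \<in> rLp M Q \<Longrightarrow> g \<in> rLp M Q \<Longrightarrow> AE y in M. f y = g y \<Longrightarrow> AE x in N. T f x = T g x"
    and T_add: "f \<in> rLp M Q \<Longrightarrow> g \<in> rLp M Q \<Longrightarrow> AE x in N. T (\<lambda>y. f y + g y) x = T f x + T g x"
    and T_cmult: "f \<in> rLp M Q \<Longrightarrow> AE x in N. T (\<lambda>y. c * f y) x = c * T f x"
begin

lemma Q_meas[measurable]: "Q \<in> borel_measurable M" and Q_ge: "q1 \<le> Q y" and Q_le: "Q y \<le> q2"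
  using exponent_betweenD[OF Q(1)] by auto

lemma P_meas[measurable]: "P \<in> borel_measurable N" and P_ge: "p1 \<le> P x" and P_le: "P x \<le> p2"
  using exponent_betweenD[OF P(1)] by auto

lemma q0: "0 \<le> q1" and q12: "q1 \<le> q2" and p12: "p1 \<le> p2"
  using Q(2) P(2) Q_ge[of undefined] Q_le[of undefined] P_ge[of undefined] P_le[of undefined] by linarith+

lemma T_measurable: "f \<in> rLp M Q \<Longrightarrow> T f \<in> borel_measurable N"
  by (intro rLp_measurable[of _ _ P] T_in)

lemmas rLp_Q_cmult = rLp_cmult[OF Q(1) q0]
lemmas rLp_Q_sum = rLp_sum[OF Q(1) q0]
lemmas rLp_Q_add = rLp_add[OF Q(1) q0]
lemmas rLp_Q_mono = rLp_mono[OF Q(1) q0]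

lemma T_zero: "AE x in N. T (\<lambda>y. 0) x = 0"
  using T_cmult[OF rLp_zero, of 0] by simp

lemma T_sum:
  assumes "finite I" "\<And>i. i \<in> I \<Longrightarrow> f i \<in> rLp M Q"
  shows "AE x in N. T (\<lambda>y. \<Sum>i\<in>I. c i * f i y) x = (\<Sum>i\<in>I. c i * T (f i) x)"
  using assms
proof (induction I)
  case empty
  then show ?case using T_zero by simp
next
  case (insert i I)
  have 1: "AE x in N. T (\<lambda>y. c i * f i y + (\<Sum>i\<in>I. c i * f i y)) x
      = T (\<lambda>y. c i * f i y) x + T (\<lambda>y. \<Sum>i\<in>I. c i * f i y) x"
    using insert by (intro T_add rLp_Q_cmult rLp_Q_sum) auto
  have 2: "AE x in N. T (\<lambda>y. c i * f i y) x = c i * T (f i) x"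
    using insert by (intro T_cmult) auto
  have 3: "AE x in N. T (\<lambda>y. \<Sum>i\<in>I. c i * f i y) x = (\<Sum>i\<in>I. c i * T (f i) x)"
    using insert by auto
  show ?case using 1 2 3 by eventually_elim (simp add: insert)
qed

text \<open>The \<open>\<ell>\<^sup>r\<close>-valued extension in modular form. The index sets
  consist of natural numbers because a definition cannot quantify over index types.\<close>

definition lr_bound :: "real \<Rightarrow> real \<Rightarrow> bool" where
  "lr_bound r C \<longleftrightarrow> (\<forall>(I :: nat set) f. finite I \<longrightarrow> (\<forall>i\<in>I. f i \<in> rLp M Q) \<longrightarrow>
     (\<integral>\<^sup>+y. ennreal ((\<Sum>i\<in>I. \<bar>f i y\<bar> powr r) powr (Q y / r)) \<partial>M) \<le> 1 \<longrightarrow>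
     (\<integral>\<^sup>+x. ennreal ((\<Sum>i\<in>I. \<bar>T (f i) x\<bar> powr r) powr (P x / r)) \<partial>N) \<le> ennreal C)"

text \<open>Division by \<open>\<Lambda>\<close> brings the input modular down to 1, since all
  exponents are at least 1; on the output side the factor returns as at most
  \<open>\<Lambda> powr p2\<close>.\<close>

lemma lr_bound_scale:
  fixes I :: "nat set"
  assumes C: "lr_bound r C" "0 \<le> C" and r: "0 < r" and I: "finite I" "\<And>i. i \<in> I \<Longrightarrow> f i \<in> rLp M Q"
    and \<Lambda>: "1 \<le> \<Lambda>" "(\<integral>\<^sup>+y. ennreal ((\<Sum>i\<in>I. \<bar>f i y\<bar> powr r) powr (Q y / r)) \<partial>M) \<le> ennreal \<Lambda>"
  shows "(\<integral>\<^sup>+x. ennreal ((\<Sum>i\<in>I. \<bar>T (f i) x\<bar> powr r) powr (P x / r)) \<partial>N) \<le> ennreal (\<Lambda> powr p2 * C)"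
proof -
  have scale: "(\<Sum>i\<in>I. \<bar>c * g i\<bar> powr r) powr (s / r) = c powr s * (\<Sum>i\<in>I. \<bar>g i\<bar> powr r) powr (s / r)"
    if "0 \<le> c" for c s :: real and g :: "nat \<Rightarrow> real"
  proof -
    have "(\<Sum>i\<in>I. \<bar>c * g i\<bar> powr r) = c powr r * (\<Sum>i\<in>I. \<bar>g i\<bar> powr r)"
      using that by (simp add: abs_mult powr_mult sum_distrib_left)
    then show ?thesis using r by (simp add: powr_mult sum_nonneg powr_powr)
  qed
  have [measurable]: "f i \<in> borel_measurable M" "T (f i) \<in> borel_measurable N" if "i \<in> I" for i
    using I(2)[OF that] by (auto intro: T_measurable rLp_measurable)
  define g where "g i y = 1 / \<Lambda> * f i y" for i y
  have g: "g i \<in> rLp M Q" if "i \<in> I" for i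
    unfolding g_def by (intro rLp_Q_cmult I that)
  have "(\<integral>\<^sup>+y. ennreal ((\<Sum>i\<in>I. \<bar>g i y\<bar> powr r) powr (Q y / r)) \<partial>M)
      \<le> (\<integral>\<^sup>+y. ennreal (1 / \<Lambda>) * ennreal ((\<Sum>i\<in>I. \<bar>f i y\<bar> powr r) powr (Q y / r)) \<partial>M)"
  proof (rule nn_integral_mono)
    fix y
    have "(1 / \<Lambda>) powr Q y \<le> (1 / \<Lambda>) powr 1"
      using \<Lambda> Q(2) Q_ge[of y] by (intro powr_mono') auto
    moreover have "(\<Sum>i\<in>I. \<bar>g i y\<bar> powr r) powr (Q y / r) = (1 / \<Lambda>) powr Q y * (\<Sum>i\<in>I. \<bar>f i y\<bar> powr r) powr (Q y / r)"
      unfolding g_def using \<Lambda> by (intro scale) auto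
    ultimately have "(\<Sum>i\<in>I. \<bar>g i y\<bar> powr r) powr (Q y / r) \<le> (1 / \<Lambda>) powr 1 * (\<Sum>i\<in>I. \<bar>f i y\<bar> powr r) powr (Q y / r)"
      by (simp only: mult_right_mono powr_ge_zero)
    then have "(\<Sum>i\<in>I. \<bar>g i y\<bar> powr r) powr (Q y / r) \<le> 1 / \<Lambda> * (\<Sum>i\<in>I. \<bar>f i y\<bar> powr r) powr (Q y / r)"
      using \<Lambda> by simp
    then show "ennreal ((\<Sum>i\<in>I. \<bar>g i y\<bar> powr r) powr (Q y / r)) \<le> ennreal (1 / \<Lambda>) * ennreal ((\<Sum>i\<in>I. \<bar>f i y\<bar> powr r) powr (Q y / r))"
      using \<Lambda> by (simp add: ennreal_leI flip: ennreal_mult)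
  qed
  also have "\<dots> = ennreal (1 / \<Lambda>) * (\<integral>\<^sup>+y. ennreal ((\<Sum>i\<in>I. \<bar>f i y\<bar> powr r) powr (Q y / r)) \<partial>M)"
    by (rule nn_integral_cmult) measurable
  also have "\<dots> \<le> ennreal (1 / \<Lambda>) * ennreal \<Lambda>" by (intro mult_left_mono \<Lambda>) auto
  also have "\<dots> = 1" using \<Lambda> by (simp flip: ennreal_mult)
  finally have "(\<integral>\<^sup>+x. ennreal ((\<Sum>i\<in>I. \<bar>T (g i) x\<bar> powr r) powr (P x / r)) \<partial>N) \<le> ennreal C"
    using C(1) I g unfolding lr_bound_def by blast
  moreover have "(\<integral>\<^sup>+x. ennreal ((\<Sum>i\<in>I. \<bar>T (f i) x\<bar> powr r) powr (P x / r)) \<partial>N)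
     \<le> (\<integral>\<^sup>+x. ennreal (\<Lambda> powr p2) * ennreal ((\<Sum>i\<in>I. \<bar>T (g i) x\<bar> powr r) powr (P x / r)) \<partial>N)"
  proof (rule nn_integral_mono_AE)
    have "AE x in N. \<forall>i\<in>I. T (g i) x = 1 / \<Lambda> * T (f i) x"
      unfolding g_def using I by (intro AE_finite_allI T_cmult) auto
    then show "AE x in N. ennreal ((\<Sum>i\<in>I. \<bar>T (f i) x\<bar> powr r) powr (P x / r))
         \<le> ennreal (\<Lambda> powr p2) * ennreal ((\<Sum>i\<in>I. \<bar>T (g i) x\<bar> powr r) powr (P x / r))"
    proof eventually_elim
      fix x assume x: "\<forall>i\<in>I. T (g i) x = 1 / \<Lambda> * T (f i) x"
      have "(\<Sum>i\<in>I. \<bar>T (f i) x\<bar> powr r) = (\<Sum>i\<in>I. \<bar>\<Lambda> * T (g i) x\<bar> powr r)"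
        using x \<Lambda> by (intro sum.cong) auto
      then have "(\<Sum>i\<in>I. \<bar>T (f i) x\<bar> powr r) powr (P x / r) = \<Lambda> powr P x * (\<Sum>i\<in>I. \<bar>T (g i) x\<bar> powr r) powr (P x / r)"
        using \<Lambda> scale[of \<Lambda> "\<lambda>i. T (g i) x" "P x"] by simp
      also have "\<dots> \<le> \<Lambda> powr p2 * (\<Sum>i\<in>I. \<bar>T (g i) x\<bar> powr r) powr (P x / r)"
        using \<Lambda> P_le by (intro mult_right_mono powr_mono) auto
      finally show "ennreal ((\<Sum>i\<in>I. \<bar>T (f i) x\<bar> powr r) powr (P x / r))
         \<le> ennreal (\<Lambda> powr p2) * ennreal ((\<Sum>i\<in>I. \<bar>T (g i) x\<bar> powr r) powr (P x / r))"
        by (simp add: ennreal_leI flip: ennreal_mult)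
    qed
  qed
  moreover have "\<dots> = ennreal (\<Lambda> powr p2) * (\<integral>\<^sup>+x. ennreal ((\<Sum>i\<in>I. \<bar>T (g i) x\<bar> powr r) powr (P x / r)) \<partial>N)"
  proof (rule nn_integral_cmult)
    have [measurable]: "T (g i) \<in> borel_measurable N" if "i \<in> I" for i
      using g[OF that] by (rule T_measurable)
    show "(\<lambda>x. ennreal ((\<Sum>i\<in>I. \<bar>T (g i) x\<bar> powr r) powr (P x / r))) \<in> borel_measurable N" by measurable
  qed
  moreover have "ennreal (\<Lambda> powr p2) * ennreal C = ennreal (\<Lambda> powr p2 * C)"
    using C by (simp add: ennreal_mult)
  ultimately show ?thesis by (metis (no_types, lifting) mult_left_mono order_trans zero_le)
qed

end

section \<open>Boundedness in modular form and its vector-valued extension\<close>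

locale bounded_lp_map = lp_map M Q N P T q1 q2 p1 p2
  for M :: "'b measure" and Q and N :: "'a measure" and P T q1 q2 p1 p2 +
  fixes B :: real
  assumes B: "0 \<le> B" and T_bounded: "f \<in> rLp M Q \<Longrightarrow> rmod M Q f \<le> 1 \<Longrightarrow> rmod N P (T f) \<le> ennreal B"
begin

lemma T_bounded_scale:
  assumes f: "f \<in> rLp M Q" and \<Lambda>: "1 \<le> \<Lambda>" "rmod M Q f \<le> ennreal \<Lambda>"
  shows "rmod N P (T f) \<le> ennreal (\<Lambda> powr p2 * B)"
proof -
  have g: "(\<lambda>y. 1 / \<Lambda> * f y) \<in> rLp M Q" by (intro rLp_Q_cmult f)
  have "rmod M Q (\<lambda>y. 1 / \<Lambda> * f y) \<le> ennreal ((1 / \<Lambda>) powr q1) * rmod M Q f"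
    using \<Lambda> f by (intro rmod_cmult_le1[OF Q(1)]) (auto simp: rLp_measurable)
  also have "\<dots> \<le> ennreal ((1 / \<Lambda>) powr 1) * ennreal \<Lambda>"
    using \<Lambda> Q(2) by (intro mult_mono ennreal_leI powr_mono') auto
  also have "\<dots> = 1" using \<Lambda> by (simp flip: ennreal_mult)
  finally have b: "rmod N P (T (\<lambda>y. 1 / \<Lambda> * f y)) \<le> ennreal B" by (intro T_bounded g)
  have "AE x in N. T (\<lambda>y. 1 / \<Lambda> * f y) x = 1 / \<Lambda> * T f x" by (rule T_cmult[OF f])
  then have "AE x in N. T f x = \<Lambda> * T (\<lambda>y. 1 / \<Lambda> * f y) x"
    by eventually_elim (use \<Lambda> in auto)
  then have "rmod N P (T f) = rmod N P (\<lambda>x. \<Lambda> * T (\<lambda>y. 1 / \<Lambda> * f y) x)" by (rule rmod_cong_AE)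
  also have "\<dots> \<le> ennreal (\<Lambda> powr p2) * rmod N P (T (\<lambda>y. 1 / \<Lambda> * f y))"
    using \<Lambda> by (intro rmod_cmult_ge1[OF P(1)] T_measurable g)
  also have "\<dots> \<le> ennreal (\<Lambda> powr p2) * ennreal B" by (intro mult_left_mono b) auto
  also have "\<dots> = ennreal (\<Lambda> powr p2 * B)" using B by (simp add: ennreal_mult)
  finally show ?thesis .
qed

text \<open>Signed sums commute with \<open>T\<close> almost everywhere. Khintchine's upper estimate
  bounds their mean input modular, and at each point at least a sixth of the sign choices gives an
  output of at least half the square function; the transfer by Markov's inequality joins the two
  facts.\<close>

lemma lr_bound_2: "\<exists>C\<ge>0. lr_bound 2 C"
proof -
  define K where "K = 2 * exp 1 * q2 powr q2"
  have K: "1 \<le> K"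
  proof -
    have "1 \<le> q2" using Q(2) q12 by simp
    then have "1 \<le> q2 powr q2" by (intro ge_one_powr_ge_zero) auto
    moreover have "1 \<le> 2 * exp (1::real)" using exp_ge_add_one_self[of "1::real"] by simp
    ultimately show ?thesis unfolding K_def using mult_mono[of 1 "2 * exp 1" 1 "q2 powr q2"] by simp
  qed
  define D where "D = 2 powr p2 * ((12 * K) powr p2 * B)"
  have D: "0 \<le> D" using B by (simp add: D_def)
  have "lr_bound 2 (2 / (1/6) * D)"
    unfolding lr_bound_def
  proof (intro allI impI)
    fix I :: "nat set" and f
    assume I: "finite I" and f: "\<forall>i\<in>I. f i \<in> rLp M Q"
      and le: "(\<integral>\<^sup>+y. ennreal ((\<Sum>i\<in>I. \<bar>f i y\<bar> powr 2) powr (Q y / 2)) \<partial>M) \<le> 1"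
    have [measurable]: "f i \<in> borel_measurable M" "T (f i) \<in> borel_measurable N" if "i \<in> I" for i
      using f that by (auto intro: T_measurable rLp_measurable)
    define F where "F \<omega> y = signed_sum I (\<lambda>i. f i y) \<omega>" for \<omega> y
    define G where "G \<omega> x = signed_sum I (\<lambda>i. T (f i) x) \<omega>" for \<omega> x
    have F_eq: "F \<omega> = (\<lambda>y. \<Sum>i\<in>I. (if i \<in> \<omega> then 1 else -1) * f i y)" for \<omega>
      unfolding F_def signed_sum_def by (intro ext sum.cong) auto
    have G_eq: "G \<omega> = (\<lambda>x. \<Sum>i\<in>I. (if i \<in> \<omega> then 1 else -1) * T (f i) x)" for \<omega>
      unfolding G_def signed_sum_def by (intro ext sum.cong) auto
    have F_in: "F \<omega> \<in> rLp M Q" for \<omega> unfolding F_eq using f by (intro rLp_Q_sum) auto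
    have [measurable]: "F \<omega> \<in> borel_measurable M" for \<omega> using F_in by (rule rLp_measurable)
    have [measurable]: "G \<omega> \<in> borel_measurable N" for \<omega> unfolding G_eq by measurable
    have TF: "AE x in N. T (F \<omega>) x = G \<omega> x" for \<omega>
      unfolding F_eq G_eq using I f by (intro T_sum) auto
    \<comment> \<open>The factor 2 in \<open>Z\<close> is the square root of the 4 in Khintchine's
      lower estimate, and \<open>12 * K\<close> is \<open>2 * K / (1/6)\<close>.\<close>
    show "(\<integral>\<^sup>+x. ennreal ((\<Sum>i\<in>I. \<bar>T (f i) x\<bar> powr 2) powr (P x / 2)) \<partial>N) \<le> ennreal (2 / (1/6) * D)"
    proof (rule markov_transfer[where \<Omega> = "Pow I" and w = "\<lambda>_. 1 / 2 ^ card I" and B = K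
          and R = "\<lambda>\<omega>. rmod M Q (F \<omega>)" and Z = "\<lambda>\<omega> x. \<bar>2 * G \<omega> x\<bar> powr P x"])
      fix x
      let ?A = "\<Sum>i\<in>I. \<bar>T (f i) x\<bar> powr 2"
      let ?k = "?A powr (P x / 2)"
      have A: "?A = (\<Sum>i\<in>I. (T (f i) x)\<^sup>2)" by simp
      have "{\<omega> \<in> Pow I. (\<Sum>i\<in>I. (T (f i) x)\<^sup>2) / 4 \<le> (G \<omega> x)\<^sup>2} \<subseteq> {\<omega> \<in> Pow I. ?k \<le> \<bar>2 * G \<omega> x\<bar> powr P x}"
      proof safe
        fix \<omega> assume "(\<Sum>i\<in>I. (T (f i) x)\<^sup>2) / 4 \<le> (G \<omega> x)\<^sup>2"
        then have "?A \<le> \<bar>2 * G \<omega> x\<bar>\<^sup>2" by simp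
        then have "?A powr (P x / 2) \<le> (\<bar>2 * G \<omega> x\<bar>\<^sup>2) powr (P x / 2)"
          using P(2) P_ge[of x] by (intro powr_mono2) (auto simp: sum_nonneg)
        also have "\<dots> = (\<bar>2 * G \<omega> x\<bar> powr 2) powr (P x / 2)" by simp
        also have "\<dots> = \<bar>2 * G \<omega> x\<bar> powr P x" unfolding powr_powr by simp
        finally show "?k \<le> \<bar>2 * G \<omega> x\<bar> powr P x" .
      qed
      then have "card {\<omega> \<in> Pow I. (\<Sum>i\<in>I. (T (f i) x)\<^sup>2) / 4 \<le> (G \<omega> x)\<^sup>2} \<le> card {\<omega> \<in> Pow I. ?k \<le> \<bar>2 * G \<omega> x\<bar> powr P x}"
        using I by (intro card_mono) auto
      with khintchine_lower[OF I, of "\<lambda>i. T (f i) x"]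
      have "2 ^ card I / 6 \<le> real (card {\<omega> \<in> Pow I. ?k \<le> \<bar>2 * G \<omega> x\<bar> powr P x})"
        unfolding G_def by linarith
      then have "1 / 6 \<le> real (card {\<omega> \<in> Pow I. ?k \<le> \<bar>2 * G \<omega> x\<bar> powr P x}) / 2 ^ card I"
        by (simp add: field_simps)
      also have "\<dots> = (\<Sum>\<omega>\<in>Pow I. if ?k \<le> \<bar>2 * G \<omega> x\<bar> powr P x then 1 / 2 ^ card I else 0)"
        using I by (simp add: sum.If_cases Int_def)
      finally show "(1::real) / 6 \<le> (\<Sum>\<omega>\<in>Pow I. if ?k \<le> \<bar>2 * G \<omega> x\<bar> powr P x then 1 / 2 ^ card I else 0)" .
    next
      have "(\<Sum>\<omega>\<in>Pow I. ennreal (1 / 2 ^ card I) * rmod M Q (F \<omega>))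
         \<le> ennreal K * (\<integral>\<^sup>+y. ennreal ((\<Sum>i\<in>I. \<bar>f i y\<bar> powr 2) powr (Q y / 2)) \<partial>M)"
        unfolding rmod_def
      proof (rule nn_integral_weighted_sum_le)
        fix y
        have "(\<Sum>\<omega>\<in>Pow I. \<bar>F \<omega> y\<bar> powr Q y) \<le> 2 ^ card I * K * (\<Sum>i\<in>I. (f i y)\<^sup>2) powr (Q y / 2)"
          unfolding F_def K_def using I Q(2) Q_ge[of y] Q_le[of y] by (intro khintchine_upper) auto
        then have "1 / 2 ^ card I * (\<Sum>\<omega>\<in>Pow I. \<bar>F \<omega> y\<bar> powr Q y)
            \<le> 1 / 2 ^ card I * (2 ^ card I * K * (\<Sum>i\<in>I. (f i y)\<^sup>2) powr (Q y / 2))"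
          by (intro mult_left_mono) auto
        then show "(\<Sum>\<omega>\<in>Pow I. 1 / 2 ^ card I * \<bar>F \<omega> y\<bar> powr Q y) \<le> K * (\<Sum>i\<in>I. \<bar>f i y\<bar> powr 2) powr (Q y / 2)"
          by (simp add: sum_divide_distrib)
      qed (use K in auto)
      also have "\<dots> \<le> ennreal K * 1" by (intro mult_left_mono le) auto
      finally show "(\<Sum>\<omega>\<in>Pow I. ennreal (1 / 2 ^ card I) * rmod M Q (F \<omega>)) \<le> ennreal K" by simp
    next
      fix \<omega> assume "rmod M Q (F \<omega>) \<le> ennreal (2 * K / (1/6))"
      then have R: "rmod M Q (F \<omega>) \<le> ennreal (12 * K)" by simp
      have "(\<integral>\<^sup>+x. ennreal (\<bar>2 * G \<omega> x\<bar> powr P x) \<partial>N) = rmod N P (\<lambda>x. 2 * T (F \<omega>) x)"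
        using TF[of \<omega>] by (auto simp: rmod_def intro!: nn_integral_cong_AE)
      also have "\<dots> \<le> ennreal (2 powr p2) * rmod N P (T (F \<omega>))"
        by (intro rmod_cmult_ge1[OF P(1)] T_measurable F_in) auto
      also have "\<dots> \<le> ennreal (2 powr p2) * ennreal ((12 * K) powr p2 * B)"
        using K by (intro mult_left_mono T_bounded_scale F_in R) auto
      also have "\<dots> = ennreal D" using B by (simp add: D_def flip: ennreal_mult)
      finally show "(\<integral>\<^sup>+x. ennreal (\<bar>2 * G \<omega> x\<bar> powr P x) \<partial>N) \<le> ennreal D" .
    next
      show "(\<Sum>\<omega>\<in>Pow I. 1 / 2 ^ card I) = (1::real)" using I by (simp add: card_Pow)
    qed (use I K D in auto)
  qed
  then show ?thesis using D by (intro exI[of _ "2 / (1/6) * D"]) auto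
qed

end

context bounded_lp_map
begin

text \<open>The square-function bound is applied to the family multiplied by square roots of Pareto
  variables of index r / 2. Averaging turns the randomly weighted sums of squares into sums of r-th
  powers. On the input side this needs moments of order \<open>Q y / 2\<close> below the index,
  which is the condition \<open>q2 < r\<close>; on the output side only a lower bound in probability
  is used.\<close>

lemma lr_bound_lt_2:
  assumes r: "q2 < r" "r < 2"
  shows "\<exists>C\<ge>0. lr_bound r C"
proof -
  obtain C2 where C2: "0 \<le> C2" "lr_bound 2 C2" using lr_bound_2 by blast
  define t where "t = r / 2"
  have r0: "1 < r" using r Q(2) q12 by simp
  have t: "0 < t" "t < 1" "q2 / 2 < t" using r r0 by (auto simp: t_def)
  define K where "K = 1 + 2 powr (1 - t) / (2 powr (1 - t) - 1) + 1 / (1 - 2 powr (q2 / 2 - t))"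
  have K: "1 \<le> K"
  proof -
    have "1 < 2 powr (1 - t)" using t by (intro gr_one_powr) auto
    moreover have "2 powr (q2 / 2 - t) < 1" using t powr_less_mono[of "q2 / 2 - t" 0 2] by simp
    ultimately show ?thesis by (simp add: K_def)
  qed
  define c where "c = 2 powr (- t) / 8"
  have c: "0 < c" "c \<le> 1" using powr_mono[of "- t" 0 2] t by (auto simp: c_def)
  define D where "D = (2 * K / c) powr p2 * C2"
  have D: "0 \<le> D" using C2 by (simp add: D_def)
  have "lr_bound r (2 / c * D)"
    unfolding lr_bound_def
  proof (intro allI impI)
    fix I :: "nat set" and f
    assume I: "finite I" and f: "\<forall>i\<in>I. f i \<in> rLp M Q"
      and le: "(\<integral>\<^sup>+y. ennreal ((\<Sum>i\<in>I. \<bar>f i y\<bar> powr r) powr (Q y / r)) \<partial>M) \<le> 1"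
    have [measurable]: "f i \<in> borel_measurable M" "T (f i) \<in> borel_measurable N" if "i \<in> I" for i
      using f that by (auto intro: T_measurable rLp_measurable)
    \<comment> \<open>The truncation level depends on the number of functions; the constants
      \<open>K\<close>, \<open>c\<close> and \<open>D\<close> do not.\<close>
    obtain L :: nat where L: "(4 * real (card I)) powr (1/t) < 2 ^ L"
      using real_arch_pow[of 2] by auto
    define \<Omega> where "\<Omega> = pareto_space L I"
    define w where "w = pareto_prod t L I"
    have w: "0 \<le> w \<omega>" for \<omega> using t by (simp add: w_def pareto_prod_nonneg)
    have \<Omega>: "finite \<Omega>" using I by (simp add: \<Omega>_def finite_pareto_space)
    define F where "F \<omega> i y = sqrt (2 ^ \<omega> i) * f i y" for \<omega> :: "nat \<Rightarrow> nat" and i y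
    have F_in: "F \<omega> i \<in> rLp M Q" if "i \<in> I" for \<omega> i unfolding F_def using f that by (intro rLp_Q_cmult) auto
    have sq: "\<bar>sqrt (2 ^ n) * z\<bar> powr 2 = z\<^sup>2 * 2 ^ n" for n :: nat and z :: real
      by (simp add: power_mult_distrib mult.commute)
    have sqr: "(z\<^sup>2) powr t = \<bar>z\<bar> powr r" for z :: real
      using powr_powr[of "\<bar>z\<bar>" 2 t] by (simp add: t_def)
    show "(\<integral>\<^sup>+x. ennreal ((\<Sum>i\<in>I. \<bar>T (f i) x\<bar> powr r) powr (P x / r)) \<partial>N) \<le> ennreal (2 / c * D)"
    proof (rule markov_transfer[where \<Omega> = \<Omega> and w = w and B = K
          and R = "\<lambda>\<omega>. \<integral>\<^sup>+y. ennreal ((\<Sum>i\<in>I. (f i y)\<^sup>2 * 2 ^ \<omega> i) powr (Q y / 2)) \<partial>M"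
          and Z = "\<lambda>\<omega> x. (\<Sum>i\<in>I. (T (f i) x)\<^sup>2 * 2 ^ \<omega> i) powr (P x / 2)"])
      fix x
      let ?S = "\<Sum>i\<in>I. \<bar>T (f i) x\<bar> powr r"
      have "c \<le> (\<Sum>\<omega>\<in>\<Omega>. if (\<Sum>i\<in>I. ((T (f i) x)\<^sup>2) powr t) powr (1/t) \<le> (\<Sum>i\<in>I. (T (f i) x)\<^sup>2 * 2 ^ \<omega> i) then w \<omega> else 0)"
        unfolding c_def \<Omega>_def w_def using t I L by (intro pareto_lower) auto
      also have "\<dots> \<le> (\<Sum>\<omega>\<in>\<Omega>. if ?S powr (P x / r) \<le> (\<Sum>i\<in>I. (T (f i) x)\<^sup>2 * 2 ^ \<omega> i) powr (P x / 2) then w \<omega> else 0)"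
      proof (rule sum_mono)
        fix \<omega>
        have "?S powr (P x / r) \<le> X powr (P x / 2)" if "?S powr (1/t) \<le> X" for X
        proof -
          have "?S powr (P x / r) = (?S powr (1/t)) powr (P x / 2)" by (simp add: powr_powr t_def)
          also have "\<dots> \<le> X powr (P x / 2)" using that P(2) P_ge[of x] by (intro powr_mono2) auto
          finally show ?thesis .
        qed
        then show "(if (\<Sum>i\<in>I. ((T (f i) x)\<^sup>2) powr t) powr (1/t) \<le> (\<Sum>i\<in>I. (T (f i) x)\<^sup>2 * 2 ^ \<omega> i) then w \<omega> else 0)
          \<le> (if ?S powr (P x / r) \<le> (\<Sum>i\<in>I. (T (f i) x)\<^sup>2 * 2 ^ \<omega> i) powr (P x / 2) then w \<omega> else 0)"
          unfolding sqr using w[of \<omega>] by auto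
      qed
      finally show "c \<le> \<dots>" .
    next
      have "(\<Sum>\<omega>\<in>\<Omega>. ennreal (w \<omega>) * (\<integral>\<^sup>+y. ennreal ((\<Sum>i\<in>I. (f i y)\<^sup>2 * 2 ^ \<omega> i) powr (Q y / 2)) \<partial>M))
         \<le> ennreal K * (\<integral>\<^sup>+y. ennreal ((\<Sum>i\<in>I. \<bar>f i y\<bar> powr r) powr (Q y / r)) \<partial>M)"
      proof (rule nn_integral_weighted_sum_le)
        fix y
        have "(\<Sum>\<omega>\<in>\<Omega>. w \<omega> * (\<Sum>i\<in>I. (f i y)\<^sup>2 * 2 ^ \<omega> i) powr (Q y / 2))
           \<le> K * (\<Sum>i\<in>I. ((f i y)\<^sup>2) powr t) powr (Q y / 2 / t)"
          unfolding \<Omega>_def w_def K_def using t I Q(2) Q_ge[of y] Q_le[of y] by (intro pareto_moment) auto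
        then show "(\<Sum>\<omega>\<in>\<Omega>. w \<omega> * (\<Sum>i\<in>I. (f i y)\<^sup>2 * 2 ^ \<omega> i) powr (Q y / 2)) \<le> K * (\<Sum>i\<in>I. \<bar>f i y\<bar> powr r) powr (Q y / r)"
          unfolding sqr by (simp add: t_def)
      qed (use K w in auto)
      also have "\<dots> \<le> ennreal K * 1" by (intro mult_left_mono le) auto
      finally show "(\<Sum>\<omega>\<in>\<Omega>. ennreal (w \<omega>) * (\<integral>\<^sup>+y. ennreal ((\<Sum>i\<in>I. (f i y)\<^sup>2 * 2 ^ \<omega> i) powr (Q y / 2)) \<partial>M)) \<le> ennreal K" by simp
    next
      fix \<omega> assume R: "(\<integral>\<^sup>+y. ennreal ((\<Sum>i\<in>I. (f i y)\<^sup>2 * 2 ^ \<omega> i) powr (Q y / 2)) \<partial>M) \<le> ennreal (2 * K / c)"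
      have "(\<integral>\<^sup>+x. ennreal ((\<Sum>i\<in>I. (T (f i) x)\<^sup>2 * 2 ^ \<omega> i) powr (P x / 2)) \<partial>N)
          = (\<integral>\<^sup>+x. ennreal ((\<Sum>i\<in>I. \<bar>T (F \<omega> i) x\<bar> powr 2) powr (P x / 2)) \<partial>N)"
      proof (rule nn_integral_cong_AE)
        have "AE x in N. \<forall>i\<in>I. T (F \<omega> i) x = sqrt (2 ^ \<omega> i) * T (f i) x"
          unfolding F_def using I f by (intro AE_finite_allI T_cmult) auto
        then show "AE x in N. ennreal ((\<Sum>i\<in>I. (T (f i) x)\<^sup>2 * 2 ^ \<omega> i) powr (P x / 2))
            = ennreal ((\<Sum>i\<in>I. \<bar>T (F \<omega> i) x\<bar> powr 2) powr (P x / 2))"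
          by eventually_elim (simp add: power_mult_distrib mult.commute)
      qed
      also have "\<dots> \<le> ennreal ((2 * K / c) powr p2 * C2)"
      proof (rule lr_bound_scale[OF C2(2,1) _ I])
        show "1 \<le> 2 * K / c" using K c by (simp add: field_simps)
        show "(\<integral>\<^sup>+y. ennreal ((\<Sum>i\<in>I. \<bar>F \<omega> i y\<bar> powr 2) powr (Q y / 2)) \<partial>M) \<le> ennreal (2 * K / c)"
          using R unfolding F_def sq .
      qed (use F_in in auto)
      finally show "(\<integral>\<^sup>+x. ennreal ((\<Sum>i\<in>I. (T (f i) x)\<^sup>2 * 2 ^ \<omega> i) powr (P x / 2)) \<partial>N) \<le> ennreal D"
        by (simp add: D_def)
    next
      show "(\<Sum>\<omega>\<in>\<Omega>. w \<omega>) = 1" using I by (simp add: \<Omega>_def w_def pareto_prod_sum)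
    qed (use \<Omega> K c D w in auto)
  qed
  then show ?thesis using D c by (intro exI[of _ "2 / c * D"]) auto
qed

text \<open>The family is lifted pointwise to random families with controlled square sums. The
  square-function bound applies to these outcome by outcome, and the quotient estimate brings the
  images back. The lift is nonlinear, but \<open>T\<close> has to commute only with the finite
  average over outcomes that recovers each function.\<close>

lemma lr_bound_gt_2:
  assumes r: "2 < r" "r < p1"
  shows "\<exists>C\<ge>0. lr_bound r C"
proof -
  obtain C2 where C2: "0 \<le> C2" "lr_bound 2 C2" using lr_bound_2 by blast
  define t where "t = r / (r - 1) / 2"
  have t: "0 < t" "t < 1" using r by (auto simp: t_def field_simps)
  show ?thesis
  proof (rule pareto_quotient_bound[OF r p12])
  fix K assume K: "0 < K"
    "\<And>(I :: nat set) L g h p. finite I \<Longrightarrow> p1 \<le> p \<Longrightarrow> p \<le> p2 \<Longrightarrow>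
      (\<And>i. i \<in> I \<Longrightarrow> g i = (\<Sum>\<omega>\<in>pareto_space L I. pareto_prod (r / (r - 1) / 2) L I \<omega> * (sqrt (2 ^ \<omega> i) * h i \<omega>))) \<Longrightarrow>
      (\<Sum>i\<in>I. \<bar>g i\<bar> powr r) powr (p / r)
        \<le> K * (\<Sum>\<omega>\<in>pareto_space L I. pareto_prod (r / (r - 1) / 2) L I \<omega> * (\<Sum>i\<in>I. (h i \<omega>)\<^sup>2) powr (p / 2))"
  define D where "D = (16 powr q2) powr p2 * C2"
  have D: "0 \<le> D" using C2 by (simp add: D_def)
  have "lr_bound r (K * D)"
    unfolding lr_bound_def
  proof (intro allI impI)
    fix I :: "nat set" and f
    assume I: "finite I" and f: "\<forall>i\<in>I. f i \<in> rLp M Q"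
      and le: "(\<integral>\<^sup>+y. ennreal ((\<Sum>i\<in>I. \<bar>f i y\<bar> powr r) powr (Q y / r)) \<partial>M) \<le> 1"
    have [measurable]: "f i \<in> borel_measurable M" "T (f i) \<in> borel_measurable N" if "i \<in> I" for i
      using f that by (auto intro: T_measurable rLp_measurable)
    obtain L :: nat where L: "(4 * real (card I)) powr (1/t) < 2 ^ L"
      using real_arch_pow[of 2] by auto
    then have L': "(4 * real (card I)) powr (1 / (r / (r - 1) / 2)) \<le> 2 ^ L" by (simp add: t_def)
    define \<Omega> where "\<Omega> = pareto_space L I"
    define w where "w = pareto_prod t L I"
    have w: "0 \<le> w \<omega>" for \<omega> using t by (simp add: w_def pareto_prod_nonneg)
    have \<Omega>: "finite \<Omega>" using I by (simp add: \<Omega>_def finite_pareto_space)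
    define F where "F \<omega> i y = pareto_lift r L I (\<lambda>i. f i y) i \<omega>" for \<omega> i y
    have F_meas[measurable]: "F \<omega> i \<in> borel_measurable M" if "i \<in> I" for \<omega> i
      unfolding F_def by (rule measurable_pareto_lift[OF I that]) measurable
    have F_exp: "f i y = (\<Sum>\<omega>\<in>\<Omega>. w \<omega> * (sqrt (2 ^ \<omega> i) * F \<omega> i y))" if "i \<in> I" for i y
      unfolding F_def \<Omega>_def w_def t_def using r(1) I that L' by (rule pareto_lift_expectation)
    have F_sq: "(\<Sum>i\<in>I. \<bar>F \<omega> i y\<bar> powr 2) powr (Q y / 2) \<le> 16 powr q2 * (\<Sum>i\<in>I. \<bar>f i y\<bar> powr r) powr (Q y / r)" for \<omega> y
    proof -
      let ?n = "(\<Sum>i\<in>I. \<bar>f i y\<bar> powr r) powr (1/r)"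
      have "(\<Sum>i\<in>I. \<bar>F \<omega> i y\<bar> powr 2) \<le> (16 * ?n)\<^sup>2"
        using pareto_lift_bound[OF r(1) I L', of "\<lambda>i. f i y" \<omega>] by (simp add: F_def)
      then have "(\<Sum>i\<in>I. \<bar>F \<omega> i y\<bar> powr 2) powr (Q y / 2) \<le> ((16 * ?n)\<^sup>2) powr (Q y / 2)"
        using Q(2) Q_ge[of y] by (intro powr_mono2) (auto simp: sum_nonneg)
      also have "(16 * ?n)\<^sup>2 = (16 * ?n) powr 2" by simp
      also have "\<dots> powr (Q y / 2) = (16 * ?n) powr Q y" unfolding powr_powr by simp
      also have "\<dots> = 16 powr Q y * (\<Sum>i\<in>I. \<bar>f i y\<bar> powr r) powr (Q y / r)"
        by (simp add: powr_mult powr_powr)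
      also have "\<dots> \<le> 16 powr q2 * (\<Sum>i\<in>I. \<bar>f i y\<bar> powr r) powr (Q y / r)"
        using Q_le[of y] by (intro mult_right_mono powr_mono) auto
      finally show ?thesis .
    qed
    have F_int: "(\<integral>\<^sup>+y. ennreal ((\<Sum>i\<in>I. \<bar>F \<omega> i y\<bar> powr 2) powr (Q y / 2)) \<partial>M) \<le> ennreal (16 powr q2)" for \<omega>
    proof -
      have "(\<integral>\<^sup>+y. ennreal ((\<Sum>i\<in>I. \<bar>F \<omega> i y\<bar> powr 2) powr (Q y / 2)) \<partial>M)
         \<le> (\<integral>\<^sup>+y. ennreal (16 powr q2) * ennreal ((\<Sum>i\<in>I. \<bar>f i y\<bar> powr r) powr (Q y / r)) \<partial>M)"
        by (intro nn_integral_mono, subst ennreal_mult[symmetric]) (use F_sq in \<open>auto simp only: powr_ge_zero intro!: ennreal_leI\<close>)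
      also have "\<dots> = ennreal (16 powr q2) * (\<integral>\<^sup>+y. ennreal ((\<Sum>i\<in>I. \<bar>f i y\<bar> powr r) powr (Q y / r)) \<partial>M)"
        by (rule nn_integral_cmult) measurable
      also have "\<dots> \<le> ennreal (16 powr q2) * 1" by (intro mult_left_mono le) auto
      finally show ?thesis by simp
    qed
    have F_in: "F \<omega> i \<in> rLp M Q" if i: "i \<in> I" for \<omega> i
    proof -
      have "rmod M Q (F \<omega> i) \<le> (\<integral>\<^sup>+y. ennreal ((\<Sum>i\<in>I. \<bar>F \<omega> i y\<bar> powr 2) powr (Q y / 2)) \<partial>M)"
        unfolding rmod_def
      proof (intro nn_integral_mono ennreal_leI)
        fix y
        have "\<bar>F \<omega> i y\<bar> powr Q y = (\<bar>F \<omega> i y\<bar> powr 2) powr (Q y / 2)" unfolding powr_powr by simp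
        also have "\<dots> \<le> (\<Sum>i\<in>I. \<bar>F \<omega> i y\<bar> powr 2) powr (Q y / 2)"
          using i I Q(2) Q_ge[of y] by (intro powr_mono2 member_le_sum) auto
        finally show "\<bar>F \<omega> i y\<bar> powr Q y \<le> (\<Sum>i\<in>I. \<bar>F \<omega> i y\<bar> powr 2) powr (Q y / 2)" .
      qed
      also have "\<dots> < \<infinity>" using F_int[of \<omega>] by (auto intro: order.strict_trans1)
      finally show ?thesis using i by (simp add: rLp_def)
    qed
    have [measurable]: "T (F \<omega> i) \<in> borel_measurable N" if "i \<in> I" for \<omega> i
      using F_in[OF that] by (rule T_measurable)
    have G_int: "(\<integral>\<^sup>+x. ennreal ((\<Sum>i\<in>I. (T (F \<omega> i) x)\<^sup>2) powr (P x / 2)) \<partial>N) \<le> ennreal D" for \<omega>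
    proof -
      have "1 \<le> 16 powr q2" using Q(2) q12 by (intro ge_one_powr_ge_zero) auto
      then have "(\<integral>\<^sup>+x. ennreal ((\<Sum>i\<in>I. \<bar>T (F \<omega> i) x\<bar> powr 2) powr (P x / 2)) \<partial>N) \<le> ennreal ((16 powr q2) powr p2 * C2)"
        by (intro lr_bound_scale[OF C2(2,1) _ I F_in] F_int) auto
      then show ?thesis by (simp add: D_def)
    qed
    have "AE x in N. \<forall>i\<in>I. T (f i) x = (\<Sum>\<omega>\<in>\<Omega>. w \<omega> * (sqrt (2 ^ \<omega> i) * T (F \<omega> i) x))"
    proof (intro AE_finite_allI I)
      fix i assume i: "i \<in> I"
      have "f i = (\<lambda>y. \<Sum>\<omega>\<in>\<Omega>. (w \<omega> * sqrt (2 ^ \<omega> i)) * F \<omega> i y)"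
        using F_exp[OF i] by (auto simp: mult.assoc)
      moreover have "AE x in N. T (\<lambda>y. \<Sum>\<omega>\<in>\<Omega>. (w \<omega> * sqrt (2 ^ \<omega> i)) * F \<omega> i y) x
          = (\<Sum>\<omega>\<in>\<Omega>. (w \<omega> * sqrt (2 ^ \<omega> i)) * T (F \<omega> i) x)"
        using \<Omega> F_in[OF i] by (intro T_sum) auto
      ultimately show "AE x in N. T (f i) x = (\<Sum>\<omega>\<in>\<Omega>. w \<omega> * (sqrt (2 ^ \<omega> i) * T (F \<omega> i) x))"
        by (simp add: mult.assoc)
    qed
    then have "AE x in N. (\<Sum>i\<in>I. \<bar>T (f i) x\<bar> powr r) powr (P x / r)
        \<le> K * (\<Sum>\<omega>\<in>\<Omega>. w \<omega> * (\<Sum>i\<in>I. (T (F \<omega> i) x)\<^sup>2) powr (P x / 2))"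
    proof eventually_elim
      fix x assume "\<forall>i\<in>I. T (f i) x = (\<Sum>\<omega>\<in>\<Omega>. w \<omega> * (sqrt (2 ^ \<omega> i) * T (F \<omega> i) x))"
      then show "(\<Sum>i\<in>I. \<bar>T (f i) x\<bar> powr r) powr (P x / r)
        \<le> K * (\<Sum>\<omega>\<in>\<Omega>. w \<omega> * (\<Sum>i\<in>I. (T (F \<omega> i) x)\<^sup>2) powr (P x / 2))"
        unfolding \<Omega>_def w_def t_def using P_ge P_le I by (intro K(2)) auto
    qed
    then have "(\<integral>\<^sup>+x. ennreal ((\<Sum>i\<in>I. \<bar>T (f i) x\<bar> powr r) powr (P x / r)) \<partial>N)
       \<le> (\<integral>\<^sup>+x. (\<Sum>\<omega>\<in>\<Omega>. ennreal (K * w \<omega>) * ennreal ((\<Sum>i\<in>I. (T (F \<omega> i) x)\<^sup>2) powr (P x / 2))) \<partial>N)"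
    proof (intro nn_integral_mono_AE, eventually_elim)
      fix x
      let ?g = "\<lambda>\<omega>. (\<Sum>i\<in>I. (T (F \<omega> i) x)\<^sup>2) powr (P x / 2)"
      assume "(\<Sum>i\<in>I. \<bar>T (f i) x\<bar> powr r) powr (P x / r) \<le> K * (\<Sum>\<omega>\<in>\<Omega>. w \<omega> * ?g \<omega>)"
      then have "ennreal ((\<Sum>i\<in>I. \<bar>T (f i) x\<bar> powr r) powr (P x / r)) \<le> ennreal (\<Sum>\<omega>\<in>\<Omega>. K * w \<omega> * ?g \<omega>)"
        by (simp add: ennreal_leI sum_distrib_left mult.assoc)
      also have "\<dots> = (\<Sum>\<omega>\<in>\<Omega>. ennreal (K * w \<omega> * ?g \<omega>))"
        using w K(1) by (intro sum_ennreal[symmetric]) auto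
      also have "\<dots> = (\<Sum>\<omega>\<in>\<Omega>. ennreal (K * w \<omega>) * ennreal (?g \<omega>))"
        using w K(1) by (intro sum.cong refl ennreal_mult) auto
      finally show "ennreal ((\<Sum>i\<in>I. \<bar>T (f i) x\<bar> powr r) powr (P x / r)) \<le> (\<Sum>\<omega>\<in>\<Omega>. ennreal (K * w \<omega>) * ennreal (?g \<omega>))" .
    qed
    also have "\<dots> = (\<Sum>\<omega>\<in>\<Omega>. ennreal (K * w \<omega>) * (\<integral>\<^sup>+x. ennreal ((\<Sum>i\<in>I. (T (F \<omega> i) x)\<^sup>2) powr (P x / 2)) \<partial>N))"
      by (subst nn_integral_sum) (auto intro!: sum.cong nn_integral_cmult)
    also have "\<dots> \<le> (\<Sum>\<omega>\<in>\<Omega>. ennreal (K * w \<omega>) * ennreal D)"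
      by (intro sum_mono mult_left_mono G_int) auto
    also have "\<dots> = (\<Sum>\<omega>\<in>\<Omega>. ennreal (K * w \<omega> * D))"
      using w K(1) D by (intro sum.cong refl ennreal_mult[symmetric]) auto
    also have "\<dots> = ennreal (\<Sum>\<omega>\<in>\<Omega>. K * w \<omega> * D)"
      using w K(1) D by (intro sum_ennreal) auto
    also have "(\<Sum>\<omega>\<in>\<Omega>. K * w \<omega> * D) = (\<Sum>\<omega>\<in>\<Omega>. w \<omega>) * (K * D)"
      unfolding sum_distrib_right by (intro sum.cong) auto
    also have "(\<Sum>\<omega>\<in>\<Omega>. w \<omega>) = 1" using I by (simp add: \<Omega>_def w_def pareto_prod_sum)
    finally show "(\<integral>\<^sup>+x. ennreal ((\<Sum>i\<in>I. \<bar>T (f i) x\<bar> powr r) powr (P x / r)) \<partial>N) \<le> ennreal (K * D)" by simp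
  qed
  then show ?thesis using D K(1) by (intro exI[of _ "K * D"]) auto
  qed
qed

end

section \<open>Extremal elements for modulars\<close>

lemma nn_integral_fatou_le:
  fixes u :: "nat \<Rightarrow> 'a \<Rightarrow> ennreal" and c :: ennreal
  assumes u: "\<And>n. u n \<in> borel_measurable M"
    and lim: "AE x in M. (\<lambda>n. u n x) \<longlonglongrightarrow> u' x"
    and C: "\<And>n. (\<integral>\<^sup>+x. u n x \<partial>M) \<le> C n" "C \<longlonglongrightarrow> c"
  shows "(\<integral>\<^sup>+x. u' x \<partial>M) \<le> c"
proof -
  have "(\<integral>\<^sup>+x. u' x \<partial>M) = (\<integral>\<^sup>+x. liminf (\<lambda>n. u n x) \<partial>M)"
  proof (rule nn_integral_cong_AE, use lim in eventually_elim)
    fix x assume "(\<lambda>n. u n x) \<longlonglongrightarrow> u' x"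
    then show "u' x = liminf (\<lambda>n. u n x)"
      by (simp add: lim_imp_Liminf)
  qed
  also have "\<dots> \<le> liminf (\<lambda>n. \<integral>\<^sup>+x. u n x \<partial>M)" by (rule nn_integral_liminf[OF u])
  also have "\<dots> \<le> liminf C" by (intro Liminf_mono always_eventually allI C(1))
  also have "\<dots> = c" using C(2) by (simp add: lim_imp_Liminf)
  finally show ?thesis .
qed

text \<open>In the series \<open>D\<close> the factors 2 ^ n are beaten by the rate (1/4) ^ n, so it
  is integrable. It controls two things: the increments are summable, and by Cauchy-Schwarz the
  squares of all members lie below one integrable function. That majorant later permits dominated
  convergence for powers with varying exponent.\<close>

lemma fast_L2_cauchy_dominated_limit:
  fixes x :: "nat \<Rightarrow> 'a \<Rightarrow> real"
  assumes x[measurable]: "\<And>n. x n \<in> borel_measurable M"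
    and x0: "(\<integral>\<^sup>+t. ennreal ((x 0 t)\<^sup>2) \<partial>M) < \<infinity>"
    and d: "\<And>n. (\<integral>\<^sup>+t. ennreal ((x (Suc n) t - x n t)\<^sup>2) \<partial>M) \<le> ennreal (C * (1/4) ^ n)" and C: "0 \<le> C"
  obtains X and W :: "'a \<Rightarrow> ennreal"
  where "X \<in> borel_measurable M" "W \<in> borel_measurable M" "(\<integral>\<^sup>+t. W t \<partial>M) < \<infinity>"
    "AE t in M. (\<lambda>n. x n t) \<longlonglongrightarrow> X t" "AE t in M. \<forall>n. ennreal ((x n t)\<^sup>2) \<le> W t"
proof -
  define dd where "dd n t = x (Suc n) t - x n t" for n t
  have [measurable]: "dd n \<in> borel_measurable M" for n unfolding dd_def by measurable
  define D where "D t = (\<Sum>n. ennreal (2 ^ n * (dd n t)\<^sup>2))" for t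
  have [measurable]: "D \<in> borel_measurable M" unfolding D_def by measurable
  have "(\<integral>\<^sup>+t. D t \<partial>M) = (\<Sum>n. \<integral>\<^sup>+t. ennreal (2 ^ n * (dd n t)\<^sup>2) \<partial>M)"
    unfolding D_def by (rule nn_integral_suminf) measurable
  also have "\<dots> \<le> (\<Sum>n. ennreal (C * (1/2) ^ n))"
  proof (rule suminf_le)
    fix n
    have "(\<integral>\<^sup>+t. ennreal (2 ^ n * (dd n t)\<^sup>2) \<partial>M) = ennreal (2 ^ n) * (\<integral>\<^sup>+t. ennreal ((dd n t)\<^sup>2) \<partial>M)"
      by (simp add: ennreal_mult nn_integral_cmult)
    also have "\<dots> \<le> ennreal (2 ^ n) * ennreal (C * (1/4) ^ n)"
      using d unfolding dd_def by (intro mult_left_mono) auto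
    also have "\<dots> = ennreal (C * (1/2) ^ n)"
    proof -
      have "2 ^ n * (C * (1/4) ^ n) = C * (2 * (1/4)) ^ n" unfolding power_mult_distrib by (simp only: mult_ac)
      then show ?thesis using C by (simp flip: ennreal_mult)
    qed
    finally show "(\<integral>\<^sup>+t. ennreal (2 ^ n * (dd n t)\<^sup>2) \<partial>M) \<le> ennreal (C * (1/2) ^ n)" .
  qed auto
  also have "\<dots> < \<infinity>"
  proof -
    have "summable (\<lambda>n. C * (1/2) ^ n)" by (intro summable_mult summable_geometric) auto
    then have "(\<Sum>n. ennreal (C * (1/2) ^ n)) \<noteq> top"
      using C by (intro ennreal_suminf_neq_top) auto
    then show ?thesis by (simp add: less_top)
  qed
  finally have D_fin: "(\<integral>\<^sup>+t. D t \<partial>M) < \<infinity>" .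
  then have D_AE: "AE t in M. D t \<noteq> \<infinity>"
    by (intro nn_integral_noteq_infinite) auto
  have x_sum: "x n t = x 0 t + (\<Sum>k<n. dd k t)" for n t
    by (induction n) (auto simp: dd_def)
  define X where "X t = lim (\<lambda>n. x n t)" for t
  define W where "W t = ennreal (2 * (x 0 t)\<^sup>2) + 4 * D t" for t
  show ?thesis
  proof (rule that[of X W])
    show "X \<in> borel_measurable M" "W \<in> borel_measurable M" unfolding X_def W_def by measurable
    have "(\<integral>\<^sup>+t. W t \<partial>M) = 2 * (\<integral>\<^sup>+t. ennreal ((x 0 t)\<^sup>2) \<partial>M) + 4 * (\<integral>\<^sup>+t. D t \<partial>M)"
      unfolding W_def by (simp add: nn_integral_add nn_integral_cmult ennreal_mult)
    also have "\<dots> < \<infinity>" using x0 D_fin by (simp add: ennreal_mult_less_top)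
    finally show "(\<integral>\<^sup>+t. W t \<partial>M) < \<infinity>" .
    show "AE t in M. (\<lambda>n. x n t) \<longlonglongrightarrow> X t"
      using D_AE
    proof eventually_elim
      fix t assume "D t \<noteq> \<infinity>"
      then have "summable (\<lambda>n. 2 ^ n * (dd n t)\<^sup>2)"
        unfolding D_def by (intro summable_suminf_not_top) auto
      then have sm: "summable (\<lambda>n. (1/2) ^ n + 2 ^ n * (dd n t)\<^sup>2)"
        by (intro summable_add summable_geometric) auto
      have "summable (\<lambda>n. dd n t)"
      proof (rule summable_comparison_test'[OF sm])
        fix n
        have "0 \<le> (2 ^ n * \<bar>dd n t\<bar> - 1)\<^sup>2 + (2 ^ n * \<bar>dd n t\<bar>)" by simp
        then have "2 ^ n * \<bar>dd n t\<bar> \<le> 1 + (2 ^ n * \<bar>dd n t\<bar>)\<^sup>2"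
          by (simp add: power2_eq_square algebra_simps)
        then have "(1/2) ^ n * (2 ^ n * \<bar>dd n t\<bar>) \<le> (1/2) ^ n * (1 + (2 ^ n * \<bar>dd n t\<bar>)\<^sup>2)"
          by (intro mult_left_mono) auto
        moreover have "(1/2) ^ n * (2 ^ n * \<bar>dd n t\<bar>) = \<bar>dd n t\<bar>"
          by (simp add: power_one_over)
        moreover have "(1/2) ^ n * (1 + (2 ^ n * \<bar>dd n t\<bar>)\<^sup>2) = (1/2) ^ n + 2 ^ n * (dd n t)\<^sup>2"
          by (simp add: power_one_over power_mult_distrib power2_eq_square field_simps)
        ultimately show "norm (dd n t) \<le> (1/2) ^ n + 2 ^ n * (dd n t)\<^sup>2" by simp
      qed
      then have "(\<lambda>n. x 0 t + (\<Sum>k<n. dd k t)) \<longlonglongrightarrow> x 0 t + (\<Sum>k. dd k t)"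
        by (intro tendsto_add tendsto_const summable_LIMSEQ)
      then have "convergent (\<lambda>n. x n t)" by (simp add: convergentI flip: x_sum)
      then show "(\<lambda>n. x n t) \<longlonglongrightarrow> X t" unfolding X_def by (simp add: convergent_LIMSEQ_iff)
    qed
    show "AE t in M. \<forall>n. ennreal ((x n t)\<^sup>2) \<le> W t"
    proof (intro AE_I2 allI)
      fix t n
      have "(\<Sum>k<n. dd k t)\<^sup>2 = (\<Sum>k<n. sqrt ((1/2) ^ k) * (sqrt (2 ^ k) * dd k t))\<^sup>2"
        by (intro arg_cong[where f="\<lambda>z. z\<^sup>2"] sum.cong) (auto simp: real_sqrt_divide power_one_over)
      also have "\<dots> \<le> (\<Sum>k<n. (sqrt ((1/2) ^ k))\<^sup>2) * (\<Sum>k<n. (sqrt (2 ^ k) * dd k t)\<^sup>2)"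
        by (rule Cauchy_Schwarz_ineq_sum)
      also have "\<dots> = (\<Sum>k<n. (1/2) ^ k) * (\<Sum>k<n. 2 ^ k * (dd k t)\<^sup>2)"
        by (simp add: power_mult_distrib)
      also have "\<dots> \<le> 2 * (\<Sum>k<n. 2 ^ k * (dd k t)\<^sup>2)"
      proof (intro mult_right_mono sum_nonneg)
        show "(\<Sum>k<n. (1/2) ^ k) \<le> (2::real)" by (simp add: sum_gp_strict)
      qed auto
      finally have *: "(\<Sum>k<n. dd k t)\<^sup>2 \<le> 2 * (\<Sum>k<n. 2 ^ k * (dd k t)\<^sup>2)" .
      have "(x n t)\<^sup>2 \<le> 2 * (x 0 t)\<^sup>2 + 2 * (\<Sum>k<n. dd k t)\<^sup>2"
      proof -
        have "0 \<le> (x 0 t - (\<Sum>k<n. dd k t))\<^sup>2" by simp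
        then show ?thesis unfolding x_sum[of n] by (simp add: power2_eq_square algebra_simps)
      qed
      also have "\<dots> \<le> 2 * (x 0 t)\<^sup>2 + 4 * (\<Sum>k<n. 2 ^ k * (dd k t)\<^sup>2)" using * by simp
      finally have "ennreal ((x n t)\<^sup>2) \<le> ennreal (2 * (x 0 t)\<^sup>2 + 4 * (\<Sum>k<n. 2 ^ k * (dd k t)\<^sup>2))"
        by (rule ennreal_leI)
      also have "\<dots> = ennreal (2 * (x 0 t)\<^sup>2) + 4 * (\<Sum>k<n. ennreal (2 ^ k * (dd k t)\<^sup>2))"
        by (simp add: ennreal_mult sum_nonneg flip: sum_ennreal)
      also have "\<dots> \<le> W t"
        unfolding W_def D_def by (intro add_left_mono mult_left_mono sum_le_suminf) auto
      finally show "ennreal ((x n t)\<^sup>2) \<le> W t" .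
    qed
  qed
qed

lemma powr_eq_sq_half: "a powr s = (a powr (s/2))\<^sup>2" for a s :: real
  by (simp add: power2_eq_square flip: powr_add)

lemma powr_limit_from_sqrt_limit:
  fixes g :: "nat \<Rightarrow> 'a \<Rightarrow> real"
  assumes s: "0 < s x" and g: "\<And>n. 0 \<le> g n x" and lim: "(\<lambda>n. g n x powr (s x / 2)) \<longlonglongrightarrow> X x"
  shows "(\<lambda>n. g n x) \<longlonglongrightarrow> \<bar>X x\<bar> powr (2 / s x)"
proof -
  have "(\<lambda>n. \<bar>g n x powr (s x / 2)\<bar> powr (2 / s x)) \<longlonglongrightarrow> \<bar>X x\<bar> powr (2 / s x)"
    using s by (intro tendsto_powr' tendsto_rabs lim tendsto_const) auto
  then show ?thesis using s g by (simp add: powr_powr)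
qed

text \<open>Uniform convexity and concavity control half powers; the limit is taken there and
  carried back by the power 2 / s y.\<close>

lemma powr_cauchy_dominated_limit:
  fixes g :: "nat \<Rightarrow> 'a \<Rightarrow> real"
  assumes s: "s \<in> borel_measurable M" "\<And>y. 0 < s y"
    and g: "\<And>n. g n \<in> borel_measurable M" "\<And>n y. 0 \<le> g n y" "rmod M s (g 0) < \<infinity>" and C: "0 \<le> C"
    and cauchy: "\<And>n. (\<integral>\<^sup>+y. ennreal ((g (Suc n) y powr (s y / 2) - g n y powr (s y / 2))\<^sup>2) \<partial>M) \<le> ennreal (C * (1/4) ^ n)"
  obtains G W where "G \<in> borel_measurable M" "\<forall>y. 0 \<le> G y" "W \<in> borel_measurable M" "(\<integral>\<^sup>+t. W t \<partial>M) < \<infinity>"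
    "AE y in M. (\<lambda>n. g n y) \<longlonglongrightarrow> G y" "AE y in M. \<forall>n. ennreal (\<bar>g n y\<bar> powr s y) \<le> W y"
proof -
  note [measurable] = s(1) g(1)
  have sq: "(g n y powr (s y / 2))\<^sup>2 = \<bar>g n y\<bar> powr s y" for n y
    using g(2) by (simp add: powr_eq_sq_half[of "g n y" "s y"])
  have x0: "(\<integral>\<^sup>+y. ennreal ((g 0 y powr (s y / 2))\<^sup>2) \<partial>M) < \<infinity>" using g(3) unfolding sq rmod_def .
  have meas: "(\<lambda>y. g n y powr (s y / 2)) \<in> borel_measurable M" for n by measurable
  obtain X W where X[measurable]: "X \<in> borel_measurable M" and W: "W \<in> borel_measurable M" "(\<integral>\<^sup>+t. W t \<partial>M) < \<infinity>"
    and lim: "AE y in M. (\<lambda>n. g n y powr (s y / 2)) \<longlonglongrightarrow> X y"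
    and dom: "AE y in M. \<forall>n. ennreal ((g n y powr (s y / 2))\<^sup>2) \<le> W y"
    by (rule fast_L2_cauchy_dominated_limit[OF meas x0 cauchy C])
  have "(\<lambda>y. \<bar>X y\<bar> powr (2 / s y)) \<in> borel_measurable M" by measurable
  moreover have "AE y in M. (\<lambda>n. g n y) \<longlonglongrightarrow> \<bar>X y\<bar> powr (2 / s y)"
    using lim by eventually_elim (rule powr_limit_from_sqrt_limit[where s = s and g = g and X = X, OF s(2) g(2)])
  moreover have "AE y in M. \<forall>n. ennreal (\<bar>g n y\<bar> powr s y) \<le> W y" using dom unfolding sq .
  ultimately show ?thesis using W by (intro that[of "\<lambda>y. \<bar>X y\<bar> powr (2 / s y)" W]) auto
qed

text \<open>
  Uniform convexity makes a minimising sequence Cauchy, which replaces a separation theorem: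
  the first variation at the limit is the weight in the factorization below.
\<close>

lemma powr_modular_minimiser:
  fixes \<G> :: "('a \<Rightarrow> real) set" and s :: "'a \<Rightarrow> real"
  assumes s: "exponent_between M s s1 s2" "1 < s1"
    and meas: "\<And>g. g \<in> \<G> \<Longrightarrow> g \<in> borel_measurable M" and nonneg: "\<And>g x. g \<in> \<G> \<Longrightarrow> 0 \<le> g x"
    and ne: "\<G> \<noteq> {}" and fin: "\<And>g. g \<in> \<G> \<Longrightarrow> rmod M s g < \<infinity>"
    and mid: "\<And>g h. g \<in> \<G> \<Longrightarrow> h \<in> \<G> \<Longrightarrow> (\<lambda>x. (g x + h x) / 2) \<in> \<G>"
  shows "\<exists>g\<in>borel_measurable M. (\<forall>x. 0 \<le> g x) \<and> rmod M s g = (INF g\<in>\<G>. rmod M s g) \<and>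
    (\<forall>k\<in>borel_measurable M. (\<forall>x. 0 \<le> k x) \<longrightarrow> rmod M s k < \<infinity> \<longrightarrow>
       (\<forall>h\<in>\<G>. \<forall>t>0. (\<lambda>x. (h x + t * k x) / (1 + t)) \<in> \<G>) \<longrightarrow>
       (INF g\<in>\<G>. rmod M s g) \<le> (\<integral>\<^sup>+x. ennreal (s x * g x powr (s x - 1) * k x) \<partial>M))"
proof -
  have [measurable]: "s \<in> borel_measurable M" by (rule exponent_betweenD[OF s(1)])
  have s_ge: "s1 \<le> s x" and s_le: "s x \<le> s2" for x using exponent_betweenD(2,3)[OF s(1)] by auto
  have s_gt: "1 < s x" for x using s_ge[of x] s(2) by simp
  define hf :: real where "hf = 1 / 2"
  have hf: "0 \<le> hf" by (simp add: hf_def)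
  define a where "a = (INF g\<in>\<G>. rmod M s g)"
  obtain g0 where g0: "g0 \<in> \<G>" using ne by auto
  have a_le: "a \<le> rmod M s g" if "g \<in> \<G>" for g unfolding a_def using that by (rule INF_lower)
  have a_fin: "a < \<infinity>" using a_le[OF g0] fin[OF g0] by (rule order.strict_trans1)
  have "\<exists>g\<in>\<G>. rmod M s g \<le> a + ennreal ((1/4) ^ n)" for n
  proof -
    have "a < a + ennreal ((1/4) ^ n)"
      using a_fin ennreal_add_left_cancel_less[of a 0 "ennreal ((1/4) ^ n)"] by simp
    then show ?thesis unfolding a_def INF_less_iff by (auto intro: less_imp_le)
  qed
  then obtain g where g: "\<And>n. g n \<in> \<G>" "\<And>n. rmod M s (g n) \<le> a + ennreal ((1/4) ^ n)" by metis
  have [measurable]: "g n \<in> borel_measurable M" for n by (rule meas[OF g(1)])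
  have gn: "0 \<le> g n x" for n x by (rule nonneg[OF g(1)])
  define x where "x n y = g n y powr (s y / 2)" for n y
  have [measurable]: "x n \<in> borel_measurable M" for n unfolding x_def by measurable
  define c where "c = min (s1 - 1) 1 / 4"
  have c: "0 < c" using s(2) by (simp add: c_def)
  \<comment> \<open>Midpoints stay in the set, so their modular is at least the infimum
    \<open>a\<close>. The convexity gap is therefore at most the (1/4) ^ n by which two consecutive
    members may exceed \<open>a\<close>.\<close>
  have cauchy: "(\<integral>\<^sup>+y. ennreal ((x (Suc n) y - x n y)\<^sup>2) \<partial>M) \<le> ennreal (1 / c * (1/4) ^ n)" for n
  proof -
    let ?m = "\<lambda>y. (g (Suc n) y + g n y) / 2"
    have "ennreal c * (\<integral>\<^sup>+y. ennreal ((x (Suc n) y - x n y)\<^sup>2) \<partial>M) + rmod M s ?m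
        = (\<integral>\<^sup>+y. ennreal c * ennreal ((x (Suc n) y - x n y)\<^sup>2) + ennreal (\<bar>?m y\<bar> powr s y) \<partial>M)"
      unfolding rmod_def by (simp add: nn_integral_add nn_integral_cmult)
    also have "\<dots> \<le> (\<integral>\<^sup>+y. ennreal hf * ennreal (\<bar>g (Suc n) y\<bar> powr s y) + ennreal hf * ennreal (\<bar>g n y\<bar> powr s y) \<partial>M)"
    proof (rule nn_integral_mono)
      fix y
      have arith: "A + D \<le> hf * B + hf * C" if "A \<le> (B + C) / 2 - D" for A B C D :: real
        using that by (simp add: add_divide_distrib hf_def)
      have abs_eq: "\<bar>g (Suc n) y\<bar> = g (Suc n) y" "\<bar>g n y\<bar> = g n y" "\<bar>?m y\<bar> = ?m y"
        using gn[of n y] gn[of "Suc n" y] by auto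
      have "c * (x (Suc n) y - x n y)\<^sup>2 \<le> (g (Suc n) y powr s y + g n y powr s y) / 2 - (?m y) powr s y"
        unfolding c_def x_def using s s_ge gn by (intro powr_uniform_convexity) auto
      then have "c * (x (Suc n) y - x n y)\<^sup>2 + \<bar>?m y\<bar> powr s y \<le> hf * \<bar>g (Suc n) y\<bar> powr s y + hf * \<bar>g n y\<bar> powr s y"
        unfolding abs_eq by (rule arith)
      then show "ennreal c * ennreal ((x (Suc n) y - x n y)\<^sup>2) + ennreal (\<bar>?m y\<bar> powr s y)
          \<le> ennreal hf * ennreal (\<bar>g (Suc n) y\<bar> powr s y) + ennreal hf * ennreal (\<bar>g n y\<bar> powr s y)"
        using c hf by (simp add: ennreal_leI flip: ennreal_mult ennreal_plus)
    qed
    also have "\<dots> = ennreal hf * rmod M s (g (Suc n)) + ennreal hf * rmod M s (g n)"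
      unfolding rmod_def by (subst nn_integral_add) (auto simp: nn_integral_cmult)
    also have "\<dots> \<le> ennreal hf * (a + ennreal ((1/4) ^ n)) + ennreal hf * (a + ennreal ((1/4) ^ n))"
    proof (intro add_mono mult_left_mono g(2))
      have "rmod M s (g (Suc n)) \<le> a + ennreal ((1/4) ^ Suc n)" by (rule g(2))
      also have "\<dots> \<le> a + ennreal ((1/4) ^ n)" by (intro add_left_mono ennreal_leI power_decreasing) auto
      finally show "rmod M s (g (Suc n)) \<le> a + ennreal ((1/4) ^ n)" .
    qed auto
    also have "\<dots> = a + ennreal ((1/4) ^ n)"
    proof -
      have "ennreal hf + ennreal hf = 1" by (subst ennreal_plus[symmetric]) (auto simp: hf_def)
      then show ?thesis by (simp flip: distrib_right)
    qed
    finally have "ennreal c * (\<integral>\<^sup>+y. ennreal ((x (Suc n) y - x n y)\<^sup>2) \<partial>M) + a \<le> a + ennreal ((1/4) ^ n)"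
      using a_le[OF mid[OF g(1)[of "Suc n"] g(1)[of n]]] by (meson add_left_mono order_trans)
    then have "ennreal c * (\<integral>\<^sup>+y. ennreal ((x (Suc n) y - x n y)\<^sup>2) \<partial>M) \<le> ennreal ((1/4) ^ n)"
      using a_fin by (auto simp: add.commute[of _ a] ennreal_add_left_cancel_le)
    then have "ennreal c * (\<integral>\<^sup>+y. ennreal ((x (Suc n) y - x n y)\<^sup>2) \<partial>M) \<le> ennreal c * ennreal (1 / c * (1/4) ^ n)"
      using c by (simp flip: ennreal_mult)
    then show ?thesis using c by (simp add: ennreal_mult_le_mult_iff)
  qed
  obtain G W where G[measurable]: "G \<in> borel_measurable M" and "\<forall>y. 0 \<le> G y" and W[measurable]: "W \<in> borel_measurable M"
    and W_fin: "(\<integral>\<^sup>+t. W t \<partial>M) < \<infinity>" and G_lim: "AE y in M. (\<lambda>n. g n y) \<longlonglongrightarrow> G y"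
    and W_dom: "AE y in M. \<forall>n. ennreal (\<bar>g n y\<bar> powr s y) \<le> W y"
    by (rule powr_cauchy_dominated_limit[OF \<open>s \<in> borel_measurable M\<close> order.strict_trans[OF zero_less_one s_gt] meas[OF g(1)] gn fin[OF g(1)] _ cauchy[unfolded x_def]])
      (use c in auto)
  then have G0: "0 \<le> G y" for y by blast
  \<comment> \<open>The limit need not belong to the set, so inequalities for members have to be
    carried over to it. This requires convergence of the modulars along perturbed sequences as
    well.\<close>
  have perturbed_limit: "(\<lambda>n. rmod M s (\<lambda>y. g n y + k y)) \<longlonglongrightarrow> rmod M s (\<lambda>y. G y + k y)"
    if k[measurable]: "k \<in> borel_measurable M" and k0: "\<And>y. 0 \<le> k y" and kfin: "rmod M s k < \<infinity>" for k
    unfolding rmod_def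
  proof (rule nn_integral_dominated_convergence[where w = "\<lambda>y. ennreal (2 powr s2) * (W y + ennreal (\<bar>k y\<bar> powr s y))"])
    fix n
    show "AE y in M. ennreal (\<bar>g n y + k y\<bar> powr s y) \<le> ennreal (2 powr s2) * (W y + ennreal (\<bar>k y\<bar> powr s y))"
      using W_dom
    proof eventually_elim
      fix y assume "\<forall>n. ennreal (\<bar>g n y\<bar> powr s y) \<le> W y"
      then have w: "ennreal (\<bar>g n y\<bar> powr s y) \<le> W y" ..
      have "\<bar>g n y + k y\<bar> powr s y \<le> 2 powr s2 * (\<bar>g n y\<bar> powr s y + \<bar>k y\<bar> powr s y)"
        using powr_add_le[of "s y" s2 "g n y" "k y"] s_le[of y] s_gt[of y] gn k0 by simp
      then have "ennreal (\<bar>g n y + k y\<bar> powr s y) \<le> ennreal (2 powr s2) * (ennreal (\<bar>g n y\<bar> powr s y) + ennreal (\<bar>k y\<bar> powr s y))"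
        by (simp add: ennreal_leI flip: ennreal_mult ennreal_plus)
      also have "\<dots> \<le> ennreal (2 powr s2) * (W y + ennreal (\<bar>k y\<bar> powr s y))"
        by (intro mult_left_mono add_right_mono w) auto
      finally show "ennreal (\<bar>g n y + k y\<bar> powr s y) \<le> \<dots>" .
    qed
    show "(\<integral>\<^sup>+y. ennreal (2 powr s2) * (W y + ennreal (\<bar>k y\<bar> powr s y)) \<partial>M) < \<infinity>"
      using W_fin kfin unfolding rmod_def
      by (subst nn_integral_cmult) (auto simp: nn_integral_add ennreal_mult_less_top)
    show "AE y in M. (\<lambda>n. ennreal (\<bar>g n y + k y\<bar> powr s y)) \<longlonglongrightarrow> ennreal (\<bar>G y + k y\<bar> powr s y)"
      using G_lim
    proof eventually_elim
      fix y assume "(\<lambda>n. g n y) \<longlonglongrightarrow> G y"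
      then show "(\<lambda>n. ennreal (\<bar>g n y + k y\<bar> powr s y)) \<longlonglongrightarrow> ennreal (\<bar>G y + k y\<bar> powr s y)"
        using s_gt[of y] by (intro tendsto_ennrealI tendsto_powr' tendsto_rabs tendsto_add tendsto_const) auto
    qed
  qed measurable
  have "(\<lambda>n. rmod M s (\<lambda>y. g n y + 0)) \<longlonglongrightarrow> rmod M s (\<lambda>y. G y + 0)"
    by (rule perturbed_limit) (auto simp: rmod_def)
  then have lim_rmod: "(\<lambda>n. rmod M s (g n)) \<longlonglongrightarrow> rmod M s G" by simp
  have "(\<lambda>n. a + ennreal ((1/4) ^ n)) \<longlonglongrightarrow> a + ennreal 0"
    by (intro tendsto_add tendsto_const tendsto_ennrealI LIMSEQ_realpow_zero) auto
  then have "rmod M s G \<le> a" using LIMSEQ_le[OF lim_rmod] g(2) by auto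
  moreover have "a \<le> rmod M s G" using a_le[OF g(1)] by (intro LIMSEQ_le_const[OF lim_rmod]) auto
  ultimately have G_a: "rmod M s G = a" by simp
  show ?thesis
  proof (intro bexI[of _ G] conjI allI ballI impI)
    show "rmod M s G = (INF g\<in>\<G>. rmod M s g)" using G_a by (simp add: a_def)
    fix k assume k[measurable]: "k \<in> borel_measurable M" and "\<forall>x. 0 \<le> k x" and kfin: "rmod M s k < \<infinity>"
      and "\<forall>h\<in>\<G>. \<forall>t>0. (\<lambda>x. (h x + t * k x) / (1 + t)) \<in> \<G>"
    then have k0: "\<And>x. 0 \<le> k x"
      and dir: "\<And>h t. h \<in> \<G> \<Longrightarrow> 0 < t \<Longrightarrow> (\<lambda>x. (h x + t * k x) / (1 + t)) \<in> \<G>" by auto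
    \<comment> \<open>The integrand of the derivative in direction \<open>k\<close>, taken at the
      perturbed point: there the tangent inequality bounds the difference quotient from above.
      Letting t tend to 0 comes last.\<close>
    define V where "V t y = s y * (G y + t * k y) powr (s y - 1) * k y" for t y
    have [measurable]: "V t \<in> borel_measurable M" for t unfolding V_def by measurable
    have le_V: "a \<le> (\<integral>\<^sup>+y. ennreal (V t y) \<partial>M)" if t: "0 < t" "t \<le> 1" for t
    proof -
      have tk: "rmod M s (\<lambda>y. t * k y) < \<infinity>"
        using rmod_cmult_le1[OF s(1) k, of t] t kfin by (auto simp: ennreal_mult_less_top intro: order.strict_trans1)
      \<comment> \<open>Exponents are at least 1, so dividing by 1 + t lowers the modular by at
        least that factor. The gain 1 + t is what finally gives the lower bound \<open>a\<close> for
        the derivative.\<close>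
      have step: "ennreal (1 + t) * a \<le> rmod M s (\<lambda>y. g n y + t * k y)" for n
      proof -
        have "rmod M s (\<lambda>y. (g n y + t * k y) / (1 + t)) = rmod M s (\<lambda>y. 1 / (1 + t) * (g n y + t * k y))" by simp
        also have "\<dots> \<le> ennreal ((1 / (1 + t)) powr s1) * rmod M s (\<lambda>y. g n y + t * k y)"
          using t by (intro rmod_cmult_le1[OF s(1)]) auto
        also have "\<dots> \<le> ennreal ((1 / (1 + t)) powr 1) * rmod M s (\<lambda>y. g n y + t * k y)"
          using t s(2) by (intro mult_right_mono ennreal_leI powr_mono') auto
        finally have "a \<le> ennreal (1 / (1 + t)) * rmod M s (\<lambda>y. g n y + t * k y)"
          using a_le[OF dir[OF g(1)[of n] t(1)]] t by simp
        then have "ennreal (1 + t) * a \<le> ennreal (1 + t) * (ennreal (1 / (1 + t)) * rmod M s (\<lambda>y. g n y + t * k y))"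
          by (intro mult_left_mono) auto
        also have "\<dots> = rmod M s (\<lambda>y. g n y + t * k y)"
        proof -
          have "ennreal (1 + t) * ennreal (1 / (1 + t)) = 1"
            using t by (subst ennreal_mult[symmetric]) auto
          then show ?thesis by (simp only: mult.assoc[symmetric] mult_1)
        qed
        finally show ?thesis .
      qed
      have "ennreal (1 + t) * a \<le> rmod M s (\<lambda>y. G y + t * k y)"
        using step t k0 tk by (intro LIMSEQ_le_const[OF perturbed_limit]) auto
      also have "\<dots> \<le> (\<integral>\<^sup>+y. ennreal (\<bar>G y\<bar> powr s y) + ennreal t * ennreal (V t y) \<partial>M)"
        unfolding rmod_def
      proof (rule nn_integral_mono)
        fix y
        let ?z = "G y + t * k y"
        have z: "0 \<le> ?z" using G0 k0 t by auto
        have zz: "?z * ?z powr (s y - 1) = ?z powr s y"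
          using z by (cases "?z = 0") (auto simp: powr_mult_base)
        have "s y * G y * ?z powr (s y - 1) \<le> G y powr s y + (s y - 1) * ?z powr s y"
          using s_gt[of y] z G0 by (intro powr_tangent_below) auto
        then have "s y * G y * ?z powr (s y - 1) \<le> G y powr s y + s y * (?z * ?z powr (s y - 1)) - ?z powr s y"
          unfolding zz by (simp add: algebra_simps)
        then have "?z powr s y \<le> G y powr s y + t * V t y"
          unfolding V_def by (simp add: algebra_simps)
        then show "ennreal (\<bar>?z\<bar> powr s y) \<le> ennreal (\<bar>G y\<bar> powr s y) + ennreal t * ennreal (V t y)"
          using z G0 t k0 s_gt[of y] by (simp add: ennreal_leI V_def flip: ennreal_mult ennreal_plus)
      qed
      also have "\<dots> = a + ennreal t * (\<integral>\<^sup>+y. ennreal (V t y) \<partial>M)"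
        using G_a unfolding rmod_def by (simp add: nn_integral_add nn_integral_cmult)
      finally have "a + ennreal t * a \<le> a + ennreal t * (\<integral>\<^sup>+y. ennreal (V t y) \<partial>M)"
        using t by (simp add: distrib_right)
      then have "ennreal t * a \<le> ennreal t * (\<integral>\<^sup>+y. ennreal (V t y) \<partial>M)"
        using a_fin by (auto simp: ennreal_add_left_cancel_le)
      then show ?thesis using t by (simp add: ennreal_mult_le_mult_iff)
    qed
    have "(\<lambda>n. \<integral>\<^sup>+y. ennreal (V (1 / Suc n) y) \<partial>M) \<longlonglongrightarrow> (\<integral>\<^sup>+y. ennreal (V 0 y) \<partial>M)"
    proof (rule nn_integral_dominated_convergence[where w = "\<lambda>y. ennreal s2 * ennreal (\<bar>G y + k y\<bar> powr s y)"])
      fix n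
      show "AE y in M. ennreal (V (1 / Suc n) y) \<le> ennreal s2 * ennreal (\<bar>G y + k y\<bar> powr s y)"
      proof (rule AE_I2)
        fix y
        let ?z = "G y + k y"
        have z: "0 \<le> ?z" using G0 k0 by auto
        have "1 / real (Suc n) * k y \<le> 1 * k y" using k0 by (intro mult_right_mono) auto
        then have "(G y + 1 / real (Suc n) * k y) powr (s y - 1) \<le> ?z powr (s y - 1)"
          using s_gt[of y] G0[of y] k0[of y] by (intro powr_mono2 add_left_mono) auto
        then have "V (1 / Suc n) y \<le> s2 * ?z powr (s y - 1) * ?z"
          unfolding V_def using s_gt[of y] s_le[of y] G0[of y] k0[of y] by (intro mult_mono) auto
        also have "\<dots> = s2 * ?z powr s y"
          using z by (cases "?z = 0") (auto simp: powr_mult_base mult.commute)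
        finally have "V (1 / Suc n) y \<le> s2 * \<bar>?z\<bar> powr s y" using z by simp
        moreover have "0 \<le> s2" using s_gt[of y] s_le[of y] by simp
        ultimately show "ennreal (V (1 / Suc n) y) \<le> ennreal s2 * ennreal (\<bar>?z\<bar> powr s y)"
          by (simp add: ennreal_leI flip: ennreal_mult)
      qed
      have "G \<in> rLp M s" "k \<in> rLp M s" using G_a a_fin kfin by (auto simp: rLp_def)
      then have "(\<lambda>y. G y + k y) \<in> rLp M s" using s by (intro rLp_add[OF s(1)]) auto
      then have "(\<integral>\<^sup>+y. ennreal (\<bar>G y + k y\<bar> powr s y) \<partial>M) < \<infinity>" by (simp add: rLp_def rmod_def)
      then show "(\<integral>\<^sup>+y. ennreal s2 * ennreal (\<bar>G y + k y\<bar> powr s y) \<partial>M) < \<infinity>"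
        by (subst nn_integral_cmult) (auto simp: ennreal_mult_less_top)
      show "AE y in M. (\<lambda>n. ennreal (V (1 / Suc n) y)) \<longlonglongrightarrow> ennreal (V 0 y)"
      proof (intro AE_I2 tendsto_ennrealI)
        fix y
        have "(\<lambda>n. G y + 1 / Suc n * k y) \<longlonglongrightarrow> G y + 0 * k y"
          by (intro tendsto_add tendsto_mult tendsto_const LIMSEQ_Suc lim_1_over_n)
        then show "(\<lambda>n. V (1 / Suc n) y) \<longlonglongrightarrow> V 0 y"
          unfolding V_def using s_gt[of y] G0[of y] k0[of y]
          by (intro tendsto_mult tendsto_const tendsto_powr') auto
      qed
    qed measurable
    then have "a \<le> (\<integral>\<^sup>+y. ennreal (V 0 y) \<partial>M)"
      by (rule LIMSEQ_le_const) (auto intro!: le_V)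
    then show "(INF g\<in>\<G>. rmod M s g) \<le> (\<integral>\<^sup>+x. ennreal (s x * G x powr (s x - 1) * k x) \<partial>M)"
      by (simp add: a_def V_def)
  qed (use G G0 in auto)
qed

text \<open>The concave counterpart, with a supremum and uniform concavity. The derivative of the
  power is singular where the maximiser vanishes, while \<open>0 powr (s x - 1)\<close> would
  silently be 0 there. Adding the positive function \<open>h0\<close> removes the singularity; since
  the derivative is decreasing, the shift preserves the upper bound.\<close>

lemma powr_modular_maximiser:
  fixes \<H> :: "('a \<Rightarrow> real) set" and s :: "'a \<Rightarrow> real"
  assumes s: "exponent_between M s s1 s2" "0 < s1" "s2 < 1"
    and meas: "\<And>g. g \<in> \<H> \<Longrightarrow> g \<in> borel_measurable M" and nonneg: "\<And>g x. g \<in> \<H> \<Longrightarrow> 0 \<le> g x"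
    and ne: "\<H> \<noteq> {}" and bound: "\<And>g. g \<in> \<H> \<Longrightarrow> rmod M s g \<le> ennreal B"
    and mid: "\<And>g h. g \<in> \<H> \<Longrightarrow> h \<in> \<H> \<Longrightarrow> (\<lambda>x. (g x + h x) / 2) \<in> \<H>"
  shows "\<exists>g\<in>borel_measurable M. (\<forall>x. 0 \<le> g x) \<and> rmod M s g \<le> ennreal B \<and>
    (\<forall>k\<in>borel_measurable M. \<forall>h0\<in>borel_measurable M. (\<forall>x. 0 \<le> k x) \<longrightarrow> (\<forall>x. 0 < h0 x) \<longrightarrow>
       (\<forall>h\<in>\<H>. \<forall>t>0. (\<lambda>x. (h x + t * k x) / (1 + t)) \<in> \<H>) \<longrightarrow>
       (\<integral>\<^sup>+x. ennreal (s x * (g x + h0 x) powr (s x - 1) * k x) \<partial>M) \<le> ennreal B)"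
proof -
  have [measurable]: "s \<in> borel_measurable M" by (rule exponent_betweenD[OF s(1)])
  have s_ge: "s1 \<le> s x" and s_le: "s x \<le> s2" for x using exponent_betweenD(2,3)[OF s(1)] by auto
  have s_gt: "0 < s x" "s x < 1" for x using s_ge[of x] s_le[of x] s(2,3) by auto
  define hf :: real where "hf = 1 / 2"
  have hf: "0 \<le> hf" by (simp add: hf_def)
  define a where "a = (SUP g\<in>\<H>. rmod M s g)"
  have le_a: "rmod M s g \<le> a" if "g \<in> \<H>" for g unfolding a_def using that by (rule SUP_upper)
  have a_B: "a \<le> ennreal B" unfolding a_def by (intro SUP_least bound)
  then have a_fin: "a < \<infinity>" by (auto intro: order.strict_trans1)
  have "\<exists>g\<in>\<H>. a \<le> rmod M s g + ennreal ((1/4) ^ n)" for n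
  proof (rule ccontr)
    assume "\<not> ?thesis"
    then have *: "rmod M s g + ennreal ((1/4) ^ n) < a" if "g \<in> \<H>" for g using that by (auto simp: not_le)
    have "rmod M s g \<le> a - ennreal ((1/4) ^ n)" if "g \<in> \<H>" for g
      using *[OF that] by (intro ennreal_le_minus_iff[THEN iffD2] disjI1 less_imp_le) (auto simp: add.commute)
    then have "a \<le> a - ennreal ((1/4) ^ n)" unfolding a_def by (intro SUP_least) auto
    moreover have "a - ennreal ((1/4) ^ n) < a"
    proof (rule ennreal_between)
      show "0 < a" using ne * by (metis all_not_in_conv not_gr_zero not_less_zero)
    qed (use a_fin in auto)
    ultimately show False by simp
  qed
  then obtain g where g: "\<And>n. g n \<in> \<H>" "\<And>n. a \<le> rmod M s (g n) + ennreal ((1/4) ^ n)" by metis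
  have [measurable]: "g n \<in> borel_measurable M" for n by (rule meas[OF g(1)])
  have gn: "0 \<le> g n x" for n x by (rule nonneg[OF g(1)])
  have gfin: "rmod M s (g n) < \<infinity>" for n using le_a[OF g(1)] a_fin by (auto intro: order.strict_trans1)
  define x where "x n y = g n y powr (s y / 2)" for n y
  have [measurable]: "x n \<in> borel_measurable M" for n unfolding x_def by measurable
  define c where "c = (1 - s2) / 8"
  have c: "0 < c" using s(3) by (simp add: c_def)
  have cauchy: "(\<integral>\<^sup>+y. ennreal ((x (Suc n) y - x n y)\<^sup>2) \<partial>M) \<le> ennreal (1 / c * (1/4) ^ n)" for n
  proof -
    let ?m = "\<lambda>y. (g (Suc n) y + g n y) / 2"
    let ?I = "\<integral>\<^sup>+y. ennreal ((x (Suc n) y - x n y)\<^sup>2) \<partial>M"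
    have g': "a \<le> rmod M s (g (Suc n)) + ennreal ((1/4) ^ n)"
    proof -
      have "a \<le> rmod M s (g (Suc n)) + ennreal ((1/4) ^ Suc n)" by (rule g(2))
      also have "\<dots> \<le> rmod M s (g (Suc n)) + ennreal ((1/4) ^ n)" by (intro add_left_mono ennreal_leI power_decreasing) auto
      finally show ?thesis .
    qed
    have half: "ennreal hf + ennreal hf = 1" by (subst ennreal_plus[symmetric]) (auto simp: hf_def)
    have "a = ennreal hf * a + ennreal hf * a" by (simp add: half flip: distrib_right)
    also have "\<dots> \<le> ennreal hf * (rmod M s (g (Suc n)) + ennreal ((1/4) ^ n)) + ennreal hf * (rmod M s (g n) + ennreal ((1/4) ^ n))"
      by (intro add_mono mult_left_mono g(2) g') auto
    also have "\<dots> = (ennreal hf * rmod M s (g (Suc n)) + ennreal hf * rmod M s (g n)) + (ennreal hf + ennreal hf) * ennreal ((1/4) ^ n)"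
      by (simp only: distrib_left distrib_right add_ac)
    finally have a1: "a \<le> (ennreal hf * rmod M s (g (Suc n)) + ennreal hf * rmod M s (g n)) + ennreal ((1/4) ^ n)"
      by (simp only: half mult_1)
    have "ennreal c * ?I + (ennreal hf * rmod M s (g (Suc n)) + ennreal hf * rmod M s (g n))
        = (\<integral>\<^sup>+y. ennreal c * ennreal ((x (Suc n) y - x n y)\<^sup>2)
              + (ennreal hf * ennreal (\<bar>g (Suc n) y\<bar> powr s y) + ennreal hf * ennreal (\<bar>g n y\<bar> powr s y)) \<partial>M)"
      unfolding rmod_def by (simp add: nn_integral_add nn_integral_cmult)
    also have "\<dots> \<le> rmod M s ?m"
      unfolding rmod_def
    proof (rule nn_integral_mono)
      fix y
      have arith: "A + (hf * B + hf * C) \<le> D" if "A \<le> D - (B + C) / 2" for A B C D :: real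
        using that by (simp add: add_divide_distrib hf_def)
      have abs_eq: "\<bar>g (Suc n) y\<bar> = g (Suc n) y" "\<bar>g n y\<bar> = g n y" "\<bar>?m y\<bar> = ?m y"
        using gn[of n y] gn[of "Suc n" y] by auto
      have "c * (x (Suc n) y - x n y)\<^sup>2 \<le> (?m y) powr s y - (g (Suc n) y powr s y + g n y powr s y) / 2"
        unfolding c_def x_def using s s_le s_gt gn by (intro powr_uniform_concavity) auto
      then have "c * (x (Suc n) y - x n y)\<^sup>2 + (hf * \<bar>g (Suc n) y\<bar> powr s y + hf * \<bar>g n y\<bar> powr s y) \<le> \<bar>?m y\<bar> powr s y"
        unfolding abs_eq by (rule arith)
      then show "ennreal c * ennreal ((x (Suc n) y - x n y)\<^sup>2)
          + (ennreal hf * ennreal (\<bar>g (Suc n) y\<bar> powr s y) + ennreal hf * ennreal (\<bar>g n y\<bar> powr s y))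
          \<le> ennreal (\<bar>?m y\<bar> powr s y)"
        using c hf by (simp add: ennreal_leI flip: ennreal_mult ennreal_plus)
    qed
    also have "\<dots> \<le> a" by (intro le_a mid g(1))
    finally have "ennreal c * ?I + (ennreal hf * rmod M s (g (Suc n)) + ennreal hf * rmod M s (g n))
        \<le> (ennreal hf * rmod M s (g (Suc n)) + ennreal hf * rmod M s (g n)) + ennreal ((1/4) ^ n)"
      using a1 by (rule order_trans)
    moreover have "ennreal hf * rmod M s (g (Suc n)) + ennreal hf * rmod M s (g n) < \<infinity>"
      using gfin by (simp add: ennreal_mult_less_top)
    ultimately have "ennreal c * ?I \<le> ennreal ((1/4) ^ n)"
      by (subst (asm) add.commute) (auto simp: ennreal_add_left_cancel_le)
    then have "ennreal c * ?I \<le> ennreal c * ennreal (1 / c * (1/4) ^ n)"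
      using c by (simp flip: ennreal_mult)
    then show ?thesis using c by (simp add: ennreal_mult_le_mult_iff)
  qed
  obtain G W where G[measurable]: "G \<in> borel_measurable M" and "\<forall>y. 0 \<le> G y" and W[measurable]: "W \<in> borel_measurable M"
    and W_fin: "(\<integral>\<^sup>+t. W t \<partial>M) < \<infinity>" and G_lim: "AE y in M. (\<lambda>n. g n y) \<longlonglongrightarrow> G y"
    and W_dom: "AE y in M. \<forall>n. ennreal (\<bar>g n y\<bar> powr s y) \<le> W y"
    by (rule powr_cauchy_dominated_limit[OF \<open>s \<in> borel_measurable M\<close> s_gt(1) meas[OF g(1)] gn gfin _ cauchy[unfolded x_def]])
      (use c in auto)
  then have G0: "0 \<le> G y" for y by blast
  have "(\<lambda>n. \<integral>\<^sup>+y. ennreal (\<bar>g n y\<bar> powr s y) \<partial>M) \<longlonglongrightarrow> (\<integral>\<^sup>+y. ennreal (\<bar>G y\<bar> powr s y) \<partial>M)"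
  proof (rule nn_integral_dominated_convergence[where w = W])
    show "AE y in M. ennreal (\<bar>g n y\<bar> powr s y) \<le> W y" for n
      using W_dom by eventually_elim blast
    show "AE y in M. (\<lambda>n. ennreal (\<bar>g n y\<bar> powr s y)) \<longlonglongrightarrow> ennreal (\<bar>G y\<bar> powr s y)"
      using G_lim
    proof eventually_elim
      fix y assume "(\<lambda>n. g n y) \<longlonglongrightarrow> G y"
      then show "(\<lambda>n. ennreal (\<bar>g n y\<bar> powr s y)) \<longlonglongrightarrow> ennreal (\<bar>G y\<bar> powr s y)"
        using s_gt[of y] by (intro tendsto_ennrealI tendsto_powr' tendsto_rabs tendsto_const) auto
    qed
  qed (use W_fin in auto)
  then have lim_rmod: "(\<lambda>n. rmod M s (g n)) \<longlonglongrightarrow> rmod M s G" by (simp add: rmod_def)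
  have "(\<lambda>n. rmod M s (g n) + ennreal ((1/4) ^ n)) \<longlonglongrightarrow> rmod M s G + ennreal 0"
    by (intro tendsto_add lim_rmod tendsto_ennrealI LIMSEQ_realpow_zero) auto
  then have "a \<le> rmod M s G + ennreal 0" using g(2) by (intro LIMSEQ_le_const) auto
  then have a_G: "a \<le> rmod M s G" by simp
  have G_a: "rmod M s G \<le> a" using le_a[OF g(1)] by (intro LIMSEQ_le_const2[OF lim_rmod]) auto
  show ?thesis
  proof (intro bexI[of _ G] conjI allI ballI impI)
    show "rmod M s G \<le> ennreal B" using G_a a_B by (rule order_trans)
    fix k h0 :: "'a \<Rightarrow> real" assume k[measurable]: "k \<in> borel_measurable M" and "\<forall>x. 0 \<le> k x"
      and h0[measurable]: "h0 \<in> borel_measurable M" and "\<forall>x. 0 < h0 x"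
      and "\<forall>h\<in>\<H>. \<forall>t>0. (\<lambda>x. (h x + t * k x) / (1 + t)) \<in> \<H>"
    then have k0: "\<And>x. 0 \<le> k x" and h0_pos: "\<And>x. 0 < h0 x"
      and dir: "\<And>h t. h \<in> \<H> \<Longrightarrow> 0 < t \<Longrightarrow> (\<lambda>x. (h x + t * k x) / (1 + t)) \<in> \<H>" by auto
    define V where "V t y = s y * (G y + t * k y + h0 y) powr (s y - 1) * k y" for t y
    have [measurable]: "V t \<in> borel_measurable M" for t unfolding V_def by measurable
    have V_le: "(\<integral>\<^sup>+y. ennreal (V t y) \<partial>M) \<le> a" if t: "0 < t" for t
    proof -
      \<comment> \<open>Exponents are below 1, so multiplication by 1 + t raises the modular by at
        most that factor; hence the difference quotient is at most \<open>a\<close>.\<close>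
      have step: "rmod M s (\<lambda>y. g n y + t * k y) \<le> ennreal (1 + t) * a" for n
      proof -
        have "rmod M s (\<lambda>y. g n y + t * k y) = rmod M s (\<lambda>y. (1 + t) * ((g n y + t * k y) / (1 + t)))"
          using t by (intro rmod_cong_AE) auto
        also have "\<dots> \<le> ennreal ((1 + t) powr s2) * rmod M s (\<lambda>y. (g n y + t * k y) / (1 + t))"
          using t by (intro rmod_cmult_ge1[OF s(1)]) auto
        also have "\<dots> \<le> ennreal ((1 + t) powr 1) * a"
          using t s(3) by (intro mult_mono ennreal_leI powr_mono le_a dir g(1)) auto
        finally show ?thesis using t by simp
      qed
      have "rmod M s (\<lambda>y. G y + t * k y) \<le> ennreal (1 + t) * a"
        unfolding rmod_def
      proof (rule nn_integral_fatou_le[where u = "\<lambda>n y. ennreal (\<bar>g n y + t * k y\<bar> powr s y)" and C = "\<lambda>_. ennreal (1 + t) * a"])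
        show "AE y in M. (\<lambda>n. ennreal (\<bar>g n y + t * k y\<bar> powr s y)) \<longlonglongrightarrow> ennreal (\<bar>G y + t * k y\<bar> powr s y)"
          using G_lim
        proof eventually_elim
          fix y assume "(\<lambda>n. g n y) \<longlonglongrightarrow> G y"
          then show "(\<lambda>n. ennreal (\<bar>g n y + t * k y\<bar> powr s y)) \<longlonglongrightarrow> ennreal (\<bar>G y + t * k y\<bar> powr s y)"
            using s_gt[of y] by (intro tendsto_ennrealI tendsto_powr' tendsto_rabs tendsto_add tendsto_const) auto
        qed
      qed (use step in \<open>auto simp: rmod_def\<close>)
      moreover have "a + ennreal t * (\<integral>\<^sup>+y. ennreal (V t y) \<partial>M) \<le> rmod M s (\<lambda>y. G y + t * k y)"
      proof -
        have "a + ennreal t * (\<integral>\<^sup>+y. ennreal (V t y) \<partial>M) \<le> rmod M s G + ennreal t * (\<integral>\<^sup>+y. ennreal (V t y) \<partial>M)"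
          by (intro add_right_mono a_G)
        also have "\<dots> = (\<integral>\<^sup>+y. ennreal (\<bar>G y\<bar> powr s y) + ennreal t * ennreal (V t y) \<partial>M)"
          unfolding rmod_def by (simp add: nn_integral_add nn_integral_cmult)
        also have "\<dots> \<le> rmod M s (\<lambda>y. G y + t * k y)"
          unfolding rmod_def
        proof (rule nn_integral_mono)
          fix y
          let ?z = "G y + t * k y"
          have z: "0 \<le> ?z" using G0[of y] k0[of y] t by auto
          have "G y powr s y + t * V t y \<le> ?z powr s y"
          proof (cases "?z = 0")
            case True
            then have "G y = 0" "k y = 0" using G0[of y] k0[of y] t by (auto simp: add_nonneg_eq_0_iff)
            then show ?thesis by (simp add: V_def)
          next
            case False
            then have zp: "0 < ?z" using z by simp
            have zz: "?z * ?z powr (s y - 1) = ?z powr s y" using zp by (simp add: powr_mult_base)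
            have "G y powr s y \<le> s y * G y * ?z powr (s y - 1) + (1 - s y) * ?z powr s y"
              using s_gt[of y] zp G0 by (intro powr_tangent_above) auto
            also have "\<dots> = ?z powr s y + s y * (G y * ?z powr (s y - 1) - ?z * ?z powr (s y - 1))"
              unfolding zz by (simp add: algebra_simps)
            also have "\<dots> = ?z powr s y - t * (s y * ?z powr (s y - 1) * k y)"
              by (simp add: algebra_simps)
            finally have 1: "G y powr s y + t * (s y * ?z powr (s y - 1) * k y) \<le> ?z powr s y" by simp
            have "(?z + h0 y) powr (s y - 1) \<le> ?z powr (s y - 1)"
              using zp h0_pos[of y] s_gt[of y] by (intro powr_mono2') auto
            then have "V t y \<le> s y * ?z powr (s y - 1) * k y"
              unfolding V_def using s_gt[of y] k0[of y] by (intro mult_right_mono mult_left_mono) auto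
            then have "t * V t y \<le> t * (s y * ?z powr (s y - 1) * k y)"
              using t by (intro mult_left_mono) auto
            with 1 show ?thesis by linarith
          qed
          moreover have "0 \<le> V t y" unfolding V_def using s_gt[of y] k0[of y] by simp
          ultimately show "ennreal (\<bar>G y\<bar> powr s y) + ennreal t * ennreal (V t y) \<le> ennreal (\<bar>?z\<bar> powr s y)"
            using z G0[of y] t by (simp add: ennreal_leI flip: ennreal_mult ennreal_plus)
        qed
        finally show ?thesis .
      qed
      ultimately have "a + ennreal t * (\<integral>\<^sup>+y. ennreal (V t y) \<partial>M) \<le> ennreal (1 + t) * a"
        by (rule order_trans[rotated])
      also have "ennreal (1 + t) * a = a + ennreal t * a"
        using t by (simp add: distrib_right)
      finally have "a + ennreal t * (\<integral>\<^sup>+y. ennreal (V t y) \<partial>M) \<le> a + ennreal t * a" .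
      then have "ennreal t * (\<integral>\<^sup>+y. ennreal (V t y) \<partial>M) \<le> ennreal t * a"
        using a_fin by (auto simp: ennreal_add_left_cancel_le)
      then show ?thesis using t by (simp add: ennreal_mult_le_mult_iff)
    qed
    \<comment> \<open>Only an upper bound is wanted, so Fatou's lemma takes the place of dominated
      convergence; the shift by \<open>h0\<close> makes the integrands converge pointwise.\<close>
    have "(\<integral>\<^sup>+y. ennreal (V 0 y) \<partial>M) \<le> a"
    proof (rule nn_integral_fatou_le[where u = "\<lambda>n y. ennreal (V (1 / Suc n) y)" and C = "\<lambda>_. a"])
      show "AE y in M. (\<lambda>n. ennreal (V (1 / Suc n) y)) \<longlonglongrightarrow> ennreal (V 0 y)"
      proof (intro AE_I2 tendsto_ennrealI)
        fix y
        have "(\<lambda>n. G y + 1 / Suc n * k y + h0 y) \<longlonglongrightarrow> G y + 0 * k y + h0 y"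
          by (intro tendsto_add tendsto_mult tendsto_const LIMSEQ_Suc lim_1_over_n)
        then show "(\<lambda>n. V (1 / Suc n) y) \<longlonglongrightarrow> V 0 y"
          unfolding V_def using G0[of y] h0_pos[of y]
          by (intro tendsto_mult tendsto_const tendsto_powr) auto
      qed
    qed (use V_le in auto)
    also have "a \<le> ennreal B" by (rule a_B)
    finally show "(\<integral>\<^sup>+x. ennreal (s x * (G x + h0 x) powr (s x - 1) * k x) \<partial>M) \<le> ennreal B"
      by (simp add: V_def)
  qed (use G G0 in auto)
qed

section \<open>Factorization through weights\<close>

text \<open>Each pair couples an input with an output function, so that a constraint on one
  component restricts the modular of the other. The closure properties make the admissible sets of
  the two extremal problems below convex.\<close>

definition function_cone :: "'b measure \<Rightarrow> 'a measure \<Rightarrow> (('b \<Rightarrow> real) \<times> ('a \<Rightarrow> real)) set \<Rightarrow> bool" where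
  "function_cone M N \<K> \<longleftrightarrow>
     (\<forall>g h. (g, h) \<in> \<K> \<longrightarrow>
        g \<in> borel_measurable M \<and> h \<in> borel_measurable N \<and> (\<forall>y. 0 \<le> g y) \<and> (\<forall>x. 0 \<le> h x)) \<and>
     (\<lambda>_. 0, \<lambda>_. 0) \<in> \<K> \<and>
     (\<forall>g h g' h'. (g, h) \<in> \<K> \<longrightarrow> (g', h') \<in> \<K> \<longrightarrow> (\<lambda>y. g y + g' y, \<lambda>x. h x + h' x) \<in> \<K>) \<and>
     (\<forall>c g h. 0 < c \<longrightarrow> (g, h) \<in> \<K> \<longrightarrow> (\<lambda>y. c * g y, \<lambda>x. c * h x) \<in> \<K>)"

lemma function_coneD:
  assumes "function_cone M N \<K>"
  shows "(g, h) \<in> \<K> \<Longrightarrow> g \<in> borel_measurable M" "(g, h) \<in> \<K> \<Longrightarrow> h \<in> borel_measurable N"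
    "(g, h) \<in> \<K> \<Longrightarrow> 0 \<le> g y" "(g, h) \<in> \<K> \<Longrightarrow> 0 \<le> h x" "(\<lambda>_. 0, \<lambda>_. 0) \<in> \<K>"
    "(g, h) \<in> \<K> \<Longrightarrow> (g', h') \<in> \<K> \<Longrightarrow> (\<lambda>y. g y + g' y, \<lambda>x. h x + h' x) \<in> \<K>"
    "0 < c \<Longrightarrow> (g, h) \<in> \<K> \<Longrightarrow> (\<lambda>y. c * g y, \<lambda>x. c * h x) \<in> \<K>"
  using assms unfolding function_cone_def by simp_all

lemma exponent_between_conjugate:
  assumes "exponent_between M s a b" "1 < a"
  shows "exponent_between M (\<lambda>x. s x / (s x - 1)) 1 (b / (a - 1))"
proof -
  have [measurable]: "s \<in> borel_measurable M" by (rule exponent_betweenD[OF assms(1)])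
  have "1 \<le> s x / (s x - 1) \<and> s x / (s x - 1) \<le> b / (a - 1)" for x
  proof
    have x: "a \<le> s x" "s x \<le> b" using exponent_betweenD(2,3)[OF assms(1), of x] by auto
    show "1 \<le> s x / (s x - 1)" using x assms(2) by (simp add: field_simps)
    show "s x / (s x - 1) \<le> b / (a - 1)" using x assms(2) by (intro frac_le) auto
  qed
  then show ?thesis by (simp add: exponent_between_def)
qed

lemma exponent_between_concave_conjugate:
  assumes "exponent_between M s a b" "0 \<le> a" "b < 1"
  shows "exponent_between M (\<lambda>x. s x / (1 - s x)) a (b / (1 - b))"
proof -
  have [measurable]: "s \<in> borel_measurable M" by (rule exponent_betweenD[OF assms(1)])
  have "a \<le> s x / (1 - s x) \<and> s x / (1 - s x) \<le> b / (1 - b)" for x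
  proof -
    have s: "a \<le> s x" "s x \<le> b" using exponent_betweenD(2,3)[OF assms(1), of x] by auto
    have "s x * (1 - s x) \<le> s x" using s assms by (simp add: mult_left_le)
    then have "s x \<le> s x / (1 - s x)" using s assms by (simp add: pos_le_divide_eq)
    moreover have "s x / (1 - s x) \<le> b / (1 - b)" using s assms by (intro frac_le) auto
    ultimately show ?thesis using s by simp
  qed
  then show ?thesis by (simp add: exponent_between_def)
qed

lemma young_integral:
  assumes \<sigma>: "exponent_between N \<sigma> \<sigma>1 \<sigma>2" "1 < \<sigma>1"
    and h: "h \<in> borel_measurable N" "\<And>x. 0 \<le> h x" and u: "u \<in> borel_measurable N" "\<And>x. 0 \<le> u x"
  shows "(\<integral>\<^sup>+x. ennreal (h x * u x) \<partial>N) \<le> rmod N \<sigma> h + rmod N (\<lambda>x. \<sigma> x / (\<sigma> x - 1)) u"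
proof -
  have [measurable]: "\<sigma> \<in> borel_measurable N" by (rule exponent_betweenD[OF \<sigma>(1)])
  note h(1)[measurable] u(1)[measurable]
  have "(\<integral>\<^sup>+x. ennreal (h x * u x) \<partial>N)
      \<le> (\<integral>\<^sup>+x. ennreal (\<bar>h x\<bar> powr \<sigma> x) + ennreal (\<bar>u x\<bar> powr (\<sigma> x / (\<sigma> x - 1))) \<partial>N)"
  proof (rule nn_integral_mono)
    fix x
    have s: "1 < \<sigma> x" using exponent_betweenD(2)[OF \<sigma>(1), of x] \<sigma>(2) by simp
    have "h x * u x \<le> h x powr \<sigma> x / \<sigma> x + u x powr (\<sigma> x / (\<sigma> x - 1)) / (\<sigma> x / (\<sigma> x - 1))"
      using s h(2) u(2) by (intro Youngs_inequality) (auto simp: field_simps)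
    also have "\<dots> \<le> h x powr \<sigma> x / 1 + u x powr (\<sigma> x / (\<sigma> x - 1)) / 1"
      using s by (intro add_mono divide_left_mono) (auto simp: field_simps)
    finally have "h x * u x \<le> \<bar>h x\<bar> powr \<sigma> x + \<bar>u x\<bar> powr (\<sigma> x / (\<sigma> x - 1))"
      using h(2) u(2) by simp
    then show "ennreal (h x * u x) \<le> ennreal (\<bar>h x\<bar> powr \<sigma> x) + ennreal (\<bar>u x\<bar> powr (\<sigma> x / (\<sigma> x - 1)))"
      by (simp add: ennreal_leI flip: ennreal_plus)
  qed
  also have "\<dots> = rmod N \<sigma> h + rmod N (\<lambda>x. \<sigma> x / (\<sigma> x - 1)) u"
    unfolding rmod_def by (rule nn_integral_add) measurable
  finally show ?thesis .
qed

text \<open>For exponents below 1 Young's inequality runs in the reverse direction: g powr s is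
  split into (g / u) powr s and a power of \<open>u\<close>, which leads to the concave conjugate s
  / (1 - s).\<close>

lemma young_integral_concave:
  assumes s: "exponent_between M s s1 s2" "0 < s1" "s2 < 1"
    and g: "g \<in> borel_measurable M" "\<And>y. 0 \<le> g y" and u: "u \<in> borel_measurable M" "AE y in M. 0 < u y"
  shows "rmod M s g \<le> (\<integral>\<^sup>+y. ennreal (g y * inverse (u y)) \<partial>M) + rmod M (\<lambda>y. s y / (1 - s y)) u"
proof -
  have [measurable]: "s \<in> borel_measurable M" by (rule exponent_betweenD[OF s(1)])
  note g(1)[measurable] u(1)[measurable]
  have s_gt: "0 < s x" "s x < 1" for x using exponent_betweenD(2,3)[OF s(1), of x] s by auto
  have "rmod M s g \<le> (\<integral>\<^sup>+y. ennreal (g y * inverse (u y)) + ennreal (\<bar>u y\<bar> powr (s y / (1 - s y))) \<partial>M)"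
    unfolding rmod_def
  proof (rule nn_integral_mono_AE, use u(2) in eventually_elim)
    fix y assume uy: "0 < u y"
    have gy: "0 \<le> g y" by (rule g(2))
    have "g y powr s y = (g y / u y) powr s y * (u y powr (s y / (1 - s y))) powr (1 - s y)"
      using uy gy s_gt[of y] by (simp add: powr_divide powr_powr)
    also have "\<dots> \<le> s y * (g y / u y) + (1 - s y) * u y powr (s y / (1 - s y))"
      using uy gy s_gt[of y] by (intro young_powr) auto
    also have "\<dots> \<le> 1 * (g y / u y) + 1 * u y powr (s y / (1 - s y))"
      using uy gy s_gt[of y] by (intro add_mono mult_right_mono) auto
    finally have "g y powr s y \<le> g y * inverse (u y) + u y powr (s y / (1 - s y))"
      by (simp add: divide_inverse)
    then show "ennreal (\<bar>g y\<bar> powr s y) \<le> ennreal (g y * inverse (u y)) + ennreal (\<bar>u y\<bar> powr (s y / (1 - s y)))"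
      using uy gy by (simp add: ennreal_leI flip: ennreal_plus)
  qed
  also have "\<dots> = (\<integral>\<^sup>+y. ennreal (g y * inverse (u y)) \<partial>M) + rmod M (\<lambda>y. s y / (1 - s y)) u"
    unfolding rmod_def by (rule nn_integral_add) measurable
  finally show ?thesis .
qed

lemma nn_integral_weight_cmult:
  assumes "0 \<le> c" "k \<in> borel_measurable M"
  shows "(\<integral>\<^sup>+x. ennreal (c * k x) \<partial>M) = ennreal c * (\<integral>\<^sup>+x. ennreal (k x) \<partial>M)"
proof -
  have "(\<integral>\<^sup>+x. ennreal (c * k x) \<partial>M) = (\<integral>\<^sup>+x. ennreal c * ennreal (k x) \<partial>M)"
    using assms(1) by (intro nn_integral_cong ennreal_mult') auto
  then show ?thesis using assms(2) by (simp add: nn_integral_cmult)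
qed

lemma function_cone_segment:
  assumes cone: "function_cone M N \<K>" and g: "(g, h) \<in> \<K>" "(g', h') \<in> \<K>" and t: "0 < t"
  shows "(\<lambda>y. (g y + t * g' y) / (1 + t), \<lambda>x. (h x + t * h' x) / (1 + t)) \<in> \<K>"
proof -
  note D = function_coneD[OF cone]
  have "(\<lambda>y. 1 / (1 + t) * (g y + t * g' y), \<lambda>x. 1 / (1 + t) * (h x + t * h' x)) \<in> \<K>"
    using t by (intro D(7) D(6)[OF g(1)] D(7)[OF t g(2)]) auto
  then show ?thesis by simp
qed

lemma nn_integral_segment:
  assumes h: "h \<in> borel_measurable M" "\<And>x. 0 \<le> h x" and h': "h' \<in> borel_measurable M" "\<And>x. 0 \<le> h' x"
    and w: "w \<in> borel_measurable M" "AE x in M. 0 \<le> w x" and t: "0 < t"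
  shows "(\<integral>\<^sup>+x. ennreal (h x * w x) \<partial>M) \<le> 1 \<Longrightarrow> (\<integral>\<^sup>+x. ennreal (h' x * w x) \<partial>M) \<le> 1 \<Longrightarrow>
      (\<integral>\<^sup>+x. ennreal ((h x + t * h' x) / (1 + t) * w x) \<partial>M) \<le> 1" (is "?I \<le> 1 \<Longrightarrow> ?I' \<le> 1 \<Longrightarrow> ?S \<le> 1")
    and "1 \<le> (\<integral>\<^sup>+x. ennreal (h x * w x) \<partial>M) \<Longrightarrow> 1 \<le> (\<integral>\<^sup>+x. ennreal (h' x * w x) \<partial>M) \<Longrightarrow>
      1 \<le> (\<integral>\<^sup>+x. ennreal ((h x + t * h' x) / (1 + t) * w x) \<partial>M)"
proof -
  note [measurable] = h(1) h'(1) w(1)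
  define c d where "c = 1 / (1 + t)" and "d = t / (1 + t)"
  have cd: "0 \<le> c" "0 \<le> d" "c + d = 1" using t by (auto simp: c_def d_def field_simps)
  have "?S = (\<integral>\<^sup>+x. ennreal c * ennreal (h x * w x) + ennreal d * ennreal (h' x * w x) \<partial>M)"
  proof (rule nn_integral_cong_AE, use w(2) in eventually_elim)
    fix x assume "0 \<le> w x"
    moreover have "(h x + t * h' x) / (1 + t) * w x = c * (h x * w x) + d * (h' x * w x)"
      by (simp add: c_def d_def add_divide_distrib distrib_right mult.assoc)
    ultimately show "ennreal ((h x + t * h' x) / (1 + t) * w x) = ennreal c * ennreal (h x * w x) + ennreal d * ennreal (h' x * w x)"
      using h(2)[of x] h'(2)[of x] cd by (simp flip: ennreal_mult ennreal_plus)
  qed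
  then have S: "?S = ennreal c * ?I + ennreal d * ?I'" by (simp add: nn_integral_add nn_integral_cmult)
  have one: "ennreal c + ennreal d = 1" using cd by (simp flip: ennreal_plus)
  show "?I \<le> 1 \<Longrightarrow> ?I' \<le> 1 \<Longrightarrow> ?S \<le> 1"
    unfolding S using add_mono[OF mult_left_mono[of ?I 1 "ennreal c"] mult_left_mono[of ?I' 1 "ennreal d"]] one by simp
  show "1 \<le> ?I \<Longrightarrow> 1 \<le> ?I' \<Longrightarrow> 1 \<le> ?S"
    unfolding S using add_mono[OF mult_left_mono[of 1 ?I "ennreal c"] mult_left_mono[of 1 ?I' "ennreal d"]] one by simp
qed

text \<open>For a fixed \<open>u\<close> the modular of \<open>g\<close> is minimised under the
  constraint \<open>1 \<le> J h\<close>. Young's inequality and the assumed bound on the cone keep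
  the minimum \<open>a\<close> away from 0. By the variational inequality every pair satisfies a * J
  h \<le> \<integral> k V, with \<open>V\<close> the derivative at the minimiser; \<open>U\<close>
  is \<open>V\<close> divided by a bound for its conjugate modular.\<close>

lemma factorization_convex:
  fixes \<K> :: "(('b \<Rightarrow> real) \<times> ('a \<Rightarrow> real)) set"
  assumes cone: "function_cone M N \<K>"
    and s: "exponent_between M s s1 s2" "1 < s1" and \<sigma>: "exponent_between N \<sigma> \<sigma>1 \<sigma>2" "1 < \<sigma>1"
    and fin: "\<And>g h. (g, h) \<in> \<K> \<Longrightarrow> rmod M s g < \<infinity>"
    and ext: "\<And>g h. (g, h) \<in> \<K> \<Longrightarrow> rmod M s g \<le> 1 \<Longrightarrow> rmod N \<sigma> h \<le> ennreal C" and C: "0 \<le> C"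
  shows "\<exists>K>0. \<forall>u\<in>borel_measurable N. (\<forall>x. 0 \<le> u x) \<longrightarrow> rmod N (\<lambda>x. \<sigma> x / (\<sigma> x - 1)) u \<le> 1 \<longrightarrow>
    (\<exists>U\<in>borel_measurable M. (\<forall>y. 0 \<le> U y) \<and> rmod M (\<lambda>y. s y / (s y - 1)) U \<le> 1 \<and>
      (\<forall>(g, h)\<in>\<K>. (\<integral>\<^sup>+x. ennreal (h x * u x) \<partial>N) \<le> ennreal K * (\<integral>\<^sup>+y. ennreal (g y * U y) \<partial>M)))"
proof -
  note coneD = function_coneD[OF cone]
  have [measurable]: "s \<in> borel_measurable M" by (rule exponent_betweenD[OF s(1)])
  have s_ge: "s1 \<le> s x" and s_le: "s x \<le> s2" for x using exponent_betweenD(2,3)[OF s(1)] by auto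
  have s_gt: "1 < s x" for x using s_ge[of x] s(2) by simp
  have s2: "1 < s2" using s_gt s_le order.strict_trans1 order.strict_trans2 by blast
  \<comment> \<open>If a constrained \<open>g\<close> had modular at most
    \<open>1 / l powr s2\<close>, the pair multiplied by \<open>l\<close> would have input modular
    at most 1, and Young's inequality would force l \<le> C + 1.\<close>
  define l where "l = C + 2"
  have l: "1 \<le> l" using C by (simp add: l_def)
  \<comment> \<open>A bound for s powr (s / (s - 1)) over all exponents that occur, the factor
    between the conjugate modular of s * g powr (s - 1) and the modular of \<open>g\<close>.\<close>
  define Bd where "Bd = s2 powr (s2 / (s1 - 1))"
  have Bd: "0 < Bd" using s2 by (simp add: Bd_def)
  define K where "K = l powr s2 + Bd"
  show ?thesis
  proof (intro exI[of _ K] conjI ballI impI)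
    show "0 < K" using Bd by (simp add: K_def add_nonneg_pos)
    fix u assume u[measurable]: "u \<in> borel_measurable N" and u0: "\<forall>x. 0 \<le> u x"
      and u1: "rmod N (\<lambda>x. \<sigma> x / (\<sigma> x - 1)) u \<le> 1"
    define J where "J h = (\<integral>\<^sup>+x. ennreal (h x * u x) \<partial>N)" for h :: "'a \<Rightarrow> real"
    have J_scale: "J (\<lambda>x. c * h x) = ennreal c * J h" if "0 \<le> c" "(g, h) \<in> \<K>" for c g h
      using nn_integral_weight_cmult[of c "\<lambda>x. h x * u x" N] coneD(2)[OF that(2)] that(1)
      by (simp add: J_def mult.assoc)
    define \<G> where "\<G> = {g. \<exists>h. (g, h) \<in> \<K> \<and> 1 \<le> J h}"
    have G_combine: "(\<lambda>y. (g y + t * k y) / (1 + t)) \<in> \<G>" if "g \<in> \<G>" "k \<in> \<G>" "0 < t" for g k t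
    proof -
      obtain h h' where h: "(g, h) \<in> \<K>" "1 \<le> J h" "(k, h') \<in> \<K>" "1 \<le> J h'"
        using \<open>g \<in> \<G>\<close> \<open>k \<in> \<G>\<close> unfolding \<G>_def by blast
      have "1 \<le> J (\<lambda>x. (h x + t * h' x) / (1 + t))"
        unfolding J_def using h coneD(2,4) u0 that(3) by (intro nn_integral_segment(2)) (auto simp: J_def)
      then show ?thesis
        using function_cone_segment[OF cone h(1,3) \<open>0 < t\<close>] by (auto simp: \<G>_def)
    qed
    show "\<exists>U\<in>borel_measurable M. (\<forall>y. 0 \<le> U y) \<and> rmod M (\<lambda>y. s y / (s y - 1)) U \<le> 1 \<and>
      (\<forall>(g, h)\<in>\<K>. (\<integral>\<^sup>+x. ennreal (h x * u x) \<partial>N) \<le> ennreal K * (\<integral>\<^sup>+y. ennreal (g y * U y) \<partial>M))"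
    proof (cases "\<G> = {}")
      case True
      \<comment> \<open>A pair with positive \<open>J h\<close> could be scaled to satisfy the
        constraint. So all these integrals vanish, and the zero weight will do.\<close>
      have "J h = 0" if gh: "(g, h) \<in> \<K>" for g h
      proof (rule ccontr)
        assume "J h \<noteq> 0"
        have "\<exists>c>0. ennreal c \<le> J h"
        proof (cases "J h")
          case (real c)
          then show ?thesis using \<open>J h \<noteq> 0\<close> by (intro exI[of _ c]) auto
        qed (auto intro: exI[of _ 1])
        then obtain c where c: "0 < c" "ennreal c \<le> J h" by blast
        have "(\<lambda>y. 1 / c * g y, \<lambda>x. 1 / c * h x) \<in> \<K>" using c gh by (intro coneD(7)) auto
        moreover have "1 \<le> J (\<lambda>x. 1 / c * h x)"
        proof -
          have "1 = ennreal (1 / c) * ennreal c" using c by (subst ennreal_mult[symmetric]) auto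
          also have "\<dots> \<le> ennreal (1 / c) * J h" using c by (intro mult_left_mono) auto
          also have "\<dots> = J (\<lambda>x. 1 / c * h x)" using c gh by (intro J_scale[symmetric]) auto
          finally show ?thesis .
        qed
        ultimately show False using True by (auto simp: \<G>_def)
      qed
      then show ?thesis by (intro bexI[of _ "\<lambda>_. 0"]) (auto simp: J_def rmod_def)
    next
      case False
      have lower: "ennreal (1 / l powr s2) \<le> rmod M s g" if "g \<in> \<G>" for g
      proof (rule ccontr)
        assume "\<not> ?thesis"
        then have small: "rmod M s g \<le> ennreal (1 / l powr s2)" by simp
        obtain h where h: "(g, h) \<in> \<K>" "1 \<le> J h" using \<open>g \<in> \<G>\<close> by (auto simp: \<G>_def)
        have lh: "(\<lambda>y. l * g y, \<lambda>x. l * h x) \<in> \<K>" using l h by (intro coneD(7)) auto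
        have "rmod M s (\<lambda>y. l * g y) \<le> ennreal (l powr s2) * rmod M s g"
          using l h coneD(1) by (intro rmod_cmult_ge1[OF s(1)]) auto
        also have "\<dots> \<le> ennreal (l powr s2) * ennreal (1 / l powr s2)"
          by (intro mult_left_mono small) auto
        also have "\<dots> = 1" using l by (subst ennreal_mult[symmetric]) auto
        finally have hC: "rmod N \<sigma> (\<lambda>x. l * h x) \<le> ennreal C" by (rule ext[OF lh])
        have "ennreal l = ennreal l * 1" by simp
        also have "\<dots> \<le> ennreal l * J h" by (intro mult_left_mono h) auto
        also have "\<dots> = J (\<lambda>x. l * h x)" using l h by (intro J_scale[symmetric]) auto
        also have "\<dots> \<le> rmod N \<sigma> (\<lambda>x. l * h x) + rmod N (\<lambda>x. \<sigma> x / (\<sigma> x - 1)) u"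
          unfolding J_def using coneD(2,4)[OF lh] u0 by (intro young_integral[OF \<sigma>]) auto
        also have "\<dots> \<le> ennreal C + 1" by (intro add_mono hC u1)
        also have "\<dots> = ennreal (C + 1)" using C by simp
        finally show False using C by (simp add: l_def)
      qed
      have "\<exists>g\<in>borel_measurable M. (\<forall>x. 0 \<le> g x) \<and> rmod M s g = (INF g\<in>\<G>. rmod M s g) \<and>
        (\<forall>k\<in>borel_measurable M. (\<forall>x. 0 \<le> k x) \<longrightarrow> rmod M s k < \<infinity> \<longrightarrow>
           (\<forall>h\<in>\<G>. \<forall>t>0. (\<lambda>x. (h x + t * k x) / (1 + t)) \<in> \<G>) \<longrightarrow>
           (INF g\<in>\<G>. rmod M s g) \<le> (\<integral>\<^sup>+x. ennreal (s x * g x powr (s x - 1) * k x) \<partial>M))"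
      proof (rule powr_modular_minimiser[OF s])
        show "g \<in> borel_measurable M" "rmod M s g < \<infinity>" if "g \<in> \<G>" for g
          using that coneD(1) fin by (auto simp: \<G>_def)
        show "0 \<le> g x" if "g \<in> \<G>" for g x
          using that coneD(3) by (auto simp: \<G>_def)
        show "(\<lambda>x. (g x + h x) / 2) \<in> \<G>" if "g \<in> \<G>" "h \<in> \<G>" for g h
          using G_combine[OF that, of 1] by simp
        show "\<G> \<noteq> {}" by (rule False)
      qed
      then obtain g where g[measurable]: "g \<in> borel_measurable M" and g0: "\<And>x. 0 \<le> g x"
        and ga: "rmod M s g = (INF g\<in>\<G>. rmod M s g)"
        and var: "\<And>k. k \<in> borel_measurable M \<Longrightarrow> (\<forall>x. 0 \<le> k x) \<Longrightarrow> rmod M s k < \<infinity> \<Longrightarrow>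
          (\<forall>h\<in>\<G>. \<forall>t>0. (\<lambda>x. (h x + t * k x) / (1 + t)) \<in> \<G>) \<Longrightarrow>
          (INF g\<in>\<G>. rmod M s g) \<le> (\<integral>\<^sup>+x. ennreal (s x * g x powr (s x - 1) * k x) \<partial>M)"
        by blast
      have a_ge: "ennreal (1 / l powr s2) \<le> rmod M s g" unfolding ga by (intro INF_greatest lower)
      have "rmod M s g < \<infinity>"
      proof -
        obtain g' where "g' \<in> \<G>" using False by auto
        then have "rmod M s g \<le> rmod M s g'" "rmod M s g' < \<infinity>"
          unfolding ga using fin by (auto simp: \<G>_def intro!: INF_lower)
        then show ?thesis by (rule order.strict_trans1)
      qed
      then obtain a where a: "rmod M s g = ennreal a" "0 \<le> a" by (cases "rmod M s g") auto
      have a_ge': "1 / l powr s2 \<le> a" using a_ge a by simp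
      have a_pos: "0 < a" using a_ge' l by (intro less_le_trans[OF _ a_ge']) auto
      define V where "V y = s y * g y powr (s y - 1)" for y
      have [measurable]: "V \<in> borel_measurable M" unfolding V_def by measurable
      have V0: "0 \<le> V y" for y using s_gt[of y] by (simp add: V_def)
      have key: "ennreal a * J h \<le> (\<integral>\<^sup>+y. ennreal (k y * V y) \<partial>M)" if kh: "(k, h) \<in> \<K>" for k h
      proof -
        have [measurable]: "k \<in> borel_measurable M" by (rule coneD(1)[OF kh])
        \<comment> \<open>\<open>J h\<close> may be infinite, so the inequality is proved for every
          finite \<open>c\<close> below it.\<close>
        have c_bound: "ennreal a * ennreal c \<le> (\<integral>\<^sup>+y. ennreal (k y * V y) \<partial>M)" if c: "0 < c" "ennreal c \<le> J h" for c
        proof -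
          have kc: "(\<lambda>y. 1 / c * k y, \<lambda>x. 1 / c * h x) \<in> \<K>" using c kh by (intro coneD(7)) auto
          have "1 = ennreal (1 / c) * ennreal c" using c by (subst ennreal_mult[symmetric]) auto
          also have "\<dots> \<le> ennreal (1 / c) * J h" using c by (intro mult_left_mono) auto
          also have "\<dots> = J (\<lambda>x. 1 / c * h x)" using c kh by (intro J_scale[symmetric]) auto
          finally have kG: "(\<lambda>y. 1 / c * k y) \<in> \<G>" using kc by (auto simp: \<G>_def)
          have "ennreal a \<le> (\<integral>\<^sup>+y. ennreal (s y * g y powr (s y - 1) * (1 / c * k y)) \<partial>M)"
            unfolding a(1)[symmetric] ga
            using coneD(1)[OF kc] coneD(3)[OF kc] fin[OF kc] G_combine[OF _ kG] by (intro var) auto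
          also have "\<dots> = (\<integral>\<^sup>+y. ennreal (1 / c) * ennreal (k y * V y) \<partial>M)"
            using c coneD(3)[OF kh] V0
            by (intro nn_integral_cong) (simp add: V_def mult_ac flip: ennreal_mult)
          also have "\<dots> = ennreal (1 / c) * (\<integral>\<^sup>+y. ennreal (k y * V y) \<partial>M)"
            by (rule nn_integral_cmult) measurable
          finally have "ennreal c * ennreal a \<le> ennreal c * (ennreal (1 / c) * (\<integral>\<^sup>+y. ennreal (k y * V y) \<partial>M))"
            by (rule mult_left_mono) auto
          also have "\<dots> = (\<integral>\<^sup>+y. ennreal (k y * V y) \<partial>M)"
            using c by (simp flip: mult.assoc ennreal_mult)
          finally show ?thesis by (simp only: mult.commute)
        qed
        show ?thesis
        proof (cases "J h")
          case (real c)
          then show ?thesis using c_bound[of c] by (cases "c = 0") auto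
        next
          case top
          have large: "ennreal n \<le> (\<integral>\<^sup>+y. ennreal (k y * V y) \<partial>M)" if "0 < n" for n
            using c_bound[of "n / a"] a_pos that top by (simp flip: ennreal_mult)
          have "(\<integral>\<^sup>+y. ennreal (k y * V y) \<partial>M) = top"
          proof (rule ccontr)
            assume "\<not> ?thesis"
            then obtain i where i: "(\<integral>\<^sup>+y. ennreal (k y * V y) \<partial>M) = ennreal i" "0 \<le> i"
              by (cases "\<integral>\<^sup>+y. ennreal (k y * V y) \<partial>M") auto
            have "ennreal (i + 1) \<le> ennreal i"
              using large[of "i + 1"] i by simp
            then show False using i by simp
          qed
          then show ?thesis by simp
        qed
      qed
      define \<Lambda> where "\<Lambda> = max 1 (Bd * a)"
      have \<Lambda>: "1 \<le> \<Lambda>" "Bd * a \<le> \<Lambda>" by (auto simp: \<Lambda>_def)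
      define U where "U y = 1 / \<Lambda> * V y" for y
      have [measurable]: "U \<in> borel_measurable M" unfolding U_def by measurable
      have "rmod M (\<lambda>y. s y / (s y - 1)) V \<le> (\<integral>\<^sup>+y. ennreal Bd * ennreal (\<bar>g y\<bar> powr s y) \<partial>M)"
        unfolding rmod_def
      proof (rule nn_integral_mono)
        fix y
        have e: "(s y - 1) * (s y / (s y - 1)) = s y" using s_gt[of y] by simp
        have "\<bar>V y\<bar> powr (s y / (s y - 1)) = s y powr (s y / (s y - 1)) * g y powr s y"
          using V0[of y] s_gt[of y] e by (simp add: V_def powr_mult powr_powr)
        also have "s y powr (s y / (s y - 1)) \<le> s2 powr (s y / (s y - 1))"
          using s_gt[of y] s_le[of y] by (intro powr_mono2) auto
        also have "\<dots> \<le> Bd"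
          unfolding Bd_def using s2 s_gt[of y] s_le[of y] s_ge[of y] s(2) by (intro powr_mono frac_le) auto
        finally show "ennreal (\<bar>V y\<bar> powr (s y / (s y - 1))) \<le> ennreal Bd * ennreal (\<bar>g y\<bar> powr s y)"
          using g0[of y] Bd by (simp add: ennreal_leI mult_right_mono flip: ennreal_mult)
      qed
      also have "\<dots> = ennreal Bd * ennreal a"
        unfolding a(1)[symmetric] rmod_def by (rule nn_integral_cmult) measurable
      finally have V_mod: "rmod M (\<lambda>y. s y / (s y - 1)) V \<le> ennreal (Bd * a)"
        using Bd a by (simp add: ennreal_mult)
      have "rmod M (\<lambda>y. s y / (s y - 1)) U \<le> ennreal ((1 / \<Lambda>) powr 1) * rmod M (\<lambda>y. s y / (s y - 1)) V"
        unfolding U_def using \<Lambda> by (intro rmod_cmult_le1[OF exponent_between_conjugate[OF s]]) auto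
      also have "\<dots> \<le> ennreal (1 / \<Lambda>) * ennreal \<Lambda>"
        using \<Lambda> V_mod by (intro mult_mono order_trans[OF V_mod] ennreal_leI) auto
      also have "\<dots> = 1" using \<Lambda> by (subst ennreal_mult[symmetric]) auto
      finally have U_mod: "rmod M (\<lambda>y. s y / (s y - 1)) U \<le> 1" .
      have K_ge: "\<Lambda> / a \<le> K"
      proof -
        have "\<Lambda> / a \<le> (1 + Bd * a) / a" using a_pos Bd by (intro divide_right_mono) (auto simp: \<Lambda>_def)
        also have "\<dots> = 1 / a + Bd" using a_pos by (simp add: field_simps)
        also have "1 / a \<le> l powr s2" using a_ge' a_pos l by (simp add: field_simps)
        finally show ?thesis by (simp add: K_def)
      qed
      have main: "J h \<le> ennreal K * (\<integral>\<^sup>+y. ennreal (k y * U y) \<partial>M)" if kh: "(k, h) \<in> \<K>" for k h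
      proof -
        have [measurable]: "k \<in> borel_measurable M" by (rule coneD(1)[OF kh])
        have "J h = ennreal (1 / a) * (ennreal a * J h)"
          using a_pos by (simp flip: mult.assoc ennreal_mult)
        also have "\<dots> \<le> ennreal (1 / a) * (\<integral>\<^sup>+y. ennreal (k y * V y) \<partial>M)"
          by (rule mult_left_mono[OF key[OF kh]]) auto
        also have "(\<integral>\<^sup>+y. ennreal (k y * V y) \<partial>M) = (\<integral>\<^sup>+y. ennreal \<Lambda> * ennreal (k y * U y) \<partial>M)"
          using \<Lambda> coneD(3)[OF kh] V0
          by (intro nn_integral_cong) (simp add: U_def flip: ennreal_mult)
        also have "\<dots> = ennreal \<Lambda> * (\<integral>\<^sup>+y. ennreal (k y * U y) \<partial>M)"
          by (rule nn_integral_cmult) measurable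
        also have "ennreal (1 / a) * (ennreal \<Lambda> * (\<integral>\<^sup>+y. ennreal (k y * U y) \<partial>M)) = ennreal (\<Lambda> / a) * (\<integral>\<^sup>+y. ennreal (k y * U y) \<partial>M)"
          using a_pos \<Lambda> by (simp flip: mult.assoc ennreal_mult)
        also have "\<dots> \<le> ennreal K * (\<integral>\<^sup>+y. ennreal (k y * U y) \<partial>M)"
          by (intro mult_right_mono ennreal_leI K_ge) auto
        finally show ?thesis .
      qed
      show ?thesis
        using main U_mod V0 \<Lambda> by (intro bexI[of _ U]) (auto simp: J_def U_def)
    qed
  qed
qed

text \<open>Dual to the convex case: the output modular is maximised under the constraint
  \<open>J g \<le> 1\<close>. Up to the bounded factor \<open>\<sigma>\<close>, the reciprocal of
  \<open>U\<close> is proportional to the derivative at the maximiser, shifted by \<open>h0\<close>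
  so that \<open>U\<close> is positive everywhere. By \<open>1 / 2 \<le> \<sigma>1\<close> the
  concave conjugate exponent of \<open>\<sigma>\<close> is at least 1, so dividing by
  \<open>\<Lambda>\<close> brings the modular of the weight down to 1.\<close>

lemma factorization_concave:
  fixes \<K> :: "(('b \<Rightarrow> real) \<times> ('a \<Rightarrow> real)) set"
  assumes cone: "function_cone M N \<K>"
    and s: "exponent_between M s s1 s2" "0 < s1" "s2 < 1"
    and \<sigma>: "exponent_between N \<sigma> \<sigma>1 \<sigma>2" "1 / 2 \<le> \<sigma>1" "\<sigma>2 < 1"
    and ext: "\<And>g h. (g, h) \<in> \<K> \<Longrightarrow> rmod M s g \<le> 1 \<Longrightarrow> rmod N \<sigma> h \<le> ennreal C" and C: "0 \<le> C"
    and h0: "h0 \<in> borel_measurable N" "\<And>x. 0 < h0 x" "rmod N \<sigma> h0 \<le> 1"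
  shows "\<exists>K>0. \<forall>u\<in>borel_measurable M. (AE y in M. 0 < u y) \<longrightarrow> rmod M (\<lambda>y. s y / (1 - s y)) u \<le> 1 \<longrightarrow>
    (\<exists>U\<in>borel_measurable N. (\<forall>x. 0 < U x) \<and> rmod N (\<lambda>x. \<sigma> x / (1 - \<sigma> x)) U \<le> 1 \<and>
      (\<forall>(g, h)\<in>\<K>. (\<integral>\<^sup>+x. ennreal (h x * inverse (U x)) \<partial>N) \<le> ennreal K * (\<integral>\<^sup>+y. ennreal (g y * inverse (u y)) \<partial>M)))"
proof -
  note coneD = function_coneD[OF cone]
  have [measurable]: "s \<in> borel_measurable M" "\<sigma> \<in> borel_measurable N" "h0 \<in> borel_measurable N"
    using exponent_betweenD(1)[OF s(1)] exponent_betweenD(1)[OF \<sigma>(1)] h0 by auto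
  have \<sigma>_gt: "1/2 \<le> \<sigma> x" "\<sigma> x < 1" "\<sigma>1 \<le> \<sigma> x" "\<sigma> x \<le> \<sigma>2" for x using exponent_betweenD(2,3)[OF \<sigma>(1), of x] \<sigma> by auto
  \<comment> \<open>The constraint and the modular of \<open>u\<close> give input modular at most 2,
    and (1 / l) powr s1 = 1 / 2 scales this to 1.\<close>
  define l :: real where "l = 2 powr (1 / s1)"
  have l: "1 \<le> l" using s by (simp add: l_def ge_one_powr_ge_zero)
  define B where "B = l * C + 1"
  have B: "1 \<le> B" using l C by (simp add: B_def)
  define \<Lambda> where "\<Lambda> = B + 1"
  define K where "K = \<Lambda> / \<sigma>1 * B"
  show ?thesis
  proof (intro exI[of _ K] conjI ballI impI)
    show "0 < K" using B \<sigma>(2) by (simp add: K_def \<Lambda>_def)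
    fix u assume u[measurable]: "u \<in> borel_measurable M" and u0: "AE y in M. 0 < u y"
      and u1: "rmod M (\<lambda>y. s y / (1 - s y)) u \<le> 1"
    define J where "J g = (\<integral>\<^sup>+y. ennreal (g y * inverse (u y)) \<partial>M)" for g :: "'b \<Rightarrow> real"
    have J_scale: "J (\<lambda>x. c * g x) = ennreal c * J g" if "0 \<le> c" "(g, h) \<in> \<K>" for c g h
      using nn_integral_weight_cmult[of c "\<lambda>x. g x * inverse (u x)" M] coneD(1)[OF that(2)] that(1)
      by (simp add: J_def mult.assoc)
    define \<H> where "\<H> = {h. \<exists>g. (g, h) \<in> \<K> \<and> J g \<le> 1}"
    have H_combine: "(\<lambda>y. (h y + t * k y) / (1 + t)) \<in> \<H>" if "h \<in> \<H>" "k \<in> \<H>" "0 < t" for h k t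
    proof -
      obtain g g' where g: "(g, h) \<in> \<K>" "J g \<le> 1" "(g', k) \<in> \<K>" "J g' \<le> 1"
        using \<open>h \<in> \<H>\<close> \<open>k \<in> \<H>\<close> unfolding \<H>_def by blast
      have "AE y in M. 0 \<le> inverse (u y)" using u0 by eventually_elim simp
      then have "J (\<lambda>y. (g y + t * g' y) / (1 + t)) \<le> 1"
        unfolding J_def using g coneD(1,3) that(3) by (intro nn_integral_segment(1)) (auto simp: J_def)
      then show ?thesis
        using function_cone_segment[OF cone g(1,3) \<open>0 < t\<close>] by (auto simp: \<H>_def)
    qed
    have upper: "rmod N \<sigma> h \<le> ennreal B" if "h \<in> \<H>" for h
    proof -
      obtain g where g: "(g, h) \<in> \<K>" "J g \<le> 1" using \<open>h \<in> \<H>\<close> by (auto simp: \<H>_def)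
      have [measurable]: "g \<in> borel_measurable M" "h \<in> borel_measurable N" using coneD(1,2)[OF g(1)] by auto
      have "rmod M s g \<le> J g + rmod M (\<lambda>y. s y / (1 - s y)) u"
        unfolding J_def using coneD(3)[OF g(1)] u0 by (intro young_integral_concave[OF s]) auto
      also have "\<dots> \<le> 1 + 1" by (intro add_mono g u1)
      finally have g2: "rmod M s g \<le> 2" by simp
      have gl: "(\<lambda>y. 1 / l * g y, \<lambda>x. 1 / l * h x) \<in> \<K>" using l g by (intro coneD(7)) auto
      have "rmod M s (\<lambda>y. 1 / l * g y) \<le> ennreal ((1 / l) powr s1) * rmod M s g"
        using l by (intro rmod_cmult_le1[OF s(1)]) auto
      also have "\<dots> \<le> ennreal ((1 / l) powr s1) * ennreal 2"
        using g2 by (intro mult_left_mono) auto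
      also have "\<dots> = 1"
      proof -
        have "(1 / l) powr s1 = 1 / 2" using s by (simp add: l_def powr_divide powr_powr)
        moreover have "ennreal (1 / 2) * ennreal 2 = 1" by (subst ennreal_mult[symmetric]) auto
        ultimately show ?thesis by (simp only:)
      qed
      finally have hl: "rmod N \<sigma> (\<lambda>x. 1 / l * h x) \<le> ennreal C" by (rule ext[OF gl])
      have "rmod N \<sigma> h = rmod N \<sigma> (\<lambda>x. l * (1 / l * h x))" using l by simp
      also have "\<dots> \<le> ennreal (l powr \<sigma>2) * rmod N \<sigma> (\<lambda>x. 1 / l * h x)"
        using l by (intro rmod_cmult_ge1[OF \<sigma>(1)]) auto
      also have "\<dots> \<le> ennreal (l powr 1) * ennreal C"
        using l \<sigma> hl by (intro mult_mono ennreal_leI powr_mono) auto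
      also have "\<dots> = ennreal (l * C)" using l C by (simp add: ennreal_mult)
      also have "\<dots> \<le> ennreal B" by (intro ennreal_leI) (simp add: B_def)
      finally show ?thesis .
    qed
    have "\<exists>H\<in>borel_measurable N. (\<forall>x. 0 \<le> H x) \<and> rmod N \<sigma> H \<le> ennreal B \<and>
      (\<forall>k\<in>borel_measurable N. \<forall>h0\<in>borel_measurable N. (\<forall>x. 0 \<le> k x) \<longrightarrow> (\<forall>x. 0 < h0 x) \<longrightarrow>
         (\<forall>h\<in>\<H>. \<forall>t>0. (\<lambda>x. (h x + t * k x) / (1 + t)) \<in> \<H>) \<longrightarrow>
         (\<integral>\<^sup>+x. ennreal (\<sigma> x * (H x + h0 x) powr (\<sigma> x - 1) * k x) \<partial>N) \<le> ennreal B)"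
    proof (rule powr_modular_maximiser[OF \<sigma>(1) _ \<sigma>(3)])
      show "0 < \<sigma>1" using \<sigma>(2) by simp
      show "h \<in> borel_measurable N" if "h \<in> \<H>" for h
        using that coneD(2) by (auto simp: \<H>_def)
      show "0 \<le> h x" if "h \<in> \<H>" for h x
        using that coneD(4) by (auto simp: \<H>_def)
      show "(\<lambda>x. (g x + h x) / 2) \<in> \<H>" if "g \<in> \<H>" "h \<in> \<H>" for g h
        using H_combine[OF that, of 1] by simp
      have "(\<lambda>_. 0) \<in> \<H>" using coneD(5) by (auto simp: \<H>_def J_def intro!: exI[of _ "\<lambda>_. 0"])
      then show "\<H> \<noteq> {}" by auto
    qed (rule upper)
    then obtain H where H[measurable]: "H \<in> borel_measurable N" and H0: "\<And>x. 0 \<le> H x" and H_B: "rmod N \<sigma> H \<le> ennreal B"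
      and var: "\<And>k h0. k \<in> borel_measurable N \<Longrightarrow> (\<forall>x. 0 \<le> k x) \<Longrightarrow> h0 \<in> borel_measurable N \<Longrightarrow> (\<forall>x. 0 < h0 x) \<Longrightarrow>
       (\<forall>h\<in>\<H>. \<forall>t>0. (\<lambda>x. (h x + t * k x) / (1 + t)) \<in> \<H>) \<Longrightarrow>
       (\<integral>\<^sup>+x. ennreal (\<sigma> x * (H x + h0 x) powr (\<sigma> x - 1) * k x) \<partial>N) \<le> ennreal B"
      by blast
    define Z where "Z x = H x + h0 x" for x
    have [measurable]: "Z \<in> borel_measurable N" unfolding Z_def by measurable
    have Z0: "0 < Z x" for x unfolding Z_def using H0[of x] h0(2)[of x] by simp
    have key: "(\<integral>\<^sup>+x. ennreal (\<sigma> x * Z x powr (\<sigma> x - 1) * k x) \<partial>N) \<le> J g * ennreal B" if gk: "(g, k) \<in> \<K>" for g k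
    proof (rule ennreal_le_epsilon)
      fix e :: real assume e: "0 < e" and "J g * ennreal B < top"
      then have "J g < top" using B by (auto simp: ennreal_mult_less_top)
      then obtain j where j: "J g = ennreal j" "0 \<le> j" by (cases "J g") auto
      \<comment> \<open>\<open>J g\<close> may be 0, so the normalisation divides by a slightly
        larger number; after multiplication by \<open>B\<close> the excess is exactly
        \<open>e\<close>.\<close>
      define c where "c = j + e / B"
      have c: "0 < c" using j e B by (auto simp: c_def intro!: add_nonneg_pos)
      have [measurable]: "k \<in> borel_measurable N" using coneD(2)[OF gk] .
      have gc: "(\<lambda>y. 1 / c * g y, \<lambda>x. 1 / c * k x) \<in> \<K>" using c gk by (intro coneD(7)) auto
      have "J (\<lambda>y. 1 / c * g y) = ennreal (1 / c) * J g" using c gk by (intro J_scale) auto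
      also have "\<dots> = ennreal (j / c)" using c j by (simp flip: ennreal_mult)
      also have "\<dots> \<le> 1" using c j e B by (simp add: c_def field_simps)
      finally have kH: "(\<lambda>x. 1 / c * k x) \<in> \<H>" using gc by (auto simp: \<H>_def)
      have "(\<integral>\<^sup>+x. ennreal (\<sigma> x * Z x powr (\<sigma> x - 1) * k x) \<partial>N)
         = (\<integral>\<^sup>+x. ennreal c * ennreal (\<sigma> x * (H x + h0 x) powr (\<sigma> x - 1) * (1 / c * k x)) \<partial>N)"
        using c by (intro nn_integral_cong) (simp add: Z_def mult_ac flip: ennreal_mult')
      also have "\<dots> = ennreal c * (\<integral>\<^sup>+x. ennreal (\<sigma> x * (H x + h0 x) powr (\<sigma> x - 1) * (1 / c * k x)) \<partial>N)"
        by (rule nn_integral_cmult) measurable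
      also have "\<dots> \<le> ennreal c * ennreal B"
        using coneD(2)[OF gc] coneD(4)[OF gc] h0 H_combine[OF _ kH] by (intro mult_left_mono var) auto
      also have "\<dots> = ennreal (j * B + e)" using c B by (simp add: c_def distrib_right flip: ennreal_mult)
      also have "\<dots> = J g * ennreal B + ennreal e" using j B e by (simp add: ennreal_mult)
      finally show "(\<integral>\<^sup>+x. ennreal (\<sigma> x * Z x powr (\<sigma> x - 1) * k x) \<partial>N) \<le> J g * ennreal B + ennreal e" .
    qed
    define U where "U x = 1 / \<Lambda> * Z x powr (1 - \<sigma> x)" for x
    have \<Lambda>: "1 \<le> \<Lambda>" using B by (simp add: \<Lambda>_def)
    have [measurable]: "U \<in> borel_measurable N" unfolding U_def by measurable
    have U0: "0 < U x" for x using Z0[of x] \<Lambda> by (simp add: U_def)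
    have "rmod N (\<lambda>x. \<sigma> x / (1 - \<sigma> x)) (\<lambda>x. Z x powr (1 - \<sigma> x)) \<le> (\<integral>\<^sup>+x. ennreal (\<bar>H x\<bar> powr \<sigma> x) + ennreal (\<bar>h0 x\<bar> powr \<sigma> x) \<partial>N)"
      unfolding rmod_def
    proof (rule nn_integral_mono)
      fix x
      have "(Z x powr (1 - \<sigma> x)) powr (\<sigma> x / (1 - \<sigma> x)) = (H x + h0 x) powr \<sigma> x"
        using \<sigma>_gt[of x] by (simp add: powr_powr Z_def)
      also have "\<dots> \<le> H x powr \<sigma> x + h0 x powr \<sigma> x"
        using \<sigma>_gt[of x] H0[of x] h0(2)[of x] by (intro powr_add_le_concave) auto
      finally show "ennreal (\<bar>Z x powr (1 - \<sigma> x)\<bar> powr (\<sigma> x / (1 - \<sigma> x))) \<le> ennreal (\<bar>H x\<bar> powr \<sigma> x) + ennreal (\<bar>h0 x\<bar> powr \<sigma> x)"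
        using H0[of x] h0(2)[of x] by (simp add: ennreal_leI flip: ennreal_plus)
    qed
    also have "\<dots> = rmod N \<sigma> H + rmod N \<sigma> h0"
      unfolding rmod_def by (rule nn_integral_add) measurable
    also have "\<dots> \<le> ennreal B + 1" by (intro add_mono H_B h0(3))
    also have "\<dots> = ennreal \<Lambda>" using B by (simp add: \<Lambda>_def)
    finally have Z_mod: "rmod N (\<lambda>x. \<sigma> x / (1 - \<sigma> x)) (\<lambda>x. Z x powr (1 - \<sigma> x)) \<le> ennreal \<Lambda>" .
    have exp1: "exponent_between N (\<lambda>x. \<sigma> x / (1 - \<sigma> x)) 1 (\<sigma>2 / (1 - \<sigma>2))"
    proof -
      have "exponent_between N (\<lambda>x. \<sigma> x / (1 - \<sigma> x)) \<sigma>1 (\<sigma>2 / (1 - \<sigma>2))"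
        using \<sigma> by (intro exponent_between_concave_conjugate) auto
      moreover have "1 \<le> \<sigma> x / (1 - \<sigma> x)" for x using \<sigma>_gt[of x] by (simp add: field_simps)
      ultimately show ?thesis by (auto simp: exponent_between_def)
    qed
    have "rmod N (\<lambda>x. \<sigma> x / (1 - \<sigma> x)) U \<le> ennreal ((1 / \<Lambda>) powr 1) * rmod N (\<lambda>x. \<sigma> x / (1 - \<sigma> x)) (\<lambda>x. Z x powr (1 - \<sigma> x))"
      unfolding U_def using \<Lambda> by (intro rmod_cmult_le1[OF exp1]) auto
    also have "\<dots> \<le> ennreal ((1 / \<Lambda>) powr 1) * ennreal \<Lambda>" by (rule mult_left_mono[OF Z_mod]) auto
    also have "\<dots> = 1" using \<Lambda> by (simp flip: ennreal_mult)
    finally have U_mod: "rmod N (\<lambda>x. \<sigma> x / (1 - \<sigma> x)) U \<le> 1" .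
    have main: "(\<integral>\<^sup>+x. ennreal (k x * inverse (U x)) \<partial>N) \<le> ennreal K * J g" if gk: "(g, k) \<in> \<K>" for g k
    proof -
      have [measurable]: "k \<in> borel_measurable N" using coneD(2)[OF gk] .
      have "(\<integral>\<^sup>+x. ennreal (k x * inverse (U x)) \<partial>N) \<le> (\<integral>\<^sup>+x. ennreal (\<Lambda> / \<sigma>1) * ennreal (\<sigma> x * Z x powr (\<sigma> x - 1) * k x) \<partial>N)"
      proof (rule nn_integral_mono)
        fix x
        have kx: "0 \<le> k x" by (rule coneD(4)[OF gk])
        have "inverse (U x) = \<Lambda> * Z x powr (\<sigma> x - 1)"
        proof -
          have "inverse (Z x powr (1 - \<sigma> x)) = Z x powr (- (1 - \<sigma> x))" by (rule powr_minus[symmetric])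
          then show ?thesis unfolding U_def inverse_mult_distrib using \<Lambda> by simp
        qed
        then have "k x * inverse (U x) = \<Lambda> * (1 * (Z x powr (\<sigma> x - 1) * k x))" by (simp add: mult_ac)
        also have "\<dots> \<le> \<Lambda> * (\<sigma> x / \<sigma>1 * (Z x powr (\<sigma> x - 1) * k x))"
          using \<Lambda> kx \<sigma>_gt[of x] \<sigma>(2) by (intro mult_left_mono mult_right_mono) (auto simp: field_simps)
        also have "\<dots> = \<Lambda> / \<sigma>1 * (\<sigma> x * Z x powr (\<sigma> x - 1) * k x)" by simp
        finally show "ennreal (k x * inverse (U x)) \<le> ennreal (\<Lambda> / \<sigma>1) * ennreal (\<sigma> x * Z x powr (\<sigma> x - 1) * k x)"
          using \<Lambda> \<sigma>(2) kx \<sigma>_gt[of x] by (subst ennreal_mult[symmetric]) (auto intro!: ennreal_leI mult_nonneg_nonneg)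
      qed
      also have "\<dots> = ennreal (\<Lambda> / \<sigma>1) * (\<integral>\<^sup>+x. ennreal (\<sigma> x * Z x powr (\<sigma> x - 1) * k x) \<partial>N)"
        by (rule nn_integral_cmult) measurable
      also have "\<dots> \<le> ennreal (\<Lambda> / \<sigma>1) * (J g * ennreal B)"
        by (rule mult_left_mono[OF key[OF gk]]) auto
      also have "\<dots> = ennreal (\<Lambda> / \<sigma>1) * ennreal B * J g" by (simp only: mult_ac)
      also have "ennreal (\<Lambda> / \<sigma>1) * ennreal B = ennreal K"
        unfolding K_def using \<Lambda> \<sigma>(2) B by (intro ennreal_mult[symmetric]) auto
      finally show ?thesis .
    qed
    show "\<exists>U\<in>borel_measurable N. (\<forall>x. 0 < U x) \<and> rmod N (\<lambda>x. \<sigma> x / (1 - \<sigma> x)) U \<le> 1 \<and>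
      (\<forall>(g, h)\<in>\<K>. (\<integral>\<^sup>+x. ennreal (h x * inverse (U x)) \<partial>N) \<le> ennreal K * (\<integral>\<^sup>+y. ennreal (g y * inverse (u y)) \<partial>M))"
      using main U_mod U0 by (intro bexI[of _ U]) (auto simp: J_def)
  qed
qed

text \<open>Sigma-finiteness provides a positive integrable function; after division by its integral
  plus 1, its power 1 / \<sigma> x has the required modular. Such functions serve to make weights
  strictly positive.\<close>

lemma ex_positive_small_modular:
  assumes "sigma_finite_measure N" and \<sigma>: "exponent_between N \<sigma> \<sigma>1 \<sigma>2" "0 < \<sigma>1"
  shows "\<exists>h\<in>borel_measurable N. (\<forall>x. 0 < h x) \<and> rmod N \<sigma> h \<le> 1"
proof -
  interpret sigma_finite_measure N by fact
  have [measurable]: "\<sigma> \<in> borel_measurable N" by (rule exponent_betweenD[OF \<sigma>(1)])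
  have \<sigma>0: "0 < \<sigma> x" for x using exponent_betweenD(2)[OF \<sigma>(1), of x] \<sigma>(2) by simp
  obtain e :: "'a \<Rightarrow> ennreal" where e[measurable]: "e \<in> borel_measurable N"
    and e_fin: "integral\<^sup>N N e \<noteq> \<infinity>" and e_pos: "\<And>x. x \<in> space N \<Longrightarrow> 0 < e x \<and> e x < \<infinity>"
    using Ex_finite_integrable_function by auto
  obtain I where I: "integral\<^sup>N N e = ennreal I" "0 \<le> I" using e_fin by (cases "integral\<^sup>N N e") auto
  define v where "v x = (if x \<in> space N then enn2real (e x) / (I + 1) else 1)" for x
  have v_pos: "0 < v x" for x
    using e_pos[of x] I by (auto simp: v_def enn2real_positive_iff)
  have [measurable]: "v \<in> borel_measurable N"
    by (subst measurable_cong[of N _ "\<lambda>x. enn2real (e x) / (I + 1)"]) (auto simp: v_def)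
  define h where "h x = v x powr (1 / \<sigma> x)" for x
  have "rmod N \<sigma> h = (\<integral>\<^sup>+x. ennreal (1 / (I + 1)) * e x \<partial>N)"
    unfolding rmod_def
  proof (rule nn_integral_cong)
    fix x assume x: "x \<in> space N"
    have "\<bar>h x\<bar> powr \<sigma> x = v x" using \<sigma>0[of x] v_pos[of x] by (simp add: h_def powr_powr)
    also have "\<dots> = 1 / (I + 1) * enn2real (e x)" using x by (simp add: v_def)
    finally have "ennreal (\<bar>h x\<bar> powr \<sigma> x) = ennreal (1 / (I + 1) * enn2real (e x))" by (rule arg_cong)
    also have "\<dots> = ennreal (1 / (I + 1)) * ennreal (enn2real (e x))"
      using I by (intro ennreal_mult) auto
    finally have "ennreal (\<bar>h x\<bar> powr \<sigma> x) = ennreal (1 / (I + 1)) * ennreal (enn2real (e x))" .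
    then show "ennreal (\<bar>h x\<bar> powr \<sigma> x) = ennreal (1 / (I + 1)) * e x"
      using e_pos[OF x] by simp
  qed
  also have "\<dots> = ennreal (1 / (I + 1)) * ennreal I"
    unfolding I(1)[symmetric] by (rule nn_integral_cmult) measurable
  also have "\<dots> = ennreal (I / (I + 1))" using I by (simp flip: ennreal_mult)
  also have "\<dots> \<le> 1" using I by simp
  finally have "rmod N \<sigma> h \<le> 1" .
  moreover have "h \<in> borel_measurable N" unfolding h_def by measurable
  moreover have "0 < h x" for x using v_pos[of x] by (simp add: h_def)
  ultimately show ?thesis by blast
qed

section \<open>The cone of power sums of an operator\<close>

context bounded_lp_map
begin

text \<open>Lists turn the sum of two elements into a concatenation. The output component is fixed
  only almost everywhere because \<open>T\<close> commutes with multiples only almost everywhere;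
  measurability and nonnegativity are therefore demanded separately.\<close>

definition power_sum_cone :: "real \<Rightarrow> (('b \<Rightarrow> real) \<times> ('a \<Rightarrow> real)) set" where
  "power_sum_cone r = {(g, h). h \<in> borel_measurable N \<and> (\<forall>x. 0 \<le> h x) \<and>
     (\<exists>fs. set fs \<subseteq> rLp M Q \<and> g = (\<lambda>y. \<Sum>f\<leftarrow>fs. \<bar>f y\<bar> powr r) \<and>
        (AE x in N. h x = (\<Sum>f\<leftarrow>fs. \<bar>T f x\<bar> powr r)))}"

lemma power_sum_cone_single:
  assumes "f \<in> rLp M Q"
  shows "(\<lambda>y. \<bar>f y\<bar> powr r, \<lambda>x. \<bar>T f x\<bar> powr r) \<in> power_sum_cone r"
proof -
  have [measurable]: "T f \<in> borel_measurable N" by (rule T_measurable[OF assms])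
  show ?thesis unfolding power_sum_cone_def using assms by (auto intro!: exI[of _ "[f]"])
qed

lemma function_cone_power_sum_cone:
  assumes r: "0 < r"
  shows "function_cone M N (power_sum_cone r)"
  unfolding function_cone_def
proof (safe)
  fix g h assume gh: "(g, h) \<in> power_sum_cone r"
  then obtain fs where fs: "set fs \<subseteq> rLp M Q" "g = (\<lambda>y. \<Sum>f\<leftarrow>fs. \<bar>f y\<bar> powr r)"
    and h: "h \<in> borel_measurable N" "\<forall>x. 0 \<le> h x" "AE x in N. h x = (\<Sum>f\<leftarrow>fs. \<bar>T f x\<bar> powr r)"
    by (auto simp: power_sum_cone_def)
  show "h \<in> borel_measurable N" "\<And>x. 0 \<le> h x" using h by auto
  show "\<And>y. 0 \<le> g y" using fs by (auto intro!: sum_list_nonneg)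
  have "(\<lambda>y. \<Sum>f\<leftarrow>fs. \<bar>f y\<bar> powr r) \<in> borel_measurable M"
    using fs(1) by (induction fs) (auto intro!: borel_measurable_add dest: rLp_measurable)
  then show "g \<in> borel_measurable M" using fs by simp
  {
    fix g' h' assume "(g', h') \<in> power_sum_cone r"
    then obtain fs' where fs': "set fs' \<subseteq> rLp M Q" "g' = (\<lambda>y. \<Sum>f\<leftarrow>fs'. \<bar>f y\<bar> powr r)"
      and h': "h' \<in> borel_measurable N" "\<forall>x. 0 \<le> h' x" "AE x in N. h' x = (\<Sum>f\<leftarrow>fs'. \<bar>T f x\<bar> powr r)"
      by (auto simp: power_sum_cone_def)
    have "AE x in N. h x + h' x = (\<Sum>f\<leftarrow>fs @ fs'. \<bar>T f x\<bar> powr r)"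
      using h(3) h'(3) by eventually_elim simp
    then show "(\<lambda>y. g y + g' y, \<lambda>x. h x + h' x) \<in> power_sum_cone r"
      unfolding power_sum_cone_def using fs fs' h h' by (auto intro!: exI[of _ "fs @ fs'"])
  }
  fix c :: real assume c: "0 < c"
  define d where "d = c powr (1 / r)"
  have d: "\<bar>d * z\<bar> powr r = c * \<bar>z\<bar> powr r" for z
    using c r by (simp add: d_def abs_mult powr_mult powr_powr)
  let ?fs = "map (\<lambda>f y. d * f y) fs"
  have "AE x in N. \<forall>f\<in>set fs. T (\<lambda>y. d * f y) x = d * T f x"
    using fs(1) by (intro AE_finite_allI T_cmult) auto
  then have "AE x in N. c * h x = (\<Sum>f\<leftarrow>?fs. \<bar>T f x\<bar> powr r)"
    using h(3)
  proof eventually_elim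
    fix x assume x: "\<forall>f\<in>set fs. T (\<lambda>y. d * f y) x = d * T f x" "h x = (\<Sum>f\<leftarrow>fs. \<bar>T f x\<bar> powr r)"
    have "map (\<lambda>f. \<bar>T f x\<bar> powr r) ?fs = map (\<lambda>f. c * \<bar>T f x\<bar> powr r) fs"
      using x(1) d by auto
    then show "c * h x = (\<Sum>f\<leftarrow>?fs. \<bar>T f x\<bar> powr r)"
      unfolding x(2) by (simp only: sum_list_const_mult)
  qed
  moreover have "(\<lambda>y. c * g y) = (\<lambda>y. \<Sum>f\<leftarrow>?fs. \<bar>f y\<bar> powr r)"
    unfolding fs(2) by (simp add: o_def d sum_list_const_mult)
  moreover have "set ?fs \<subseteq> rLp M Q" using fs(1) by (auto intro!: rLp_Q_cmult)
  ultimately show "(\<lambda>y. c * g y, \<lambda>x. c * h x) \<in> power_sum_cone r"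
    unfolding power_sum_cone_def using h c by (auto intro!: exI[of _ ?fs])
next
  show "(\<lambda>_. 0, \<lambda>_. 0) \<in> power_sum_cone r"
    unfolding power_sum_cone_def by (auto intro!: exI[of _ "[]"])
qed

lemma power_sum_cone_bound:
  assumes C: "lr_bound r C" and gh: "(g, h) \<in> power_sum_cone r" and le: "rmod M (\<lambda>y. Q y / r) g \<le> 1"
  shows "rmod N (\<lambda>x. P x / r) h \<le> ennreal C"
proof -
  obtain fs where fs: "set fs \<subseteq> rLp M Q" "g = (\<lambda>y. \<Sum>f\<leftarrow>fs. \<bar>f y\<bar> powr r)"
    and h: "h \<in> borel_measurable N" "\<forall>x. 0 \<le> h x" "AE x in N. h x = (\<Sum>f\<leftarrow>fs. \<bar>T f x\<bar> powr r)"
    using gh by (auto simp: power_sum_cone_def)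
  define I where "I = {0..<length fs}"
  have sumI: "(\<Sum>f\<leftarrow>fs. F f) = (\<Sum>i\<in>I. F (fs ! i))" for F :: "('b \<Rightarrow> real) \<Rightarrow> real"
    by (simp add: sum_list_sum_nth I_def)
  have "rmod M (\<lambda>y. Q y / r) g = (\<integral>\<^sup>+y. ennreal ((\<Sum>i\<in>I. \<bar>(fs ! i) y\<bar> powr r) powr (Q y / r)) \<partial>M)"
    unfolding rmod_def fs(2) sumI by (simp add: abs_of_nonneg sum_nonneg)
  then have "(\<integral>\<^sup>+y. ennreal ((\<Sum>i\<in>I. \<bar>(fs ! i) y\<bar> powr r) powr (Q y / r)) \<partial>M) \<le> 1" using le by simp
  moreover have "\<forall>i\<in>I. fs ! i \<in> rLp M Q" using fs(1) by (auto simp: I_def)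
  ultimately have "(\<integral>\<^sup>+x. ennreal ((\<Sum>i\<in>I. \<bar>T (fs ! i) x\<bar> powr r) powr (P x / r)) \<partial>N) \<le> ennreal C"
    using C unfolding lr_bound_def I_def by blast
  moreover have "rmod N (\<lambda>x. P x / r) h = (\<integral>\<^sup>+x. ennreal ((\<Sum>i\<in>I. \<bar>T (fs ! i) x\<bar> powr r) powr (P x / r)) \<partial>N)"
    unfolding rmod_def
  proof (rule nn_integral_cong_AE, use h(3) in eventually_elim)
    fix x assume "h x = (\<Sum>f\<leftarrow>fs. \<bar>T f x\<bar> powr r)"
    then show "ennreal (\<bar>h x\<bar> powr (P x / r)) = ennreal ((\<Sum>i\<in>I. \<bar>T (fs ! i) x\<bar> powr r) powr (P x / r))"
      unfolding sumI by (simp add: sum_nonneg)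
  qed
  ultimately show ?thesis by simp
qed

lemma exponent_between_scaled:
  assumes "0 < r"
  shows "exponent_between M (\<lambda>y. Q y / r) (q1 / r) (q2 / r)" "exponent_between N (\<lambda>x. P x / r) (p1 / r) (p2 / r)"
  using assms Q_ge Q_le P_ge P_le by (auto simp: exponent_between_def divide_right_mono)

lemma power_sum_cone_finite:
  assumes r: "0 < r" and gh: "(g, h) \<in> power_sum_cone r"
  shows "rmod M (\<lambda>y. Q y / r) g < \<infinity>"
proof -
  obtain fs where fs: "set fs \<subseteq> rLp M Q" "g = (\<lambda>y. \<Sum>f\<leftarrow>fs. \<bar>f y\<bar> powr r)"
    using gh by (auto simp: power_sum_cone_def)
  have single: "(\<lambda>y. \<bar>f y\<bar> powr r) \<in> rLp M (\<lambda>y. Q y / r)" if "f \<in> rLp M Q" for f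
  proof -
    have [measurable]: "f \<in> borel_measurable M" using that by (rule rLp_measurable)
    have "rmod M (\<lambda>y. Q y / r) (\<lambda>y. \<bar>f y\<bar> powr r) = rmod M Q f"
      unfolding rmod_def using r by (simp add: powr_powr)
    then show ?thesis using that by (simp add: rLp_def)
  qed
  have "(\<lambda>y. \<Sum>f\<leftarrow>fs. \<bar>f y\<bar> powr r) \<in> rLp M (\<lambda>y. Q y / r)"
    using fs(1)
  proof (induction fs)
    case (Cons f fs)
    then show ?case using single r q0 by (auto intro!: rLp_add[OF exponent_between_scaled(1)[OF r]])
  qed (auto intro: rLp_zero)
  then show ?thesis using fs(2) by (simp add: rLp_def)
qed

text \<open>The factorisation with the exponents \<open>Q y / r\<close> and \<open>P x / r\<close>,
  both bounded below by a number above 1, whose conjugates are \<open>Q y / (Q y - r)\<close> and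
  \<open>P x / (P x - r)\<close>. The conclusion concerns single functions, but the extremal problem
  needs the convex cone, and with it the vector-valued bound.\<close>

lemma weight_factorization_convex:
  assumes r: "2 \<le> r" "r < q1" "r < p1"
  shows "\<exists>K>0. \<forall>u\<in>borel_measurable N. (\<forall>x. 0 \<le> u x) \<longrightarrow> rmod N (\<lambda>x. P x / (P x - r)) u \<le> 1 \<longrightarrow>
    (\<exists>U\<in>borel_measurable M. (\<forall>y. 0 \<le> U y) \<and> rmod M (\<lambda>y. Q y / (Q y - r)) U \<le> 1 \<and>
      (\<forall>f\<in>rLp M Q. (\<integral>\<^sup>+x. ennreal (\<bar>T f x\<bar> powr r * u x) \<partial>N) \<le> ennreal K * (\<integral>\<^sup>+y. ennreal (\<bar>f y\<bar> powr r * U y) \<partial>M)))"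
proof -
  have r0: "0 < r" using r by simp
  have "\<exists>C\<ge>0. lr_bound r C"
    using r lr_bound_2 lr_bound_gt_2[of r] by (cases "r = 2") auto
  then obtain C where C: "0 \<le> C" "lr_bound r C" by blast
  have conj: "z / r / (z / r - 1) = z / (z - r)" for z
  proof -
    have "z / r - 1 = (z - r) / r" using r0 by (simp add: diff_divide_distrib)
    then show ?thesis using r0 by simp
  qed
  have "\<exists>K>0. \<forall>u\<in>borel_measurable N. (\<forall>x. 0 \<le> u x) \<longrightarrow> rmod N (\<lambda>x. P x / r / (P x / r - 1)) u \<le> 1 \<longrightarrow>
    (\<exists>U\<in>borel_measurable M. (\<forall>y. 0 \<le> U y) \<and> rmod M (\<lambda>y. Q y / r / (Q y / r - 1)) U \<le> 1 \<and>
      (\<forall>(g, h)\<in>power_sum_cone r. (\<integral>\<^sup>+x. ennreal (h x * u x) \<partial>N) \<le> ennreal K * (\<integral>\<^sup>+y. ennreal (g y * U y) \<partial>M)))"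
    using r C by (intro factorization_convex[OF function_cone_power_sum_cone[OF r0]
        exponent_between_scaled(1)[OF r0] _ exponent_between_scaled(2)[OF r0] _ _ power_sum_cone_bound])
      (auto intro: power_sum_cone_finite[OF r0, simplified])
  then obtain K where "0 < K" and K: "\<And>u. u \<in> borel_measurable N \<Longrightarrow> \<forall>x. 0 \<le> u x \<Longrightarrow> rmod N (\<lambda>x. P x / (P x - r)) u \<le> 1 \<Longrightarrow>
    \<exists>U\<in>borel_measurable M. (\<forall>y. 0 \<le> U y) \<and> rmod M (\<lambda>y. Q y / (Q y - r)) U \<le> 1 \<and>
      (\<forall>(g, h)\<in>power_sum_cone r. (\<integral>\<^sup>+x. ennreal (h x * u x) \<partial>N) \<le> ennreal K * (\<integral>\<^sup>+y. ennreal (g y * U y) \<partial>M))"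
    unfolding conj by blast
  show ?thesis
  proof (intro exI[of _ K] conjI ballI impI \<open>0 < K\<close>)
    fix u assume "u \<in> borel_measurable N" "\<forall>x. 0 \<le> u x" "rmod N (\<lambda>x. P x / (P x - r)) u \<le> 1"
    from K[OF this] obtain U where U: "U \<in> borel_measurable M" "(\<forall>y. 0 \<le> U y)" "rmod M (\<lambda>y. Q y / (Q y - r)) U \<le> 1"
      and key: "\<forall>(g, h)\<in>power_sum_cone r. (\<integral>\<^sup>+x. ennreal (h x * u x) \<partial>N) \<le> ennreal K * (\<integral>\<^sup>+y. ennreal (g y * U y) \<partial>M)"
      by blast
    show "\<exists>U\<in>borel_measurable M. (\<forall>y. 0 \<le> U y) \<and> rmod M (\<lambda>y. Q y / (Q y - r)) U \<le> 1 \<and>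
      (\<forall>f\<in>rLp M Q. (\<integral>\<^sup>+x. ennreal (\<bar>T f x\<bar> powr r * u x) \<partial>N) \<le> ennreal K * (\<integral>\<^sup>+y. ennreal (\<bar>f y\<bar> powr r * U y) \<partial>M))"
      using U bspec[OF key power_sum_cone_single] by (intro bexI[of _ U]) auto
  qed
qed

text \<open>The same with both exponents below 1. Since 1 < P x and r \<le> 2, the exponent
  \<open>P x / r\<close> is at least 1 / 2, as the concave factorisation requires.\<close>

lemma weight_factorization_concave:
  assumes r: "r \<le> 2" "q2 < r" "p2 < r" and N: "sigma_finite_measure N"
  shows "\<exists>K>0. \<forall>u\<in>borel_measurable M. (AE y in M. 0 < u y) \<longrightarrow> rmod M (\<lambda>y. Q y / (r - Q y)) u \<le> 1 \<longrightarrow>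
    (\<exists>U\<in>borel_measurable N. (\<forall>x. 0 < U x) \<and> rmod N (\<lambda>x. P x / (r - P x)) U \<le> 1 \<and>
      (\<forall>f\<in>rLp M Q. (\<integral>\<^sup>+x. ennreal (\<bar>T f x\<bar> powr r * inverse (U x)) \<partial>N)
         \<le> ennreal K * (\<integral>\<^sup>+y. ennreal (\<bar>f y\<bar> powr r * inverse (u y)) \<partial>M)))"
proof -
  have r0: "0 < r" using r q0 q12 by simp
  have "\<exists>C\<ge>0. lr_bound r C"
    using r lr_bound_2 lr_bound_lt_2[of r] by (cases "r = 2") auto
  then obtain C where C: "0 \<le> C" "lr_bound r C" by blast
  have conj: "z / r / (1 - z / r) = z / (r - z)" for z
  proof -
    have "1 - z / r = (r - z) / r" using r0 by (simp add: diff_divide_distrib)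
    then show ?thesis using r0 by simp
  qed
  obtain h0 where h0: "h0 \<in> borel_measurable N" "\<And>x. 0 < h0 x" "rmod N (\<lambda>x. P x / r) h0 \<le> 1"
    using ex_positive_small_modular[OF N exponent_between_scaled(2)[OF r0]] r0 P(2) by auto
  have "\<exists>K>0. \<forall>u\<in>borel_measurable M. (AE y in M. 0 < u y) \<longrightarrow> rmod M (\<lambda>y. Q y / r / (1 - Q y / r)) u \<le> 1 \<longrightarrow>
    (\<exists>U\<in>borel_measurable N. (\<forall>x. 0 < U x) \<and> rmod N (\<lambda>x. P x / r / (1 - P x / r)) U \<le> 1 \<and>
      (\<forall>(g, h)\<in>power_sum_cone r. (\<integral>\<^sup>+x. ennreal (h x * inverse (U x)) \<partial>N) \<le> ennreal K * (\<integral>\<^sup>+y. ennreal (g y * inverse (u y)) \<partial>M)))"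
    using r r0 C Q(2) P(2) h0 by (intro factorization_concave[OF function_cone_power_sum_cone[OF r0]
        exponent_between_scaled(1)[OF r0] _ _ exponent_between_scaled(2)[OF r0] _ _ power_sum_cone_bound])
      (auto simp: field_simps)
  then obtain K where "0 < K" and K: "\<And>u. u \<in> borel_measurable M \<Longrightarrow> AE y in M. 0 < u y \<Longrightarrow> rmod M (\<lambda>y. Q y / (r - Q y)) u \<le> 1 \<Longrightarrow>
    \<exists>U\<in>borel_measurable N. (\<forall>x. 0 < U x) \<and> rmod N (\<lambda>x. P x / (r - P x)) U \<le> 1 \<and>
      (\<forall>(g, h)\<in>power_sum_cone r. (\<integral>\<^sup>+x. ennreal (h x * inverse (U x)) \<partial>N) \<le> ennreal K * (\<integral>\<^sup>+y. ennreal (g y * inverse (u y)) \<partial>M))"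
    unfolding conj by blast
  show ?thesis
  proof (intro exI[of _ K] conjI ballI impI \<open>0 < K\<close>)
    fix u assume "u \<in> borel_measurable M" "AE y in M. 0 < u y" "rmod M (\<lambda>y. Q y / (r - Q y)) u \<le> 1"
    from K[OF this] obtain U where U: "U \<in> borel_measurable N" "(\<forall>x. 0 < U x)" "rmod N (\<lambda>x. P x / (r - P x)) U \<le> 1"
      and key: "\<forall>(g, h)\<in>power_sum_cone r. (\<integral>\<^sup>+x. ennreal (h x * inverse (U x)) \<partial>N) \<le> ennreal K * (\<integral>\<^sup>+y. ennreal (g y * inverse (u y)) \<partial>M)"
      by blast
    show "\<exists>U\<in>borel_measurable N. (\<forall>x. 0 < U x) \<and> rmod N (\<lambda>x. P x / (r - P x)) U \<le> 1 \<and>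
      (\<forall>f\<in>rLp M Q. (\<integral>\<^sup>+x. ennreal (\<bar>T f x\<bar> powr r * inverse (U x)) \<partial>N) \<le> ennreal K * (\<integral>\<^sup>+y. ennreal (\<bar>f y\<bar> powr r * inverse (u y)) \<partial>M))"
      using U bspec[OF key power_sum_cone_single] by (intro bexI[of _ U]) auto
  qed
qed

end

section \<open>Weighted bounds imply boundedness\<close>

text \<open>Jensen's inequality, by averaging the tangent inequalities at \<open>z\<close>. The
  total weight may be below 1, which suits partial sums of a series.\<close>

lemma powr_sum_jensen:
  fixes u l :: "nat \<Rightarrow> real"
  assumes a: "1 \<le> a" and u: "\<And>n. 0 \<le> u n" and l: "\<And>n. 0 \<le> l n" "(\<Sum>n<N. l n) \<le> 1"
  shows "(\<Sum>n<N. l n * u n) powr a \<le> (\<Sum>n<N. l n * u n powr a)"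
proof -
  define z where "z = (\<Sum>n<N. l n * u n)"
  have z: "0 \<le> z" unfolding z_def using u l by (intro sum_nonneg) auto
  have zz: "z * z powr (a - 1) = z powr a" using z by (cases "z = 0") (auto simp: powr_mult_base)
  have "a * z powr a = (\<Sum>n<N. l n * (a * u n * z powr (a - 1)))"
    unfolding zz[symmetric] by (subst z_def) (simp add: sum_distrib_left sum_distrib_right mult_ac)
  also have "\<dots> \<le> (\<Sum>n<N. l n * (u n powr a + (a - 1) * z powr a))"
    using u l a z by (intro sum_mono mult_left_mono powr_tangent_below) auto
  also have "\<dots> = (\<Sum>n<N. l n * u n powr a) + (\<Sum>n<N. l n) * ((a - 1) * z powr a)"
    by (simp add: distrib_left sum.distrib sum_distrib_right)
  also have "\<dots> \<le> (\<Sum>n<N. l n * u n powr a) + 1 * ((a - 1) * z powr a)"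
    using l a by (intro add_left_mono mult_right_mono) auto
  finally show ?thesis by (simp add: algebra_simps flip: z_def)
qed

text \<open>Convexity merges countably many weights of modular at most 1 into one such weight, which
  dominates the n-th of them almost everywhere up to the factor 2 ^ Suc n. Monotone convergence of
  the partial sums shows that the series is finite almost everywhere.\<close>

lemma geometric_mean_series:
  fixes u :: "nat \<Rightarrow> 'a \<Rightarrow> real"
  assumes a: "exponent_between M a 1 b"
    and u[measurable]: "\<And>n. u n \<in> borel_measurable M" and u0: "\<And>n x. 0 \<le> u n x" and u1: "\<And>n. rmod M a (u n) \<le> 1"
  shows "\<exists>W\<in>borel_measurable M. (\<forall>x. 0 \<le> W x) \<and> rmod M a W \<le> 1 \<and>
    (AE x in M. (\<lambda>n. (1/2) ^ Suc n * u n x) sums W x)"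
proof -
  have [measurable]: "a \<in> borel_measurable M" by (rule exponent_betweenD[OF a])
  have a1: "1 \<le> a x" for x by (rule exponent_betweenD[OF a])
  define S where "S N x = (\<Sum>n<N. (1/2) ^ Suc n * u n x)" for N x
  have [measurable]: "S N \<in> borel_measurable M" for N unfolding S_def by measurable
  have S0: "0 \<le> S N x" for N x unfolding S_def using u0 by (intro sum_nonneg) auto
  have S_mono: "S N x \<le> S N' x" if "N \<le> N'" for N N' x
    unfolding S_def using that u0 by (intro sum_mono2) auto
  have geo: "(\<Sum>n<N. (1/2::real) ^ Suc n) \<le> 1" for N
  proof -
    have "(\<Sum>n<N. (1/2::real) ^ Suc n) = 1 - (1/2) ^ N" by (induction N) auto
    then show ?thesis by simp
  qed
  have S_int: "(\<integral>\<^sup>+x. ennreal (S N x powr a x) \<partial>M) \<le> 1" for N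
  proof -
    have "(\<integral>\<^sup>+x. ennreal (S N x powr a x) \<partial>M) \<le> (\<integral>\<^sup>+x. (\<Sum>n<N. ennreal ((1/2) ^ Suc n) * ennreal (\<bar>u n x\<bar> powr a x)) \<partial>M)"
    proof (rule nn_integral_mono)
      fix x
      have "S N x powr a x \<le> (\<Sum>n<N. (1/2) ^ Suc n * u n x powr a x)"
        unfolding S_def using u0 a1 geo by (intro powr_sum_jensen) auto
      then have "ennreal (S N x powr a x) \<le> ennreal (\<Sum>n<N. (1/2) ^ Suc n * u n x powr a x)" by (rule ennreal_leI)
      also have "\<dots> = (\<Sum>n<N. ennreal ((1/2) ^ Suc n * u n x powr a x))"
        by (intro sum_ennreal[symmetric]) auto
      also have "\<dots> = (\<Sum>n<N. ennreal ((1/2) ^ Suc n) * ennreal (\<bar>u n x\<bar> powr a x))"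
      proof (intro sum.cong refl)
        fix n show "ennreal ((1/2) ^ Suc n * u n x powr a x) = ennreal ((1/2) ^ Suc n) * ennreal (\<bar>u n x\<bar> powr a x)"
          using u0[of n x] by (subst ennreal_mult[symmetric]) auto
      qed
      finally show "ennreal (S N x powr a x) \<le> (\<Sum>n<N. ennreal ((1/2) ^ Suc n) * ennreal (\<bar>u n x\<bar> powr a x))" .
    qed
    also have "\<dots> = (\<Sum>n<N. ennreal ((1/2) ^ Suc n) * rmod M a (u n))"
      unfolding rmod_def by (subst nn_integral_sum) (auto intro!: sum.cong nn_integral_cmult)
    also have "\<dots> \<le> (\<Sum>n<N. ennreal ((1/2) ^ Suc n) * 1)" by (intro sum_mono mult_left_mono u1) auto
    also have "\<dots> = (\<Sum>n<N. ennreal ((1/2) ^ Suc n))" by simp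
    also have "\<dots> = ennreal (\<Sum>n<N. (1/2) ^ Suc n)" by (intro sum_ennreal) auto
    also have "\<dots> \<le> ennreal 1" by (intro ennreal_leI geo)
    finally show ?thesis by simp
  qed
  define G where "G x = (SUP N. ennreal (S N x powr a x))" for x
  have [measurable]: "G \<in> borel_measurable M" unfolding G_def by measurable
  have "(\<integral>\<^sup>+x. G x \<partial>M) = (SUP N. \<integral>\<^sup>+x. ennreal (S N x powr a x) \<partial>M)"
    unfolding G_def
  proof (rule nn_integral_monotone_convergence_SUP)
    show "incseq (\<lambda>N x. ennreal (S N x powr a x))"
      unfolding incseq_def le_fun_def using S_mono S0 order_trans[OF zero_le_one a1]
      by (auto intro!: ennreal_leI powr_mono2)
  qed measurable
  then have G1: "(\<integral>\<^sup>+x. G x \<partial>M) \<le> 1" using S_int by (simp add: SUP_le_iff)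
  have G_fin: "AE x in M. G x \<noteq> \<infinity>"
    using G1 by (intro nn_integral_noteq_infinite) (auto simp: top_unique)
  define W where "W x = enn2real (\<Sum>n. ennreal ((1/2) ^ Suc n * u n x))" for x
  have [measurable]: "W \<in> borel_measurable M" unfolding W_def by measurable
  have W_sums: "AE x in M. (\<lambda>n. (1/2) ^ Suc n * u n x) sums W x"
    using G_fin
  proof eventually_elim
    fix x assume "G x \<noteq> \<infinity>"
    then obtain c where c: "G x = ennreal c" "0 \<le> c" by (cases "G x") auto
    have "S N x \<le> c powr (1 / a x)" for N
    proof -
      have "ennreal (S N x powr a x) \<le> ennreal c" unfolding c(1)[symmetric] G_def by (rule SUP_upper) simp
      then have "S N x powr a x \<le> c" using c by simp
      then have "(S N x powr a x) powr (1 / a x) \<le> c powr (1 / a x)"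
        using a1[of x] by (intro powr_mono2) auto
      then show ?thesis using a1[of x] S0[of N x] by (simp add: powr_powr)
    qed
    then have sm: "summable (\<lambda>n. (1/2) ^ Suc n * u n x)"
      unfolding S_def using u0 by (intro summableI_nonneg_bounded[where x = "c powr (1 / a x)"]) auto
    then have "(\<Sum>n. ennreal ((1/2) ^ Suc n * u n x)) = ennreal (\<Sum>n. (1/2) ^ Suc n * u n x)"
      using u0 by (intro suminf_ennreal2) auto
    then have "W x = (\<Sum>n. (1/2) ^ Suc n * u n x)"
      using u0 sm by (simp only: W_def) (auto intro!: enn2real_ennreal suminf_nonneg)
    then show "(\<lambda>n. (1/2) ^ Suc n * u n x) sums W x" using sm by (simp only: summable_sums)
  qed
  have "rmod M a W \<le> (\<integral>\<^sup>+x. G x \<partial>M)"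
    unfolding rmod_def
  proof (rule nn_integral_mono_AE, use W_sums in eventually_elim)
    fix x assume "(\<lambda>n. (1/2) ^ Suc n * u n x) sums W x"
    then have "(\<lambda>N. S N x) \<longlonglongrightarrow> W x" unfolding sums_def S_def .
    then have "(\<lambda>N. ennreal (\<bar>S N x\<bar> powr a x)) \<longlonglongrightarrow> ennreal (\<bar>W x\<bar> powr a x)"
      using a1[of x] by (intro tendsto_ennrealI tendsto_powr' tendsto_rabs tendsto_const) auto
    then show "ennreal (\<bar>W x\<bar> powr a x) \<le> G x"
    proof (rule LIMSEQ_le_const2, intro exI allI impI)
      fix N
      have "ennreal (S N x powr a x) \<le> G x" unfolding G_def by (rule SUP_upper) simp
      then show "ennreal (\<bar>S N x\<bar> powr a x) \<le> G x" using S0[of N x] by simp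
    qed
  qed
  then have "rmod M a W \<le> 1" using G1 by (rule order_trans)
  then show ?thesis using W_sums by (intro bexI[of _ W]) (auto simp: W_def)
qed

text \<open>A substitute for division by the norm. With \<open>l\<close> the least power of 2 that
  brings the modular down to 1, half of \<open>l\<close> is not enough, so the modular cannot have
  dropped below \<open>2 powr (- p2)\<close>.\<close>

lemma dyadic_normalisation:
  assumes P: "exponent_between N P p1 p2" "1 < p1" and f: "f \<in> rLp N P" and big: "1 < rmod N P f"
  obtains l where "1 \<le> l" "rmod N P (\<lambda>x. 1 / l * f x) \<le> 1" "ennreal (2 powr (- p2)) \<le> rmod N P (\<lambda>x. 1 / l * f x)"
    "rmod N P f \<le> ennreal (l powr p2)"
proof -
  have [measurable]: "f \<in> borel_measurable N" by (rule rLp_measurable[OF f])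
  obtain t where t: "rmod N P f = ennreal t" "0 \<le> t" using f by (cases "rmod N P f") (auto simp: rLp_def)
  define A where "A k \<longleftrightarrow> rmod N P (\<lambda>x. 1 / 2 ^ k * f x) \<le> 1" for k :: nat
  have "\<exists>k. A k"
  proof -
    obtain k :: nat where k: "t < 2 ^ k" using real_arch_pow[of 2] by auto
    have "rmod N P (\<lambda>x. 1 / 2 ^ k * f x) \<le> ennreal ((1 / 2 ^ k) powr p1) * rmod N P f"
      by (intro rmod_cmult_le1[OF P(1)]) auto
    also have "\<dots> \<le> ennreal ((1 / 2 ^ k) powr 1) * ennreal t"
      unfolding t(1) using P(2) by (intro mult_right_mono ennreal_leI powr_mono') auto
    also have "\<dots> = ennreal (1 / 2 ^ k * t)" using t by (simp flip: ennreal_mult)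
    also have "\<dots> \<le> 1" using k t by (simp add: field_simps)
    finally show ?thesis unfolding A_def by blast
  qed
  define k where "k = (LEAST k. A k)"
  have k: "A k" unfolding k_def using \<open>\<exists>k. A k\<close> by (rule LeastI_ex)
  have "k \<noteq> 0"
  proof
    assume "k = 0"
    then have "A 0" using k by simp
    then show False using big by (simp add: A_def)
  qed
  then have "\<not> A (k - 1)" unfolding k_def by (intro not_less_Least) (auto simp flip: k_def)
  then have "1 < rmod N P (\<lambda>x. 1 / 2 ^ (k - 1) * f x)" by (simp add: A_def)
  also have "\<dots> = rmod N P (\<lambda>x. 2 * (1 / 2 ^ k * f x))"
    using \<open>k \<noteq> 0\<close> by (cases k) auto
  also have "\<dots> \<le> ennreal (2 powr p2) * rmod N P (\<lambda>x. 1 / 2 ^ k * f x)"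
    by (intro rmod_cmult_ge1[OF P(1)]) auto
  finally have one: "1 \<le> ennreal (2 powr p2) * rmod N P (\<lambda>x. 1 / 2 ^ k * f x)" by simp
  show ?thesis
  proof (rule that[of "2 ^ k"])
    show "rmod N P (\<lambda>x. 1 / 2 ^ k * f x) \<le> 1" using k by (simp add: A_def)
    have "ennreal (2 powr (- p2)) * 1 \<le> ennreal (2 powr (- p2)) * (ennreal (2 powr p2) * rmod N P (\<lambda>x. 1 / 2 ^ k * f x))"
      by (intro mult_left_mono one) auto
    also have "\<dots> = rmod N P (\<lambda>x. 1 / 2 ^ k * f x)"
    proof -
      have "ennreal (2 powr (- p2)) * ennreal (2 powr p2) = 1"
        by (subst ennreal_mult[symmetric]) (auto simp flip: powr_add)
      then show ?thesis by (simp only: mult.assoc[symmetric] mult_1)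
    qed
    finally show "ennreal (2 powr (- p2)) \<le> rmod N P (\<lambda>x. 1 / 2 ^ k * f x)" by simp
    have "rmod N P f = rmod N P (\<lambda>x. 2 ^ k * (1 / 2 ^ k * f x))" by simp
    also have "\<dots> \<le> ennreal ((2 ^ k) powr p2) * rmod N P (\<lambda>x. 1 / 2 ^ k * f x)"
      by (intro rmod_cmult_ge1[OF P(1)]) auto
    also have "\<dots> \<le> ennreal ((2 ^ k) powr p2) * 1"
      using k by (intro mult_left_mono) (auto simp: A_def)
    finally show "rmod N P f \<le> ennreal ((2 ^ k) powr p2)" by simp
  qed simp
qed

section \<open>Unbounded maps and a weight without partner\<close>

context lp_map
begin

text \<open>The weight \<bar>h n\<bar> powr (P x - r) is extremal for the normalised image
  \<open>h n\<close>: its product with \<bar>h n\<bar> powr r is \<bar>h n\<bar> powr P x, and its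
  conjugate modular is that of \<open>h n\<close>. Within the series it loses a factor of order 2 ^
  n, but the image itself is larger by at least 4 ^ n, whereas Young's inequality keeps the other
  side of the weighted inequality bounded.\<close>

lemma converse_convex:
  assumes r: "1 \<le> r" "r < q1" "r < p1" and N: "sigma_finite_measure N"
    and weights: "\<And>u. u \<in> borel_measurable N \<Longrightarrow> AE x in N. 0 < u x \<Longrightarrow> rmod N (\<lambda>x. P x / (P x - r)) u < \<infinity> \<Longrightarrow>
      \<exists>U\<in>borel_measurable M. rmod M (\<lambda>y. Q y / (Q y - r)) U < \<infinity> \<and>
        (\<exists>K>0. \<forall>f\<in>rLp M Q. (\<integral>\<^sup>+x. ennreal (\<bar>T f x\<bar> powr r * u x) \<partial>N) \<le> ennreal K * (\<integral>\<^sup>+y. ennreal (\<bar>f y\<bar> powr r * U y) \<partial>M))"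
  shows "\<exists>B\<ge>0. \<forall>f\<in>rLp M Q. rmod M Q f \<le> 1 \<longrightarrow> rmod N P (T f) \<le> ennreal B"
proof (rule ccontr)
  assume unbounded: "\<not> ?thesis"
  have p2: "1 < p2" using P p12 by simp
  \<comment> \<open>The threshold is a power with exponent \<open>p2\<close> so that the normalising
    factor is at least 4 ^ n.\<close>
  have "\<exists>f\<in>rLp M Q. rmod M Q f \<le> 1 \<and> ennreal ((4 ^ n) powr p2) < rmod N P (T f)" for n :: nat
    using unbounded by (auto simp: not_le dest!: spec[of _ "(4 ^ n) powr p2"])
  then obtain f where f: "\<And>n. f n \<in> rLp M Q" "\<And>n. rmod M Q (f n) \<le> 1"
    "\<And>n :: nat. ennreal ((4 ^ n) powr p2) < rmod N P (T (f n))" by metis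
  have "\<exists>l. 4 ^ n \<le> l \<and> rmod N P (\<lambda>x. 1 / l * T (f n) x) \<le> 1 \<and>
      ennreal (2 powr (- p2)) \<le> rmod N P (\<lambda>x. 1 / l * T (f n) x)" for n
  proof -
    have "1 \<le> (4 ^ n) powr p2" using p2 by (intro ge_one_powr_ge_zero) auto
    then have "1 < rmod N P (T (f n))" using f(3)[of n]
      by (metis ennreal_1 ennreal_leI order.strict_trans1)
    then obtain l where l: "1 \<le> l" "rmod N P (\<lambda>x. 1 / l * T (f n) x) \<le> 1"
      "ennreal (2 powr (- p2)) \<le> rmod N P (\<lambda>x. 1 / l * T (f n) x)" "rmod N P (T (f n)) \<le> ennreal (l powr p2)"
      using dyadic_normalisation[OF P T_in[OF f(1)]] by metis
    have "ennreal ((4 ^ n) powr p2) < ennreal (l powr p2)" using f(3) l(4) by (rule order.strict_trans2)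
    then have "(4 ^ n) powr p2 < l powr p2" by (simp add: ennreal_less_iff)
    then have "4 ^ n \<le> l" using p2 l(1) by (meson not_le powr_mono2 order_trans zero_le_one less_imp_le less_le_not_le)
    then show ?thesis using l by blast
  qed
  then obtain l where l: "\<And>n. 4 ^ n \<le> l n" "\<And>n. rmod N P (\<lambda>x. 1 / l n * T (f n) x) \<le> 1"
      "\<And>n. ennreal (2 powr (- p2)) \<le> rmod N P (\<lambda>x. 1 / l n * T (f n) x)" by metis
  have l_pos: "0 < l n" for n using l(1)[of n] by (rule less_le_trans[rotated]) simp
  have [measurable]: "T (f n) \<in> borel_measurable N" "f n \<in> borel_measurable M" for n
    using f(1) by (auto intro: T_measurable rLp_measurable)
  have Pr: "1 < P x" "r < P x" for x using P(2) P_ge[of x] r by auto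
  have r0: "0 < r" using r by simp
  have aP: "exponent_between N (\<lambda>x. P x / (P x - r)) 1 (p2 / (p1 - r))"
  proof -
    have "1 \<le> P x / (P x - r) \<and> P x / (P x - r) \<le> p2 / (p1 - r)" for x
    proof
      show "1 \<le> P x / (P x - r)" using Pr[of x] r by (simp add: field_simps)
      show "P x / (P x - r) \<le> p2 / (p1 - r)" using Pr[of x] P_ge[of x] P_le[of x] r by (intro frac_le) auto
    qed
    then show ?thesis by (simp add: exponent_between_def)
  qed
  obtain e where e: "e \<in> borel_measurable N" "\<And>x. 0 < e x" "rmod N (\<lambda>x. P x / (P x - r)) e \<le> 1"
    using ex_positive_small_modular[OF N aP] by auto
  define h where "h n x = 1 / l n * T (f n) x" for n x
  have h_eq: "h n = (\<lambda>x. 1 / l n * T (f n) x)" for n by (simp add: h_def fun_eq_iff)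
  have [measurable]: "h n \<in> borel_measurable N" for n unfolding h_def by measurable
  define v where "v n x = \<bar>h n x\<bar> powr (P x - r)" for n x
  \<comment> \<open>The leading term \<open>e\<close> makes the sum a positive weight.\<close>
  define u where "u n = (case n of 0 \<Rightarrow> e | Suc m \<Rightarrow> v m)" for n
  have v_mod: "rmod N (\<lambda>x. P x / (P x - r)) (v n) \<le> 1" for n
  proof -
    have "rmod N (\<lambda>x. P x / (P x - r)) (v n) = rmod N P (h n)"
      unfolding rmod_def
    proof (intro nn_integral_cong arg_cong[where f=ennreal])
      fix x
      have "(P x - r) * (P x / (P x - r)) = P x" using Pr[of x] by simp
      then show "\<bar>v n x\<bar> powr (P x / (P x - r)) = \<bar>h n x\<bar> powr P x" by (simp add: v_def powr_powr)
    qed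
    then show ?thesis using l(2)[of n] by (simp only: h_eq)
  qed
  have "\<exists>W\<in>borel_measurable N. (\<forall>x. 0 \<le> W x) \<and> rmod N (\<lambda>x. P x / (P x - r)) W \<le> 1 \<and>
    (AE x in N. (\<lambda>n. (1/2) ^ Suc n * u n x) sums W x)"
  proof (rule geometric_mean_series[OF aP])
    show "u n \<in> borel_measurable N" for n using e unfolding u_def v_def by (cases n) auto
    show "0 \<le> u n x" for n x using less_imp_le[OF e(2)] by (cases n) (auto simp: u_def v_def)
    show "rmod N (\<lambda>x. P x / (P x - r)) (u n) \<le> 1" for n using e v_mod by (cases n) (auto simp: u_def)
  qed
  then obtain W where W[measurable]: "W \<in> borel_measurable N" and W1: "rmod N (\<lambda>x. P x / (P x - r)) W \<le> 1"
    and W_sums: "AE x in N. (\<lambda>n. (1/2) ^ Suc n * u n x) sums W x" by blast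
  have u0: "0 \<le> u n x" for n x using less_imp_le[OF e(2)] by (cases n) (auto simp: u_def v_def)
  have W_ge: "AE x in N. \<forall>n. (1/2) ^ Suc n * u n x \<le> W x"
    using W_sums
  proof (eventually_elim, intro allI)
    fix x n assume sums: "(\<lambda>n. (1/2) ^ Suc n * u n x) sums W x"
    have "(\<Sum>k\<in>{n}. (1/2) ^ Suc k * u k x) \<le> (\<Sum>k. (1/2) ^ Suc k * u k x)"
      using u0 by (intro sum_le_suminf sums_summable[OF sums]) auto
    then show "(1/2) ^ Suc n * u n x \<le> W x" using sums_unique[OF sums] by simp
  qed
  have W_pos: "AE x in N. 0 < W x"
    using W_ge
  proof eventually_elim
    fix x assume "\<forall>n. (1/2) ^ Suc n * u n x \<le> W x"
    then have "(1/2) ^ Suc 0 * u 0 x \<le> W x" by blast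
    moreover have "0 < (1/2) ^ Suc 0 * u 0 x" using e(2)[of x] by (simp add: u_def)
    ultimately show "0 < W x" by linarith
  qed
  have "rmod N (\<lambda>x. P x / (P x - r)) W < \<infinity>" using W1 by (auto intro: order.strict_trans1)
  then obtain U K where U[measurable]: "U \<in> borel_measurable M"
    and U_fin: "rmod M (\<lambda>y. Q y / (Q y - r)) U < \<infinity>" and K: "0 < K"
    and TK: "\<And>f. f \<in> rLp M Q \<Longrightarrow> (\<integral>\<^sup>+x. ennreal (\<bar>T f x\<bar> powr r * W x) \<partial>N) \<le> ennreal K * (\<integral>\<^sup>+y. ennreal (\<bar>f y\<bar> powr r * U y) \<partial>M)"
    using weights[OF W W_pos] by blast
  obtain R where R: "rmod M (\<lambda>y. Q y / (Q y - r)) U = ennreal R" "0 \<le> R"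
    using U_fin by (cases "rmod M (\<lambda>y. Q y / (Q y - r)) U") auto
  have conj: "z / r / (z / r - 1) = z / (z - r)" for z
  proof -
    have "z / r - 1 = (z - r) / r" using r0 by (simp add: diff_divide_distrib)
    then show ?thesis using r0 by simp
  qed
  have right: "(\<integral>\<^sup>+y. ennreal (\<bar>f n y\<bar> powr r * U y) \<partial>M) \<le> ennreal (1 + R)" for n
  proof -
    have "(\<integral>\<^sup>+y. ennreal (\<bar>f n y\<bar> powr r * U y) \<partial>M) \<le> (\<integral>\<^sup>+y. ennreal (\<bar>f n y\<bar> powr r * \<bar>U y\<bar>) \<partial>M)"
      by (intro nn_integral_mono ennreal_leI mult_left_mono) auto
    also have "\<dots> \<le> rmod M (\<lambda>y. Q y / r) (\<lambda>y. \<bar>f n y\<bar> powr r) + rmod M (\<lambda>y. Q y / r / (Q y / r - 1)) (\<lambda>y. \<bar>U y\<bar>)"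
      using r r0 Q_ge Q_le
      by (intro young_integral[where ?\<sigma>1.0 = "q1 / r" and ?\<sigma>2.0 = "q2 / r"]) (auto simp: exponent_between_def divide_right_mono)
    also have "rmod M (\<lambda>y. Q y / r) (\<lambda>y. \<bar>f n y\<bar> powr r) = rmod M Q (f n)"
      unfolding rmod_def using r0 by (simp add: powr_powr)
    also have "rmod M (\<lambda>y. Q y / r / (Q y / r - 1)) (\<lambda>y. \<bar>U y\<bar>) = ennreal R"
      unfolding conj R(1)[symmetric] by (simp add: rmod_def)
    also have "rmod M Q (f n) + ennreal R \<le> 1 + ennreal R" by (intro add_right_mono f(2))
    finally show ?thesis using R by simp
  qed
  have left: "ennreal (2 ^ n * (2 powr (- p2) / 4)) \<le> (\<integral>\<^sup>+x. ennreal (\<bar>T (f n) x\<bar> powr r * W x) \<partial>N)" for n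
  proof -
    define c :: real where "c = 4 ^ n * (1/2) ^ Suc (Suc n)"
    have c: "0 \<le> c" "c = 2 ^ n / 4"
    proof -
      have "(4::real) ^ n = 2 ^ n * 2 ^ n" by (simp flip: power_mult_distrib)
      then show "c = 2 ^ n / 4" by (simp add: c_def power_one_over field_simps)
    qed (simp add: c_def)
    have "2 ^ n * (2 powr (- p2) / 4) = c * 2 powr (- p2)" unfolding c(2) by simp
    then have "ennreal (2 ^ n * (2 powr (- p2) / 4)) = ennreal c * ennreal (2 powr (- p2))"
      using c(1) by (simp only: ennreal_mult powr_ge_zero)
    also have "\<dots> \<le> ennreal c * rmod N P (h n)"
      using l(3)[of n] unfolding h_eq by (intro mult_left_mono) auto
    also have "\<dots> = (\<integral>\<^sup>+x. ennreal c * ennreal (\<bar>h n x\<bar> powr P x) \<partial>N)"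
      unfolding rmod_def by (rule nn_integral_cmult[symmetric]) measurable
    also have "\<dots> \<le> (\<integral>\<^sup>+x. ennreal (\<bar>T (f n) x\<bar> powr r * W x) \<partial>N)"
    proof (rule nn_integral_mono_AE, use W_ge in eventually_elim)
      fix x assume "\<forall>n. (1/2) ^ Suc n * u n x \<le> W x"
      then have "(1/2) ^ Suc (Suc n) * u (Suc n) x \<le> W x" by blast
      then have w: "(1/2) ^ Suc (Suc n) * v n x \<le> W x" by (simp add: u_def)
      have "\<bar>T (f n) x\<bar> = l n * \<bar>h n x\<bar>" using l_pos[of n] by (simp add: h_def abs_mult)
      then have "\<bar>T (f n) x\<bar> powr r = l n powr r * \<bar>h n x\<bar> powr r" using l_pos[of n] by (simp add: powr_mult)
      moreover have "4 ^ n \<le> l n powr r"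
      proof -
        have "1 \<le> l n" using l(1)[of n] by (rule order_trans[rotated]) simp
        then have "l n powr 1 \<le> l n powr r" using r by (intro powr_mono) auto
        then show ?thesis using l(1)[of n] l_pos[of n] by simp
      qed
      ultimately have "4 ^ n * \<bar>h n x\<bar> powr r \<le> \<bar>T (f n) x\<bar> powr r" by (simp add: mult_right_mono)
      then have "(4 ^ n * \<bar>h n x\<bar> powr r) * ((1/2) ^ Suc (Suc n) * v n x) \<le> \<bar>T (f n) x\<bar> powr r * W x"
        using w by (intro mult_mono) (auto simp: v_def)
      moreover have "\<bar>h n x\<bar> powr r * v n x = \<bar>h n x\<bar> powr P x" by (simp add: v_def flip: powr_add)
      moreover have "(4 ^ n * \<bar>h n x\<bar> powr r) * ((1/2) ^ Suc (Suc n) * v n x) = c * (\<bar>h n x\<bar> powr r * v n x)"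
        by (simp only: c_def mult_ac)
      ultimately have "c * \<bar>h n x\<bar> powr P x \<le> \<bar>T (f n) x\<bar> powr r * W x" by (simp only:)
      then show "ennreal c * ennreal (\<bar>h n x\<bar> powr P x) \<le> ennreal (\<bar>T (f n) x\<bar> powr r * W x)"
        by (simp only: ennreal_mult[OF c(1) powr_ge_zero, symmetric] ennreal_leI)
    qed
    finally show ?thesis .
  qed
  have all: "2 ^ n * (2 powr (- p2) / 4) \<le> K * (1 + R)" for n :: nat
  proof -
    have "ennreal (2 ^ n * (2 powr (- p2) / 4)) \<le> ennreal K * ennreal (1 + R)"
      using left[of n] TK[OF f(1)[of n]] mult_left_mono[OF right[of n], of "ennreal K"] by (meson order_trans zero_le)
    also have "\<dots> = ennreal (K * (1 + R))" using K R by (intro ennreal_mult[symmetric]) auto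
    finally show ?thesis using K R by (subst (asm) ennreal_le_iff) auto
  qed
  obtain n :: nat where "K * (1 + R) / (2 powr (- p2) / 4) < 2 ^ n" using real_arch_pow[of 2] by auto
  then show False using all[of n] by (simp add: field_simps)
qed

text \<open>Here the inputs are coded. The weight \<bar>f n\<bar> powr (r - Q y) makes the input
  side of the weighted inequality at most 2 ^ Suc (Suc n), and the reverse Young inequality then
  bounds the modular of the n-th image divided by 4 ^ n. For large \<open>n\<close> this contradicts
  the growth of the images.\<close>

lemma converse_concave:
  assumes r: "1 \<le> r" "q2 < r" "p2 < r" and M: "sigma_finite_measure M"
    and weights: "\<And>u. u \<in> borel_measurable M \<Longrightarrow> AE y in M. 0 < u y \<Longrightarrow> rmod M (\<lambda>y. Q y / (r - Q y)) u < \<infinity> \<Longrightarrow>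
      \<exists>U\<in>borel_measurable N. (AE x in N. 0 < U x) \<and> rmod N (\<lambda>x. P x / (r - P x)) U < \<infinity> \<and>
        (\<exists>K>0. \<forall>f\<in>rLp M Q. (\<integral>\<^sup>+x. ennreal (\<bar>T f x\<bar> powr r * inverse (U x)) \<partial>N)
            \<le> ennreal K * (\<integral>\<^sup>+y. ennreal (\<bar>f y\<bar> powr r * inverse (u y)) \<partial>M))"
    and r2: "r \<le> 2"
  shows "\<exists>B\<ge>0. \<forall>f\<in>rLp M Q. rmod M Q f \<le> 1 \<longrightarrow> rmod N P (T f) \<le> ennreal B"
proof (rule ccontr)
  assume unbounded: "\<not> ?thesis"
  have p2: "1 < p2" using P p12 by simp
  have "\<exists>f\<in>rLp M Q. rmod M Q f \<le> 1 \<and> ennreal ((4 ^ n) powr p2) < rmod N P (T f)" for n :: nat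
    using unbounded by (auto simp: not_le dest!: spec[of _ "(4 ^ n) powr p2"])
  then obtain f where f: "\<And>n. f n \<in> rLp M Q" "\<And>n. rmod M Q (f n) \<le> 1"
    "\<And>n :: nat. ennreal ((4 ^ n) powr p2) < rmod N P (T (f n))" by metis
  have [measurable]: "T (f n) \<in> borel_measurable N" "f n \<in> borel_measurable M" for n
    using f(1) by (auto intro: T_measurable rLp_measurable)
  have Qr: "1 < Q y" "Q y < r" for y using Q(2) Q_ge[of y] Q_le[of y] r by auto
  have Pr: "1 < P y" "P y < r" for y using P(2) P_ge[of y] P_le[of y] r by auto
  have r0: "0 < r" using r by simp
  have aQ: "exponent_between M (\<lambda>y. Q y / (r - Q y)) 1 (q2 / (r - q2))"
  proof -
    have "1 \<le> Q x / (r - Q x) \<and> Q x / (r - Q x) \<le> q2 / (r - q2)" for x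
    proof
      show "1 \<le> Q x / (r - Q x)" using Qr[of x] r2 by (simp add: field_simps)
      show "Q x / (r - Q x) \<le> q2 / (r - q2)" using Qr[of x] Q_le[of x] r by (intro frac_le) auto
    qed
    then show ?thesis by (simp add: exponent_between_def)
  qed
  have aP: "exponent_between N (\<lambda>y. P y / (r - P y)) 1 (p2 / (r - p2))"
  proof -
    have "1 \<le> P x / (r - P x) \<and> P x / (r - P x) \<le> p2 / (r - p2)" for x
    proof
      show "1 \<le> P x / (r - P x)" using Pr[of x] r2 by (simp add: field_simps)
      show "P x / (r - P x) \<le> p2 / (r - p2)" using Pr[of x] P_le[of x] r by (intro frac_le) auto
    qed
    then show ?thesis by (simp add: exponent_between_def)
  qed
  obtain e where e: "e \<in> borel_measurable M" "\<And>x. 0 < e x" "rmod M (\<lambda>y. Q y / (r - Q y)) e \<le> 1"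
    using ex_positive_small_modular[OF M aQ] by auto
  define v where "v n y = \<bar>f n y\<bar> powr (r - Q y)" for n y
  define u where "u n = (case n of 0 \<Rightarrow> e | Suc m \<Rightarrow> v m)" for n
  have v_mod: "rmod M (\<lambda>y. Q y / (r - Q y)) (v n) \<le> 1" for n
  proof -
    have "rmod M (\<lambda>y. Q y / (r - Q y)) (v n) = rmod M Q (f n)"
      unfolding rmod_def
    proof (intro nn_integral_cong arg_cong[where f=ennreal])
      fix x
      have "(r - Q x) * (Q x / (r - Q x)) = Q x" using Qr[of x] by simp
      then show "\<bar>v n x\<bar> powr (Q x / (r - Q x)) = \<bar>f n x\<bar> powr Q x" by (simp add: v_def powr_powr)
    qed
    then show ?thesis using f(2)[of n] by simp
  qed
  have u0: "0 \<le> u n x" for n x using less_imp_le[OF e(2)] by (cases n) (auto simp: u_def v_def)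
  have "\<exists>W\<in>borel_measurable M. (\<forall>x. 0 \<le> W x) \<and> rmod M (\<lambda>y. Q y / (r - Q y)) W \<le> 1 \<and>
    (AE x in M. (\<lambda>n. (1/2) ^ Suc n * u n x) sums W x)"
  proof (rule geometric_mean_series[OF aQ])
    show "u n \<in> borel_measurable M" for n using e unfolding u_def v_def by (cases n) auto
    show "rmod M (\<lambda>y. Q y / (r - Q y)) (u n) \<le> 1" for n using e v_mod by (cases n) (auto simp: u_def)
  qed (rule u0)
  then obtain W where W[measurable]: "W \<in> borel_measurable M" and W1: "rmod M (\<lambda>y. Q y / (r - Q y)) W \<le> 1"
    and W_sums: "AE x in M. (\<lambda>n. (1/2) ^ Suc n * u n x) sums W x" by blast
  have W_ge: "AE x in M. \<forall>n. (1/2) ^ Suc n * u n x \<le> W x"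
    using W_sums
  proof (eventually_elim, intro allI)
    fix x n assume sums: "(\<lambda>n. (1/2) ^ Suc n * u n x) sums W x"
    have "(\<Sum>k\<in>{n}. (1/2) ^ Suc k * u k x) \<le> (\<Sum>k. (1/2) ^ Suc k * u k x)"
      using u0 by (intro sum_le_suminf sums_summable[OF sums]) auto
    then show "(1/2) ^ Suc n * u n x \<le> W x" using sums_unique[OF sums] by simp
  qed
  have W_pos: "AE x in M. 0 < W x"
    using W_ge
  proof eventually_elim
    fix x assume "\<forall>n. (1/2) ^ Suc n * u n x \<le> W x"
    then have "(1/2) ^ Suc 0 * u 0 x \<le> W x" by blast
    moreover have "0 < (1/2) ^ Suc 0 * u 0 x" using e(2)[of x] by (simp add: u_def)
    ultimately show "0 < W x" by linarith
  qed
  have "rmod M (\<lambda>y. Q y / (r - Q y)) W < \<infinity>" using W1 by (auto intro: order.strict_trans1)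
  then obtain U K where U[measurable]: "U \<in> borel_measurable N" and U0: "AE x in N. 0 < U x"
    and U_fin: "rmod N (\<lambda>x. P x / (r - P x)) U < \<infinity>" and K: "0 < K"
    and TK: "\<And>f. f \<in> rLp M Q \<Longrightarrow> (\<integral>\<^sup>+x. ennreal (\<bar>T f x\<bar> powr r * inverse (U x)) \<partial>N)
        \<le> ennreal K * (\<integral>\<^sup>+y. ennreal (\<bar>f y\<bar> powr r * inverse (W y)) \<partial>M)"
    using weights[OF W W_pos] by blast
  obtain R where R: "rmod N (\<lambda>x. P x / (r - P x)) U = ennreal R" "0 \<le> R"
    using U_fin by (cases "rmod N (\<lambda>x. P x / (r - P x)) U") auto
  have right: "(\<integral>\<^sup>+y. ennreal (\<bar>f n y\<bar> powr r * inverse (W y)) \<partial>M) \<le> ennreal (2 ^ Suc (Suc n))" for n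
  proof -
    have "(\<integral>\<^sup>+y. ennreal (\<bar>f n y\<bar> powr r * inverse (W y)) \<partial>M)
       \<le> (\<integral>\<^sup>+y. ennreal (2 ^ Suc (Suc n)) * ennreal (\<bar>f n y\<bar> powr Q y) \<partial>M)"
    proof (rule nn_integral_mono_AE, use W_ge in eventually_elim)
      fix y assume "\<forall>n. (1/2) ^ Suc n * u n y \<le> W y"
      then have "(1/2) ^ Suc (Suc n) * u (Suc n) y \<le> W y" by blast
      then have w: "(1/2) ^ Suc (Suc n) * v n y \<le> W y" by (simp add: u_def)
      have "\<bar>f n y\<bar> powr r * inverse (W y) \<le> 2 ^ Suc (Suc n) * \<bar>f n y\<bar> powr Q y"
      proof (cases "f n y = 0")
        case False
        then have v: "0 < v n y" by (simp add: v_def)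
        then have "0 < (1/2) ^ Suc (Suc n) * v n y" by simp
        then have "inverse (W y) \<le> inverse ((1/2) ^ Suc (Suc n) * v n y)" using w by (intro le_imp_inverse_le)
        also have "\<dots> = 2 ^ Suc (Suc n) * inverse (v n y)" by (simp add: power_one_over field_simps)
        finally have "\<bar>f n y\<bar> powr r * inverse (W y) \<le> \<bar>f n y\<bar> powr r * (2 ^ Suc (Suc n) * inverse (v n y))"
          by (intro mult_left_mono) auto
        also have "\<dots> = 2 ^ Suc (Suc n) * (\<bar>f n y\<bar> powr r * inverse (v n y))" by (simp only: mult_ac)
        also have "\<bar>f n y\<bar> powr r * inverse (v n y) = \<bar>f n y\<bar> powr Q y"
          by (simp add: v_def flip: powr_minus powr_add)
        finally show ?thesis .
      qed simp
      then show "ennreal (\<bar>f n y\<bar> powr r * inverse (W y)) \<le> ennreal (2 ^ Suc (Suc n)) * ennreal (\<bar>f n y\<bar> powr Q y)"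
        by (subst ennreal_mult[symmetric]) (auto intro: ennreal_leI)
    qed
    also have "\<dots> = ennreal (2 ^ Suc (Suc n)) * rmod M Q (f n)"
      unfolding rmod_def by (rule nn_integral_cmult) measurable
    also have "\<dots> \<le> ennreal (2 ^ Suc (Suc n)) * 1" by (intro mult_left_mono f(2)) auto
    finally show ?thesis by simp
  qed
  \<comment> \<open>Scaling \<open>U\<close> by \<open>\<eta>\<close> brings its modular to at most
    1 / 2, which leaves the other half for the integral term in the reverse Young
    inequality.\<close>
  define \<eta> where "\<eta> = 1 / (2 * (R + 1))"
  have \<eta>: "0 < \<eta>" "\<eta> \<le> 1" "\<eta> * R \<le> 1/2" using R by (auto simp: \<eta>_def field_simps)
  define V where "V x = \<eta> * U x" for x
  have [measurable]: "V \<in> borel_measurable N" unfolding V_def by measurable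
  have V0: "AE x in N. 0 < V x" using U0 by eventually_elim (use \<eta> in \<open>simp add: V_def\<close>)
  have "rmod N (\<lambda>x. P x / (r - P x)) V \<le> ennreal (\<eta> powr 1) * rmod N (\<lambda>x. P x / (r - P x)) U"
    unfolding V_def using \<eta> by (intro rmod_cmult_le1[OF aP]) auto
  also have "\<dots> = ennreal (\<eta> * R)" using \<eta> R by (simp flip: ennreal_mult)
  also have "\<dots> \<le> ennreal (1/2)" by (rule ennreal_leI) (rule \<eta>)
  finally have V_half: "rmod N (\<lambda>x. P x / (r - P x)) V \<le> ennreal (1/2)" .
  have conj: "z / r / (1 - z / r) = z / (r - z)" for z
  proof -
    have "1 - z / r = (r - z) / r" using r0 by (simp add: diff_divide_distrib)
    then show ?thesis using r0 by simp
  qed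
  \<comment> \<open>For this \<open>n\<close> the integral term
    \<open>4 * K / (\<eta> * 2 ^ n)\<close> is at most 1 / 2.\<close>
  obtain n :: nat where n: "8 * K / \<eta> < 2 ^ n" using real_arch_pow[of 2] by auto
  define h where "h x = 1 / 4 ^ n * T (f n) x" for x
  have [measurable]: "h \<in> borel_measurable N" unfolding h_def by measurable
  have "rmod N P h = rmod N (\<lambda>x. P x / r) (\<lambda>x. \<bar>h x\<bar> powr r)"
    unfolding rmod_def using r0 by (simp add: powr_powr)
  also have "\<dots> \<le> (\<integral>\<^sup>+x. ennreal (\<bar>h x\<bar> powr r * inverse (V x)) \<partial>N) + rmod N (\<lambda>x. P x / r / (1 - P x / r)) V"
    using r r0 P(2) P_ge P_le V0
    by (intro young_integral_concave[where ?s1.0 = "p1 / r" and ?s2.0 = "p2 / r"]) (auto simp: exponent_between_def divide_right_mono)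
  also have "(\<integral>\<^sup>+x. ennreal (\<bar>h x\<bar> powr r * inverse (V x)) \<partial>N)
      \<le> (\<integral>\<^sup>+x. ennreal (1 / (\<eta> * 4 ^ n)) * ennreal (\<bar>T (f n) x\<bar> powr r * inverse (U x)) \<partial>N)"
  proof (rule nn_integral_mono_AE, use U0 in eventually_elim)
    fix x assume Ux: "0 < U x"
    have "\<bar>h x\<bar> powr r = (1 / 4 ^ n) powr r * \<bar>T (f n) x\<bar> powr r" by (simp add: h_def abs_mult powr_mult powr_divide)
    also have "\<dots> \<le> (1 / 4 ^ n) powr 1 * \<bar>T (f n) x\<bar> powr r"
      using r by (intro mult_right_mono powr_mono') auto
    finally have "\<bar>h x\<bar> powr r * inverse (V x) \<le> (1 / 4 ^ n * \<bar>T (f n) x\<bar> powr r) * inverse (V x)"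
      using Ux \<eta> by (intro mult_right_mono) (auto simp: V_def)
    also have "\<dots> = 1 / (\<eta> * 4 ^ n) * (\<bar>T (f n) x\<bar> powr r * inverse (U x))"
      by (simp add: V_def divide_inverse mult_ac)
    finally show "ennreal (\<bar>h x\<bar> powr r * inverse (V x)) \<le> ennreal (1 / (\<eta> * 4 ^ n)) * ennreal (\<bar>T (f n) x\<bar> powr r * inverse (U x))"
      using \<eta> Ux by (subst ennreal_mult[symmetric]) (auto intro: ennreal_leI)
  qed
  also have "\<dots> = ennreal (1 / (\<eta> * 4 ^ n)) * (\<integral>\<^sup>+x. ennreal (\<bar>T (f n) x\<bar> powr r * inverse (U x)) \<partial>N)"
    by (rule nn_integral_cmult) measurable
  also have "\<dots> \<le> ennreal (1 / (\<eta> * 4 ^ n)) * (ennreal K * ennreal (2 ^ Suc (Suc n)))"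
    using mult_left_mono[OF right[of n], of "ennreal K"] TK[OF f(1)[of n]]
    by (intro mult_left_mono) (auto intro: order_trans)
  also have "\<dots> = ennreal (1 / (\<eta> * 4 ^ n) * (K * 2 ^ Suc (Suc n)))"
    using \<eta> K by (simp only: ennreal_mult[symmetric] less_imp_le zero_le_power zero_le_numeral mult_nonneg_nonneg zero_le_divide_1_iff)
  also have "1 / (\<eta> * 4 ^ n) * (K * 2 ^ Suc (Suc n)) = 4 * K / (\<eta> * 2 ^ n)"
  proof -
    have "(4::real) ^ n = 2 ^ n * 2 ^ n" by (simp flip: power_mult_distrib)
    then show ?thesis using \<eta> by (simp add: field_simps)
  qed
  also have "rmod N (\<lambda>x. P x / r / (1 - P x / r)) V \<le> ennreal (1/2)" unfolding conj by (rule V_half)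
  also have "ennreal (4 * K / (\<eta> * 2 ^ n)) \<le> ennreal (1/2)"
    using n \<eta> by (intro ennreal_leI) (simp add: field_simps)
  also have "ennreal (1/2) + ennreal (1/2) = 1" by (subst ennreal_plus[symmetric]) auto
  finally have h1: "rmod N P h \<le> 1" by (simp add: add_mono)
  have "rmod N P (T (f n)) = rmod N P (\<lambda>x. 4 ^ n * h x)" by (simp add: h_def)
  also have "\<dots> \<le> ennreal ((4 ^ n) powr p2) * rmod N P h" by (intro rmod_cmult_ge1[OF P(1)]) auto
  also have "\<dots> \<le> ennreal ((4 ^ n) powr p2) * 1" by (intro mult_left_mono h1) auto
  finally show False using f(3)[of n] by simp
qed

end

section \<open>Iteration of weights\<close>

lemma nn_integral_geometric_mean_series:
  fixes u :: "nat \<Rightarrow> 'a \<Rightarrow> real"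
  assumes u[measurable]: "\<And>n. u n \<in> borel_measurable M" and u0: "\<And>n x. 0 \<le> u n x"
    and sums: "AE x in M. (\<lambda>n. (1/2) ^ Suc n * u n x) sums W x"
    and h[measurable]: "h \<in> borel_measurable M" and h0: "\<And>x. 0 \<le> h x"
  shows "(\<integral>\<^sup>+x. ennreal (h x * W x) \<partial>M) = (\<Sum>n. ennreal ((1/2) ^ Suc n) * (\<integral>\<^sup>+x. ennreal (h x * u n x) \<partial>M))"
proof -
  have "(\<integral>\<^sup>+x. ennreal (h x * W x) \<partial>M) = (\<integral>\<^sup>+x. (\<Sum>n. ennreal ((1/2) ^ Suc n) * ennreal (h x * u n x)) \<partial>M)"
  proof (rule nn_integral_cong_AE, use sums in eventually_elim)
    fix x assume "(\<lambda>n. (1/2) ^ Suc n * u n x) sums W x"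
    then have "(\<lambda>n. h x * ((1/2) ^ Suc n * u n x)) sums (h x * W x)" by (rule sums_mult)
    then have "(\<Sum>n. ennreal (h x * ((1/2) ^ Suc n * u n x))) = ennreal (h x * W x)"
      using u0 h0 by (intro suminf_ennreal_eq) auto
    moreover have "ennreal (h x * ((1/2) ^ Suc n * u n x)) = ennreal ((1/2) ^ Suc n) * ennreal (h x * u n x)" for n
    proof -
      have "h x * ((1/2) ^ Suc n * u n x) = (1/2) ^ Suc n * (h x * u n x)" by (simp only: mult_ac)
      then show ?thesis using u0[of n x] h0[of x] by (simp only: ennreal_mult mult_nonneg_nonneg zero_le_power zero_le_divide_1_iff zero_le_numeral)
    qed
    ultimately show "ennreal (h x * W x) = (\<Sum>n. ennreal ((1/2) ^ Suc n) * ennreal (h x * u n x))" by simp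
  qed
  also have "\<dots> = (\<Sum>n. \<integral>\<^sup>+x. ennreal ((1/2) ^ Suc n) * ennreal (h x * u n x) \<partial>M)"
    by (rule nn_integral_suminf) measurable
  also have "\<dots> = (\<Sum>n. ennreal ((1/2) ^ Suc n) * (\<integral>\<^sup>+x. ennreal (h x * u n x) \<partial>M))"
    by (intro suminf_cong nn_integral_cmult) measurable
  finally show ?thesis .
qed

text \<open>Halving at each step and shifting the index turns the inequalities between consecutive
  weights into one for their sum, at the price of a factor 2 in the constant. Every step keeps the
  modular at most 1, so the bound on \<open>W\<close> and the factor in
  \<open>u x \<le> 2 * W x\<close> do not depend on \<open>K\<close>.\<close>

lemma iterated_weight_convex:
  fixes \<P> :: "(('a \<Rightarrow> real) \<times> ('a \<Rightarrow> real)) set"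
  assumes a: "exponent_between M a 1 b"
    and \<P>: "\<And>g h. (g, h) \<in> \<P> \<Longrightarrow> g \<in> borel_measurable M \<and> h \<in> borel_measurable M \<and> (\<forall>x. 0 \<le> g x) \<and> (\<forall>x. 0 \<le> h x)"
    and K: "0 < K"
    and step: "\<And>u. u \<in> borel_measurable M \<Longrightarrow> \<forall>x. 0 \<le> u x \<Longrightarrow> rmod M a u \<le> 1 \<Longrightarrow>
      \<exists>U\<in>borel_measurable M. (\<forall>x. 0 \<le> U x) \<and> rmod M a U \<le> 1 \<and>
        (\<forall>g h. (g, h) \<in> \<P> \<longrightarrow> (\<integral>\<^sup>+x. ennreal (h x * u x) \<partial>M) \<le> ennreal K * (\<integral>\<^sup>+x. ennreal (g x * U x) \<partial>M))"
    and u: "u \<in> borel_measurable M" "\<forall>x. 0 \<le> u x" "rmod M a u \<le> 1"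
  shows "\<exists>W\<in>borel_measurable M. (\<forall>x. 0 \<le> W x) \<and> rmod M a W \<le> 1 \<and> (AE x in M. u x \<le> 2 * W x) \<and>
    (\<forall>g h. (g, h) \<in> \<P> \<longrightarrow> (\<integral>\<^sup>+x. ennreal (h x * W x) \<partial>M) \<le> ennreal (2 * K) * (\<integral>\<^sup>+x. ennreal (g x * W x) \<partial>M))"
proof -
  define ok where "ok u \<longleftrightarrow> u \<in> borel_measurable M \<and> (\<forall>x. 0 \<le> u x) \<and> rmod M a u \<le> 1" for u
  define good where "good u U \<longleftrightarrow> (\<forall>g h. (g, h) \<in> \<P> \<longrightarrow>
    (\<integral>\<^sup>+x. ennreal (h x * u x) \<partial>M) \<le> ennreal K * (\<integral>\<^sup>+x. ennreal (g x * U x) \<partial>M))" for u U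
  have "\<forall>u. \<exists>U. ok u \<longrightarrow> ok U \<and> good u U"
    using step unfolding ok_def good_def by meson
  then obtain \<Phi> where \<Phi>: "\<And>u. ok u \<Longrightarrow> ok (\<Phi> u) \<and> good u (\<Phi> u)" by metis
  define v where "v n = (\<Phi> ^^ n) u" for n
  have v_ok: "ok (v n)" for n by (induction n) (use u \<Phi> in \<open>auto simp: v_def ok_def\<close>)
  have v_good: "good (v n) (v (Suc n))" for n using \<Phi>[OF v_ok[of n]] by (simp add: v_def)
  have v_meas[measurable]: "v n \<in> borel_measurable M" and v0: "0 \<le> v n x" and v1: "rmod M a (v n) \<le> 1" for n x
    using v_ok[of n] by (auto simp: ok_def)
  obtain W where W: "W \<in> borel_measurable M" "\<forall>x. 0 \<le> W x" "rmod M a W \<le> 1"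
    and sums: "AE x in M. (\<lambda>n. (1/2) ^ Suc n * v n x) sums W x"
    using geometric_mean_series[OF a, of v, OF v_meas v0 v1] by blast
  have "AE x in M. u x \<le> 2 * W x"
    using sums
  proof eventually_elim
    fix x assume s: "(\<lambda>n. (1/2) ^ Suc n * v n x) sums W x"
    have "(\<Sum>k\<in>{0}. (1/2) ^ Suc k * v k x) \<le> (\<Sum>k. (1/2) ^ Suc k * v k x)"
      using v0 by (intro sum_le_suminf sums_summable[OF s]) auto
    then show "u x \<le> 2 * W x" using sums_unique[OF s] by (simp add: v_def)
  qed
  moreover have "(\<integral>\<^sup>+x. ennreal (h x * W x) \<partial>M) \<le> ennreal (2 * K) * (\<integral>\<^sup>+x. ennreal (g x * W x) \<partial>M)"
    if gh: "(g, h) \<in> \<P>" for g h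
  proof -
    define G where "G n = (\<integral>\<^sup>+x. ennreal (g x * v n x) \<partial>M)" for n
    have "(\<integral>\<^sup>+x. ennreal (h x * W x) \<partial>M) = (\<Sum>n. ennreal ((1/2) ^ Suc n) * (\<integral>\<^sup>+x. ennreal (h x * v n x) \<partial>M))"
      using \<P>[OF gh] by (intro nn_integral_geometric_mean_series v_meas v0 sums) auto
    also have "\<dots> \<le> (\<Sum>n. ennreal (2 * K) * (ennreal ((1/2) ^ Suc (Suc n)) * G (Suc n)))"
    proof (rule suminf_le)
      fix n
      have "ennreal ((1/2) ^ Suc n) * (\<integral>\<^sup>+x. ennreal (h x * v n x) \<partial>M) \<le> ennreal ((1/2) ^ Suc n) * (ennreal K * G (Suc n))"
        using v_good[of n] gh unfolding good_def G_def by (intro mult_left_mono) auto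
      also have "\<dots> = ennreal ((1/2) ^ Suc n) * ennreal K * G (Suc n)" by (simp only: mult.assoc)
      also have "ennreal ((1/2) ^ Suc n) * ennreal K = ennreal (2 * K) * ennreal ((1/2) ^ Suc (Suc n))"
      proof -
        have "(1/2) ^ Suc n * K = 2 * K * (1/2) ^ Suc (Suc n)" by simp
        moreover have "ennreal ((1/2) ^ Suc n) * ennreal K = ennreal ((1/2) ^ Suc n * K)"
          using K by (intro ennreal_mult[symmetric]) auto
        moreover have "ennreal (2 * K) * ennreal ((1/2) ^ Suc (Suc n)) = ennreal (2 * K * (1/2) ^ Suc (Suc n))"
          using K by (intro ennreal_mult[symmetric]) auto
        ultimately show ?thesis by (simp only:)
      qed
      finally show "ennreal ((1/2) ^ Suc n) * (\<integral>\<^sup>+x. ennreal (h x * v n x) \<partial>M)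
          \<le> ennreal (2 * K) * (ennreal ((1/2) ^ Suc (Suc n)) * G (Suc n))" by (simp only: mult.assoc)
    qed auto
    also have "\<dots> = ennreal (2 * K) * (\<Sum>n. ennreal ((1/2) ^ Suc (Suc n)) * G (Suc n))"
      by (rule ennreal_suminf_cmult)
    also have "(\<Sum>n. ennreal ((1/2) ^ Suc (Suc n)) * G (Suc n)) \<le> (\<Sum>n. ennreal ((1/2) ^ Suc n) * G n)"
      using suminf_offset[of "\<lambda>n. ennreal ((1/2) ^ Suc n) * G n" 1] by simp
    also have "(\<Sum>n. ennreal ((1/2) ^ Suc n) * G n) = (\<integral>\<^sup>+x. ennreal (g x * W x) \<partial>M)"
      unfolding G_def using \<P>[OF gh] by (intro nn_integral_geometric_mean_series[symmetric] v_meas v0 sums) auto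
    finally show ?thesis by (simp add: mult_left_mono)
  qed
  ultimately show ?thesis using W by (intro bexI[of _ W]) auto
qed

text \<open>Dominated convergence makes the modular of the errors tend to 0 after any scaling.
  Choosing \<open>\<nu> j\<close> so that 2 ^ j times the error has modular at most 1, boundedness
  makes the images of the errors summable in modular, hence convergent to 0 almost
  everywhere.\<close>

lemma (in bounded_lp_map) dominated_limit_ae_subsequence:
  assumes f: "f \<in> rLp M Q" and F: "\<And>n. F n \<in> rLp M Q"
    and dom: "\<And>n. AE y in M. \<bar>F n y - f y\<bar> \<le> \<bar>f y\<bar>" and lim: "AE y in M. (\<lambda>n. F n y) \<longlonglongrightarrow> f y"
  shows "\<exists>\<nu>. AE x in N. (\<lambda>j. T (F (\<nu> j)) x) \<longlonglongrightarrow> T f x"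
proof -
  have [measurable]: "f \<in> borel_measurable M" "F n \<in> borel_measurable M" for n
    using f F by (auto intro: rLp_measurable)
  define g where "g n y = F n y + (-1) * f y" for n y
  have g_in: "g n \<in> rLp M Q" for n unfolding g_def by (intro rLp_Q_add rLp_Q_cmult f F)
  have [measurable]: "g n \<in> borel_measurable M" for n using g_in by (rule rLp_measurable)
  have "\<exists>n. rmod M Q (\<lambda>y. 2 ^ j * g n y) \<le> 1" for j :: nat
  proof -
    have "(\<lambda>n. rmod M Q (\<lambda>y. 2 ^ j * g n y)) \<longlonglongrightarrow> (\<integral>\<^sup>+y. 0 \<partial>M)"
      unfolding rmod_def
    proof (rule nn_integral_dominated_convergence[where w = "\<lambda>y. ennreal (\<bar>2 ^ j * f y\<bar> powr Q y)"])
      show "AE y in M. ennreal (\<bar>2 ^ j * g n y\<bar> powr Q y) \<le> ennreal (\<bar>2 ^ j * f y\<bar> powr Q y)" for n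
        using dom[of n]
      proof eventually_elim
        fix y assume "\<bar>F n y - f y\<bar> \<le> \<bar>f y\<bar>"
        then have "\<bar>2 ^ j * g n y\<bar> \<le> \<bar>2 ^ j * f y\<bar>" by (simp add: g_def abs_mult)
        then show "ennreal (\<bar>2 ^ j * g n y\<bar> powr Q y) \<le> ennreal (\<bar>2 ^ j * f y\<bar> powr Q y)"
          using q0 Q_ge[of y] by (intro ennreal_leI powr_mono2) auto
      qed
      have "(\<lambda>y. 2 ^ j * f y) \<in> rLp M Q" by (intro rLp_Q_cmult f)
      then show "(\<integral>\<^sup>+y. ennreal (\<bar>2 ^ j * f y\<bar> powr Q y) \<partial>M) < \<infinity>" by (simp add: rLp_def rmod_def)
      show "AE y in M. (\<lambda>n. ennreal (\<bar>2 ^ j * g n y\<bar> powr Q y)) \<longlonglongrightarrow> 0"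
        using lim
      proof eventually_elim
        fix y assume "(\<lambda>n. F n y) \<longlonglongrightarrow> f y"
        then have "(\<lambda>n. 2 ^ j * (F n y + (-1) * f y)) \<longlonglongrightarrow> 2 ^ j * (f y + (-1) * f y)"
          by (intro tendsto_mult tendsto_add tendsto_const)
        then have "(\<lambda>n. \<bar>2 ^ j * g n y\<bar> powr Q y) \<longlonglongrightarrow> \<bar>2 ^ j * (f y + (-1) * f y)\<bar> powr Q y"
          unfolding g_def using Q(2) Q_ge[of y] by (intro tendsto_powr' tendsto_rabs tendsto_const) auto
        then show "(\<lambda>n. ennreal (\<bar>2 ^ j * g n y\<bar> powr Q y)) \<longlonglongrightarrow> 0"
          by (intro tendsto_ennrealI[where x = 0, simplified]) simp
      qed
    qed measurable
    then have "(\<lambda>n. rmod M Q (\<lambda>y. 2 ^ j * g n y)) \<longlonglongrightarrow> 0" by simp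
    then have "eventually (\<lambda>n. rmod M Q (\<lambda>y. 2 ^ j * g n y) < 1) sequentially"
      by (rule order_tendstoD) simp
    then show ?thesis by (auto simp: eventually_sequentially intro: less_imp_le)
  qed
  then obtain \<nu> where \<nu>: "\<And>j :: nat. rmod M Q (\<lambda>y. 2 ^ j * g (\<nu> j) y) \<le> 1" by metis
  have [measurable]: "T (g n) \<in> borel_measurable N" for n by (intro T_measurable g_in)
  have small: "rmod N P (T (g (\<nu> j))) \<le> ennreal (B * (1/2) ^ j)" for j
  proof -
    have "AE x in N. T (\<lambda>y. 2 ^ j * g (\<nu> j) y) x = 2 ^ j * T (g (\<nu> j)) x" by (rule T_cmult[OF g_in])
    then have "AE x in N. T (g (\<nu> j)) x = (1/2) ^ j * T (\<lambda>y. 2 ^ j * g (\<nu> j) y) x"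
      by eventually_elim (simp add: power_one_over)
    then have "rmod N P (T (g (\<nu> j))) = rmod N P (\<lambda>x. (1/2) ^ j * T (\<lambda>y. 2 ^ j * g (\<nu> j) y) x)"
      by (rule rmod_cong_AE)
    also have "\<dots> \<le> ennreal (((1/2) ^ j) powr p1) * rmod N P (T (\<lambda>y. 2 ^ j * g (\<nu> j) y))"
      by (intro rmod_cmult_le1[OF P(1)] T_measurable rLp_Q_cmult g_in) (auto simp: power_le_one)
    also have "\<dots> \<le> ennreal (((1/2) ^ j) powr 1) * ennreal B"
      using P(2) by (intro mult_mono ennreal_leI powr_mono' T_bounded \<nu> rLp_Q_cmult g_in) (auto simp: power_le_one)
    also have "\<dots> = ennreal (B * (1/2) ^ j)" using B by (simp add: mult.commute flip: ennreal_mult)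
    finally show ?thesis .
  qed
  have "(\<integral>\<^sup>+x. (\<Sum>j. ennreal (\<bar>T (g (\<nu> j)) x\<bar> powr P x)) \<partial>N) = (\<Sum>j. rmod N P (T (g (\<nu> j))))"
    unfolding rmod_def by (rule nn_integral_suminf) measurable
  also have "\<dots> \<le> (\<Sum>j. ennreal (B * (1/2) ^ j))" by (intro suminf_le small) auto
  also have "\<dots> < \<infinity>"
  proof -
    have "summable (\<lambda>n. B * (1/2) ^ n)" by (intro summable_mult summable_geometric) auto
    then have "(\<Sum>n. ennreal (B * (1/2) ^ n)) \<noteq> top"
      using B by (intro ennreal_suminf_neq_top) auto
    then show ?thesis by (simp add: less_top)
  qed
  finally have "AE x in N. (\<Sum>j. ennreal (\<bar>T (g (\<nu> j)) x\<bar> powr P x)) \<noteq> \<infinity>"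
    by (intro nn_integral_noteq_infinite) auto
  moreover have "AE x in N. \<forall>n. T (g n) x = T (F n) x - T f x"
    unfolding AE_all_countable
  proof
    fix n
    have "AE x in N. T (g n) x = T (F n) x + T (\<lambda>y. (-1) * f y) x"
      unfolding g_def by (intro T_add rLp_Q_cmult f F)
    moreover have "AE x in N. T (\<lambda>y. (-1) * f y) x = (-1) * T f x" by (rule T_cmult[OF f])
    ultimately show "AE x in N. T (g n) x = T (F n) x - T f x" by eventually_elim simp
  qed
  ultimately have "AE x in N. (\<lambda>j. T (F (\<nu> j)) x) \<longlonglongrightarrow> T f x"
  proof eventually_elim
    fix x assume fin: "(\<Sum>j. ennreal (\<bar>T (g (\<nu> j)) x\<bar> powr P x)) \<noteq> \<infinity>" and eq: "\<forall>n. T (g n) x = T (F n) x - T f x"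
    have "summable (\<lambda>j. \<bar>T (g (\<nu> j)) x\<bar> powr P x)"
      using fin by (intro summable_suminf_not_top) auto
    then have "(\<lambda>j. \<bar>T (g (\<nu> j)) x\<bar> powr P x) \<longlonglongrightarrow> 0" by (rule summable_LIMSEQ_zero)
    then have "(\<lambda>j. (\<bar>T (g (\<nu> j)) x\<bar> powr P x) powr (1 / P x)) \<longlonglongrightarrow> 0 powr (1 / P x)"
      using P(2) P_ge[of x] by (intro tendsto_powr' tendsto_const) auto
    then have "(\<lambda>j. \<bar>T (g (\<nu> j)) x\<bar>) \<longlonglongrightarrow> 0"
      using P(2) P_ge[of x] by (simp add: powr_powr)
    then have "(\<lambda>j. T (F (\<nu> j)) x - T f x) \<longlonglongrightarrow> 0" by (simp only: tendsto_rabs_zero_iff eq)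
    then show "(\<lambda>j. T (F (\<nu> j)) x) \<longlonglongrightarrow> T f x" by (rule LIM_zero_cancel)
  qed
  then show ?thesis by blast
qed

text \<open>Hoelder's inequality with masses \<open>d n\<close>, obtained by summing the tangent
  inequalities for the quotients \<open>x n / d n\<close> at the point X / D.\<close>

lemma weighted_power_sum_le:
  fixes x d :: "nat \<Rightarrow> real"
  assumes r: "1 \<le> r" and x: "\<And>n. n < N \<Longrightarrow> 0 \<le> x n" and d: "\<And>n. n < N \<Longrightarrow> 0 < d n" and D: "(\<Sum>n<N. d n) \<le> D" "0 < D"
  shows "(\<Sum>n<N. x n) powr r \<le> D powr (r - 1) * (\<Sum>n<N. x n powr r * d n powr (1 - r))"
proof -
  define X where "X = (\<Sum>n<N. x n)"
  define z where "z = X / D"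
  have X: "0 \<le> X" unfolding X_def using x by (intro sum_nonneg) auto
  have z: "0 \<le> z" using X D by (simp add: z_def)
  have Xz: "X = D * z" using D by (simp add: z_def)
  have each: "r * x n * z powr (r - 1) \<le> x n powr r * d n powr (1 - r) + (r - 1) * z powr r * d n" if n: "n < N" for n
  proof -
    have "r * (x n / d n) * z powr (r - 1) \<le> (x n / d n) powr r + (r - 1) * z powr r"
      using r x[OF n] d[OF n] z by (intro powr_tangent_below) auto
    then have "d n * (r * (x n / d n) * z powr (r - 1)) \<le> d n * ((x n / d n) powr r + (r - 1) * z powr r)"
      using d[OF n] by (intro mult_left_mono) auto
    moreover have "d n * (r * (x n / d n) * z powr (r - 1)) = r * x n * z powr (r - 1)"
      using d[OF n] by simp
    moreover have "d n * (x n / d n) powr r = x n powr r * d n powr (1 - r)"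
      using d[OF n] x[OF n] by (simp add: powr_divide powr_diff)
    ultimately show ?thesis by (simp add: distrib_left mult_ac)
  qed
  have zz: "z * z powr (r - 1) = z powr r" using z by (cases "z = 0") (auto simp: powr_mult_base)
  have "r * (D * z powr r) = r * X * z powr (r - 1)" unfolding Xz zz[symmetric] by simp
  also have "\<dots> = (\<Sum>n<N. r * x n * z powr (r - 1))" by (simp add: X_def sum_distrib_left sum_distrib_right)
  also have "\<dots> \<le> (\<Sum>n<N. x n powr r * d n powr (1 - r) + (r - 1) * z powr r * d n)"
    using each by (intro sum_mono) auto
  also have "\<dots> = (\<Sum>n<N. x n powr r * d n powr (1 - r)) + (r - 1) * z powr r * (\<Sum>n<N. d n)"
    by (simp add: sum.distrib sum_distrib_left)
  also have "\<dots> \<le> (\<Sum>n<N. x n powr r * d n powr (1 - r)) + (r - 1) * z powr r * D"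
    using r D by (intro add_left_mono mult_left_mono) auto
  finally have "D * z powr r \<le> (\<Sum>n<N. x n powr r * d n powr (1 - r))" by (simp add: algebra_simps)
  then have "D powr (r - 1) * (D * z powr r) \<le> D powr (r - 1) * (\<Sum>n<N. x n powr r * d n powr (1 - r))"
    by (intro mult_left_mono) auto
  moreover have "D powr (r - 1) * (D * z powr r) = X powr r"
    using D z r by (simp add: Xz powr_mult powr_diff)
  ultimately show ?thesis by (simp add: X_def)
qed

text \<open>
  The weights \<open>2\<^sup>-\<^sup>n u\<^sub>n\<close> of the iteration are combined through \<open>V = \<Sum>\<^sub>n (2\<^sup>-\<^sup>n u\<^sub>n)\<^sup>e\<close> with
  \<open>e = 1 / (r - 1)\<close>: then \<open>V powr (1 - r)\<close> is the infimal convolution of the weights \<open>2\<^sup>n / u\<^sub>n\<close>,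
  attained by splitting \<open>f\<close> proportionally to the terms of \<open>V\<close>.
\<close>

lemma iterated_weight_concave:
  assumes "bounded_lp_map M P M P T p1 p2 p1 p2 B"
    and r: "1 < r" "r \<le> 2" and a: "exponent_between M a 1 b" and K: "0 < K"
    and step: "\<And>u. u \<in> borel_measurable M \<Longrightarrow> AE x in M. 0 < u x \<Longrightarrow> rmod M a u \<le> 1 \<Longrightarrow>
      \<exists>U\<in>borel_measurable M. (\<forall>x. 0 < U x) \<and> rmod M a U \<le> 1 \<and>
        (\<forall>f\<in>rLp M P. (\<integral>\<^sup>+x. ennreal (\<bar>T f x\<bar> powr r * inverse (U x)) \<partial>M)
           \<le> ennreal K * (\<integral>\<^sup>+x. ennreal (\<bar>f x\<bar> powr r * inverse (u x)) \<partial>M))"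
    and u: "u \<in> borel_measurable M" "\<forall>x. 0 < u x" "rmod M a u \<le> 1"
  shows "\<exists>w\<in>borel_measurable M. (AE x in M. u x \<le> w x) \<and> rmod M a (\<lambda>x. 1/2 * w x) \<le> 1 \<and>
    (\<forall>f\<in>rLp M P. (\<integral>\<^sup>+x. ennreal (\<bar>T f x\<bar> powr r * inverse (w x)) \<partial>M)
       \<le> ennreal (2 * K) * (\<integral>\<^sup>+x. ennreal (\<bar>f x\<bar> powr r * inverse (w x)) \<partial>M))"
proof -
  interpret bounded_lp_map M P M P T p1 p2 p1 p2 B by fact
  define ok where "ok u \<longleftrightarrow> u \<in> borel_measurable M \<and> (\<forall>x. 0 < u x) \<and> rmod M a u \<le> 1" for u
  define good where "good u U \<longleftrightarrow> (\<forall>f\<in>rLp M P. (\<integral>\<^sup>+x. ennreal (\<bar>T f x\<bar> powr r * inverse (U x)) \<partial>M)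
           \<le> ennreal K * (\<integral>\<^sup>+x. ennreal (\<bar>f x\<bar> powr r * inverse (u x)) \<partial>M))" for u U
  have "\<exists>U. ok u \<longrightarrow> ok U \<and> good u U" for u
  proof (cases "ok u")
    case True
    then show ?thesis using step[of u] unfolding ok_def good_def by auto
  qed simp
  then obtain \<Phi> where \<Phi>: "\<And>u. ok u \<Longrightarrow> ok (\<Phi> u) \<and> good u (\<Phi> u)" by metis
  define v where "v n = (\<Phi> ^^ n) u" for n
  have v_ok: "ok (v n)" for n by (induction n) (use u \<Phi> in \<open>auto simp: v_def ok_def\<close>)
  have v_good: "good (v n) (v (Suc n))" for n using \<Phi>[OF v_ok[of n]] by (simp add: v_def)
  have v_meas[measurable]: "v n \<in> borel_measurable M" and v_pos: "0 < v n x" and v1: "rmod M a (v n) \<le> 1" for n x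
    using v_ok[of n] by (auto simp: ok_def)
  obtain W where W[measurable]: "W \<in> borel_measurable M" and W0: "\<forall>x. 0 \<le> W x" and W1: "rmod M a W \<le> 1"
    and W_sums: "AE x in M. (\<lambda>n. (1/2) ^ Suc n * v n x) sums W x"
    using geometric_mean_series[OF a, of v, OF v_meas less_imp_le[OF v_pos] v1] by blast
  \<comment> \<open>By r \<le> 2 the exponent \<open>e\<close> is at least 1, so the sum of the
    powers c n powr e is at most the e-th power of the sum. This gives w \<le> 2 W and hence the
    factor 2 for the norm.\<close>
  define e where "e = 1 / (r - 1)"
  have e: "1 \<le> e" "e * (r - 1) = 1" using r by (auto simp: e_def field_simps)
  define c where "c n x = (1/2) ^ n * v n x" for n x
  have c_pos: "0 < c n x" for n x using v_pos[of n x] by (simp add: c_def)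
  have [measurable]: "c n \<in> borel_measurable M" for n unfolding c_def by measurable
  define V where "V x = (\<Sum>n. c n x powr e)" for x
  have [measurable]: "V \<in> borel_measurable M" unfolding V_def by measurable
  define w where "w x = V x powr (r - 1)" for x
  have [measurable]: "w \<in> borel_measurable M" unfolding w_def by measurable
  have c_sums: "AE x in M. (\<lambda>n. c n x) sums (2 * W x)"
    using W_sums
  proof eventually_elim
    fix x assume "(\<lambda>n. (1/2) ^ Suc n * v n x) sums W x"
    then have "(\<lambda>n. 2 * ((1/2) ^ Suc n * v n x)) sums (2 * W x)" by (rule sums_mult)
    then show "(\<lambda>n. c n x) sums (2 * W x)" by (simp add: c_def)
  qed
  have V_facts: "AE x in M. (\<lambda>n. c n x powr e) sums V x \<and> (\<forall>n. c n x powr e \<le> V x) \<and> V x \<le> (2 * W x) powr e \<and> 0 < V x"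
    using c_sums
  proof eventually_elim
    fix x assume s: "(\<lambda>n. c n x) sums (2 * W x)"
    have cS: "c n x \<le> 2 * W x" for n
    proof -
      have "(\<Sum>k\<in>{n}. c k x) \<le> (\<Sum>k. c k x)"
        using c_pos by (intro sum_le_suminf sums_summable[OF s]) (auto intro: less_imp_le)
      then show ?thesis using sums_unique[OF s] by simp
    qed
    have S: "0 < 2 * W x" using cS[of 0] c_pos[of 0 x] by linarith
    have cle: "c n x powr e \<le> (2 * W x) powr (e - 1) * c n x" for n
    proof -
      have "c n x powr (e - 1) * c n x \<le> (2 * W x) powr (e - 1) * c n x"
        using c_pos[of n x] cS[of n] e by (intro mult_right_mono powr_mono2) auto
      moreover have "c n x powr (e - 1) * c n x = c n x powr e" using c_pos[of n x] by (simp add: powr_diff)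
      ultimately show ?thesis by simp
    qed
    have s2: "(\<lambda>n. (2 * W x) powr (e - 1) * c n x) sums ((2 * W x) powr (e - 1) * (2 * W x))" by (rule sums_mult[OF s])
    have sm: "summable (\<lambda>n. c n x powr e)"
      by (rule summable_comparison_test'[OF sums_summable[OF s2]]) (use cle in simp)
    have each: "c n x powr e \<le> V x" for n
    proof -
      have "(\<Sum>k\<in>{n}. c k x powr e) \<le> (\<Sum>k. c k x powr e)" by (intro sum_le_suminf sm) auto
      then show ?thesis by (simp add: V_def)
    qed
    have "V x \<le> (\<Sum>n. (2 * W x) powr (e - 1) * c n x)"
      unfolding V_def by (intro suminf_le sm sums_summable[OF s2] cle)
    also have "\<dots> = (2 * W x) powr (e - 1) * (2 * W x)" using sums_unique[OF s2] by simp
    also have "\<dots> = (2 * W x) powr e" using S by (simp add: powr_diff)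
    finally have "V x \<le> (2 * W x) powr e" .
    moreover have "0 < V x" using each[of 0] c_pos[of 0 x] by (intro less_le_trans[OF _ each[of 0]]) simp
    ultimately show "(\<lambda>n. c n x powr e) sums V x \<and> (\<forall>n. c n x powr e \<le> V x) \<and> V x \<le> (2 * W x) powr e \<and> 0 < V x"
      using each summable_sums[OF sm] by (simp add: V_def)
  qed
  have "AE x in M. u x \<le> w x"
    using V_facts
  proof eventually_elim
    fix x assume "(\<lambda>n. c n x powr e) sums V x \<and> (\<forall>n. c n x powr e \<le> V x) \<and> V x \<le> (2 * W x) powr e \<and> 0 < V x"
    then have "c 0 x powr e \<le> V x" by blast
    then have "(c 0 x powr e) powr (r - 1) \<le> w x" unfolding w_def using r by (intro powr_mono2) auto
    moreover have "(c 0 x powr e) powr (r - 1) = c 0 x" using c_pos[of 0 x] e by (simp add: powr_powr)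
    ultimately show "u x \<le> w x" by (simp add: c_def v_def)
  qed
  moreover have "rmod M a (\<lambda>x. 1/2 * w x) \<le> 1"
  proof -
    have "rmod M a (\<lambda>x. 1/2 * w x) \<le> rmod M a W"
    proof (rule rmod_mono_AE[OF a], simp, use V_facts in eventually_elim)
      fix x assume V: "(\<lambda>n. c n x powr e) sums V x \<and> (\<forall>n. c n x powr e \<le> V x) \<and> V x \<le> (2 * W x) powr e \<and> 0 < V x"
      then have "w x \<le> ((2 * W x) powr e) powr (r - 1)" unfolding w_def using r by (intro powr_mono2) auto
      also have "\<dots> = 2 * W x" using W0 e by (simp add: powr_powr)
      finally show "\<bar>1/2 * w x\<bar> \<le> \<bar>W x\<bar>" using W0 by (simp add: w_def)
    qed
    then show ?thesis using W1 by (rule order_trans)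
  qed
  moreover have "(\<integral>\<^sup>+x. ennreal (\<bar>T f x\<bar> powr r * inverse (w x)) \<partial>M)
       \<le> ennreal (2 * K) * (\<integral>\<^sup>+x. ennreal (\<bar>f x\<bar> powr r * inverse (w x)) \<partial>M)" if f: "f \<in> rLp M P" for f
  proof -
    define t where "t n x = c n x powr e / V x" for n x
    have [measurable]: "t n \<in> borel_measurable M" for n unfolding t_def by measurable
    have [measurable]: "f \<in> borel_measurable M" by (rule rLp_measurable[OF f])
    define F where "F n x = f x * t n x" for n x
    define S where "S N x = (\<Sum>n<N. 1 * F n x)" for N x
    have [measurable]: "F n \<in> borel_measurable M" "S N \<in> borel_measurable M" for n N unfolding F_def S_def by measurable
    have F_in: "F n \<in> rLp M P" for n
    proof (rule rLp_Q_mono[OF f])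
      show "AE x in M. \<bar>F n x\<bar> \<le> \<bar>f x\<bar>"
        using V_facts
      proof eventually_elim
        fix x assume V: "(\<lambda>n. c n x powr e) sums V x \<and> (\<forall>n. c n x powr e \<le> V x) \<and> V x \<le> (2 * W x) powr e \<and> 0 < V x"
        then have "0 \<le> t n x" "t n x \<le> 1" by (auto simp: t_def)
        then have "\<bar>f x\<bar> * t n x \<le> \<bar>f x\<bar> * 1" by (intro mult_left_mono) auto
        then show "\<bar>F n x\<bar> \<le> \<bar>f x\<bar>" using \<open>0 \<le> t n x\<close> by (simp add: F_def abs_mult)
      qed
    qed measurable
    have S_in: "S N \<in> rLp M P" for N unfolding S_def by (intro rLp_Q_sum F_in)
    have [measurable]: "T (F n) \<in> borel_measurable M" "T (S N) \<in> borel_measurable M" for n N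
      by (intro T_measurable F_in S_in)+
    have t_sum: "AE x in M. (\<forall>N. 0 \<le> (\<Sum>n<N. t n x) \<and> (\<Sum>n<N. t n x) \<le> 1) \<and> (\<lambda>N. \<Sum>n<N. t n x) \<longlonglongrightarrow> 1"
      using V_facts
    proof eventually_elim
      fix x assume V: "(\<lambda>n. c n x powr e) sums V x \<and> (\<forall>n. c n x powr e \<le> V x) \<and> V x \<le> (2 * W x) powr e \<and> 0 < V x"
      have s: "(\<lambda>n. t n x) sums 1"
        using sums_divide[of "\<lambda>n. c n x powr e" "V x" "V x"] V by (simp add: t_def)
      have t0: "0 \<le> t n x" for n using V by (simp add: t_def less_imp_le)
      have "(\<Sum>n<N. t n x) \<le> 1" for N
        using sum_le_suminf[OF sums_summable[OF s], of "{..<N}"] t0 sums_unique[OF s] by simp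
      then show "(\<forall>N. 0 \<le> (\<Sum>n<N. t n x) \<and> (\<Sum>n<N. t n x) \<le> 1) \<and> (\<lambda>N. \<Sum>n<N. t n x) \<longlonglongrightarrow> 1"
        using s t0 by (auto simp: sums_def intro: sum_nonneg)
    qed
    have S_eq: "S N x = f x * (\<Sum>n<N. t n x)" for N x by (simp add: S_def F_def sum_distrib_left)
    \<comment> \<open>\<open>T\<close> commutes only with finite sums, so the splitting of
      \<open>f\<close> is cut off at \<open>N\<close>. The estimate for the partial sums is carried
      over by almost everywhere convergence along \<open>\<nu>\<close> and Fatou's lemma.\<close>
    obtain \<nu> where \<nu>: "AE x in M. (\<lambda>j. T (S (\<nu> j)) x) \<longlonglongrightarrow> T f x"
    proof -
      have "AE x in M. \<bar>S N x - f x\<bar> \<le> \<bar>f x\<bar>" for N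
        using t_sum
      proof eventually_elim
        fix x assume "(\<forall>N. 0 \<le> (\<Sum>n<N. t n x) \<and> (\<Sum>n<N. t n x) \<le> 1) \<and> (\<lambda>N. \<Sum>n<N. t n x) \<longlonglongrightarrow> 1"
        then have "\<bar>(\<Sum>n<N. t n x) - 1\<bar> \<le> 1" by auto
        then have "\<bar>f x\<bar> * \<bar>(\<Sum>n<N. t n x) - 1\<bar> \<le> \<bar>f x\<bar> * 1" by (intro mult_left_mono) auto
        then show "\<bar>S N x - f x\<bar> \<le> \<bar>f x\<bar>" by (simp add: S_eq right_diff_distrib flip: abs_mult)
      qed
      moreover have "AE x in M. (\<lambda>N. S N x) \<longlonglongrightarrow> f x"
        using t_sum
      proof eventually_elim
        fix x assume "(\<forall>N. 0 \<le> (\<Sum>n<N. t n x) \<and> (\<Sum>n<N. t n x) \<le> 1) \<and> (\<lambda>N. \<Sum>n<N. t n x) \<longlonglongrightarrow> 1"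
        then have "(\<lambda>N. f x * (\<Sum>n<N. t n x)) \<longlonglongrightarrow> f x * 1" by (intro tendsto_mult tendsto_const) auto
        then show "(\<lambda>N. S N x) \<longlonglongrightarrow> f x" by (simp add: S_eq)
      qed
      ultimately show ?thesis using dominated_limit_ae_subsequence[OF f, of S, OF S_in] that by blast
    qed
    define R where "R = (\<integral>\<^sup>+x. ennreal (\<bar>f x\<bar> powr r * inverse (w x)) \<partial>M)"
    have partial: "(\<integral>\<^sup>+x. ennreal (\<bar>T (S N) x\<bar> powr r * inverse (w x)) \<partial>M) \<le> ennreal (2 * K) * R" for N
    proof -
      have TS: "AE x in M. T (S N) x = (\<Sum>n<N. 1 * T (F n) x)"
        unfolding S_def by (intro T_sum F_in) auto
      have "(\<integral>\<^sup>+x. ennreal (\<bar>T (S N) x\<bar> powr r * inverse (w x)) \<partial>M)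
         \<le> (\<integral>\<^sup>+x. (\<Sum>n<N. ennreal (2 ^ Suc n) * ennreal (\<bar>T (F n) x\<bar> powr r * inverse (v (Suc n) x))) \<partial>M)"
      proof (rule nn_integral_mono_AE, use TS V_facts in eventually_elim)
        fix x assume TSx: "T (S N) x = (\<Sum>n<N. 1 * T (F n) x)"
          and V: "(\<lambda>n. c n x powr e) sums V x \<and> (\<forall>n. c n x powr e \<le> V x) \<and> V x \<le> (2 * W x) powr e \<and> 0 < V x"
        \<comment> \<open>The n-th inequality leads from \<open>v n\<close> to
          \<open>v (Suc n)\<close>, so the images are weighted with the shifted terms
          \<open>c (Suc n)\<close>, whose series is still at most \<open>V\<close>.\<close>
        have d: "(\<Sum>n<N. c (Suc n) x powr e) \<le> V x"
        proof -
          have "(\<Sum>n<N. c (Suc n) x powr e) = (\<Sum>n\<in>Suc ` {..<N}. c n x powr e)" by (simp add: sum.reindex)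
          also have "\<dots> \<le> (\<Sum>n. c n x powr e)"
            using V by (intro sum_le_suminf) (auto intro: sums_summable)
          finally show ?thesis by (simp add: V_def)
        qed
        have "\<bar>T (S N) x\<bar> powr r \<le> (\<Sum>n<N. \<bar>T (F n) x\<bar>) powr r"
          unfolding TSx using r by (intro powr_mono2) auto
        also have "\<dots> \<le> V x powr (r - 1) * (\<Sum>n<N. \<bar>T (F n) x\<bar> powr r * (c (Suc n) x powr e) powr (1 - r))"
          using r V d c_pos by (intro weighted_power_sum_le) (auto simp: less_imp_neq[OF c_pos, symmetric])
        also have "(\<Sum>n<N. \<bar>T (F n) x\<bar> powr r * (c (Suc n) x powr e) powr (1 - r))
           = (\<Sum>n<N. 2 ^ Suc n * (\<bar>T (F n) x\<bar> powr r * inverse (v (Suc n) x)))"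
        proof (intro sum.cong refl)
          fix n
          have "(c (Suc n) x powr e) powr (1 - r) = c (Suc n) x powr (- (e * (r - 1)))"
            by (simp add: powr_powr algebra_simps)
          also have "\<dots> = inverse (c (Suc n) x)" using e c_pos[of "Suc n" x] by (simp add: powr_minus)
          also have "\<dots> = 2 ^ Suc n * inverse (v (Suc n) x)" by (simp add: c_def power_one_over field_simps)
          finally show "\<bar>T (F n) x\<bar> powr r * (c (Suc n) x powr e) powr (1 - r) = 2 ^ Suc n * (\<bar>T (F n) x\<bar> powr r * inverse (v (Suc n) x))"
            by (simp only: mult_ac)
        qed
        finally have "\<bar>T (S N) x\<bar> powr r * inverse (w x)
            \<le> (w x * (\<Sum>n<N. 2 ^ Suc n * (\<bar>T (F n) x\<bar> powr r * inverse (v (Suc n) x)))) * inverse (w x)"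
          unfolding w_def by (intro mult_right_mono) auto
        also have "\<dots> = (\<Sum>n<N. 2 ^ Suc n * (\<bar>T (F n) x\<bar> powr r * inverse (v (Suc n) x)))"
          using V by (simp add: w_def)
        finally have "ennreal (\<bar>T (S N) x\<bar> powr r * inverse (w x))
            \<le> ennreal (\<Sum>n<N. 2 ^ Suc n * (\<bar>T (F n) x\<bar> powr r * inverse (v (Suc n) x)))" by (rule ennreal_leI)
        also have "\<dots> = (\<Sum>n<N. ennreal (2 ^ Suc n * (\<bar>T (F n) x\<bar> powr r * inverse (v (Suc n) x))))"
          using v_pos by (intro sum_ennreal[symmetric]) (auto simp: less_imp_le)
        also have "\<dots> = (\<Sum>n<N. ennreal (2 ^ Suc n) * ennreal (\<bar>T (F n) x\<bar> powr r * inverse (v (Suc n) x)))"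
          using v_pos by (intro sum.cong refl ennreal_mult) (auto simp: less_imp_le)
        finally show "ennreal (\<bar>T (S N) x\<bar> powr r * inverse (w x))
            \<le> (\<Sum>n<N. ennreal (2 ^ Suc n) * ennreal (\<bar>T (F n) x\<bar> powr r * inverse (v (Suc n) x)))" .
      qed
      also have "\<dots> = (\<Sum>n<N. ennreal (2 ^ Suc n) * (\<integral>\<^sup>+x. ennreal (\<bar>T (F n) x\<bar> powr r * inverse (v (Suc n) x)) \<partial>M))"
        by (subst nn_integral_sum) (auto intro!: sum.cong nn_integral_cmult)
      also have "\<dots> \<le> (\<Sum>n<N. ennreal (2 ^ Suc n) * (ennreal K * (\<integral>\<^sup>+x. ennreal (\<bar>F n x\<bar> powr r * inverse (v n x)) \<partial>M)))"
        using v_good F_in unfolding good_def by (intro sum_mono mult_left_mono) auto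
      also have "\<dots> = (\<Sum>n<N. ennreal (2 * K) * (ennreal (2 ^ n) * (\<integral>\<^sup>+x. ennreal (\<bar>F n x\<bar> powr r * inverse (v n x)) \<partial>M)))"
      proof (intro sum.cong refl)
        fix n
        have "ennreal (2 ^ Suc n) * ennreal K = ennreal (2 * K) * ennreal (2 ^ n)"
          using K by (subst (1 2) ennreal_mult[symmetric]) (auto simp: mult_ac)
        then show "ennreal (2 ^ Suc n) * (ennreal K * (\<integral>\<^sup>+x. ennreal (\<bar>F n x\<bar> powr r * inverse (v n x)) \<partial>M))
           = ennreal (2 * K) * (ennreal (2 ^ n) * (\<integral>\<^sup>+x. ennreal (\<bar>F n x\<bar> powr r * inverse (v n x)) \<partial>M))"
          by (simp only: mult.assoc[symmetric])
      qed
      also have "\<dots> = ennreal (2 * K) * (\<Sum>n<N. ennreal (2 ^ n) * (\<integral>\<^sup>+x. ennreal (\<bar>F n x\<bar> powr r * inverse (v n x)) \<partial>M))"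
        by (rule sum_distrib_left[symmetric])
      also have "(\<Sum>n<N. ennreal (2 ^ n) * (\<integral>\<^sup>+x. ennreal (\<bar>F n x\<bar> powr r * inverse (v n x)) \<partial>M))
         = (\<integral>\<^sup>+x. (\<Sum>n<N. ennreal (2 ^ n) * ennreal (\<bar>F n x\<bar> powr r * inverse (v n x))) \<partial>M)"
        by (subst nn_integral_sum) (auto intro!: sum.cong nn_integral_cmult[symmetric])
      also have "\<dots> \<le> R"
        unfolding R_def
      proof (rule nn_integral_mono_AE, use V_facts in eventually_elim)
        fix x assume V: "(\<lambda>n. c n x powr e) sums V x \<and> (\<forall>n. c n x powr e \<le> V x) \<and> V x \<le> (2 * W x) powr e \<and> 0 < V x"
        have term_eq: "2 ^ n * (\<bar>F n x\<bar> powr r * inverse (v n x)) = \<bar>f x\<bar> powr r * V x powr (- r) * c n x powr e" for n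
        proof -
          have "inverse (c n x) = 2 ^ n * inverse (v n x)" by (simp add: c_def power_one_over field_simps)
          then have "2 ^ n * (\<bar>F n x\<bar> powr r * inverse (v n x)) = \<bar>F n x\<bar> powr r * inverse (c n x)" by simp
          moreover have "\<bar>F n x\<bar> powr r = \<bar>f x\<bar> powr r * (c n x powr (e * r) * V x powr (- r))"
            using V by (simp add: F_def t_def abs_mult powr_mult powr_divide powr_powr powr_minus_divide)
          ultimately have "2 ^ n * (\<bar>F n x\<bar> powr r * inverse (v n x))
             = \<bar>f x\<bar> powr r * (c n x powr (e * r) * V x powr (- r)) * inverse (c n x)" by (simp only:)
          also have "\<dots> = \<bar>f x\<bar> powr r * V x powr (- r) * (c n x powr (e * r) * inverse (c n x))" by (simp only: mult_ac)
          also have "c n x powr (e * r) * inverse (c n x) = c n x powr e"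
          proof -
            have "inverse (c n x) = c n x powr (- 1)" using c_pos[of n x] by (simp add: powr_minus)
            moreover have "e * r + - 1 = e" using e by (simp add: algebra_simps)
            ultimately show ?thesis by (simp only: powr_add[symmetric])
          qed
          finally show ?thesis .
        qed
        have "(\<Sum>n<N. ennreal (2 ^ n) * ennreal (\<bar>F n x\<bar> powr r * inverse (v n x)))
           = (\<Sum>n<N. ennreal (2 ^ n * (\<bar>F n x\<bar> powr r * inverse (v n x))))"
          using v_pos by (intro sum.cong refl ennreal_mult[symmetric]) (auto simp: less_imp_le)
        also have "\<dots> = ennreal (\<Sum>n<N. \<bar>f x\<bar> powr r * V x powr (- r) * c n x powr e)"
          unfolding term_eq by (intro sum_ennreal) auto
        also have "(\<Sum>n<N. \<bar>f x\<bar> powr r * V x powr (- r) * c n x powr e) = \<bar>f x\<bar> powr r * V x powr (- r) * (\<Sum>n<N. c n x powr e)"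
          by (rule sum_distrib_left[symmetric])
        also have "ennreal \<dots> \<le> ennreal (\<bar>f x\<bar> powr r * inverse (w x))"
        proof (rule ennreal_leI)
          have "(\<Sum>n<N. c n x powr e) \<le> V x"
            unfolding V_def using V by (intro sum_le_suminf) (auto intro: sums_summable)
          then have "\<bar>f x\<bar> powr r * V x powr (- r) * (\<Sum>n<N. c n x powr e) \<le> \<bar>f x\<bar> powr r * V x powr (- r) * V x"
            by (intro mult_left_mono) auto
          also have "\<dots> = \<bar>f x\<bar> powr r * (V x powr (- r) * V x powr 1)" using V by simp
          also have "V x powr (- r) * V x powr 1 = inverse (w x)"
            unfolding w_def powr_minus[symmetric] powr_add[symmetric] by simp
          finally show "\<bar>f x\<bar> powr r * V x powr (- r) * (\<Sum>n<N. c n x powr e) \<le> \<bar>f x\<bar> powr r * inverse (w x)" .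
        qed
        finally show "(\<Sum>n<N. ennreal (2 ^ n) * ennreal (\<bar>F n x\<bar> powr r * inverse (v n x))) \<le> ennreal (\<bar>f x\<bar> powr r * inverse (w x))" .
      qed
      finally show ?thesis by (simp add: mult_left_mono)
    qed
    have "(\<integral>\<^sup>+x. ennreal (\<bar>T f x\<bar> powr r * inverse (w x)) \<partial>M) \<le> ennreal (2 * K) * R"
    proof (rule nn_integral_fatou_le[where u = "\<lambda>j x. ennreal (\<bar>T (S (\<nu> j)) x\<bar> powr r * inverse (w x))" and C = "\<lambda>_. ennreal (2 * K) * R"])
      show "AE x in M. (\<lambda>j. ennreal (\<bar>T (S (\<nu> j)) x\<bar> powr r * inverse (w x))) \<longlonglongrightarrow> ennreal (\<bar>T f x\<bar> powr r * inverse (w x))"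
        using \<nu>
      proof eventually_elim
        fix x assume "(\<lambda>j. T (S (\<nu> j)) x) \<longlonglongrightarrow> T f x"
        then show "(\<lambda>j. ennreal (\<bar>T (S (\<nu> j)) x\<bar> powr r * inverse (w x))) \<longlonglongrightarrow> ennreal (\<bar>T f x\<bar> powr r * inverse (w x))"
          using r by (intro tendsto_ennrealI tendsto_mult tendsto_powr' tendsto_rabs tendsto_const) auto
      qed
    qed (use partial in auto)
    then show ?thesis by (simp add: R_def)
  qed
  ultimately show ?thesis by (intro bexI[of _ w]) auto
qed

section \<open>Variable Lebesgue spaces\<close>

abbreviation dual_exponent :: "real \<Rightarrow> ('a \<Rightarrow> ereal) \<Rightarrow> 'a \<Rightarrow> ereal" where
  "dual_exponent r p \<equiv> (\<lambda>x. 1 / \<bar>1 - ereal r / p x\<bar>)"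

text \<open>\<open>E\<close> is a real representative whose bounds hold everywhere, while
  \<open>e\<close> is tied to it only almost everywhere. Completeness is included because it makes
  the null set where \<open>e\<close> is infinite measurable.\<close>

definition real_exponent :: "'a measure \<Rightarrow> ('a \<Rightarrow> ereal) \<Rightarrow> ('a \<Rightarrow> real) \<Rightarrow> real \<Rightarrow> real \<Rightarrow> bool" where
  "real_exponent M e E a b \<longleftrightarrow>
     complete_measure M \<and> exponent_between M E a b \<and> 1 \<le> a \<and> (AE x in M. e x = ereal (E x))"

lemma real_exponentD:
  assumes "real_exponent M e E a b"
  shows "complete_measure M" "exponent_between M E a b" "1 \<le> a" "0 \<le> a" "AE x in M. e x = ereal (E x)"
  using assms by (auto simp: real_exponent_def)

text \<open>The numbers \<open>p1\<close> and \<open>p2\<close> are placed strictly between the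
  essential bounds and the given limits, and the exponent is clipped to the interval between them,
  which alters it on a null set only. The strict gaps keep the constants of the earlier sections
  finite.\<close>

lemma bounded_exponents_real_exponent:
  assumes p: "p \<in> bounded_exponents M" and M: "complete_measure M"
    and l: "1 \<le> l" "ereal l < essinf M p" and u: "esssup M p < ereal u"
  obtains P p1 p2 where "real_exponent M p P p1 p2" "l < p1" "p2 < u"
proof -
  have [measurable]: "p \<in> borel_measurable M" and le: "essinf M p \<le> esssup M p"
    using p by (auto simp: bounded_exponents_def)
  obtain c where c: "AE x in M. c \<le> p x" "ereal l < c"
    using l(2) unfolding essinf_def less_Sup_iff by auto
  obtain p1 where p1: "ereal l < ereal p1" "ereal p1 < c" using ereal_dense2[OF c(2)] by auto
  have c_le: "c \<le> essinf M p" unfolding essinf_def using c(1) by (intro Sup_upper) auto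
  obtain p2 where p2: "esssup M p < ereal p2" "ereal p2 < ereal u" using ereal_dense2[OF u] by auto
  have "ereal p1 < ereal p2" using p1(2) c_le le p2(1) by (meson order.strict_trans order.strict_trans2)
  then have p12: "p1 \<le> p2" by simp
  define P where "P x = max p1 (min p2 (real_of_ereal (p x)))" for x
  have [measurable]: "P \<in> borel_measurable M" unfolding P_def by measurable
  have "AE x in M. p x \<le> esssup M p" by (rule esssup_AE)
  with c(1) have "AE x in M. p x = ereal (P x)"
  proof eventually_elim
    fix x assume "c \<le> p x" "p x \<le> esssup M p"
    then have "ereal p1 \<le> p x" "p x \<le> ereal p2" using p1(2) p2(1) by (auto intro: less_imp_le order.strict_trans1 order.strict_trans2)
    then show "p x = ereal (P x)" by (cases "p x") (auto simp: P_def max_def min_def)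
  qed
  moreover have "exponent_between M P p1 p2" using p12 by (auto simp: exponent_between_def P_def)
  ultimately have "real_exponent M p P p1 p2" using M l(1) p1(1) by (auto simp: real_exponent_def)
  then show ?thesis using p1(1) p2(2) by (intro that) auto
qed

text \<open>On a null space the essential infimum is infinite, which the bounds exclude. This is
  what gives a positive weight a positive norm.\<close>

lemma bounded_exponents_nonnull:
  assumes p: "p \<in> bounded_exponents M"
  shows "\<not> (AE x in M. False)"
proof
  assume "AE x in M. False"
  then have "AE x in M. \<infinity> \<le> p x" by (rule eventually_mono) simp
  then have "\<infinity> \<le> essinf M p" unfolding essinf_def by (intro Sup_upper) simp
  then show False using p by (auto simp: bounded_exponents_def)
qed

lemma modular_eq_rmod:
  assumes e: "real_exponent M e E a b" and f: "f \<in> borel_measurable M"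
  shows "modular M e f = rmod M E f"
proof -
  interpret complete_measure M by (rule real_exponentD(1)[OF e])
  define A where "A = {x \<in> space M. e x = \<infinity>}"
  have notA: "AE x in M. x \<notin> A" using real_exponentD(5)[OF e] by eventually_elim (auto simp: A_def)
  then obtain Nn where Nn: "{x \<in> space M. x \<in> A} \<subseteq> Nn" "Nn \<in> sets M" "emeasure M Nn = 0"
    by (auto elim: AE_E)
  have "A \<subseteq> Nn" using Nn(1) by (auto simp: A_def)
  moreover have "Nn \<in> null_sets M" using Nn by auto
  ultimately have A_sets: "A \<in> sets M" by (rule complete)
  have "esssup (restrict_space M A) (\<lambda>x. ennreal \<bar>f x\<bar>) \<le> 0"
  proof (rule esssup_I)
    show "(\<lambda>x. ennreal \<bar>f x\<bar>) \<in> borel_measurable (restrict_space M A)"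
      by (intro measurable_restrict_space1) (use f in measurable)
    show "AE x in restrict_space M A. ennreal \<bar>f x\<bar> \<le> 0"
      using A_sets notA by (subst AE_restrict_space_iff) (auto elim: eventually_mono)
  qed
  moreover have "(\<integral>\<^sup>+x\<in>{x \<in> space M. e x \<noteq> \<infinity>}. ennreal (\<bar>f x\<bar> powr real_of_ereal (e x)) \<partial>M) = rmod M E f"
    unfolding rmod_def
  proof (rule nn_integral_cong_AE)
    have "AE x in M. x \<in> space M" by simp
    with real_exponentD(5)[OF e]
    show "AE x in M. ennreal (\<bar>f x\<bar> powr real_of_ereal (e x)) * indicator {x \<in> space M. e x \<noteq> \<infinity>} x = ennreal (\<bar>f x\<bar> powr E x)"
      by eventually_elim simp
  qed
  ultimately show ?thesis by (simp add: modular_def flip: A_def)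
qed

lemma var_Lp_eq_rLp:
  assumes e: "real_exponent M e E a b"
  shows "var_Lp M e = rLp M E"
proof (intro set_eqI iffI)
  note E = real_exponentD(2,4)[OF e]
  fix f
  {
    assume "f \<in> var_Lp M e"
    then obtain l where f[measurable]: "f \<in> borel_measurable M" and l: "0 < l" "modular M e (\<lambda>x. f x / l) < \<infinity>"
      by (auto simp: var_Lp_def)
    have "(\<lambda>x. f x / l) \<in> rLp M E" using l(2) by (subst (asm) modular_eq_rmod[OF e]) (auto simp: rLp_def)
    then have "(\<lambda>x. l * (f x / l)) \<in> rLp M E" by (rule rLp_cmult[OF E])
    then show "f \<in> rLp M E" using l(1) by simp
  next
    assume f: "f \<in> rLp M E"
    then have "modular M e (\<lambda>x. f x / 1) < \<infinity>" by (subst modular_eq_rmod[OF e]) (auto simp: rLp_def)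
    moreover have "f \<in> borel_measurable M" using f by (rule rLp_measurable)
    ultimately show "f \<in> var_Lp M e" unfolding var_Lp_def using zero_less_one by blast
  }
qed

lemma var_Lp_pos_iff:
  assumes e: "real_exponent M e E a b"
  shows "u \<in> var_Lp_pos M e \<longleftrightarrow> u \<in> rLp M E \<and> (AE x in M. 0 < u x)"
  by (simp add: var_Lp_pos_def var_Lp_eq_rLp[OF e])

section \<open>The Luxemburg norm and the modular\<close>

lemma var_norm_eq_Inf:
  assumes e: "real_exponent M e E a b" and f: "f \<in> rLp M E"
  shows "var_norm M e f = Inf {l. 0 < l \<and> rmod M E (\<lambda>x. 1 / l * f x) \<le> 1}"
    and "{l. 0 < l \<and> rmod M E (\<lambda>x. 1 / l * f x) \<le> 1} \<noteq> {}"
proof -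
  note E = real_exponentD(2,4)[OF e]
  have [measurable]: "f \<in> borel_measurable M" using f by (rule rLp_measurable)
  show "var_norm M e f = Inf {l. 0 < l \<and> rmod M E (\<lambda>x. 1 / l * f x) \<le> 1}"
    unfolding var_norm_def by (simp add: modular_eq_rmod[OF e] cong: conj_cong)
  obtain t where t: "rmod M E f = ennreal t" "0 \<le> t" using f by (cases "rmod M E f") (auto simp: rLp_def)
  have "rmod M E (\<lambda>x. 1 / (t + 1) * f x) \<le> ennreal ((1 / (t + 1)) powr a) * rmod M E f"
    using t by (intro rmod_cmult_le1[OF E(1)]) auto
  also have "\<dots> \<le> ennreal ((1 / (t + 1)) powr 1) * ennreal t"
    unfolding t(1) using t(2) real_exponentD(3)[OF e] by (intro mult_right_mono ennreal_leI powr_mono') auto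
  also have "\<dots> = ennreal (1 / (t + 1) * t)" using t(2) by (simp flip: ennreal_mult)
  also have "\<dots> \<le> 1" using t(2) by simp
  finally have "t + 1 \<in> {l. 0 < l \<and> rmod M E (\<lambda>x. 1 / l * f x) \<le> 1}" using t(2) by simp
  then show "{l. 0 < l \<and> rmod M E (\<lambda>x. 1 / l * f x) \<le> 1} \<noteq> {}" by blast
qed

lemma var_norm_nonneg:
  assumes "real_exponent M e E a b" "f \<in> rLp M E"
  shows "0 \<le> var_norm M e f"
  unfolding var_norm_eq_Inf(1)[OF assms] using var_norm_eq_Inf(2)[OF assms] by (intro cInf_greatest) auto

text \<open>The point is that the infimum itself satisfies the modular condition: Fatou's lemma
  carries it from l + 1 / Suc n to \<open>l\<close>.\<close>

lemma var_norm_le_iff: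
  assumes e: "real_exponent M e E a b" and f: "f \<in> rLp M E" and l: "0 < l"
  shows "var_norm M e f \<le> l \<longleftrightarrow> rmod M E (\<lambda>x. 1 / l * f x) \<le> 1"
proof -
  note E = real_exponentD(2,4)[OF e]
  have [measurable]: "E \<in> borel_measurable M" by (rule exponent_betweenD[OF E(1)])
  have [measurable]: "f \<in> borel_measurable M" using f by (rule rLp_measurable)
  define S where "S = {l. 0 < l \<and> rmod M E (\<lambda>x. 1 / l * f x) \<le> 1}"
  have norm: "var_norm M e f = Inf S" and ne: "S \<noteq> {}"
    unfolding S_def by (rule var_norm_eq_Inf[OF e f])+
  have bdd: "bdd_below S" by (rule bdd_belowI[of _ 0]) (auto simp: S_def)
  show ?thesis
  proof
    assume "rmod M E (\<lambda>x. 1 / l * f x) \<le> 1"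
    then have "l \<in> S" using l by (simp add: S_def)
    then show "var_norm M e f \<le> l" unfolding norm by (intro cInf_lower bdd)
  next
    assume le: "var_norm M e f \<le> l"
    define L where "L n = l + 1 / real (Suc n)" for n
    have L_pos: "0 < L n" for n using l by (simp add: L_def add_pos_pos)
    have L_le: "rmod M E (\<lambda>x. 1 / L n * f x) \<le> 1" for n
    proof -
      have "Inf S < L n" using le unfolding norm L_def by (intro order.strict_trans1[OF le[unfolded norm]]) simp
      then obtain s where s: "s \<in> S" "s < L n" using cInf_lessD[OF ne] by blast
      have "rmod M E (\<lambda>x. 1 / L n * f x) \<le> rmod M E (\<lambda>x. 1 / s * f x)"
      proof (rule rmod_mono_AE[OF E], rule AE_I2)
        fix x
        have "1 / L n \<le> 1 / s" using s by (auto simp: S_def intro!: divide_left_mono mult_pos_pos L_pos)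
        then have "1 / L n * \<bar>f x\<bar> \<le> 1 / s * \<bar>f x\<bar>" by (intro mult_right_mono) auto
        then show "\<bar>1 / L n * f x\<bar> \<le> \<bar>1 / s * f x\<bar>" using s L_pos[of n] by (simp add: S_def abs_mult)
      qed
      then show ?thesis using s by (auto simp: S_def)
    qed
    have L_lim: "L \<longlonglongrightarrow> l"
      unfolding L_def using tendsto_add[OF tendsto_const LIMSEQ_Suc[OF lim_1_over_n], of l] by simp
    show "rmod M E (\<lambda>x. 1 / l * f x) \<le> 1"
      unfolding rmod_def
    proof (rule nn_integral_fatou_le[where u = "\<lambda>n x. ennreal (\<bar>1 / L n * f x\<bar> powr E x)" and C = "\<lambda>_. 1"])
      show "AE x in M. (\<lambda>n. ennreal (\<bar>1 / L n * f x\<bar> powr E x)) \<longlonglongrightarrow> ennreal (\<bar>1 / l * f x\<bar> powr E x)"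
      proof (rule AE_I2)
        fix x
        have "0 < E x" using exponent_betweenD(2)[OF E(1), of x] real_exponentD(3)[OF e] by simp
        then show "(\<lambda>n. ennreal (\<bar>1 / L n * f x\<bar> powr E x)) \<longlonglongrightarrow> ennreal (\<bar>1 / l * f x\<bar> powr E x)"
          using l by (intro tendsto_ennrealI tendsto_powr' tendsto_rabs tendsto_mult tendsto_divide tendsto_const L_lim) auto
      qed
    qed (use L_le in \<open>auto simp: rmod_def\<close>)
  qed
qed

text \<open>A norm of 0 would bound the modular by every positive number, so \<open>u\<close> would
  vanish almost everywhere, which a positive function does only on a null space.\<close>

lemma var_norm_pos:
  assumes e: "real_exponent M e E a b" and u: "u \<in> rLp M E" "AE x in M. 0 < u x" and M: "\<not> (AE x in M. False)"
  shows "0 < var_norm M e u"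
proof (rule ccontr)
  note E = real_exponentD(2,4)[OF e]
  have [measurable]: "E \<in> borel_measurable M" by (rule exponent_betweenD[OF E(1)])
  have [measurable]: "u \<in> borel_measurable M" using u(1) by (rule rLp_measurable)
  assume "\<not> ?thesis"
  then have zero: "var_norm M e u \<le> l" if "0 < l" for l using that by simp
  have "rmod M E u \<le> ennreal l" if l: "0 < l" "l \<le> 1" for l
  proof -
    have one: "rmod M E (\<lambda>x. 1 / l * u x) \<le> 1" using zero[OF l(1)] var_norm_le_iff[OF e u(1) l(1)] by simp
    have "rmod M E u = rmod M E (\<lambda>x. l * (1 / l * u x))" using l by simp
    also have "\<dots> \<le> ennreal (l powr a) * rmod M E (\<lambda>x. 1 / l * u x)"
      using l by (intro rmod_cmult_le1[OF E(1)]) auto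
    also have "\<dots> \<le> ennreal (l powr 1) * 1"
      using l one real_exponentD(3)[OF e] by (intro mult_mono ennreal_leI powr_mono') auto
    finally show ?thesis using l by simp
  qed
  then have "rmod M E u \<le> 0 + ennreal l" if "0 < l" for l
    using order_trans[of "rmod M E u" "ennreal (min l 1)" "ennreal l"] that by (auto intro!: ennreal_leI)
  then have "rmod M E u \<le> 0" by (rule ennreal_le_epsilon)
  then have "(\<integral>\<^sup>+x. ennreal (\<bar>u x\<bar> powr E x) \<partial>M) = 0" by (simp only: rmod_def le_zero_eq)
  then have "AE x in M. ennreal (\<bar>u x\<bar> powr E x) = 0"
    by (rule iffD1[OF nn_integral_0_iff_AE, rotated]) measurable
  with u(2) have "AE x in M. False" by eventually_elim auto
  then show False using M by blast
qed

section \<open>Operators, weighted inequalities and dual exponents in modular form\<close>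

lemma linear_operator_lp_map:
  assumes T: "linear_operator M q N p T" and q: "real_exponent M q Q q1 q2" "1 < q1" and p: "real_exponent N p P p1 p2" "1 < p1"
  shows "lp_map M Q N P T q1 q2 p1 p2"
  using T real_exponentD(2)[OF q(1)] real_exponentD(2)[OF p(1)] q(2) p(2)
  unfolding linear_operator_def lp_map_def var_Lp_eq_rLp[OF q(1)] var_Lp_eq_rLp[OF p(1)] by simp

text \<open>Norm and modular bounds are interchangeable because the exponents lie between 1 and
  \<open>p2\<close>: a norm bound \<open>K\<close> gives the modular bound \<open>L powr p2\<close>
  with L = max 1 K, and a modular bound \<open>B\<close> gives the norm bound max 1 B.\<close>

lemma bounded_operator_iff:
  assumes T: "linear_operator M q N p T" and q: "real_exponent M q Q q1 q2" "1 < q1" and p: "real_exponent N p P p1 p2" "1 < p1"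
  shows "bounded_operator M q N p T \<longleftrightarrow> (\<exists>B\<ge>0. \<forall>f\<in>rLp M Q. rmod M Q f \<le> 1 \<longrightarrow> rmod N P (T f) \<le> ennreal B)"
proof
  interpret lp_map M Q N P T q1 q2 p1 p2 by (rule linear_operator_lp_map[OF T q p])
  assume "bounded_operator M q N p T"
  then obtain K where K: "\<And>f. f \<in> rLp M Q \<Longrightarrow> var_norm N p (T f) \<le> K * var_norm M q f"
    unfolding bounded_operator_def var_Lp_eq_rLp[OF q(1)] by auto
  define L where "L = max 1 K"
  have L: "1 \<le> L" "K \<le> L" by (auto simp: L_def)
  have "rmod N P (T f) \<le> ennreal (L powr p2)" if f: "f \<in> rLp M Q" "rmod M Q f \<le> 1" for f
  proof -
    have "var_norm M q f \<le> 1" using var_norm_le_iff[OF q(1) f(1), of 1] f(2) by simp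
    moreover have "K * var_norm M q f \<le> L * var_norm M q f"
      using L var_norm_nonneg[OF q(1) f(1)] by (intro mult_right_mono)
    moreover have "L * var_norm M q f \<le> L * 1 \<longleftrightarrow> var_norm M q f \<le> 1" using L by simp
    ultimately have "var_norm N p (T f) \<le> L" using K[OF f(1)] by linarith
    then have one: "rmod N P (\<lambda>x. 1 / L * T f x) \<le> 1"
      using var_norm_le_iff[OF p(1) T_in[OF f(1)], of L] L by simp
    have [measurable]: "T f \<in> borel_measurable N" by (rule T_measurable[OF f(1)])
    have "rmod N P (T f) = rmod N P (\<lambda>x. L * (1 / L * T f x))" using L by simp
    also have "\<dots> \<le> ennreal (L powr p2) * rmod N P (\<lambda>x. 1 / L * T f x)"
      using L by (intro rmod_cmult_ge1[OF P(1)]) auto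
    also have "\<dots> \<le> ennreal (L powr p2) * 1" by (intro mult_left_mono one) auto
    finally show ?thesis by simp
  qed
  then show "\<exists>B\<ge>0. \<forall>f\<in>rLp M Q. rmod M Q f \<le> 1 \<longrightarrow> rmod N P (T f) \<le> ennreal B"
    by (intro exI[of _ "L powr p2"]) auto
next
  interpret lp_map M Q N P T q1 q2 p1 p2 by (rule linear_operator_lp_map[OF T q p])
  assume "\<exists>B\<ge>0. \<forall>f\<in>rLp M Q. rmod M Q f \<le> 1 \<longrightarrow> rmod N P (T f) \<le> ennreal B"
  then obtain B where B: "0 \<le> B" "\<And>f. f \<in> rLp M Q \<Longrightarrow> rmod M Q f \<le> 1 \<Longrightarrow> rmod N P (T f) \<le> ennreal B" by auto
  define C where "C = max 1 B"
  have C: "1 \<le> C" "B \<le> C" by (auto simp: C_def)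
  have scaled: "var_norm N p (T f) \<le> l * C" if f: "f \<in> rLp M Q" and l: "0 < l" "var_norm M q f \<le> l" for f l
  proof -
    have g: "(\<lambda>y. 1 / l * f y) \<in> rLp M Q" by (intro rLp_Q_cmult f)
    have "rmod M Q (\<lambda>y. 1 / l * f y) \<le> 1" using var_norm_le_iff[OF q(1) f l(1)] l(2) by simp
    then have b: "rmod N P (T (\<lambda>y. 1 / l * f y)) \<le> ennreal B" by (intro B g)
    have "AE x in N. T (\<lambda>y. 1 / l * f y) x = 1 / l * T f x" by (rule T_cmult[OF f])
    then have "AE x in N. 1 / (l * C) * T f x = 1 / C * T (\<lambda>y. 1 / l * f y) x"
      by eventually_elim simp
    then have "rmod N P (\<lambda>x. 1 / (l * C) * T f x) = rmod N P (\<lambda>x. 1 / C * T (\<lambda>y. 1 / l * f y) x)"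
      by (rule rmod_cong_AE)
    also have "\<dots> \<le> ennreal ((1 / C) powr p1) * rmod N P (T (\<lambda>y. 1 / l * f y))"
      using C by (intro rmod_cmult_le1[OF P(1)] T_measurable g) auto
    also have "\<dots> \<le> ennreal ((1 / C) powr 1) * ennreal C"
      using C P(2) b by (intro mult_mono ennreal_leI powr_mono') (auto intro: order_trans ennreal_leI)
    also have "\<dots> = 1" using C by (simp flip: ennreal_mult)
    finally show ?thesis using var_norm_le_iff[OF p(1) T_in[OF f], of "l * C"] l C by simp
  qed
  have "var_norm N p (T f) \<le> C * var_norm M q f" if f: "f \<in> rLp M Q" for f
  proof (rule field_le_epsilon)
    fix d :: real assume d: "0 < d"
    \<comment> \<open>The norm of \<open>f\<close> may be 0, so the scaling uses a slightly larger
      number and the excess is sent to 0.\<close>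
    have "0 < var_norm M q f + d / C" using d C var_norm_nonneg[OF q(1) f] by (intro add_nonneg_pos) auto
    then have "var_norm N p (T f) \<le> (var_norm M q f + d / C) * C"
      using d C by (intro scaled f) auto
    also have "\<dots> = C * var_norm M q f + d" using C by (simp add: field_simps)
    finally show "var_norm N p (T f) \<le> C * var_norm M q f + d" .
  qed
  then show "bounded_operator M q N p T"
    unfolding bounded_operator_def var_Lp_eq_rLp[OF q(1)] by auto
qed

lemma weighted_bounded_iff:
  assumes q: "real_exponent M q Q q1 q2"
  shows "weighted_bounded r M q V N v T \<longleftrightarrow>
    (\<exists>K>0. \<forall>f\<in>rLp M Q. (\<integral>\<^sup>+x. ennreal (\<bar>T f x\<bar> powr r * v x) \<partial>N)
        \<le> ennreal K * (\<integral>\<^sup>+y. ennreal (\<bar>f y\<bar> powr r * V y) \<partial>M))"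
  by (simp add: weighted_bounded_def var_Lp_eq_rLp[OF q])

lemma conjugate_real_exponent_gt:
  assumes p: "real_exponent M p P p1 p2" and r: "1 \<le> r" "r < p1"
  shows "real_exponent M (dual_exponent r p) (\<lambda>x. P x / (P x - r)) 1 (p2 / (p1 - r))"
proof -
  note P = real_exponentD(2)[OF p]
  have Pm[measurable]: "P \<in> borel_measurable M" by (rule exponent_betweenD[OF P])
  have P1: "p1 \<le> P x" "P x \<le> p2" for x using exponent_betweenD[OF P] by auto
  have "1 \<le> P x / (P x - r) \<and> P x / (P x - r) \<le> p2 / (p1 - r)" for x
  proof
    show "1 \<le> P x / (P x - r)" using P1[of x] r by (simp add: field_simps)
    show "P x / (P x - r) \<le> p2 / (p1 - r)" using P1[of x] r by (intro frac_le) auto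
  qed
  moreover have "AE x in M. 1 / \<bar>1 - ereal r / p x\<bar> = ereal (P x / (P x - r))"
    using real_exponentD(5)[OF p]
  proof eventually_elim
    fix x assume x: "p x = ereal (P x)"
    have "1 - r / P x = (P x - r) / P x" using P1[of x] r by (simp add: field_simps)
    then have "\<bar>1 - ereal r / p x\<bar> = ereal ((P x - r) / P x)"
      using P1[of x] r x by (simp add: one_ereal_def)
    then show "1 / \<bar>1 - ereal r / p x\<bar> = ereal (P x / (P x - r))"
      using P1[of x] r by (simp add: one_ereal_def)
  qed
  ultimately show ?thesis
    using real_exponentD(1)[OF p] by (simp add: real_exponent_def exponent_between_def)
qed

text \<open>That the dual exponent is at least 1 comes from r - P x \<le> 1 \<le> P x, where the
  first inequality uses r \<le> 2.\<close>

lemma conjugate_real_exponent_lt: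
  assumes p: "real_exponent M p P p1 p2" and r: "p2 < r" "r \<le> 2"
  shows "real_exponent M (dual_exponent r p) (\<lambda>x. P x / (r - P x)) 1 (p2 / (r - p2))"
proof -
  note P = real_exponentD(2)[OF p]
  have Pm[measurable]: "P \<in> borel_measurable M" by (rule exponent_betweenD[OF P])
  have P1: "1 \<le> P x" "P x \<le> p2" for x
    using exponent_betweenD(2,3)[OF P, of x] real_exponentD(3)[OF p] by auto
  have "1 \<le> P x / (r - P x) \<and> P x / (r - P x) \<le> p2 / (r - p2)" for x
  proof
    show "1 \<le> P x / (r - P x)" using P1[of x] r by (simp add: field_simps)
    show "P x / (r - P x) \<le> p2 / (r - p2)" using P1[of x] r by (intro frac_le) auto
  qed
  moreover have "AE x in M. 1 / \<bar>1 - ereal r / p x\<bar> = ereal (P x / (r - P x))"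
    using real_exponentD(5)[OF p]
  proof eventually_elim
    fix x assume x: "p x = ereal (P x)"
    have "\<bar>1 - r / P x\<bar> = (r - P x) / P x" using P1[of x] r by (simp add: field_simps)
    then have "\<bar>1 - ereal r / p x\<bar> = ereal ((r - P x) / P x)"
      using P1[of x] r x by (simp add: one_ereal_def)
    then show "1 / \<bar>1 - ereal r / p x\<bar> = ereal (P x / (r - P x))"
      using P1[of x] r by (simp add: one_ereal_def)
  qed
  ultimately show ?thesis
    using real_exponentD(1)[OF p] by (simp add: real_exponent_def exponent_between_def)
qed

text \<open>This allows a weight that may vanish to be averaged with a positive one without leaving
  the unit ball.\<close>

lemma rmod_midpoint_le_1:
  assumes s: "exponent_between M s a b" "1 \<le> a" and f: "f \<in> borel_measurable M" "\<And>x. 0 \<le> f x" "rmod M s f \<le> 1"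
    and g: "g \<in> borel_measurable M" "\<And>x. 0 \<le> g x" "rmod M s g \<le> 1"
  shows "rmod M s (\<lambda>x. (f x + g x) / 2) \<le> 1"
proof -
  have [measurable]: "s \<in> borel_measurable M" by (rule exponent_betweenD[OF s(1)])
  note f(1)[measurable] g(1)[measurable]
  define c :: real where "c = 1 / 2"
  have c: "0 \<le> c" by (simp add: c_def)
  have "rmod M s (\<lambda>x. (f x + g x) / 2) \<le> (\<integral>\<^sup>+x. ennreal c * ennreal (\<bar>f x\<bar> powr s x) + ennreal c * ennreal (\<bar>g x\<bar> powr s x) \<partial>M)"
    unfolding rmod_def
  proof (rule nn_integral_mono)
    fix x
    have "((f x + g x) / 2) powr s x \<le> (f x powr s x + g x powr s x) / 2"
      using exponent_betweenD(2)[OF s(1), of x] s(2) f(2) g(2) by (intro powr_midpoint_convex) auto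
    then have "\<bar>(f x + g x) / 2\<bar> powr s x \<le> c * \<bar>f x\<bar> powr s x + c * \<bar>g x\<bar> powr s x"
      using f(2)[of x] g(2)[of x] by (simp add: c_def add_divide_distrib)
    then show "ennreal (\<bar>(f x + g x) / 2\<bar> powr s x) \<le> ennreal c * ennreal (\<bar>f x\<bar> powr s x) + ennreal c * ennreal (\<bar>g x\<bar> powr s x)"
      using c by (simp add: ennreal_leI flip: ennreal_mult ennreal_plus)
  qed
  also have "\<dots> = ennreal c * rmod M s f + ennreal c * rmod M s g"
    unfolding rmod_def by (subst nn_integral_add) (auto simp: nn_integral_cmult)
  also have "\<dots> \<le> ennreal c * 1 + ennreal c * 1" by (intro add_mono mult_left_mono f(3) g(3)) auto
  also have "\<dots> = ennreal (c + c)" by (subst ennreal_plus) (auto simp: c_def)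
  also have "\<dots> = 1" by (simp add: c_def)
  finally show ?thesis .
qed

lemma bounded_exponents_above:
  assumes p: "p \<in> bounded_exponents M" "complete_measure M" and l: "1 \<le> l" "ereal l < essinf M p"
  obtains P p1 p2 where "real_exponent M p P p1 p2" "l < p1"
proof -
  have "esssup M p < \<infinity>" using p(1) by (simp add: bounded_exponents_def)
  then obtain u where "esssup M p < ereal u" using ereal_dense2 by blast
  then show ?thesis using bounded_exponents_real_exponent[OF p l] that by blast
qed

lemma bounded_exponents_below:
  assumes p: "p \<in> bounded_exponents M" "complete_measure M" and u: "esssup M p < ereal u"
  obtains P p1 p2 where "real_exponent M p P p1 p2" "1 < p1" "p2 < u"
proof -
  have "ereal 1 < essinf M p" using p(1) by (simp add: bounded_exponents_def one_ereal_def)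
  then show ?thesis using bounded_exponents_real_exponent[OF p order_refl _ u] that by blast
qed

text \<open>The reduction from arbitrary weights to weights of modular at most 1. Where
  \<open>u\<close> fails to be positive, \<open>v\<close> is set to 1, so that it is positive
  everywhere.\<close>

lemma normalised_weight:
  assumes e: "real_exponent M e E a b" and u: "u \<in> var_Lp_pos M e" and M: "\<not> (AE x in M. False)"
  obtains n v where "n = var_norm M e u" "0 < n" "v \<in> borel_measurable M" "\<forall>x. 0 < v x" "rmod M E v \<le> 1"
    "AE x in M. u x = n * v x"
proof -
  have uL: "u \<in> rLp M E" and u_pos: "AE x in M. 0 < u x" using u unfolding var_Lp_pos_iff[OF e] by auto
  have [measurable]: "u \<in> borel_measurable M" by (rule rLp_measurable[OF uL])
  define n where "n = var_norm M e u"
  have n: "0 < n" unfolding n_def by (rule var_norm_pos[OF e uL u_pos M])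
  define v where "v x = (if 0 < u x then 1 / n * u x else 1)" for x
  have "AE x in M. v x = 1 / n * u x" using u_pos by eventually_elim (simp add: v_def)
  then have "rmod M E v = rmod M E (\<lambda>x. 1 / n * u x)" by (rule rmod_cong_AE)
  also have "\<dots> \<le> 1" using var_norm_le_iff[OF e uL n] by (simp add: n_def)
  finally have v1: "rmod M E v \<le> 1" .
  have "v \<in> borel_measurable M" unfolding v_def by measurable
  moreover have "0 < v x" for x using n by (simp add: v_def)
  moreover have "AE x in M. u x = n * v x" using u_pos by eventually_elim (use n in \<open>simp add: v_def\<close>)
  ultimately show ?thesis using that[OF n_def n _ _ v1] by blast
qed

lemma scaled_weight:
  assumes e: "real_exponent M e E a b" and W: "W \<in> borel_measurable M" "AE x in M. 0 < W x" "rmod M E W \<le> 1" and n: "0 < n"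
  shows "(\<lambda>x. n * W x) \<in> var_Lp_pos M e" "var_norm M e (\<lambda>x. n * W x) \<le> n"
proof -
  note E = real_exponentD(2,4)[OF e]
  have "W \<in> rLp M E" using W(1,3) by (auto simp: rLp_def intro: order.strict_trans1)
  then have nW: "(\<lambda>x. n * W x) \<in> rLp M E" by (rule rLp_cmult[OF E])
  moreover have "AE x in M. 0 < n * W x" using W(2) by eventually_elim (use n in simp)
  ultimately show "(\<lambda>x. n * W x) \<in> var_Lp_pos M e" by (simp add: var_Lp_pos_iff[OF e])
  show "var_norm M e (\<lambda>x. n * W x) \<le> n"
    using var_norm_le_iff[OF e nW n] W(3) n by simp
qed

lemma bounded_lp_mapI:
  assumes T: "linear_operator M q N p T" "bounded_operator M q N p T"
    and q: "real_exponent M q Q q1 q2" "1 < q1" and p: "real_exponent N p P p1 p2" "1 < p1"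
  obtains B where "bounded_lp_map M Q N P T q1 q2 p1 p2 B"
proof -
  obtain B where "0 \<le> B" "\<forall>f\<in>rLp M Q. rmod M Q f \<le> 1 \<longrightarrow> rmod N P (T f) \<le> ennreal B"
    using bounded_operator_iff[OF T(1) q p] T(2) by auto
  then have "bounded_lp_map M Q N P T q1 q2 p1 p2 B"
    by (intro bounded_lp_map.intro linear_operator_lp_map[OF T(1) q p] bounded_lp_map_axioms.intro) auto
  then show ?thesis by (rule that)
qed

section \<open>Extrapolation with two weights\<close>

lemma extrapolation_convex_necessary:
  fixes M :: "'b measure" and N :: "'a measure"
  assumes N: "complete_measure N" and M: "sigma_finite_measure M" "complete_measure M"
    and p: "p \<in> bounded_exponents N" and q: "q \<in> bounded_exponents M"
    and r: "2 \<le> r" "ereal r < essinf N p" "ereal r < essinf M q"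
    and T: "linear_operator M q N p T" "bounded_operator M q N p T"
    and u: "u \<in> var_Lp_pos N (dual_exponent r p)"
  shows "\<exists>U\<in>var_Lp_pos M (dual_exponent r q).
    var_norm M (dual_exponent r q) U \<le> var_norm N (dual_exponent r p) u \<and>
    weighted_bounded r M q U N u T"
proof -
  have r1: "1 \<le> r" using r by simp
  obtain P p1 p2 where pP: "real_exponent N p P p1 p2" "r < p1" by (rule bounded_exponents_above[OF p N r1 r(2)])
  obtain Q q1 q2 where qQ: "real_exponent M q Q q1 q2" "r < q1" by (rule bounded_exponents_above[OF q M(2) r1 r(3)])
  note \<alpha> = conjugate_real_exponent_gt[OF pP(1) r1 pP(2)] and \<beta> = conjugate_real_exponent_gt[OF qQ(1) r1 qQ(2)]
  have q1: "1 < q1" and p1: "1 < p1" using r1 pP(2) qQ(2) by auto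
  obtain B where "bounded_lp_map M Q N P T q1 q2 p1 p2 B" by (rule bounded_lp_mapI[OF T qQ(1) q1 pP(1) p1])
  then interpret bounded_lp_map M Q N P T q1 q2 p1 p2 B .
  obtain K where K: "0 < K" and weight: "\<And>u. u \<in> borel_measurable N \<Longrightarrow> \<forall>x. 0 \<le> u x \<Longrightarrow> rmod N (\<lambda>x. P x / (P x - r)) u \<le> 1 \<Longrightarrow>
    (\<exists>U\<in>borel_measurable M. (\<forall>y. 0 \<le> U y) \<and> rmod M (\<lambda>y. Q y / (Q y - r)) U \<le> 1 \<and>
      (\<forall>f\<in>rLp M Q. (\<integral>\<^sup>+x. ennreal (\<bar>T f x\<bar> powr r * u x) \<partial>N) \<le> ennreal K * (\<integral>\<^sup>+y. ennreal (\<bar>f y\<bar> powr r * U y) \<partial>M)))"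
    using weight_factorization_convex[OF r(1) qQ(2) pP(2)] by blast
  obtain n v where n: "n = var_norm N (dual_exponent r p) u" "0 < n" and v: "v \<in> borel_measurable N"
    "\<forall>x. 0 < v x" "rmod N (\<lambda>x. P x / (P x - r)) v \<le> 1" and uv: "AE x in N. u x = n * v x"
    by (rule normalised_weight[OF \<alpha> u bounded_exponents_nonnull[OF p]])
  obtain V where V: "V \<in> borel_measurable M" "\<forall>y. 0 \<le> V y" "rmod M (\<lambda>y. Q y / (Q y - r)) V \<le> 1"
    and key: "\<And>f. f \<in> rLp M Q \<Longrightarrow> (\<integral>\<^sup>+x. ennreal (\<bar>T f x\<bar> powr r * v x) \<partial>N) \<le> ennreal K * (\<integral>\<^sup>+y. ennreal (\<bar>f y\<bar> powr r * V y) \<partial>M)"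
    using weight[OF v(1) _ v(3)] less_imp_le[OF v(2)[rule_format]] by blast
  obtain V0 where V0: "V0 \<in> borel_measurable M" "\<And>y. 0 < V0 y" "rmod M (\<lambda>y. Q y / (Q y - r)) V0 \<le> 1"
    using ex_positive_small_modular[OF M(1) real_exponentD(2)[OF \<beta>]] by auto
  note [measurable] = v(1) V(1) V0(1)
  \<comment> \<open>The factorisation may return a weight with zeros. Averaging it with the positive
    \<open>V0\<close> keeps the modular at most 1 and costs only a factor 2 in the constant of the
    weighted inequality; the norm inequality tolerates no loss.\<close>
  define W where "W y = (V y + V0 y) / 2" for y
  have [measurable]: "W \<in> borel_measurable M" unfolding W_def by measurable
  have W_pos: "0 < W y" for y using V(2) V0(2)[of y] by (simp add: W_def add_nonneg_pos)
  have W1: "rmod M (\<lambda>y. Q y / (Q y - r)) W \<le> 1"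
    unfolding W_def using V V0 real_exponentD(3)[OF \<beta>]
    by (intro rmod_midpoint_le_1[OF real_exponentD(2)[OF \<beta>]]) (auto intro: less_imp_le)
  note U = scaled_weight[OF \<beta> _ AE_I2[OF W_pos] W1 n(2)]
  have "(\<integral>\<^sup>+x. ennreal (\<bar>T f x\<bar> powr r * u x) \<partial>N) \<le> ennreal (2 * K) * (\<integral>\<^sup>+y. ennreal (\<bar>f y\<bar> powr r * (n * W y)) \<partial>M)"
    if f: "f \<in> rLp M Q" for f
  proof -
    have [measurable]: "f \<in> borel_measurable M" "T f \<in> borel_measurable N" using f by (auto intro: rLp_measurable T_measurable)
    have "(\<integral>\<^sup>+x. ennreal (\<bar>T f x\<bar> powr r * u x) \<partial>N) = (\<integral>\<^sup>+x. ennreal (n * (\<bar>T f x\<bar> powr r * v x)) \<partial>N)"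
      by (rule nn_integral_cong_AE, use uv in eventually_elim) (simp only: mult_ac)
    also have "\<dots> = ennreal n * (\<integral>\<^sup>+x. ennreal (\<bar>T f x\<bar> powr r * v x) \<partial>N)"
      using n by (intro nn_integral_weight_cmult) auto
    also have "\<dots> \<le> ennreal n * (ennreal K * (\<integral>\<^sup>+y. ennreal (\<bar>f y\<bar> powr r * V y) \<partial>M))"
      by (intro mult_left_mono key f) auto
    also have "(\<integral>\<^sup>+y. ennreal (\<bar>f y\<bar> powr r * V y) \<partial>M) \<le> (\<integral>\<^sup>+y. ennreal (2 * (\<bar>f y\<bar> powr r * W y)) \<partial>M)"
    proof (intro nn_integral_mono ennreal_leI)
      fix y
      have "V y \<le> 2 * W y" using V0(2)[of y] by (simp add: W_def)
      then have "\<bar>f y\<bar> powr r * V y \<le> \<bar>f y\<bar> powr r * (2 * W y)" by (intro mult_left_mono) auto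
      then show "\<bar>f y\<bar> powr r * V y \<le> 2 * (\<bar>f y\<bar> powr r * W y)" by (simp only: mult_ac)
    qed
    also have "\<dots> = ennreal 2 * (\<integral>\<^sup>+y. ennreal (\<bar>f y\<bar> powr r * W y) \<partial>M)"
      by (intro nn_integral_weight_cmult) auto
    also have "ennreal n * (ennreal K * (ennreal 2 * (\<integral>\<^sup>+y. ennreal (\<bar>f y\<bar> powr r * W y) \<partial>M)))
        = (ennreal 2 * ennreal K) * (ennreal n * (\<integral>\<^sup>+y. ennreal (\<bar>f y\<bar> powr r * W y) \<partial>M))"
      by (simp only: mult_ac)
    also have "ennreal 2 * ennreal K = ennreal (2 * K)" using K by (intro ennreal_mult[symmetric]) auto
    also have "ennreal n * (\<integral>\<^sup>+y. ennreal (\<bar>f y\<bar> powr r * W y) \<partial>M) = (\<integral>\<^sup>+y. ennreal (n * (\<bar>f y\<bar> powr r * W y)) \<partial>M)"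
      using n by (intro nn_integral_weight_cmult[symmetric]) auto
    also have "\<dots> = (\<integral>\<^sup>+y. ennreal (\<bar>f y\<bar> powr r * (n * W y)) \<partial>M)" by (simp only: mult_ac)
    finally show ?thesis by (simp add: mult_left_mono)
  qed
  then have "weighted_bounded r M q (\<lambda>y. n * W y) N u T"
    unfolding weighted_bounded_iff[OF qQ(1)] using K by (intro exI[of _ "2 * K"]) auto
  then show ?thesis using U n(1) by (intro bexI[of _ "\<lambda>y. n * W y"]) auto
qed

lemma extrapolation_convex_sufficient:
  fixes M :: "'b measure" and N :: "'a measure"
  assumes N: "sigma_finite_measure N" "complete_measure N" and M: "complete_measure M"
    and p: "p \<in> bounded_exponents N" and q: "q \<in> bounded_exponents M"
    and r: "1 \<le> r" "ereal r < essinf N p" "ereal r < essinf M q"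
    and T: "linear_operator M q N p T"
    and weights: "\<And>u. u \<in> var_Lp_pos N (dual_exponent r p) \<Longrightarrow>
      \<exists>U\<in>var_Lp_pos M (dual_exponent r q). weighted_bounded r M q U N u T"
  shows "bounded_operator M q N p T"
proof -
  obtain P p1 p2 where pP: "real_exponent N p P p1 p2" "r < p1" by (rule bounded_exponents_above[OF p N(2) r(1,2)])
  obtain Q q1 q2 where qQ: "real_exponent M q Q q1 q2" "r < q1" by (rule bounded_exponents_above[OF q M r(1,3)])
  note \<alpha> = conjugate_real_exponent_gt[OF pP(1) r(1) pP(2)] and \<beta> = conjugate_real_exponent_gt[OF qQ(1) r(1) qQ(2)]
  have q1: "1 < q1" and p1: "1 < p1" using r(1) pP(2) qQ(2) by auto
  interpret lp_map M Q N P T q1 q2 p1 p2 by (rule linear_operator_lp_map[OF T qQ(1) q1 pP(1) p1])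
  have "\<exists>B\<ge>0. \<forall>f\<in>rLp M Q. rmod M Q f \<le> 1 \<longrightarrow> rmod N P (T f) \<le> ennreal B"
  proof (rule converse_convex[OF r(1) qQ(2) pP(2) N(1)])
    fix u assume u: "u \<in> borel_measurable N" "AE x in N. 0 < u x" "rmod N (\<lambda>x. P x / (P x - r)) u < \<infinity>"
    then have "u \<in> var_Lp_pos N (dual_exponent r p)" by (simp add: var_Lp_pos_iff[OF \<alpha>] rLp_def)
    from weights[OF this] obtain U where U: "U \<in> rLp M (\<lambda>y. Q y / (Q y - r))"
      "weighted_bounded r M q U N u T" unfolding Bex_def var_Lp_pos_iff[OF \<beta>] by blast
    then show "\<exists>U\<in>borel_measurable M. rmod M (\<lambda>y. Q y / (Q y - r)) U < \<infinity> \<and>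
        (\<exists>K>0. \<forall>f\<in>rLp M Q. (\<integral>\<^sup>+x. ennreal (\<bar>T f x\<bar> powr r * u x) \<partial>N) \<le> ennreal K * (\<integral>\<^sup>+y. ennreal (\<bar>f y\<bar> powr r * U y) \<partial>M))"
      unfolding weighted_bounded_iff[OF qQ(1)] by (intro bexI[of _ U]) (auto simp: rLp_def)
  qed
  then show ?thesis by (simp add: bounded_operator_iff[OF T qQ(1) q1 pP(1) p1])
qed

lemma extrapolation_concave_necessary:
  fixes M :: "'b measure" and N :: "'a measure"
  assumes N: "sigma_finite_measure N" "complete_measure N" and M: "complete_measure M"
    and p: "p \<in> bounded_exponents N" and q: "q \<in> bounded_exponents M"
    and r: "r \<le> 2" "esssup N p < ereal r" "esssup M q < ereal r"
    and T: "linear_operator M q N p T" "bounded_operator M q N p T"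
    and u: "u \<in> var_Lp_pos M (dual_exponent r q)"
  shows "\<exists>U\<in>var_Lp_pos N (dual_exponent r p).
    var_norm N (dual_exponent r p) U \<le> var_norm M (dual_exponent r q) u \<and>
    weighted_bounded r M q (\<lambda>y. inverse (u y)) N (\<lambda>x. inverse (U x)) T"
proof -
  obtain P p1 p2 where pP: "real_exponent N p P p1 p2" "1 < p1" "p2 < r" by (rule bounded_exponents_below[OF p N(2) r(2)])
  obtain Q q1 q2 where qQ: "real_exponent M q Q q1 q2" "1 < q1" "q2 < r" by (rule bounded_exponents_below[OF q M r(3)])
  note \<alpha> = conjugate_real_exponent_lt[OF pP(1,3) r(1)] and \<beta> = conjugate_real_exponent_lt[OF qQ(1,3) r(1)]
  obtain B where "bounded_lp_map M Q N P T q1 q2 p1 p2 B" by (rule bounded_lp_mapI[OF T qQ(1,2) pP(1,2)])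
  then interpret bounded_lp_map M Q N P T q1 q2 p1 p2 B .
  obtain K where K: "0 < K" and weight: "\<And>u. u \<in> borel_measurable M \<Longrightarrow> AE y in M. 0 < u y \<Longrightarrow> rmod M (\<lambda>y. Q y / (r - Q y)) u \<le> 1 \<Longrightarrow>
    (\<exists>U\<in>borel_measurable N. (\<forall>x. 0 < U x) \<and> rmod N (\<lambda>x. P x / (r - P x)) U \<le> 1 \<and>
      (\<forall>f\<in>rLp M Q. (\<integral>\<^sup>+x. ennreal (\<bar>T f x\<bar> powr r * inverse (U x)) \<partial>N)
         \<le> ennreal K * (\<integral>\<^sup>+y. ennreal (\<bar>f y\<bar> powr r * inverse (u y)) \<partial>M)))"
    using weight_factorization_concave[OF r(1) qQ(3) pP(3) N(1)] by blast
  obtain n v where n: "n = var_norm M (dual_exponent r q) u" "0 < n" and v: "v \<in> borel_measurable M"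
    "\<forall>x. 0 < v x" "rmod M (\<lambda>y. Q y / (r - Q y)) v \<le> 1" and uv: "AE x in M. u x = n * v x"
    by (rule normalised_weight[OF \<beta> u bounded_exponents_nonnull[OF q]])
  obtain W where W: "W \<in> borel_measurable N" "\<forall>x. 0 < W x" "rmod N (\<lambda>x. P x / (r - P x)) W \<le> 1"
    and key: "\<And>f. f \<in> rLp M Q \<Longrightarrow> (\<integral>\<^sup>+x. ennreal (\<bar>T f x\<bar> powr r * inverse (W x)) \<partial>N)
         \<le> ennreal K * (\<integral>\<^sup>+y. ennreal (\<bar>f y\<bar> powr r * inverse (v y)) \<partial>M)"
    using weight[OF v(1) AE_I2[OF v(2)[rule_format]] v(3)] by blast
  note [measurable] = v(1) W(1)
  have W_pos: "AE x in N. 0 < W x" using W(2) by simp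
  note U = scaled_weight[OF \<alpha> W(1) W_pos W(3) n(2)]
  have "(\<integral>\<^sup>+x. ennreal (\<bar>T f x\<bar> powr r * inverse (n * W x)) \<partial>N) \<le> ennreal K * (\<integral>\<^sup>+y. ennreal (\<bar>f y\<bar> powr r * inverse (u y)) \<partial>M)"
    if f: "f \<in> rLp M Q" for f
  proof -
    have [measurable]: "f \<in> borel_measurable M" "T f \<in> borel_measurable N" using f by (auto intro: rLp_measurable T_measurable)
    have "(\<integral>\<^sup>+x. ennreal (\<bar>T f x\<bar> powr r * inverse (n * W x)) \<partial>N) = (\<integral>\<^sup>+x. ennreal (inverse n * (\<bar>T f x\<bar> powr r * inverse (W x))) \<partial>N)"
      by (simp only: inverse_mult_distrib mult_ac)
    also have "\<dots> = ennreal (inverse n) * (\<integral>\<^sup>+x. ennreal (\<bar>T f x\<bar> powr r * inverse (W x)) \<partial>N)"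
      using n by (intro nn_integral_weight_cmult) auto
    also have "\<dots> \<le> ennreal (inverse n) * (ennreal K * (\<integral>\<^sup>+y. ennreal (\<bar>f y\<bar> powr r * inverse (v y)) \<partial>M))"
      by (intro mult_left_mono key f) auto
    also have "\<dots> = ennreal K * (ennreal (inverse n) * (\<integral>\<^sup>+y. ennreal (\<bar>f y\<bar> powr r * inverse (v y)) \<partial>M))"
      by (simp only: mult_ac)
    also have "ennreal (inverse n) * (\<integral>\<^sup>+y. ennreal (\<bar>f y\<bar> powr r * inverse (v y)) \<partial>M)
        = (\<integral>\<^sup>+y. ennreal (inverse n * (\<bar>f y\<bar> powr r * inverse (v y))) \<partial>M)"
      using n by (intro nn_integral_weight_cmult[symmetric]) auto
    also have "\<dots> = (\<integral>\<^sup>+y. ennreal (\<bar>f y\<bar> powr r * inverse (u y)) \<partial>M)"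
      by (rule nn_integral_cong_AE, use uv in eventually_elim) (simp only: inverse_mult_distrib mult_ac)
    finally show ?thesis .
  qed
  then have "weighted_bounded r M q (\<lambda>y. inverse (u y)) N (\<lambda>x. inverse (n * W x)) T"
    unfolding weighted_bounded_iff[OF qQ(1)] using K by (intro exI[of _ K]) auto
  then show ?thesis using U n(1) by (intro bexI[of _ "\<lambda>y. n * W y"]) auto
qed

lemma extrapolation_concave_sufficient:
  fixes M :: "'b measure" and N :: "'a measure"
  assumes N: "complete_measure N" and M: "sigma_finite_measure M" "complete_measure M"
    and p: "p \<in> bounded_exponents N" and q: "q \<in> bounded_exponents M"
    and r: "1 \<le> r" "r \<le> 2" "esssup N p < ereal r" "esssup M q < ereal r"
    and T: "linear_operator M q N p T"
    and weights: "\<And>u. u \<in> var_Lp_pos M (dual_exponent r q) \<Longrightarrow>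
      \<exists>U\<in>var_Lp_pos N (dual_exponent r p).
        weighted_bounded r M q (\<lambda>y. inverse (u y)) N (\<lambda>x. inverse (U x)) T"
  shows "bounded_operator M q N p T"
proof -
  obtain P p1 p2 where pP: "real_exponent N p P p1 p2" "1 < p1" "p2 < r" by (rule bounded_exponents_below[OF p N r(3)])
  obtain Q q1 q2 where qQ: "real_exponent M q Q q1 q2" "1 < q1" "q2 < r" by (rule bounded_exponents_below[OF q M(2) r(4)])
  note \<alpha> = conjugate_real_exponent_lt[OF pP(1,3) r(2)] and \<beta> = conjugate_real_exponent_lt[OF qQ(1,3) r(2)]
  interpret lp_map M Q N P T q1 q2 p1 p2 by (rule linear_operator_lp_map[OF T qQ(1,2) pP(1,2)])
  have "\<exists>B\<ge>0. \<forall>f\<in>rLp M Q. rmod M Q f \<le> 1 \<longrightarrow> rmod N P (T f) \<le> ennreal B"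
  proof (rule converse_concave[OF r(1) qQ(3) pP(3) M(1) _ r(2)])
    fix u assume u: "u \<in> borel_measurable M" "AE x in M. 0 < u x" "rmod M (\<lambda>y. Q y / (r - Q y)) u < \<infinity>"
    then have "u \<in> var_Lp_pos M (dual_exponent r q)" by (simp add: var_Lp_pos_iff[OF \<beta>] rLp_def)
    from weights[OF this] obtain U where U: "U \<in> rLp N (\<lambda>x. P x / (r - P x))" "AE y in N. 0 < U y"
      "weighted_bounded r M q (\<lambda>y. inverse (u y)) N (\<lambda>x. inverse (U x)) T" unfolding Bex_def var_Lp_pos_iff[OF \<alpha>] by blast
    then show "\<exists>U\<in>borel_measurable N. (AE x in N. 0 < U x) \<and> rmod N (\<lambda>x. P x / (r - P x)) U < \<infinity> \<and>
        (\<exists>K>0. \<forall>f\<in>rLp M Q. (\<integral>\<^sup>+x. ennreal (\<bar>T f x\<bar> powr r * inverse (U x)) \<partial>N)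
          \<le> ennreal K * (\<integral>\<^sup>+y. ennreal (\<bar>f y\<bar> powr r * inverse (u y)) \<partial>M))"
      unfolding weighted_bounded_iff[OF qQ(1)] by (intro bexI[of _ U]) (auto simp: rLp_def)
  qed
  then show ?thesis by (simp add: bounded_operator_iff[OF T qQ(1,2) pP(1,2)])
qed

section \<open>Extrapolation with a single weight\<close>

lemma extrapolation_convex_same_weight:
  fixes N :: "'a measure"
  assumes N: "complete_measure N" and p: "p \<in> bounded_exponents N"
    and r: "2 \<le> r" "ereal r < essinf N p"
    and C: "2 \<le> C"
    and T: "linear_operator N p N p T" "bounded_operator N p N p T"
    and u: "u \<in> var_Lp_pos N (dual_exponent r p)"
  shows "\<exists>w\<in>var_Lp_pos N (dual_exponent r p). (AE x in N. u x \<le> w x) \<and>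
    var_norm N (dual_exponent r p) w \<le> C * var_norm N (dual_exponent r p) u \<and>
    weighted_bounded r N p w N w T"
proof -
  have r1: "1 \<le> r" using r by simp
  obtain P p1 p2 where pP: "real_exponent N p P p1 p2" "r < p1" by (rule bounded_exponents_above[OF p N r1 r(2)])
  note \<alpha> = conjugate_real_exponent_gt[OF pP(1) r1 pP(2)]
  have p1: "1 < p1" using r1 pP(2) by auto
  obtain B where "bounded_lp_map N P N P T p1 p2 p1 p2 B" by (rule bounded_lp_mapI[OF T pP(1) p1 pP(1) p1])
  then interpret bounded_lp_map N P N P T p1 p2 p1 p2 B .
  obtain K where K: "0 < K" and weight: "\<And>u. u \<in> borel_measurable N \<Longrightarrow> \<forall>x. 0 \<le> u x \<Longrightarrow> rmod N (\<lambda>x. P x / (P x - r)) u \<le> 1 \<Longrightarrow>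
    (\<exists>U\<in>borel_measurable N. (\<forall>y. 0 \<le> U y) \<and> rmod N (\<lambda>y. P y / (P y - r)) U \<le> 1 \<and>
      (\<forall>f\<in>rLp N P. (\<integral>\<^sup>+x. ennreal (\<bar>T f x\<bar> powr r * u x) \<partial>N) \<le> ennreal K * (\<integral>\<^sup>+y. ennreal (\<bar>f y\<bar> powr r * U y) \<partial>N)))"
    using weight_factorization_convex[OF r(1) pP(2) pP(2)] by blast
  obtain n v where n: "n = var_norm N (dual_exponent r p) u" "0 < n" and v: "v \<in> borel_measurable N"
    "\<forall>x. 0 < v x" "rmod N (\<lambda>x. P x / (P x - r)) v \<le> 1" and uv: "AE x in N. u x = n * v x"
    by (rule normalised_weight[OF \<alpha> u bounded_exponents_nonnull[OF p]])
  define \<P> where "\<P> = {((\<lambda>x. \<bar>f x\<bar> powr r), (\<lambda>x. \<bar>T f x\<bar> powr r)) | f. f \<in> rLp N P}"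
  have "\<exists>W\<in>borel_measurable N. (\<forall>x. 0 \<le> W x) \<and> rmod N (\<lambda>x. P x / (P x - r)) W \<le> 1 \<and> (AE x in N. v x \<le> 2 * W x) \<and>
    (\<forall>g h. (g, h) \<in> \<P> \<longrightarrow> (\<integral>\<^sup>+x. ennreal (h x * W x) \<partial>N) \<le> ennreal (2 * K) * (\<integral>\<^sup>+x. ennreal (g x * W x) \<partial>N))"
  proof (rule iterated_weight_convex[OF real_exponentD(2)[OF \<alpha>] _ K _ v(1) _ v(3)])
    fix g h assume "(g, h) \<in> \<P>"
    then obtain f where f: "f \<in> rLp N P" "g = (\<lambda>x. \<bar>f x\<bar> powr r)" "h = (\<lambda>x. \<bar>T f x\<bar> powr r)" by (auto simp: \<P>_def)
    have [measurable]: "f \<in> borel_measurable N" "T f \<in> borel_measurable N" using f(1) by (auto intro: rLp_measurable T_measurable)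
    show "g \<in> borel_measurable N \<and> h \<in> borel_measurable N \<and> (\<forall>x. 0 \<le> g x) \<and> (\<forall>x. 0 \<le> h x)" unfolding f(2,3) by auto
  next
    fix u assume "u \<in> borel_measurable N" "\<forall>x. 0 \<le> u x" "rmod N (\<lambda>x. P x / (P x - r)) u \<le> 1"
    from weight[OF this] show "\<exists>U\<in>borel_measurable N. (\<forall>x. 0 \<le> U x) \<and> rmod N (\<lambda>x. P x / (P x - r)) U \<le> 1 \<and>
        (\<forall>g h. (g, h) \<in> \<P> \<longrightarrow> (\<integral>\<^sup>+x. ennreal (h x * u x) \<partial>N) \<le> ennreal K * (\<integral>\<^sup>+x. ennreal (g x * U x) \<partial>N))"
      unfolding \<P>_def by blast
  qed (use v(2)[rule_format] less_imp_le in blast)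
  then obtain W where W: "W \<in> borel_measurable N" "\<forall>x. 0 \<le> W x" "rmod N (\<lambda>x. P x / (P x - r)) W \<le> 1" "AE x in N. v x \<le> 2 * W x"
    and key: "\<And>f. f \<in> rLp N P \<Longrightarrow> (\<integral>\<^sup>+x. ennreal (\<bar>T f x\<bar> powr r * W x) \<partial>N) \<le> ennreal (2 * K) * (\<integral>\<^sup>+x. ennreal (\<bar>f x\<bar> powr r * W x) \<partial>N)"
    unfolding \<P>_def by blast
  note [measurable] = W(1)
  have W_pos: "AE x in N. 0 < W x"
    using W(4)
  proof eventually_elim
    fix x assume "v x \<le> 2 * W x"
    then show "0 < W x" using v(2)[rule_format, of x] by linarith
  qed
  \<comment> \<open>Twice \<open>W\<close> dominates \<open>v\<close>, so \<open>2 * n * W x\<close>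
    dominates \<open>u\<close> and has norm at most \<open>2 * n\<close>.\<close>
  have n2: "0 < 2 * n" using n by simp
  note w = scaled_weight[OF \<alpha> W(1) W_pos W(3) n2]
  have "AE x in N. u x \<le> 2 * n * W x"
    using uv W(4)
  proof eventually_elim
    fix x assume "u x = n * v x" "v x \<le> 2 * W x"
    then show "u x \<le> 2 * n * W x" using n(2) mult_left_mono[of "v x" "2 * W x" n] by simp
  qed
  moreover have "weighted_bounded r N p (\<lambda>x. 2 * n * W x) N (\<lambda>x. 2 * n * W x) T"
    unfolding weighted_bounded_iff[OF pP(1)]
  proof (intro exI[of _ "2 * K"] conjI ballI)
    fix f assume f: "f \<in> rLp N P"
    have [measurable]: "f \<in> borel_measurable N" "T f \<in> borel_measurable N" using f by (auto intro: rLp_measurable T_measurable)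
    have scale: "(\<integral>\<^sup>+x. ennreal (k x * (2 * n * W x)) \<partial>N) = ennreal (2 * n) * (\<integral>\<^sup>+x. ennreal (k x * W x) \<partial>N)"
      if "k \<in> borel_measurable N" for k
      using nn_integral_weight_cmult[of "2 * n" "\<lambda>x. k x * W x" N] that n2 by (simp add: mult_ac)
    have "ennreal (2 * n) * (\<integral>\<^sup>+x. ennreal (\<bar>T f x\<bar> powr r * W x) \<partial>N)
       \<le> ennreal (2 * n) * (ennreal (2 * K) * (\<integral>\<^sup>+x. ennreal (\<bar>f x\<bar> powr r * W x) \<partial>N))"
      by (intro mult_left_mono key f) auto
    also have "\<dots> = ennreal (2 * K) * (ennreal (2 * n) * (\<integral>\<^sup>+x. ennreal (\<bar>f x\<bar> powr r * W x) \<partial>N))"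
      by (rule mult.left_commute)
    finally show "(\<integral>\<^sup>+x. ennreal (\<bar>T f x\<bar> powr r * (2 * n * W x)) \<partial>N) \<le> ennreal (2 * K) * (\<integral>\<^sup>+x. ennreal (\<bar>f x\<bar> powr r * (2 * n * W x)) \<partial>N)"
      by (subst (1 2) scale) auto
  qed (use K in simp)
  moreover have "2 * n \<le> C * n" using C n(2) by (intro mult_right_mono) auto
  ultimately show ?thesis using w n(1) by (intro bexI[of _ "\<lambda>x. 2 * n * W x"]) auto
qed

lemma extrapolation_concave_same_weight:
  fixes N :: "'a measure"
  assumes N: "sigma_finite_measure N" "complete_measure N" and p: "p \<in> bounded_exponents N"
    and r: "1 < r" "r \<le> 2" "esssup N p < ereal r"
    and C: "2 \<le> C"
    and T: "linear_operator N p N p T" "bounded_operator N p N p T"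
    and u: "u \<in> var_Lp_pos N (dual_exponent r p)"
  shows "\<exists>w\<in>var_Lp_pos N (dual_exponent r p). (AE x in N. u x \<le> w x) \<and>
    var_norm N (dual_exponent r p) w \<le> C * var_norm N (dual_exponent r p) u \<and>
    weighted_bounded r N p (\<lambda>x. inverse (w x)) N (\<lambda>x. inverse (w x)) T"
proof -
  obtain P p1 p2 where pP: "real_exponent N p P p1 p2" "1 < p1" "p2 < r" by (rule bounded_exponents_below[OF p N(2) r(3)])
  note \<alpha> = conjugate_real_exponent_lt[OF pP(1,3) r(2)]
  obtain B where bB: "bounded_lp_map N P N P T p1 p2 p1 p2 B" by (rule bounded_lp_mapI[OF T pP(1,2) pP(1,2)])
  then interpret bounded_lp_map N P N P T p1 p2 p1 p2 B .
  obtain K where K: "0 < K" and weight: "\<And>u. u \<in> borel_measurable N \<Longrightarrow> AE y in N. 0 < u y \<Longrightarrow> rmod N (\<lambda>y. P y / (r - P y)) u \<le> 1 \<Longrightarrow>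
    (\<exists>U\<in>borel_measurable N. (\<forall>x. 0 < U x) \<and> rmod N (\<lambda>x. P x / (r - P x)) U \<le> 1 \<and>
      (\<forall>f\<in>rLp N P. (\<integral>\<^sup>+x. ennreal (\<bar>T f x\<bar> powr r * inverse (U x)) \<partial>N)
         \<le> ennreal K * (\<integral>\<^sup>+y. ennreal (\<bar>f y\<bar> powr r * inverse (u y)) \<partial>N)))"
    using weight_factorization_concave[OF r(2) pP(3) pP(3) N(1)] by blast
  obtain n v where n: "n = var_norm N (dual_exponent r p) u" "0 < n" and v: "v \<in> borel_measurable N"
    "\<forall>x. 0 < v x" "rmod N (\<lambda>x. P x / (r - P x)) v \<le> 1" and uv: "AE x in N. u x = n * v x"
    by (rule normalised_weight[OF \<alpha> u bounded_exponents_nonnull[OF p]])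
  have "\<exists>w\<in>borel_measurable N. (AE x in N. v x \<le> w x) \<and> rmod N (\<lambda>x. P x / (r - P x)) (\<lambda>x. 1/2 * w x) \<le> 1 \<and>
    (\<forall>f\<in>rLp N P. (\<integral>\<^sup>+x. ennreal (\<bar>T f x\<bar> powr r * inverse (w x)) \<partial>N)
       \<le> ennreal (2 * K) * (\<integral>\<^sup>+x. ennreal (\<bar>f x\<bar> powr r * inverse (w x)) \<partial>N))"
    using v(2)[rule_format] by (intro iterated_weight_concave[OF bB r(1,2) real_exponentD(2)[OF \<alpha>] K weight v(1) _ v(3)]) auto
  then obtain w where w: "w \<in> borel_measurable N" "AE x in N. v x \<le> w x" "rmod N (\<lambda>x. P x / (r - P x)) (\<lambda>x. 1/2 * w x) \<le> 1"
    and key: "\<And>f. f \<in> rLp N P \<Longrightarrow> (\<integral>\<^sup>+x. ennreal (\<bar>T f x\<bar> powr r * inverse (w x)) \<partial>N)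
       \<le> ennreal (2 * K) * (\<integral>\<^sup>+x. ennreal (\<bar>f x\<bar> powr r * inverse (w x)) \<partial>N)" by blast
  note [measurable] = w(1)
  have w_pos: "AE x in N. 0 < 1/2 * w x"
    using w(2)
  proof eventually_elim
    fix x assume "v x \<le> w x"
    then show "0 < 1/2 * w x" using v(2)[rule_format, of x] by simp
  qed
  have n2: "0 < 2 * n" using n by simp
  have half_meas: "(\<lambda>x. 1/2 * w x) \<in> borel_measurable N" by measurable
  \<comment> \<open>The function of modular at most 1 is half of \<open>w\<close>, so
    \<open>n * w x\<close> is regarded as \<open>2 * n\<close> times that half and has norm at most
    \<open>2 * n\<close>.\<close>
  have eq: "(\<lambda>x. 2 * n * (1/2 * w x)) = (\<lambda>x. n * w x)" by (simp add: fun_eq_iff)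
  note U = scaled_weight[OF \<alpha> half_meas w_pos w(3) n2, unfolded eq]
  have "AE x in N. u x \<le> n * w x"
    using uv w(2) by eventually_elim (use n in simp)
  moreover have "weighted_bounded r N p (\<lambda>x. inverse (n * w x)) N (\<lambda>x. inverse (n * w x)) T"
    unfolding weighted_bounded_iff[OF pP(1)]
  proof (intro exI[of _ "2 * K"] conjI ballI)
    fix f assume f: "f \<in> rLp N P"
    have [measurable]: "f \<in> borel_measurable N" "T f \<in> borel_measurable N" using f by (auto intro: rLp_measurable T_measurable)
    have scale: "(\<integral>\<^sup>+x. ennreal (k x * inverse (n * w x)) \<partial>N) = ennreal (inverse n) * (\<integral>\<^sup>+x. ennreal (k x * inverse (w x)) \<partial>N)"
      if "k \<in> borel_measurable N" for k
      using nn_integral_weight_cmult[of "inverse n" "\<lambda>x. k x * inverse (w x)" N] that n by (simp add: mult_ac)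
    have "ennreal (inverse n) * (\<integral>\<^sup>+x. ennreal (\<bar>T f x\<bar> powr r * inverse (w x)) \<partial>N)
       \<le> ennreal (inverse n) * (ennreal (2 * K) * (\<integral>\<^sup>+x. ennreal (\<bar>f x\<bar> powr r * inverse (w x)) \<partial>N))"
      by (intro mult_left_mono key f) auto
    also have "\<dots> = ennreal (2 * K) * (ennreal (inverse n) * (\<integral>\<^sup>+x. ennreal (\<bar>f x\<bar> powr r * inverse (w x)) \<partial>N))"
      by (rule mult.left_commute)
    finally show "(\<integral>\<^sup>+x. ennreal (\<bar>T f x\<bar> powr r * inverse (n * w x)) \<partial>N) \<le> ennreal (2 * K) * (\<integral>\<^sup>+x. ennreal (\<bar>f x\<bar> powr r * inverse (n * w x)) \<partial>N)"
      by (subst (1 2) scale) auto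
  qed (use K in simp)
  moreover have "2 * n \<le> C * n" using C n(2) by (intro mult_right_mono) auto
  ultimately show ?thesis using U n(1) by (intro bexI[of _ "\<lambda>x. n * w x"]) auto
qed

lemma weighted_bounded_mono:
  assumes "weighted_bounded r M q V N v T" "AE x in N. v' x \<le> v x" "AE y in M. V y \<le> V' y"
  shows "weighted_bounded r M q V' N v' T"
proof -
  obtain K where K: "0 < K" "\<And>f. f \<in> var_Lp M q \<Longrightarrow> (\<integral>\<^sup>+x. ennreal (\<bar>T f x\<bar> powr r * v x) \<partial>N)
        \<le> ennreal K * (\<integral>\<^sup>+y. ennreal (\<bar>f y\<bar> powr r * V y) \<partial>M)"
    using assms(1) unfolding weighted_bounded_def by blast
  have "(\<integral>\<^sup>+x. ennreal (\<bar>T f x\<bar> powr r * v' x) \<partial>N) \<le> ennreal K * (\<integral>\<^sup>+y. ennreal (\<bar>f y\<bar> powr r * V' y) \<partial>M)"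
    if "f \<in> var_Lp M q" for f
  proof -
    have "(\<integral>\<^sup>+x. ennreal (\<bar>T f x\<bar> powr r * v' x) \<partial>N) \<le> (\<integral>\<^sup>+x. ennreal (\<bar>T f x\<bar> powr r * v x) \<partial>N)"
      by (rule nn_integral_mono_AE, use assms(2) in eventually_elim) (intro ennreal_leI mult_left_mono, auto)
    also have "\<dots> \<le> ennreal K * (\<integral>\<^sup>+y. ennreal (\<bar>f y\<bar> powr r * V y) \<partial>M)" by (rule K(2)[OF that])
    also have "(\<integral>\<^sup>+y. ennreal (\<bar>f y\<bar> powr r * V y) \<partial>M) \<le> (\<integral>\<^sup>+y. ennreal (\<bar>f y\<bar> powr r * V' y) \<partial>M)"
      by (rule nn_integral_mono_AE, use assms(3) in eventually_elim) (intro ennreal_leI mult_left_mono, auto)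
    finally show ?thesis by (simp add: mult_left_mono)
  qed
  then show ?thesis unfolding weighted_bounded_def using K(1) by blast
qed

text \<open>For the converse, \<open>u x \<le> w x\<close> allows the output weight to be lowered
  from \<open>w\<close> to \<open>u\<close>, which is the two-weight condition with U = w.\<close>

lemma extrapolation_convex_same_weight_iff:
  fixes N :: "'a measure"
  assumes N: "sigma_finite_measure N" "complete_measure N" and p: "p \<in> bounded_exponents N"
    and r: "2 \<le> r" "ereal r < essinf N p" and C: "2 \<le> C" and T: "linear_operator N p N p T"
  shows "bounded_operator N p N p T \<longleftrightarrow>
    (\<forall>u\<in>var_Lp_pos N (dual_exponent r p). \<exists>w\<in>var_Lp_pos N (dual_exponent r p).
       (AE x in N. u x \<le> w x) \<and>
       var_norm N (dual_exponent r p) w \<le> C * var_norm N (dual_exponent r p) u \<and>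
       weighted_bounded r N p w N w T)" (is "_ \<longleftrightarrow> ?rhs")
proof
  assume B: "bounded_operator N p N p T"
  show ?rhs
  proof
    fix u assume "u \<in> var_Lp_pos N (dual_exponent r p)"
    from extrapolation_convex_same_weight[OF N(2) p r C T B this]
    show "\<exists>w\<in>var_Lp_pos N (dual_exponent r p). (AE x in N. u x \<le> w x) \<and>
       var_norm N (dual_exponent r p) w \<le> C * var_norm N (dual_exponent r p) u \<and>
       weighted_bounded r N p w N w T" .
  qed
next
  assume R: ?rhs
  show "bounded_operator N p N p T"
  proof (rule extrapolation_convex_sufficient[OF N N(2) p p _ r(2) r(2) T])
    show "1 \<le> r" using r by simp
    fix u assume "u \<in> var_Lp_pos N (dual_exponent r p)"
    note u = this
    show "\<exists>U\<in>var_Lp_pos N (dual_exponent r p). weighted_bounded r N p U N u T"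
    proof -
      obtain w where w: "w \<in> var_Lp_pos N (dual_exponent r p)" "AE x in N. u x \<le> w x"
        "weighted_bounded r N p w N w T" using R u by blast
      have "weighted_bounded r N p w N u T" by (rule weighted_bounded_mono[OF w(3,2)]) auto
      then show ?thesis using w(1) by blast
    qed
  qed
qed

text \<open>Inversion reverses \<open>u x \<le> w x\<close>, so for the converse it is the input
  weight that is raised, from the inverse of \<open>w\<close> to that of \<open>u\<close>, while the
  output side keeps U = w.\<close>

lemma extrapolation_concave_same_weight_iff:
  fixes N :: "'a measure"
  assumes N: "sigma_finite_measure N" "complete_measure N" and p: "p \<in> bounded_exponents N"
    and r: "1 < r" "r \<le> 2" "esssup N p < ereal r" and C: "2 \<le> C" and T: "linear_operator N p N p T"
  shows "bounded_operator N p N p T \<longleftrightarrow>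
    (\<forall>u\<in>var_Lp_pos N (dual_exponent r p). \<exists>w\<in>var_Lp_pos N (dual_exponent r p).
       (AE x in N. u x \<le> w x) \<and>
       var_norm N (dual_exponent r p) w \<le> C * var_norm N (dual_exponent r p) u \<and>
       weighted_bounded r N p (\<lambda>x. inverse (w x)) N (\<lambda>x. inverse (w x)) T)" (is "_ \<longleftrightarrow> ?rhs")
proof
  assume B: "bounded_operator N p N p T"
  show ?rhs
  proof
    fix u assume "u \<in> var_Lp_pos N (dual_exponent r p)"
    from extrapolation_concave_same_weight[OF N p r C T B this]
    show "\<exists>w\<in>var_Lp_pos N (dual_exponent r p). (AE x in N. u x \<le> w x) \<and>
       var_norm N (dual_exponent r p) w \<le> C * var_norm N (dual_exponent r p) u \<and>
       weighted_bounded r N p (\<lambda>x. inverse (w x)) N (\<lambda>x. inverse (w x)) T" .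
  qed
next
  assume R: ?rhs
  show "bounded_operator N p N p T"
  proof (rule extrapolation_concave_sufficient[OF N(2) N p p _ r(2,3,3) T])
    show "1 \<le> r" using r by simp
    fix u assume u: "u \<in> var_Lp_pos N (dual_exponent r p)"
    then obtain w where w: "w \<in> var_Lp_pos N (dual_exponent r p)" "AE x in N. u x \<le> w x"
      "weighted_bounded r N p (\<lambda>x. inverse (w x)) N (\<lambda>x. inverse (w x)) T" using R by blast
    have "AE x in N. 0 < u x" using u by (simp add: var_Lp_pos_def)
    with w(2) have "AE x in N. inverse (w x) \<le> inverse (u x)"
      by eventually_elim (rule le_imp_inverse_le)
    then have "weighted_bounded r N p (\<lambda>x. inverse (u x)) N (\<lambda>x. inverse (w x)) T"
      by (intro weighted_bounded_mono[OF w(3)]) auto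
    then show "\<exists>U\<in>var_Lp_pos N (dual_exponent r p).
        weighted_bounded r N p (\<lambda>x. inverse (u x)) N (\<lambda>x. inverse (U x)) T" using w(1) by blast
  qed
qed

theorem corollary4p3:
  fixes \<nu> :: "'a measure" and \<mu> :: "'b measure"
    and p \<alpha> :: "'a \<Rightarrow> ereal" and q \<beta> :: "'b \<Rightarrow> ereal"
    and r r' :: real
  assumes "sigma_finite_measure \<nu>" "complete_measure \<nu>" "nonatomic \<nu>"
    and "sigma_finite_measure \<mu>" "complete_measure \<mu>" "nonatomic \<mu>"
    and "p \<in> bounded_exponents \<nu>" "q \<in> bounded_exponents \<mu>"
    and "1 < r" "1 / r + 1 / r' = 1"
    and "\<alpha> = (\<lambda>x. 1 / \<bar>1 - ereal r / p x\<bar>)"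
    and "\<beta> = (\<lambda>y. 1 / \<bar>1 - ereal r / q y\<bar>)"
  shows
    "(2 \<le> r \<and> ereal r < min (essinf \<nu> p) (essinf \<mu> q) \<longrightarrow>
       (\<forall>T. linear_operator \<mu> q \<nu> p T \<longrightarrow>
         (bounded_operator \<mu> q \<nu> p T \<longleftrightarrow>
           (\<forall>u\<in>var_Lp_pos \<nu> \<alpha>. \<exists>U\<in>var_Lp_pos \<mu> \<beta>.
              var_norm \<mu> \<beta> U \<le> var_norm \<nu> \<alpha> u \<and>
              weighted_bounded r \<mu> q U \<nu> u T)))) \<and>
     (max (esssup \<nu> p) (esssup \<mu> q) < ereal r \<and> r \<le> 2 \<longrightarrow>
       (\<forall>T. linear_operator \<mu> q \<nu> p T \<longrightarrow>
         (bounded_operator \<mu> q \<nu> p T \<longleftrightarrow>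
           (\<forall>u\<in>var_Lp_pos \<mu> \<beta>. \<exists>U\<in>var_Lp_pos \<nu> \<alpha>.
              var_norm \<nu> \<alpha> U \<le> var_norm \<mu> \<beta> u \<and>
              weighted_bounded r \<mu> q (\<lambda>y. inverse (u y)) \<nu> (\<lambda>x. inverse (U x)) T)))) \<and>
     (2 \<le> r \<and> ereal r < essinf \<nu> p \<longrightarrow>
       (\<forall>T. linear_operator \<nu> p \<nu> p T \<longrightarrow>
         (bounded_operator \<nu> p \<nu> p T \<longleftrightarrow>
           (\<forall>u\<in>var_Lp_pos \<nu> \<alpha>. \<exists>w\<in>var_Lp_pos \<nu> \<alpha>.
              (AE x in \<nu>. u x \<le> w x) \<and>
              var_norm \<nu> \<alpha> w \<le> max 2 (2 powr (r / r')) * var_norm \<nu> \<alpha> u \<and>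
              weighted_bounded r \<nu> p w \<nu> w T)))) \<and>
     (esssup \<nu> p < ereal r \<and> r \<le> 2 \<longrightarrow>
       (\<forall>T. linear_operator \<nu> p \<nu> p T \<longrightarrow>
         (bounded_operator \<nu> p \<nu> p T \<longleftrightarrow>
           (\<forall>u\<in>var_Lp_pos \<nu> \<alpha>. \<exists>w\<in>var_Lp_pos \<nu> \<alpha>.
              (AE x in \<nu>. u x \<le> w x) \<and>
              var_norm \<nu> \<alpha> w \<le> max 2 (2 powr (r / r')) * var_norm \<nu> \<alpha> u \<and>
              weighted_bounded r \<nu> p (\<lambda>x. inverse (w x)) \<nu> (\<lambda>x. inverse (w x)) T))))"
proof (intro conjI impI allI)
  fix T :: "('b \<Rightarrow> real) \<Rightarrow> 'a \<Rightarrow> real"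
  assume "2 \<le> r \<and> ereal r < min (essinf \<nu> p) (essinf \<mu> q)" and T: "linear_operator \<mu> q \<nu> p T"
  then have r: "2 \<le> r" "ereal r < essinf \<nu> p" "ereal r < essinf \<mu> q" by auto
  show "bounded_operator \<mu> q \<nu> p T \<longleftrightarrow> (\<forall>u\<in>var_Lp_pos \<nu> \<alpha>. \<exists>U\<in>var_Lp_pos \<mu> \<beta>.
      var_norm \<mu> \<beta> U \<le> var_norm \<nu> \<alpha> u \<and> weighted_bounded r \<mu> q U \<nu> u T)"
    (is "_ \<longleftrightarrow> ?rhs")
  proof
    show ?rhs if "bounded_operator \<mu> q \<nu> p T"
      unfolding assms(11,12) by (intro ballI extrapolation_convex_necessary[OF assms(2,4,5,7,8) r T that])
    show "bounded_operator \<mu> q \<nu> p T" if R: ?rhs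
      by (rule extrapolation_convex_sufficient[OF assms(1,2,5,7,8) less_imp_le[OF assms(9)] r(2,3) T])
        (use R[unfolded assms(11,12)] in blast)
  qed
next
  fix T :: "('b \<Rightarrow> real) \<Rightarrow> 'a \<Rightarrow> real"
  assume "max (esssup \<nu> p) (esssup \<mu> q) < ereal r \<and> r \<le> 2" and T: "linear_operator \<mu> q \<nu> p T"
  then have r: "r \<le> 2" "esssup \<nu> p < ereal r" "esssup \<mu> q < ereal r" by auto
  show "bounded_operator \<mu> q \<nu> p T \<longleftrightarrow> (\<forall>u\<in>var_Lp_pos \<mu> \<beta>. \<exists>U\<in>var_Lp_pos \<nu> \<alpha>.
      var_norm \<nu> \<alpha> U \<le> var_norm \<mu> \<beta> u \<and>
      weighted_bounded r \<mu> q (\<lambda>y. inverse (u y)) \<nu> (\<lambda>x. inverse (U x)) T)"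
    (is "_ \<longleftrightarrow> ?rhs")
  proof
    show ?rhs if "bounded_operator \<mu> q \<nu> p T"
      unfolding assms(11,12) by (intro ballI extrapolation_concave_necessary[OF assms(1,2,5,7,8) r T that])
    show "bounded_operator \<mu> q \<nu> p T" if R: ?rhs
      by (rule extrapolation_concave_sufficient[OF assms(2,4,5,7,8) less_imp_le[OF assms(9)] r T])
        (use R[unfolded assms(11,12)] in blast)
  qed
next
  fix T :: "('a \<Rightarrow> real) \<Rightarrow> 'a \<Rightarrow> real"
  assume r: "2 \<le> r \<and> ereal r < essinf \<nu> p" and T: "linear_operator \<nu> p \<nu> p T"
  \<comment> \<open>The iteration of weights produces the factor 2, and 2 is at most
    \<open>max 2 (2 powr (r / r'))\<close>.\<close>
  show "bounded_operator \<nu> p \<nu> p T \<longleftrightarrow> (\<forall>u\<in>var_Lp_pos \<nu> \<alpha>. \<exists>w\<in>var_Lp_pos \<nu> \<alpha>.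
      (AE x in \<nu>. u x \<le> w x) \<and> var_norm \<nu> \<alpha> w \<le> max 2 (2 powr (r / r')) * var_norm \<nu> \<alpha> u \<and>
      weighted_bounded r \<nu> p w \<nu> w T)"
    unfolding assms(11) using r
    by (intro extrapolation_convex_same_weight_iff[OF assms(1,2,7) _ _ _ T] max.cobounded1) auto
next
  fix T :: "('a \<Rightarrow> real) \<Rightarrow> 'a \<Rightarrow> real"
  assume r: "esssup \<nu> p < ereal r \<and> r \<le> 2" and T: "linear_operator \<nu> p \<nu> p T"
  show "bounded_operator \<nu> p \<nu> p T \<longleftrightarrow> (\<forall>u\<in>var_Lp_pos \<nu> \<alpha>. \<exists>w\<in>var_Lp_pos \<nu> \<alpha>.
      (AE x in \<nu>. u x \<le> w x) \<and> var_norm \<nu> \<alpha> w \<le> max 2 (2 powr (r / r')) * var_norm \<nu> \<alpha> u \<and>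
      weighted_bounded r \<nu> p (\<lambda>x. inverse (w x)) \<nu> (\<lambda>x. inverse (w x)) T)"
    unfolding assms(11) using r
    by (intro extrapolation_concave_same_weight_iff[OF assms(1,2,7,9) _ _ _ T] max.cobounded1) auto
qed

end
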